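(* Let a $(G,K)$-pair $(G,K,\{K_\alpha\}_{\alpha\in A})$ act on a Lebesgue probability space $(M,\mu)$. To each $\alpha\in A$ assign the quotient measure space $(M[\alpha],\mu[\alpha])$. For $\alpha,\beta\in A$ and $g\in G$ define the polymorphism $$\Xi_{\alpha,\beta}(g):=\mathfrak x[\alpha]^\star\, g\,\mathfrak x[\beta]\in \mathrm{Pol}(M[\alpha],M[\beta])$$ (the product in the category of polymorphisms, performed in the order: first $\mathfrak x[\alpha]^\star:M[\alpha]\to M$, then $g:M\to M$, then $\mathfrak x[\beta]:M\to M[\beta]$). Then the maps $g\mapsto \Xi_{\alpha,\beta}(g)$ determine a functor from the train $\mathcal T(G,K)$ to the category of polymorphisms. That is, $\Xi_{\alpha,\beta}(g)$ depends only on the class $[K_\alpha gK_\beta]\in[K_\alpha\backslash G/K_\beta]$; $\Xi_{\alpha,\alpha}$ sends identity morphisms to identity polymorphisms; and for all $\alpha,\beta,\gamma\in A$, $g,h\in G$, the product of $\Xi_{\alpha,\beta}([K_\alpha gK_\beta])$ followed by $\Xi_{\beta,\gamma}([K_\beta hK_\gamma])$ equals $\Xi_{\alpha,\gamma}\bigl([K_\alpha gK_\beta]\circ[K_\beta hK_\gamma]\bigr)$. (A morphism $\beta\to\alpha$ of the train is sent to an element of $\mathrm{Pol}(M[\alpha],M[\beta])$.)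
   Context: Unitary representations of a topological group are strongly continuous homomorphisms into the unitary group of a separable Hilbert space. **Reduced double cosets.** Let $G$ be a separable topological group and $\rho$ a unitary representation of $G$ in $H$. For a subgroup $L$ let $H(L)$ be the subspace of $L$-fixed vectors and $P(L)$ the orthogonal projection onto it. For subgroups $L,L'$ and $g\in G$ put $\widetilde\rho_{(L,L')}(g):=P(L)\rho(g)|_{H(L')}:H(L')\to H(L)$; it depends only on the double coset $LgL'$. Write $g\sim g'$ if $\widetilde\rho_{(L,L')}(g)=\widetilde\rho_{(L,L')}(g')$ for all unitary representations $\rho$; the class of $g$ is $[LgL']$ and the set of classes is $[L\backslash G/L']$. **$(G,K)$-pairs.** Let $K\subset G$ be a subgroup and $\{K_\alpha\}_{\alpha\in A}$ a family of subgroups of $K$ indexed by a partially ordered directed set $A$ (any two elements have a common upper bound) with $\alpha\succcurlyeq\alpha'\Rightarrow K_{\alpha'}\supset K_\alpha$. This is a $(G,K)$-pair if: (A) for all $\alpha,\beta,\gamma\in A$, $\mathfrak g\in[K_\alpha\backslash G/K_\beta]$, $\mathfrak h\in[K_\beta\backslash G/K_\gamma]$ there is $\mathfrak p\in[K_\alpha\backslash G/K_\gamma]$ such that for every unitary representation $\rho$ of $G$, $\widetilde\rho_{(K_\alpha,K_\beta)}(\mathfrak g)\,\widetilde\rho_{(K_\beta,K_\gamma)}(\mathfrak h)=\widetilde\rho_{(K_\alpha,K_\gamma)}(\mathfrak p)$; (B) for every unitary representation, $\bigcup_{\alpha}H(K_\alpha)$ is dense in $H$. The (unique) $\mathfrak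 p$ is denoted $\mathfrak g\circ\mathfrak h$. The train $\mathcal T(G,K)$ is the category with object set $A$, morphisms $\beta\to\alpha$ the elements of $[K_\alpha\backslash G/K_\beta]$, and composition $\circ$. **Actions.** Let $(M,\mu)$ be a Lebesgue probability space with continuous measure. $\mathrm{Gms}(M)$ is the group of a.e. bijective transformations $m\mapsto mg$ leaving $\mu$ quasi-invariant; the Radon–Nikodym derivative $g'$ is defined by $\mu(Bg)=\int_B g'(m)\,d\mu(m)$ for measurable $B$. An action of the $(G,K)$-pair on $(M,\mu)$ is a (right) action of $G$ by elements of $\mathrm{Gms}(M)$ such that $K$ acts by measure-preserving transformations; the action is continuous in the sense that for every $s\in\mathbb R$ the unitary operators $T_{1/2+is}(g)f(m)=f(mg)\,g'(m)^{1/2+is}$ on $L^2(M,\mu)$ form a strongly continuous representation of $G$. **Polymorphisms.** Let $\mathbb R^\circ$ be the multiplicative group of positive reals with coordinate $t$. For Lebesgue probability spaces $(M,\mu),(N,\nu)$, a polymorphism $\mathfrak p\in\mathrm{Pol}(M,N)$ is a measure on $M\times N\times\mathbb R^\circ$ whose pushforward to $M$ is $\mu$ and such that the pushforward of $t\cdot\mathfrak p$ to $N$ is $\nu$. For measurable $B\subset M$, $C\subset N$ let $\mathfrak p[B\times C]$ be the pushforward to $\mathbb R^\circ$ of the restriction of $\mathfrak p$ to $B\times C\times\mathbb R^\circ$; $\mathfrak p_j\to\mathfrak p$ means that $\mathfrak p_j[B\times C]\to\mathfrak p[B\times C]$ and $t\,\mathfrak p_j[B\times C]\to t\,\mathfrak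 p[B\times C]$ weakly for all $B,C$. A polymorphism is continuous if it has the form $\mathfrak u(B\times C\times D)=\int_{B\times C}u_{m,n}(D)\,d\mu(m)\,d\nu(n)$ for a measurable function $(m,n)\mapsto u_{m,n}$ with values in finite positive measures on $\mathbb R^\circ$ having finite first moment; such polymorphisms are dense. For continuous $\mathfrak u\in\mathrm{Pol}(M,N)$, $\mathfrak v\in\mathrm{Pol}(N,L)$ (with $(L,\lambda)$ a further Lebesgue probability space) the product "$\mathfrak u$ followed by $\mathfrak v$" is the element of $\mathrm{Pol}(M,L)$ given by $w_{m,k}=\int_N u_{m,n}*v_{n,k}\,d\nu(n)$ ($*$ is convolution on $\mathbb R^\circ$); the product extends uniquely to a separately continuous associative operation $\mathrm{Pol}(M,N)\times\mathrm{Pol}(N,L)\to\mathrm{Pol}(M,L)$, giving the category of polymorphisms. The identity polymorphism of $M$ is the image of $\mu$ under $m\mapsto(m,m,1)$. The involution: $\mathfrak p^\star\in\mathrm{Pol}(N,M)$ is $t\cdot\mathfrak p'$, where $\mathfrak p'$ is the image of $\mathfrak p$ under $(m,n,t)\mapsto(n,m,t^{-1})$. An element $g\in\mathrm{Gms}(M)$ is regarded as the polymorphism $M\to M$ which is the image of $\mu$ under $m\mapsto(m,mg,g'(m))$. **Quotients.** $\Sigma[\alpha]$ is the $\sigma$-algebra of measurable sets $B\subset M$ with $\mu(B\,\triangle\,Bg)=0$ for all $g\in K_\alpha$. It determines a measurable partition of $M$, whose quotient is a Lebesgue probability space $(M[\alpha],\mu[\alpha])$ with projection $\pi_\alpha:M\to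 M[\alpha]$; thus $L^2(M[\alpha])$ is identified with the space of $K_\alpha$-fixed vectors of $L^2(M)$. The polymorphism $\mathfrak x[\alpha]\in\mathrm{Pol}(M,M[\alpha])$ is the image of $\mu$ under $m\mapsto(m,\pi_\alpha(m),1)$. *)

theory Defs
  imports "HOL-Probability.Probability" "HOL-Algebra.Module"
begin

section \<open>Unitary representations\<close>

definition complex_ring :: "complex ring" where
  "complex_ring = \<lparr>carrier = UNIV, monoid.mult = (*), one = 1, ring.zero = 0, add = (+)\<rparr>"

text \<open>Hilbert spaces are given by an explicit carrier, so that one can quantify over all of them.
  The multiplicative part of the underlying ring record is not used.\<close>

record 'h hilbert = "(complex, 'h) module" +
  hip :: "'h \<Rightarrow> 'h \<Rightarrow> complex"

definition hdist :: "'h hilbert \<Rightarrow> 'h \<Rightarrow> 'h \<Rightarrow> real" where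
  "hdist H x y = sqrt (Re (hip H (x \<ominus>\<^bsub>H\<^esub> y) (x \<ominus>\<^bsub>H\<^esub> y)))"

abbreviation htop :: "'h hilbert \<Rightarrow> 'h topology" where
  "htop H \<equiv> Metric_space.mtopology (carrier H) (hdist H)"

locale separable_hilbert_space =
  Module.module complex_ring H for H :: "'h hilbert" +
  assumes hip_add_left: "\<lbrakk>x \<in> carrier H; y \<in> carrier H; z \<in> carrier H\<rbrakk>
      \<Longrightarrow> hip H (x \<oplus>\<^bsub>H\<^esub> y) z = hip H x z + hip H y z"
    and hip_smult_left: "\<lbrakk>x \<in> carrier H; y \<in> carrier H\<rbrakk>
      \<Longrightarrow> hip H (c \<odot>\<^bsub>H\<^esub> x) y = c * hip H x y"
    and hip_cnj: "\<lbrakk>x \<in> carrier H; y \<in> carrier H\<rbrakk> \<Longrightarrow> hip H y x = cnj (hip H x y)"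
    and hip_nonneg: "x \<in> carrier H \<Longrightarrow> 0 \<le> Re (hip H x x)"
    and hip_definite: "\<lbrakk>x \<in> carrier H; hip H x x = 0\<rbrakk> \<Longrightarrow> x = \<zero>\<^bsub>H\<^esub>"
    and hcomplete: "Metric_space.mcomplete (carrier H) (hdist H)"
    and hseparable: "separable_space (htop H)"

definition unitary_operator :: "'h hilbert \<Rightarrow> ('h \<Rightarrow> 'h) \<Rightarrow> bool" where
  "unitary_operator H U \<longleftrightarrow>
     bij_betw U (carrier H) (carrier H) \<and>
     (\<forall>x\<in>carrier H. \<forall>y\<in>carrier H. U (x \<oplus>\<^bsub>H\<^esub> y) = U x \<oplus>\<^bsub>H\<^esub> U y) \<and>
     (\<forall>c. \<forall>x\<in>carrier H. U (c \<odot>\<^bsub>H\<^esub> x) = c \<odot>\<^bsub>H\<^esub> U x) \<and>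
     (\<forall>x\<in>carrier H. \<forall>y\<in>carrier H. hip H (U x) (U y) = hip H x y)"

locale topological_group = group G for G :: "'g monoid" (structure) +
  fixes T :: "'g topology"
  assumes topspace_eq: "topspace T = carrier G"
    and continuous_mult: "continuous_map (prod_topology T T) T (\<lambda>(x, y). x \<otimes> y)"
    and continuous_inv: "continuous_map T T (\<lambda>x. inv x)"

definition unitary_rep ::
  "'g monoid \<Rightarrow> 'g topology \<Rightarrow> 'h hilbert \<Rightarrow> ('g \<Rightarrow> 'h \<Rightarrow> 'h) \<Rightarrow> bool" where
  "unitary_rep G T H \<rho> \<longleftrightarrow>
     separable_hilbert_space H \<and>
     (\<forall>g\<in>carrier G. unitary_operator H (\<rho> g)) \<and>
     (\<forall>g\<in>carrier G. \<forall>h\<in>carrier G. \<forall>x\<in>carrier H. \<rho> (g \<otimes>\<^bsub>G\<^esub> h) x = \<rho> g (\<rho> h x)) \<and>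
     (\<forall>x\<in>carrier H. continuous_map T (htop H) (\<lambda>g. \<rho> g x))"

text \<open>A separable Hilbert space has at most continuum many points, so every one of them is
  isomorphic to one whose carrier is a set of elements of the following type. Below, ``all
  unitary representations'' means all unitary representations in Hilbert spaces of this kind.\<close>

type_synonym hpoint = "nat \<Rightarrow> complex"


section \<open>Reduced double cosets and the train\<close>

definition fixed_vectors :: "'h hilbert \<Rightarrow> ('g \<Rightarrow> 'h \<Rightarrow> 'h) \<Rightarrow> 'g set \<Rightarrow> 'h set" where
  "fixed_vectors H \<rho> L = {x \<in> carrier H. \<forall>l\<in>L. \<rho> l x = x}"

definition orth_proj :: "'h hilbert \<Rightarrow> 'h set \<Rightarrow> 'h \<Rightarrow> 'h" where
  "orth_proj H V x = (THE y. y \<in> V \<and> (\<forall>z\<in>V. hip H (x \<ominus>\<^bsub>H\<^esub> y) z = 0))"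

definition reduced_op ::
  "'h hilbert \<Rightarrow> ('g \<Rightarrow> 'h \<Rightarrow> 'h) \<Rightarrow> 'g set \<Rightarrow> 'g set \<Rightarrow> 'g \<Rightarrow> 'h \<Rightarrow> 'h" where
  "reduced_op H \<rho> L L' g =
     (\<lambda>x\<in>fixed_vectors H \<rho> L'. orth_proj H (fixed_vectors H \<rho> L) (\<rho> g x))"

definition reduced_rel ::
  "'g monoid \<Rightarrow> 'g topology \<Rightarrow> 'g set \<Rightarrow> 'g set \<Rightarrow> ('g \<times> 'g) set" where
  "reduced_rel G T L L' = {(g, g'). g \<in> carrier G \<and> g' \<in> carrier G \<and>
     (\<forall>(H :: hpoint hilbert) \<rho>. unitary_rep G T H \<rho> \<longrightarrow>
        reduced_op H \<rho> L L' g = reduced_op H \<rho> L L' g')}"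

definition reduced_class ::
  "'g monoid \<Rightarrow> 'g topology \<Rightarrow> 'g set \<Rightarrow> 'g set \<Rightarrow> 'g \<Rightarrow> 'g set" where
  "reduced_class G T L L' g = reduced_rel G T L L' `` {g}"

definition reduced_cosets ::
  "'g monoid \<Rightarrow> 'g topology \<Rightarrow> 'g set \<Rightarrow> 'g set \<Rightarrow> 'g set set" where
  "reduced_cosets G T L L' = carrier G // reduced_rel G T L L'"

definition class_op ::
  "'h hilbert \<Rightarrow> ('g \<Rightarrow> 'h \<Rightarrow> 'h) \<Rightarrow> 'g set \<Rightarrow> 'g set \<Rightarrow> 'g set \<Rightarrow> 'h \<Rightarrow> 'h" where
  "class_op H \<rho> L L' c = the_elem (reduced_op H \<rho> L L' ` c)"

definition is_class_product :: "'g monoid \<Rightarrow> 'g topology \<Rightarrow> 'g set \<Rightarrow> 'g set \<Rightarrow> 'g set \<Rightarrow>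
    'g set \<Rightarrow> 'g set \<Rightarrow> 'g set \<Rightarrow> bool" where
  "is_class_product G T L1 L2 L3 c d p \<longleftrightarrow>
     p \<in> reduced_cosets G T L1 L3 \<and>
     (\<forall>(H :: hpoint hilbert) \<rho>. unitary_rep G T H \<rho> \<longrightarrow>
        compose (fixed_vectors H \<rho> L3) (class_op H \<rho> L1 L2 c) (class_op H \<rho> L2 L3 d)
          = class_op H \<rho> L1 L3 p)"

text \<open>In \<open>(\<alpha>', \<alpha>) \<in> R\<close> the index \<open>\<alpha>\<close> is the larger one, so it has the smaller subgroup.\<close>

definition gk_pair :: "'g monoid \<Rightarrow> 'g topology \<Rightarrow> 'g set \<Rightarrow> 'i set \<Rightarrow> ('i \<times> 'i) set \<Rightarrow>
    ('i \<Rightarrow> 'g set) \<Rightarrow> bool" where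
  "gk_pair G T K A R Ks \<longleftrightarrow>
     topological_group G T \<and> separable_space T \<and> subgroup K G \<and>
     partial_order_on A R \<and>
     (\<forall>\<alpha>\<in>A. \<forall>\<beta>\<in>A. \<exists>\<gamma>\<in>A. (\<alpha>, \<gamma>) \<in> R \<and> (\<beta>, \<gamma>) \<in> R) \<and>
     (\<forall>\<alpha>\<in>A. subgroup (Ks \<alpha>) G \<and> Ks \<alpha> \<subseteq> K) \<and>
     (\<forall>\<alpha>'\<in>A. \<forall>\<alpha>\<in>A. (\<alpha>', \<alpha>) \<in> R \<longrightarrow> Ks \<alpha> \<subseteq> Ks \<alpha>') \<and>
     (\<forall>\<alpha>\<in>A. \<forall>\<beta>\<in>A. \<forall>\<gamma>\<in>A.
        \<forall>c\<in>reduced_cosets G T (Ks \<alpha>) (Ks \<beta>). \<forall>d\<in>reduced_cosets G T (Ks \<beta>) (Ks \<gamma>).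
          \<exists>p. is_class_product G T (Ks \<alpha>) (Ks \<beta>) (Ks \<gamma>) c d p) \<and>
     (\<forall>(H :: hpoint hilbert) \<rho>. unitary_rep G T H \<rho> \<longrightarrow>
        htop H closure_of (\<Union>\<alpha>\<in>A. fixed_vectors H \<rho> (Ks \<alpha>)) = carrier H)"

text \<open>The train: objects \<open>A\<close>; morphisms \<open>\<beta> \<rightarrow> \<alpha>\<close> are \<open>train_hom \<alpha> \<beta>\<close>.\<close>

definition train_hom :: "'g monoid \<Rightarrow> 'g topology \<Rightarrow> ('i \<Rightarrow> 'g set) \<Rightarrow> 'i \<Rightarrow> 'i \<Rightarrow> 'g set set" where
  "train_hom G T Ks \<alpha> \<beta> = reduced_cosets G T (Ks \<alpha>) (Ks \<beta>)"

definition train_comp :: "'g monoid \<Rightarrow> 'g topology \<Rightarrow> ('i \<Rightarrow> 'g set) \<Rightarrow> 'i \<Rightarrow> 'i \<Rightarrow> 'i \<Rightarrow>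
    'g set \<Rightarrow> 'g set \<Rightarrow> 'g set" where
  "train_comp G T Ks \<alpha> \<beta> \<gamma> c d =
     (THE p. is_class_product G T (Ks \<alpha>) (Ks \<beta>) (Ks \<gamma>) c d p)"

text \<open>The operator of the class of the unit is the identity of the space of fixed vectors,
  so this class is neutral for \<open>train_comp\<close>.\<close>

definition train_id :: "'g monoid \<Rightarrow> 'g topology \<Rightarrow> ('i \<Rightarrow> 'g set) \<Rightarrow> 'i \<Rightarrow> 'g set" where
  "train_id G T Ks \<alpha> = reduced_class G T (Ks \<alpha>) (Ks \<alpha>) \<one>\<^bsub>G\<^esub>"


section \<open>Lebesgue spaces and their transformations\<close>

definition mod0_isomorphic :: "'a measure \<Rightarrow> 'b measure \<Rightarrow> bool" where
  "mod0_isomorphic M N \<longleftrightarrow>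
     (\<exists>X\<in>sets M. \<exists>Y\<in>sets N. \<exists>f.
        space M - X \<in> null_sets M \<and> space N - Y \<in> null_sets N \<and> bij_betw f X Y \<and>
        (\<forall>B\<subseteq>X. B \<in> sets M \<longleftrightarrow> f ` B \<in> sets N) \<and>
        (\<forall>B\<in>sets M. B \<subseteq> X \<longrightarrow> emeasure N (f ` B) = emeasure M B))"

definition lebesgue_prob_space :: "'a measure \<Rightarrow> bool" where
  "lebesgue_prob_space M \<longleftrightarrow> prob_space M \<and> complete_measure M \<and>
     (\<exists>\<nu> :: real measure. prob_space \<nu> \<and> sets \<nu> = sets borel \<and>
        mod0_isomorphic M (completion \<nu>))"

definition continuous_measure :: "'a measure \<Rightarrow> bool" where
  "continuous_measure M \<longleftrightarrow> (\<forall>m\<in>space M. {m} \<in> null_sets M)"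

text \<open>\<open>X\<close> is a set of full measure on which \<open>g\<close> is an honest nonsingular bijection onto
  another set of full measure.\<close>

definition gms_on :: "'m measure \<Rightarrow> ('m \<Rightarrow> 'm) \<Rightarrow> 'm set \<Rightarrow> bool" where
  "gms_on M g X \<longleftrightarrow> g \<in> M \<rightarrow>\<^sub>M M \<and>
     X \<in> sets M \<and> space M - X \<in> null_sets M \<and> space M - g ` X \<in> null_sets M \<and> inj_on g X \<and>
     (\<forall>B\<in>sets M. B \<subseteq> X \<longrightarrow>
        g ` B \<in> sets M \<and> (g ` B \<in> null_sets M \<longleftrightarrow> B \<in> null_sets M))"

text \<open>Elements of \<open>Gms M\<close> are represented by everywhere defined maps; transformations that
  agree almost everywhere are not identified at the level of these representatives.\<close>

definition Gms :: "'m measure \<Rightarrow> ('m \<Rightarrow> 'm) set" where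
  "Gms M = {g. \<exists>X. gms_on M g X}"

text \<open>The set \<open>Bg\<close>, well defined up to null sets: the image of an exceptional null set under the
  representative \<open>g\<close> could be anything and has to be discarded.\<close>

definition gms_image :: "'m measure \<Rightarrow> ('m \<Rightarrow> 'm) \<Rightarrow> 'm set \<Rightarrow> 'm set" where
  "gms_image M g B = g ` (B \<inter> (SOME X. gms_on M g X))"

definition gms_deriv :: "'m measure \<Rightarrow> ('m \<Rightarrow> 'm) \<Rightarrow> 'm \<Rightarrow> real" where
  "gms_deriv M g = (SOME d. d \<in> borel_measurable M \<and> (\<forall>m. 0 < d m) \<and>
     (\<forall>B\<in>sets M. emeasure M (gms_image M g B) = (\<integral>\<^sup>+m\<in>B. ennreal (d m) \<partial>M)))"

definition gms_op :: "'m measure \<Rightarrow> real \<Rightarrow> ('m \<Rightarrow> 'm) \<Rightarrow> ('m \<Rightarrow> complex) \<Rightarrow> 'm \<Rightarrow> complex" where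
  "gms_op M s g f m = f (g m) * complex_of_real (gms_deriv M g m) powr Complex (1/2) s"

definition square_integrable :: "'m measure \<Rightarrow> ('m \<Rightarrow> complex) \<Rightarrow> bool" where
  "square_integrable M f \<longleftrightarrow> f \<in> borel_measurable M \<and> integrable M (\<lambda>m. (cmod (f m))\<^sup>2)"

text \<open>\<open>act g m\<close> is \<open>mg\<close>. A right action by elements of \<open>Gms M\<close> only has to be multiplicative
  almost everywhere for each pair of group elements. Multiplicativity and unitarity of
  \<open>gms_op M s (act g)\<close> then follow from the chain rule, so only strong continuity is
  required.\<close>

definition gk_action :: "'g monoid \<Rightarrow> 'g topology \<Rightarrow> 'g set \<Rightarrow> 'm measure \<Rightarrow>
    ('g \<Rightarrow> 'm \<Rightarrow> 'm) \<Rightarrow> bool" where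
  "gk_action G T K M act \<longleftrightarrow>
     (\<forall>g\<in>carrier G. act g \<in> Gms M) \<and>
     (\<forall>g\<in>carrier G. \<forall>h\<in>carrier G. AE m in M. act (g \<otimes>\<^bsub>G\<^esub> h) m = act h (act g m)) \<and>
     (\<forall>k\<in>K. distr M M (act k) = M) \<and>
     (\<forall>s f. square_integrable M f \<longrightarrow> (\<forall>g\<^sub>0\<in>carrier G.
        limitin euclideanreal
          (\<lambda>g. \<integral>m. (cmod (gms_op M s (act g) f m - gms_op M s (act g\<^sub>0) f m))\<^sup>2 \<partial>M)
          0 (atin T g\<^sub>0)))"


section \<open>Polymorphisms\<close>

definition Rpos :: "real measure" where
  "Rpos = restrict_space borel {0<..}"

abbreviation pol_space :: "'m measure \<Rightarrow> 'n measure \<Rightarrow> ('m \<times> 'n \<times> real) measure" where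
  "pol_space M N \<equiv> M \<Otimes>\<^sub>M (N \<Otimes>\<^sub>M Rpos)"

definition Pol :: "'m measure \<Rightarrow> 'n measure \<Rightarrow> ('m \<times> 'n \<times> real) measure set" where
  "Pol M N = {p. sets p = sets (pol_space M N) \<and>
     distr p M (\<lambda>(m, n, t). m) = M \<and>
     distr (density p (\<lambda>(m, n, t). ennreal t)) N (\<lambda>(m, n, t). n) = N}"

definition pol_slice :: "('m \<times> 'n \<times> real) measure \<Rightarrow> 'm set \<Rightarrow> 'n set \<Rightarrow> real measure" where
  "pol_slice p B C = distr (density p (indicator (B \<times> C \<times> UNIV))) Rpos (\<lambda>(m, n, t). t)"

definition weakly_conv :: "(nat \<Rightarrow> real measure) \<Rightarrow> real measure \<Rightarrow> bool" where
  "weakly_conv q q' \<longleftrightarrow>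
     (\<forall>\<phi> :: real \<Rightarrow> real. continuous_on {0<..} \<phi> \<and> bounded (\<phi> ` {0<..}) \<longrightarrow>
        (\<lambda>j. \<integral>t. \<phi> t \<partial>q j) \<longlonglongrightarrow> (\<integral>t. \<phi> t \<partial>q'))"

definition pol_conv :: "'m measure \<Rightarrow> 'n measure \<Rightarrow> (nat \<Rightarrow> ('m \<times> 'n \<times> real) measure) \<Rightarrow>
    ('m \<times> 'n \<times> real) measure \<Rightarrow> bool" where
  "pol_conv M N p p' \<longleftrightarrow> (\<forall>B\<in>sets M. \<forall>C\<in>sets N.
     weakly_conv (\<lambda>j. pol_slice (p j) B C) (pol_slice p' B C) \<and>
     weakly_conv (\<lambda>j. density (pol_slice (p j) B C) ennreal) (density (pol_slice p' B C) ennreal))"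

definition pol_density :: "'m measure \<Rightarrow> 'n measure \<Rightarrow> ('m \<Rightarrow> 'n \<Rightarrow> real measure) \<Rightarrow>
    ('m \<times> 'n \<times> real) measure \<Rightarrow> bool" where
  "pol_density M N u p \<longleftrightarrow>
     p \<in> Pol M N \<and>
     (\<forall>m\<in>space M. \<forall>n\<in>space N. sets (u m n) = sets Rpos \<and> finite_measure (u m n) \<and>
        (\<integral>\<^sup>+t. ennreal t \<partial>u m n) < \<infinity>) \<and>
     (\<forall>D\<in>sets Rpos. (\<lambda>(m, n). emeasure (u m n) D) \<in> borel_measurable (M \<Otimes>\<^sub>M N)) \<and>
     (\<forall>B\<in>sets M. \<forall>C\<in>sets N. \<forall>D\<in>sets Rpos.
        emeasure p (B \<times> C \<times> D) = (\<integral>\<^sup>+z\<in>B \<times> C. emeasure (u (fst z) (snd z)) D \<partial>(M \<Otimes>\<^sub>M N)))"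

definition mult_convolution :: "real measure \<Rightarrow> real measure \<Rightarrow> real measure" where
  "mult_convolution u v = distr (u \<Otimes>\<^sub>M v) Rpos (\<lambda>(s, t). s * t)"

text \<open>\<open>F\<close> is a separately continuous operation that is given by the formula
  \<open>w_{m,k} = \<integral> u_{m,n} * v_{n,k} d\<nu>(n)\<close> on continuous polymorphisms. The convergence of
  polymorphisms is metrizable, so continuity may be tested on sequences.\<close>

definition is_pol_product :: "'m measure \<Rightarrow> 'n measure \<Rightarrow> 'l measure \<Rightarrow>
    (('m \<times> 'n \<times> real) measure \<Rightarrow> ('n \<times> 'l \<times> real) measure \<Rightarrow> ('m \<times> 'l \<times> real) measure) \<Rightarrow>
    bool" where
  "is_pol_product M N L F \<longleftrightarrow>
     F \<in> Pol M N \<rightarrow>\<^sub>E Pol N L \<rightarrow>\<^sub>E Pol M L \<and>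
     (\<forall>u v p q. pol_density M N u p \<and> pol_density N L v q \<longrightarrow>
        (\<forall>B\<in>sets M. \<forall>C\<in>sets L. \<forall>D\<in>sets Rpos.
           emeasure (F p q) (B \<times> C \<times> D) =
             (\<integral>\<^sup>+z\<in>B \<times> C. (\<integral>\<^sup>+n. emeasure (mult_convolution (u (fst z) n) (v n (snd z))) D \<partial>N)
                \<partial>(M \<Otimes>\<^sub>M L)))) \<and>
     (\<forall>q\<in>Pol N L. \<forall>p\<in>UNIV \<rightarrow> Pol M N. \<forall>p'\<in>Pol M N.
        pol_conv M N p p' \<longrightarrow> pol_conv M L (\<lambda>j. F (p j) q) (F p' q)) \<and>
     (\<forall>p\<in>Pol M N. \<forall>q\<in>UNIV \<rightarrow> Pol N L. \<forall>q'\<in>Pol N L.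
        pol_conv N L q q' \<longrightarrow> pol_conv M L (\<lambda>j. F p (q j)) (F p q'))"

text \<open>\<open>pol_prod M N L p q\<close> is \<open>p\<close> followed by \<open>q\<close>. The operation is unique because continuous
  polymorphisms are dense; its associativity is then automatic.\<close>

definition pol_prod :: "'m measure \<Rightarrow> 'n measure \<Rightarrow> 'l measure \<Rightarrow>
    ('m \<times> 'n \<times> real) measure \<Rightarrow> ('n \<times> 'l \<times> real) measure \<Rightarrow> ('m \<times> 'l \<times> real) measure" where
  "pol_prod M N L = (THE F. is_pol_product M N L F)"

definition pol_id :: "'m measure \<Rightarrow> ('m \<times> 'm \<times> real) measure" where
  "pol_id M = distr M (pol_space M M) (\<lambda>m. (m, m, 1))"

text \<open>The factor \<open>t\<close> is the original coordinate, taken before the inversion: this is what makes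
  the involution map \<open>Pol M N\<close> to \<open>Pol N M\<close>.\<close>

definition pol_star :: "'m measure \<Rightarrow> 'n measure \<Rightarrow> ('m \<times> 'n \<times> real) measure \<Rightarrow>
    ('n \<times> 'm \<times> real) measure" where
  "pol_star M N p = distr (density p (\<lambda>(m, n, t). ennreal t)) (pol_space N M)
     (\<lambda>(m, n, t). (n, m, inverse t))"

definition pol_of_gms :: "'m measure \<Rightarrow> ('m \<Rightarrow> 'm) \<Rightarrow> ('m \<times> 'm \<times> real) measure" where
  "pol_of_gms M g = distr M (pol_space M M) (\<lambda>m. (m, g m, gms_deriv M g m))"


section \<open>Quotients\<close>

definition invariant_sets :: "'m measure \<Rightarrow> ('g \<Rightarrow> 'm \<Rightarrow> 'm) \<Rightarrow> 'g set \<Rightarrow> 'm set set" where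
  "invariant_sets M act L = {B \<in> sets M. \<forall>g\<in>L. sym_diff B (gms_image M (act g) B) \<in> null_sets M}"

text \<open>\<open>\<pi>\<close> exhibits the Lebesgue space \<open>Q\<close> as the quotient of \<open>M\<close> by the measurable partition (the
  fibres of \<open>\<pi>\<close>) that corresponds to the \<open>\<sigma>\<close>-algebra \<open>\<Sigma>\<close>. Quotients are determined only up to
  isomorphism modulo null sets, hence a predicate and not a function of \<open>\<Sigma>\<close>.\<close>

definition is_quotient :: "'m measure \<Rightarrow> 'm set set \<Rightarrow> 'q measure \<Rightarrow> ('m \<Rightarrow> 'q) \<Rightarrow> bool" where
  "is_quotient M \<Sigma> Q \<pi> \<longleftrightarrow>
     lebesgue_prob_space Q \<and> \<pi> \<in> M \<rightarrow>\<^sub>M Q \<and> distr M Q \<pi> = Q \<and>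
     (\<forall>C\<in>sets Q. \<pi> -` C \<inter> space M \<in> \<Sigma>) \<and>
     (\<forall>B\<in>\<Sigma>. \<exists>C\<in>sets Q. sym_diff B (\<pi> -` C \<inter> space M) \<in> null_sets M)"

definition pol_proj :: "'m measure \<Rightarrow> 'q measure \<Rightarrow> ('m \<Rightarrow> 'q) \<Rightarrow> ('m \<times> 'q \<times> real) measure" where
  "pol_proj M Q \<pi> = distr M (pol_space M Q) (\<lambda>m. (m, \<pi> m, 1))"

definition Xi :: "'m measure \<Rightarrow> ('g \<Rightarrow> 'm \<Rightarrow> 'm) \<Rightarrow> ('i \<Rightarrow> 'q measure) \<Rightarrow> ('i \<Rightarrow> 'm \<Rightarrow> 'q) \<Rightarrow>
    'i \<Rightarrow> 'i \<Rightarrow> 'g \<Rightarrow> ('q \<times> 'q \<times> real) measure" where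
  "Xi M act Q \<pi> \<alpha> \<beta> g =
     pol_prod (Q \<alpha>) M (Q \<beta>)
       (pol_prod (Q \<alpha>) M M (pol_star M (Q \<alpha>) (pol_proj M (Q \<alpha>) (\<pi> \<alpha>))) (pol_of_gms M (act g)))
       (pol_proj M (Q \<beta>) (\<pi> \<beta>))"

definition Xi_class :: "'m measure \<Rightarrow> ('g \<Rightarrow> 'm \<Rightarrow> 'm) \<Rightarrow> ('i \<Rightarrow> 'q measure) \<Rightarrow> ('i \<Rightarrow> 'm \<Rightarrow> 'q) \<Rightarrow>
    'i \<Rightarrow> 'i \<Rightarrow> 'g set \<Rightarrow> ('q \<times> 'q \<times> real) measure" where
  "Xi_class M act Q \<pi> \<alpha> \<beta> c = the_elem (Xi M act Q \<pi> \<alpha> \<beta> ` c)"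

end

theory Submission
  imports Defs
begin

text \<open>
A polymorphism \<open>p\<close> from \<open>M\<close> to \<open>N\<close> is determined by its Mellin forms
\<open>\<integral> h(m) f(n) t powr (1/2 + i s) dp(m, n, t)\<close>, one for every real \<open>s\<close>. The two marginal conditions say
exactly that such a form is bounded by the product of the \<open>L\<^sup>2\<close> norms of \<open>h\<close> and \<open>f\<close>, hence it is given
by a contraction \<open>T s p\<close> from \<open>L\<^sup>2 N\<close> to \<open>L\<^sup>2 M\<close>. The Mellin transform is injective, and the
convergence of polymorphisms is the pointwise convergence of Mellin forms on indicators
(uniqueness and continuity theorems for characteristic functions, in the coordinate \<open>ln t\<close>). The product
of polymorphisms is the operation that the Mellin transform turns into composition,
\<open>T s (p q) = T s p \<circ> T s q\<close>: this is clear for continuous polymorphisms, because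
\<open>t powr (1/2 + i s)\<close> is multiplicative and convolution becomes multiplication.

For a nonsingular transformation \<open>g\<close> the operator of \<open>\<Xi> g\<close> becomes the compression of the Koopman
operator \<open>f \<mapsto> f(m g) g'(m) powr (1/2 + i s)\<close> to functions on the quotients. Functions on \<open>M[\<alpha>]\<close> are the
\<open>K\<^sub>\<alpha>\<close>-fixed vectors of the Koopman representation of \<open>G\<close> in \<open>L\<^sup>2 M\<close>, so this compression is the
operator that defines the reduced double coset of \<open>g\<close> for that particular representation. Thus \<open>\<Xi> g\<close>
depends on the reduced coset only, and since composition in the train is composition of these operators
in every representation, it is sent to the product of polymorphisms.

The work lies in two places. The product is defined as the only separately continuous extension of
a formula, so existence and uniqueness have to be established. Uniqueness rests on the density of continuous
polymorphisms (\<open>continuous_Pol_dense\<close>), obtained by averaging over the cells of finer and finer finite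
partitions. For existence (\<open>composite_exists\<close>), a polymorphism \<open>q\<close> from \<open>N\<close> to \<open>L\<close> is
realised by a random map: a point \<open>n\<close> and an independent random parameter \<open>w\<close> give a point \<open>y(n, w)\<close> of \<open>L\<close>
and a factor \<open>\<tau>(n, w)\<close>; then the composite with \<open>p\<close> is the law of \<open>(m, y(n, w), t \<tau>(n, w))\<close>, where
\<open>(m, n, t)\<close> has the law \<open>p\<close>. The other place is the Koopman representation: it
has to live in a Hilbert space whose points are complex sequences, for which \<open>L\<^sup>2 M\<close> is embedded by
\<open>f \<mapsto> (\<integral> f over D i)\<close> with a dense sequence \<open>D\<close> of measurable sets.
\<close>

section \<open>The Mellin character and square integrable functions\<close>

text \<open>The character of the multiplicative group of positive reals on which everything is tested.\<close>

definition mel :: "real \<Rightarrow> real \<Rightarrow> complex" where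
  "mel s t = complex_of_real t powr Complex (1/2) s"

lemma mel_eq: "0 < t \<Longrightarrow> mel s t = complex_of_real (sqrt t) * iexp (s * ln t)"
proof -
  assume t: "0 < t"
  have "mel s t = exp (Complex (1/2) s * of_real (ln t))"
    using t by (simp add: mel_def powr_def Ln_of_real)
  also have "Complex (1/2) s * of_real (ln t) = complex_of_real (ln t / 2) + \<i> * of_real (s * ln t)"
    by (simp add: complex_eq_iff)
  also have "exp (complex_of_real (ln t / 2) + \<i> * of_real (s * ln t)) = of_real (exp (ln t / 2)) * iexp (s * ln t)"
    by (simp add: exp_add exp_of_real[symmetric])
  also have "exp (ln t / 2) = sqrt t"
    using t by (simp add: powr_half_sqrt[symmetric] powr_def)
  finally show ?thesis .
qed

lemma norm_mel: "0 < t \<Longrightarrow> cmod (mel s t) = sqrt t"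
  by (simp add: mel_eq norm_mult)

lemma mel_mult: "0 < a \<Longrightarrow> 0 < b \<Longrightarrow> mel s (a * b) = mel s a * mel s b"
  by (simp add: mel_eq real_sqrt_mult ln_mult ring_distribs exp_add)

lemma mel_1 [simp]: "mel s 1 = 1"
  by (simp add: mel_eq)

lemma space_Rpos [simp]: "space Rpos = {0<..}"
  by (simp add: Rpos_def space_restrict_space)

lemma measurable_Rpos_borel: "f \<in> borel_measurable borel \<Longrightarrow> f \<in> borel_measurable Rpos"
  unfolding Rpos_def by (rule measurable_restrict_space1)

lemma measurable_mel [measurable]: "mel s \<in> borel_measurable Rpos"
proof -
  have "(\<lambda>t. complex_of_real (sqrt t) * iexp (s * ln t)) \<in> borel_measurable Rpos"
    by (rule measurable_Rpos_borel) measurable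
  then show ?thesis by (subst measurable_cong[OF mel_eq]) auto
qed

lemma measurable_id_Rpos: "(\<lambda>t. t) \<in> borel_measurable Rpos"
  by (rule measurable_Rpos_borel) simp

lemma measurable_into_Rpos: "f \<in> borel_measurable M \<Longrightarrow> (\<And>x. x \<in> space M \<Longrightarrow> 0 < f x) \<Longrightarrow> f \<in> M \<rightarrow>\<^sub>M Rpos"
  unfolding Rpos_def by (rule measurable_restrict_space2) auto

lemma measurable_Rpos_D: "f \<in> M \<rightarrow>\<^sub>M Rpos \<Longrightarrow> f \<in> borel_measurable M"
  unfolding Rpos_def by (simp add: measurable_restrict_space2_iff)

lemma sqi_measurable: "square_integrable N f \<Longrightarrow> f \<in> borel_measurable N"
  by (simp add: square_integrable_def)

lemma sqi_integrable: "square_integrable N f \<Longrightarrow> integrable N (\<lambda>x. (cmod (f x))\<^sup>2)"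
  by (simp add: square_integrable_def)

lemma sqi_iff_nn: "square_integrable N f \<longleftrightarrow> f \<in> borel_measurable N \<and> (\<integral>\<^sup>+x. (ennreal (cmod (f x)))\<^sup>2 \<partial>N) < \<infinity>"
  unfolding square_integrable_def integrable_iff_bounded
  by (auto simp: ennreal_power)

lemma sq_add_le: "(cmod (a + b))\<^sup>2 \<le> 2 * ((cmod a)\<^sup>2 + (cmod b)\<^sup>2)"
proof -
  have "(cmod (a + b))\<^sup>2 \<le> (cmod a + cmod b)\<^sup>2"
    by (intro power_mono norm_triangle_ineq) auto
  also have "\<dots> \<le> 2 * ((cmod a)\<^sup>2 + (cmod b)\<^sup>2)"
    using sum_squares_bound[of "cmod a" "cmod b"] by (simp add: power2_sum)
  finally show ?thesis .
qed

lemma sqi_bound: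
  assumes "integrable N g" "f \<in> borel_measurable N" "AE x in N. (cmod (f x))\<^sup>2 \<le> g x"
  shows "square_integrable N f"
proof -
  have "integrable N (\<lambda>x. (cmod (f x))\<^sup>2)"
  proof (rule Bochner_Integration.integrable_bound[OF assms(1)])
    show "(\<lambda>x. (cmod (f x))\<^sup>2) \<in> borel_measurable N" using assms(2) by measurable
    show "AE x in N. norm ((cmod (f x))\<^sup>2) \<le> norm (g x)" using assms(3) by eventually_elim auto
  qed
  then show ?thesis using assms(2) by (simp add: square_integrable_def)
qed

lemma sqi_add:
  assumes "square_integrable N f" "square_integrable N g"
  shows "square_integrable N (\<lambda>x. f x + g x)"
proof (rule sqi_bound)
  show "integrable N (\<lambda>x. 2 * ((cmod (f x))\<^sup>2 + (cmod (g x))\<^sup>2))"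
    using assms by (simp add: square_integrable_def)
  show "AE x in N. (cmod (f x + g x))\<^sup>2 \<le> 2 * ((cmod (f x))\<^sup>2 + (cmod (g x))\<^sup>2)"
    using sq_add_le by (intro AE_I2)
  show "(\<lambda>x. f x + g x) \<in> borel_measurable N" using assms[THEN sqi_measurable] by simp
qed

lemma sqi_cmult:
  assumes "square_integrable N f" shows "square_integrable N (\<lambda>x. c * f x)"
  using assms by (auto simp: square_integrable_def norm_mult power_mult_distrib)

lemma sqi_cnj:
  assumes "square_integrable N f" shows "square_integrable N (\<lambda>x. cnj (f x))"
proof -
  have "(\<lambda>x. cnj (f x)) \<in> borel_measurable N"
    using assms unfolding square_integrable_def
    by (intro borel_measurable_continuous_on[OF continuous_on_cnj[OF continuous_on_id]]) auto
  then show ?thesis using assms by (auto simp: square_integrable_def)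
qed

lemma sqi_diff:
  assumes "square_integrable N f" "square_integrable N g"
  shows "square_integrable N (\<lambda>x. f x - g x)"
  using sqi_add[OF assms(1) sqi_cmult[OF assms(2), of "-1"]] by simp

lemma sqi_zero: "square_integrable N (\<lambda>x. 0)"
  by (simp add: square_integrable_def)

lemma sqi_sum: "finite I \<Longrightarrow> (\<And>i. i \<in> I \<Longrightarrow> square_integrable N (f i)) \<Longrightarrow> square_integrable N (\<lambda>x. \<Sum>i\<in>I. f i x)"
  by (induction rule: finite_induct) (auto intro: sqi_zero sqi_add)

lemma (in finite_measure) sqi_bounded:
  assumes "f \<in> borel_measurable M" "\<And>x. x \<in> space M \<Longrightarrow> cmod (f x) \<le> B"
  shows "square_integrable M f"
proof (rule sqi_bound)
  show "integrable M (\<lambda>x. B\<^sup>2)" by simp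
  show "AE x in M. (cmod (f x))\<^sup>2 \<le> B\<^sup>2"
    using assms(2) by (auto intro!: AE_I2 power_mono)
qed fact

lemma (in finite_measure) sqi_indicator: "A \<in> sets M \<Longrightarrow> square_integrable M (indicator A)"
  by (rule sqi_bounded[of _ 1]) (auto simp: indicator_def)

lemma sqi_mult_integrable:
  assumes "square_integrable N f" "square_integrable N g"
  shows "integrable N (\<lambda>x. f x * g x)"
proof (rule Bochner_Integration.integrable_bound)
  show "integrable N (\<lambda>x. (cmod (f x))\<^sup>2 + (cmod (g x))\<^sup>2)"
    using assms by (simp add: square_integrable_def)
  show "(\<lambda>x. f x * g x) \<in> borel_measurable N" using assms[THEN sqi_measurable] by simp
  show "AE x in N. norm (f x * g x) \<le> norm ((cmod (f x))\<^sup>2 + (cmod (g x))\<^sup>2)"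
  proof (rule AE_I2)
    fix x
    have "2 * cmod (f x) * cmod (g x) \<le> (cmod (f x))\<^sup>2 + (cmod (g x))\<^sup>2" by (rule sum_squares_bound)
    moreover have "0 \<le> cmod (f x) * cmod (g x)" by simp
    ultimately show "norm (f x * g x) \<le> norm ((cmod (f x))\<^sup>2 + (cmod (g x))\<^sup>2)"
      unfolding norm_mult real_norm_def using zero_le_power2[of "cmod (f x)"] zero_le_power2[of "cmod (g x)"] by linarith
  qed
qed

lemma (in finite_measure) sqi_integrable1: "square_integrable M f \<Longrightarrow> integrable M f"
  using sqi_mult_integrable[of M f "\<lambda>x. 1"] by (simp add: square_integrable_def)

definition L2n :: "'a measure \<Rightarrow> ('a \<Rightarrow> complex) \<Rightarrow> real" where
  "L2n N f = sqrt (\<integral>x. (cmod (f x))\<^sup>2 \<partial>N)"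

lemma L2n_nonneg: "0 \<le> L2n N f" by (simp add: L2n_def)

lemma L2n_sq: "(L2n N f)\<^sup>2 = (\<integral>x. (cmod (f x))\<^sup>2 \<partial>N)" by (simp add: L2n_def)

lemma nn_L2n: "square_integrable N f \<Longrightarrow> (\<integral>\<^sup>+x. (ennreal (cmod (f x)))\<^sup>2 \<partial>N) = ennreal ((L2n N f)\<^sup>2)"
  unfolding L2n_sq by (subst nn_integral_eq_integral[symmetric]) (auto simp: square_integrable_def ennreal_power)

lemma L2_simple_approx:
  assumes f: "square_integrable N f"
  obtains F where "\<And>i. simple_function N (F i)" "\<And>i. square_integrable N (F i)"
    "\<And>i x. x \<in> space N \<Longrightarrow> cmod (F i x) \<le> 2 * cmod (f x)"
    "(\<lambda>i. L2n N (\<lambda>x. F i x - f x)) \<longlonglongrightarrow> 0"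
proof -
  have [measurable]: "f \<in> borel_measurable N" using f by (rule sqi_measurable)
  obtain F where F: "\<And>i. simple_function N (F i)"
    "\<And>x. x \<in> space N \<Longrightarrow> (\<lambda>i. F i x) \<longlonglongrightarrow> f x"
    "\<And>i x. x \<in> space N \<Longrightarrow> dist (F i x) 0 \<le> 2 * dist (f x) 0"
    using borel_measurable_implies_sequence_metric[of f N 0] by (simp add: \<open>f \<in> borel_measurable N\<close>) metis
  have [measurable]: "F i \<in> borel_measurable N" for i using F(1) by (rule borel_measurable_simple_function)
  have b: "cmod (F i x) \<le> 2 * cmod (f x)" if "x \<in> space N" for i x using F(3)[OF that, of i] by simp
  have sq: "square_integrable N (F i)" for i
  proof (rule sqi_bound)
    show "integrable N (\<lambda>x. 4 * (cmod (f x))\<^sup>2)" using f by (simp add: square_integrable_def)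
    show "AE x in N. (cmod (F i x))\<^sup>2 \<le> 4 * (cmod (f x))\<^sup>2"
    proof (rule AE_I2)
      fix x assume "x \<in> space N"
      then have "(cmod (F i x))\<^sup>2 \<le> (2 * cmod (f x))\<^sup>2" using b by (intro power_mono) auto
      then show "(cmod (F i x))\<^sup>2 \<le> 4 * (cmod (f x))\<^sup>2" by (simp add: power_mult_distrib)
    qed
  qed measurable
  have "(\<lambda>i. \<integral>x. (cmod (F i x - f x))\<^sup>2 \<partial>N) \<longlonglongrightarrow> (\<integral>x. 0 \<partial>N)"
  proof (rule integral_dominated_convergence)
    show "integrable N (\<lambda>x. 9 * (cmod (f x))\<^sup>2)" using f by (simp add: square_integrable_def)
    show "AE x in N. (\<lambda>i. (cmod (F i x - f x))\<^sup>2) \<longlonglongrightarrow> 0"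
    proof (rule AE_I2)
      fix x assume "x \<in> space N"
      from F(2)[OF this] have "(\<lambda>i. (cmod (F i x - f x))\<^sup>2) \<longlonglongrightarrow> (cmod (f x - f x))\<^sup>2" by (intro tendsto_intros)
      then show "(\<lambda>i. (cmod (F i x - f x))\<^sup>2) \<longlonglongrightarrow> 0" by simp
    qed
    show "AE x in N. norm ((cmod (F i x - f x))\<^sup>2) \<le> 9 * (cmod (f x))\<^sup>2" for i
    proof (rule AE_I2)
      fix x assume "x \<in> space N"
      then have "cmod (F i x - f x) \<le> 3 * cmod (f x)"
        using b[of x i] norm_triangle_ineq4[of "F i x" "f x"] by linarith
      then have "(cmod (F i x - f x))\<^sup>2 \<le> (3 * cmod (f x))\<^sup>2" by (intro power_mono) auto
      then show "norm ((cmod (F i x - f x))\<^sup>2) \<le> 9 * (cmod (f x))\<^sup>2" by (simp add: power_mult_distrib)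
    qed
  qed measurable
  then have "(\<lambda>i. L2n N (\<lambda>x. F i x - f x)) \<longlonglongrightarrow> sqrt 0"
    unfolding L2n_def by (intro tendsto_real_sqrt) simp
  then have "(\<lambda>i. L2n N (\<lambda>x. F i x - f x)) \<longlonglongrightarrow> 0" by simp
  from that[OF F(1) sq b this] show ?thesis .
qed

definition L2_functional :: "'a measure \<Rightarrow> (('a \<Rightarrow> complex) \<Rightarrow> complex) \<Rightarrow> real \<Rightarrow> bool" where
  "L2_functional N \<Lambda> C \<longleftrightarrow>
    (\<forall>f g c. square_integrable N f \<longrightarrow> square_integrable N g \<longrightarrow> \<Lambda> (\<lambda>x. f x + c * g x) = \<Lambda> f + c * \<Lambda> g) \<and>
    (\<forall>f. square_integrable N f \<longrightarrow> cmod (\<Lambda> f) \<le> C * L2n N f)"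

lemma L2_functionalI:
  assumes "\<And>f g c. square_integrable N f \<Longrightarrow> square_integrable N g \<Longrightarrow> \<Lambda> (\<lambda>x. f x + c * g x) = \<Lambda> f + c * \<Lambda> g"
    "\<And>f. square_integrable N f \<Longrightarrow> cmod (\<Lambda> f) \<le> C * L2n N f"
  shows "L2_functional N \<Lambda> C"
  using assms by (auto simp: L2_functional_def)

lemma L2_functional_diff:
  assumes "L2_functional N \<Lambda> C" "square_integrable N f" "square_integrable N g"
  shows "\<Lambda> (\<lambda>x. f x - g x) = \<Lambda> f - \<Lambda> g"
  using assms(1)[unfolded L2_functional_def, THEN conjunct1, rule_format, OF assms(2,3), of "-1"] by simp

lemma L2_functional_bound: "L2_functional N \<Lambda> C \<Longrightarrow> square_integrable N f \<Longrightarrow> cmod (\<Lambda> f) \<le> C * L2n N f"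
  by (auto simp: L2_functional_def)

lemma L2_functional_zero: "L2_functional N \<Lambda> C \<Longrightarrow> \<Lambda> (\<lambda>x. 0) = 0"
  using L2_functional_bound[OF _ sqi_zero, of N \<Lambda> C] by (auto simp: L2n_def)

lemma L2_functional_cong:
  assumes "L2_functional N \<Lambda> C" "square_integrable N f" "square_integrable N g" "AE x in N. f x = g x"
  shows "\<Lambda> f = \<Lambda> g"
proof -
  have "L2n N (\<lambda>x. f x - g x) = 0"
    unfolding L2n_def using assms(2-4) by (subst integral_cong_AE[where g="\<lambda>x. 0"]) (auto simp: square_integrable_def)
  then have "cmod (\<Lambda> f - \<Lambda> g) \<le> 0"
    using L2_functional_bound[OF assms(1) sqi_diff[OF assms(2,3)]] L2_functional_diff[OF assms(1-3)] by simp
  then show ?thesis by simp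
qed

lemma L2_functional_sum:
  assumes "L2_functional N \<Lambda> C" "finite I" "\<And>i. i \<in> I \<Longrightarrow> square_integrable N (f i)"
  shows "\<Lambda> (\<lambda>x. \<Sum>i\<in>I. c i * f i x) = (\<Sum>i\<in>I. c i * \<Lambda> (f i))"
  using assms(2,3)
proof (induction rule: finite_induct)
  case empty show ?case using L2_functional_zero[OF assms(1)] by simp
next
  case (insert j I)
  have "\<Lambda> (\<lambda>x. (\<Sum>i\<in>I. c i * f i x) + c j * f j x) = \<Lambda> (\<lambda>x. \<Sum>i\<in>I. c i * f i x) + c j * \<Lambda> (f j)"
    using insert by (intro assms(1)[unfolded L2_functional_def, THEN conjunct1, rule_format] sqi_sum sqi_cmult) auto
  then show ?case using insert by (simp add: add.commute)
qed

text \<open>Uniformly bounded functionals that converge on indicators converge everywhere: simple functions are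
dense and the uniform bound controls the error.\<close>

lemma (in finite_measure) L2_functional_conv:
  assumes \<Lambda>: "\<And>j::nat. L2_functional M (\<Lambda> j) C" and \<Lambda>': "L2_functional M \<Lambda>' C"
    and ind: "\<And>A. A \<in> sets M \<Longrightarrow> (\<lambda>j. \<Lambda> j (indicator A)) \<longlonglongrightarrow> \<Lambda>' (indicator A)"
    and f: "square_integrable M f"
  shows "(\<lambda>j. \<Lambda> j f) \<longlonglongrightarrow> \<Lambda>' f"
proof -
  obtain F where F: "\<And>i. simple_function M (F i)" "\<And>i. square_integrable M (F i)"
    "(\<lambda>i. L2n M (\<lambda>x. F i x - f x)) \<longlonglongrightarrow> 0"
    using L2_simple_approx[OF f, of thesis] by blast
  have simple: "(\<lambda>j. \<Lambda> j (F i)) \<longlonglongrightarrow> \<Lambda>' (F i)" for i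
  proof -
    let ?Y = "F i ` space M" and ?I = "\<lambda>y x. indicator (F i -` {y} \<inter> space M) x :: complex"
    have fin: "finite ?Y" using F(1) by (simp add: simple_function_def)
    have S: "F i -` {y} \<inter> space M \<in> sets M" for y using F(1) by (rule simple_functionD)
    have eq: "AE x in M. F i x = (\<Sum>y\<in>?Y. y * ?I y x)"
    proof (rule AE_I2)
      fix x assume x: "x \<in> space M"
      have "(\<Sum>y\<in>?Y. y * ?I y x) = (\<Sum>y\<in>{F i x}. y * ?I y x)"
        by (rule sum.mono_neutral_right) (use fin x in \<open>auto simp: indicator_def\<close>)
      then show "F i x = (\<Sum>y\<in>?Y. y * ?I y x)" using x by simp
    qed
    have sqI: "square_integrable M (?I y)" for y using sqi_indicator[OF S] .
    have *: "\<Lambda>0 (F i) = (\<Sum>y\<in>?Y. y * \<Lambda>0 (?I y))" if "L2_functional M \<Lambda>0 C" for \<Lambda>0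
      using L2_functional_cong[OF that F(2) sqi_sum[OF fin sqi_cmult[OF sqI]] eq]
        L2_functional_sum[OF that fin sqI, of "\<lambda>y. y"] by simp
    have "(\<lambda>j. \<Sum>y\<in>?Y. y * \<Lambda> j (?I y)) \<longlonglongrightarrow> (\<Sum>y\<in>?Y. y * \<Lambda>' (?I y))"
      by (intro tendsto_sum tendsto_mult tendsto_const ind S)
    then show ?thesis using *[OF \<Lambda>] *[OF \<Lambda>'] by simp
  qed
  show ?thesis
  proof (rule LIMSEQ_I)
    fix r :: real assume r: "0 < r"
    have "(\<lambda>i. C * L2n M (\<lambda>x. F i x - f x)) \<longlonglongrightarrow> C * 0" by (intro tendsto_intros F(3))
    then have "\<forall>\<^sub>F i in sequentially. C * L2n M (\<lambda>x. F i x - f x) < r / 3"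
      using r by (intro order_tendstoD) auto
    then obtain i where i: "C * L2n M (\<lambda>x. F i x - f x) < r / 3" by (auto simp: eventually_sequentially)
    have d: "cmod (\<Lambda>0 (F i) - \<Lambda>0 f) < r / 3" if "L2_functional M \<Lambda>0 C" for \<Lambda>0
      using L2_functional_bound[OF that sqi_diff[OF F(2) f], of i] L2_functional_diff[OF that F(2) f, of i] i by simp
    obtain n0 where n0: "\<And>n. n \<ge> n0 \<Longrightarrow> cmod (\<Lambda> n (F i) - \<Lambda>' (F i)) < r / 3"
      using LIMSEQ_D[OF simple[of i], of "r / 3"] r by auto
    have "cmod (\<Lambda> n f - \<Lambda>' f) < r" if "n \<ge> n0" for n
    proof -
      have "\<Lambda> n f - \<Lambda>' f = (\<Lambda> n (F i) - \<Lambda>' (F i)) - (\<Lambda> n (F i) - \<Lambda> n f) + (\<Lambda>' (F i) - \<Lambda>' f)" by simp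
      then have "cmod (\<Lambda> n f - \<Lambda>' f) \<le> cmod (\<Lambda> n (F i) - \<Lambda>' (F i)) + cmod (\<Lambda> n (F i) - \<Lambda> n f) + cmod (\<Lambda>' (F i) - \<Lambda>' f)"
        by (smt (verit) norm_triangle_ineq norm_triangle_ineq4)
      then show ?thesis using n0[OF that] d[OF \<Lambda>, of n] d[OF \<Lambda>'] by linarith
    qed
    then show "\<exists>no. \<forall>n\<ge>no. norm (\<Lambda> n f - \<Lambda>' f) < r" by auto
  qed
qed

lemma (in finite_measure) L2_functional_eqI:
  assumes "L2_functional M \<Lambda> C" "L2_functional M \<Lambda>' C"
    and "\<And>A. A \<in> sets M \<Longrightarrow> \<Lambda> (indicator A) = \<Lambda>' (indicator A)"
    and "square_integrable M f"
  shows "\<Lambda> f = \<Lambda>' f"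
  using L2_functional_conv[of "\<lambda>_. \<Lambda>" C \<Lambda>' f] assms by (simp add: LIMSEQ_const_iff)

lemma integral_CS:
  assumes "square_integrable N f" "square_integrable N g"
  shows "cmod (\<integral>x. f x * g x \<partial>N) \<le> L2n N f * L2n N g"
proof -
  have [measurable]: "f \<in> borel_measurable N" "g \<in> borel_measurable N" using assms by (auto simp: square_integrable_def)
  have "(ennreal (cmod (\<integral>x. f x * g x \<partial>N)))\<^sup>2 \<le> (\<integral>\<^sup>+x. ennreal (cmod (f x)) * ennreal (cmod (g x)) \<partial>N)\<^sup>2"
    by (intro power_mono order_trans[OF integral_norm_bound_ennreal[OF sqi_mult_integrable[OF assms]]])
       (auto simp: norm_mult ennreal_mult)
  also have "\<dots> \<le> (\<integral>\<^sup>+x. (ennreal (cmod (f x)))\<^sup>2 \<partial>N) * (\<integral>\<^sup>+x. (ennreal (cmod (g x)))\<^sup>2 \<partial>N)"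
    by (rule Cauchy_Schwarz_nn_integral) auto
  also have "\<dots> = ennreal ((L2n N f * L2n N g)\<^sup>2)"
    using assms by (simp add: nn_L2n power_mult_distrib ennreal_mult)
  finally have "(cmod (\<integral>x. f x * g x \<partial>N))\<^sup>2 \<le> (L2n N f * L2n N g)\<^sup>2"
    by (simp add: ennreal_power ennreal_le_iff)
  then show ?thesis by (rule power2_le_imp_le) (simp add: L2n_nonneg)
qed

section \<open>Functionals represented by square integrable functions\<close>

lemma ennreal_square_less_top: "(x::ennreal)\<^sup>2 < \<infinity> \<Longrightarrow> x < \<infinity>"
  by (cases x) (auto simp: power2_eq_square)

lemma (in finite_measure) emeasure_less_top: "emeasure M A < \<top>"
  using emeasure_finite[of A] less_top[of "emeasure M A"] by simp

text \<open>A form of the Riesz representation theorem that uses the Radon-Nikodym theorem only: the bound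
makes the image of \<open>w\<close> under \<open>X\<close> absolutely continuous, and its density \<open>D\<close> is square integrable because the
bound may be applied to truncations of \<open>D\<close>.\<close>

lemma riesz_nonneg:
  fixes w :: "'p \<Rightarrow> real"
  assumes N: "finite_measure N" and X[measurable]: "X \<in> P \<rightarrow>\<^sub>M N" and w[measurable]: "w \<in> borel_measurable P"
    and w0: "\<And>x. 0 \<le> w x"
    and c: "c < \<infinity>"
    and bd: "\<And>g. g \<in> borel_measurable N \<Longrightarrow> (\<integral>\<^sup>+x. g (X x) * ennreal (w x) \<partial>P)\<^sup>2 \<le> c * (\<integral>\<^sup>+n. (g n)\<^sup>2 \<partial>N)"
  obtains D :: "'n \<Rightarrow> real" where "D \<in> borel_measurable N" "\<And>n. 0 \<le> D n" "(\<integral>\<^sup>+n. (ennreal (D n))\<^sup>2 \<partial>N) < \<infinity>"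
    "distr (density P w) N X = density N D"
proof -
  interpret N: finite_measure N by fact
  let ?\<kappa> = "distr (density P w) N X"
  have nn: "(\<integral>\<^sup>+n. g n \<partial>?\<kappa>) = (\<integral>\<^sup>+x. g (X x) * ennreal (w x) \<partial>P)" if [measurable]: "g \<in> borel_measurable N" for g
    by (simp add: nn_integral_distr nn_integral_density mult.commute)
  have em: "emeasure ?\<kappa> A = (\<integral>\<^sup>+x. indicator A (X x) * ennreal (w x) \<partial>P)" if "A \<in> sets N" for A
    using nn[of "indicator A"] that by simp
  have emb: "(emeasure ?\<kappa> A)\<^sup>2 \<le> c * emeasure N A" if A: "A \<in> sets N" for A
  proof -
    have "(indicator A n)\<^sup>2 = (indicator A n :: ennreal)" for n by (simp add: indicator_def)
    then show ?thesis using bd[of "indicator A"] A by (simp add: em)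
  qed
  have "emeasure ?\<kappa> (space N) < \<infinity>"
  proof -
    have "c * emeasure N (space N) < \<infinity>" using c N.emeasure_less_top[of "space N"] by (simp add: ennreal_mult_less_top)
    then have "(emeasure ?\<kappa> (space N))\<^sup>2 < \<infinity>" using emb[of "space N"] by (meson le_less_trans sets.top)
    then show ?thesis by (rule ennreal_square_less_top)
  qed
  then have fin: "finite_measure ?\<kappa>" by (intro finite_measureI) auto
  have ac: "absolutely_continuous N ?\<kappa>"
    unfolding absolutely_continuous_def
  proof (auto simp: null_sets_def)
    fix A assume "A \<in> sets N" "emeasure N A = 0"
    then have "(emeasure ?\<kappa> A)\<^sup>2 \<le> 0" using emb[of A] by simp
    then show "emeasure ?\<kappa> A = 0" by simp
  qed
  obtain D where D[measurable]: "D \<in> borel_measurable N" and AE: "AE x in N. RN_deriv N ?\<kappa> x = ennreal (D x)"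
    and D0: "\<And>x. 0 \<le> D x"
    using N.real_RN_deriv[OF fin ac] by auto
  have eq: "density N D = ?\<kappa>"
    using density_cong[OF _ _ AE] N.density_RN_deriv[OF ac] by simp
  have "(\<integral>\<^sup>+n. (ennreal (D n))\<^sup>2 \<partial>N) \<le> c"
  proof -
    let ?g = "\<lambda>k n. ennreal (min (D n) (real k))"
    have Ik: "(\<integral>\<^sup>+n. (?g k n)\<^sup>2 \<partial>N) \<le> c" for k
    proof -
      let ?I = "\<integral>\<^sup>+n. (?g k n)\<^sup>2 \<partial>N"
      have "?I \<le> (\<integral>\<^sup>+n. (ennreal (real k))\<^sup>2 \<partial>N)" by (intro nn_integral_mono power_mono ennreal_leI) auto
      also have "\<dots> < \<infinity>" using N.emeasure_less_top[of "space N"] by (simp add: ennreal_mult_less_top ennreal_power)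
      finally have fin: "?I < \<infinity>" .
      have "?I \<le> (\<integral>\<^sup>+n. ?g k n * ennreal (D n) \<partial>N)"
        unfolding power2_eq_square by (intro nn_integral_mono mult_left_mono ennreal_leI) auto
      also have "\<dots> = (\<integral>\<^sup>+n. ?g k n \<partial>?\<kappa>)"
        unfolding eq[symmetric] by (subst nn_integral_density) (auto simp: mult.commute)
      also have "\<dots> = (\<integral>\<^sup>+x. ?g k (X x) * ennreal (w x) \<partial>P)" by (rule nn) measurable
      finally have "?I\<^sup>2 \<le> (\<integral>\<^sup>+x. ?g k (X x) * ennreal (w x) \<partial>P)\<^sup>2" by (intro power_mono) auto
      also have "\<dots> \<le> c * ?I" by (rule bd) measurable
      finally have "?I * ?I \<le> ?I * c" by (simp add: power2_eq_square mult.commute)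
      then show "?I \<le> c" using fin by (cases "?I = 0") (auto simp: ennreal_mult_le_mult_iff)
    qed
    have "(\<integral>\<^sup>+n. (ennreal (D n))\<^sup>2 \<partial>N) = (\<integral>\<^sup>+n. (SUP k. (?g k n)\<^sup>2) \<partial>N)"
    proof (rule nn_integral_cong)
      fix n
      obtain k0 :: nat where k0: "D n \<le> real k0" using real_arch_simple by blast
      show "(ennreal (D n))\<^sup>2 = (SUP k. (?g k n)\<^sup>2)"
      proof (rule antisym)
        show "(ennreal (D n))\<^sup>2 \<le> (SUP k. (?g k n)\<^sup>2)" using k0 by (intro SUP_upper2[of k0]) auto
        show "(SUP k. (?g k n)\<^sup>2) \<le> (ennreal (D n))\<^sup>2" by (intro SUP_least power_mono ennreal_leI) auto
      qed
    qed
    also have "\<dots> = (SUP k. \<integral>\<^sup>+n. (?g k n)\<^sup>2 \<partial>N)"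
    proof (rule nn_integral_monotone_convergence_SUP)
      show "incseq (\<lambda>k n. (?g k n)\<^sup>2)"
        by (auto simp: incseq_def le_fun_def intro!: power_mono ennreal_leI)
    qed measurable
    also have "\<dots> \<le> c" using Ik by (rule SUP_least)
    finally show ?thesis .
  qed
  then show ?thesis using that[OF D D0 _ eq[symmetric]] c by (auto intro: le_less_trans)
qed

text \<open>The complex case follows by splitting \<open>w\<close> into positive and negative, real and imaginary parts. It is
used for the operator of a polymorphism and for conditional expectations.\<close>

lemma riesz_representation:
  fixes w :: "'p \<Rightarrow> complex"
  assumes N: "finite_measure N" and X[measurable]: "X \<in> P \<rightarrow>\<^sub>M N" and w[measurable]: "w \<in> borel_measurable P"
    and c: "c < \<infinity>"
    and bd: "\<And>g. g \<in> borel_measurable N \<Longrightarrow> (\<integral>\<^sup>+x. g (X x) * ennreal (cmod (w x)) \<partial>P)\<^sup>2 \<le> c * (\<integral>\<^sup>+n. (g n)\<^sup>2 \<partial>N)"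
  obtains f where "square_integrable N f"
    "\<And>g. square_integrable N g \<Longrightarrow> integrable P (\<lambda>x. g (X x) * w x)"
    "\<And>g. square_integrable N g \<Longrightarrow> (\<integral>x. g (X x) * w x \<partial>P) = (\<integral>n. g n * f n \<partial>N)"
proof -
  have ex: "\<exists>f. square_integrable N f \<and> (\<forall>g. square_integrable N g \<longrightarrow> integrable P (\<lambda>x. g (X x) * v x) \<and>
      (\<integral>x. g (X x) * v x \<partial>P) = (\<integral>n. g n * f n \<partial>N))"
    if v[measurable]: "v \<in> borel_measurable P" and v0: "\<And>x. 0 \<le> v x" and vw: "\<And>x. v x \<le> cmod (w x)" for v :: "'p \<Rightarrow> real"
  proof -
    have bd': "(\<integral>\<^sup>+x. g (X x) * ennreal (v x) \<partial>P)\<^sup>2 \<le> c * (\<integral>\<^sup>+n. (g n)\<^sup>2 \<partial>N)" if "g \<in> borel_measurable N" for g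
      by (rule order_trans[OF _ bd[OF that]]) (auto intro!: power_mono nn_integral_mono mult_left_mono ennreal_leI vw)
    obtain D where D[measurable]: "D \<in> borel_measurable N" and D0: "\<And>n. 0 \<le> D n" and D2: "(\<integral>\<^sup>+n. (ennreal (D n))\<^sup>2 \<partial>N) < \<infinity>"
      and eq: "distr (density P v) N X = density N D"
      using riesz_nonneg[OF N X v v0 c bd'] by blast
    have sq: "square_integrable N (\<lambda>n. complex_of_real (D n))"
      unfolding sqi_iff_nn using D2 D0 by simp
    show ?thesis
    proof (intro exI conjI allI impI)
      show "square_integrable N (\<lambda>n. complex_of_real (D n))" by fact
      fix g assume g: "square_integrable N g"
      have [measurable]: "g \<in> borel_measurable N" using g by (rule sqi_measurable)
      have i: "integrable N (\<lambda>n. g n * complex_of_real (D n))" by (rule sqi_mult_integrable[OF g sq])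
      then have "integrable (density N D) g"
        using D0 by (subst integrable_density) (auto simp: scaleR_conv_of_real mult.commute)
      then have "integrable (density P v) (\<lambda>x. g (X x))"
        unfolding eq[symmetric] by (subst (asm) integrable_distr_eq) auto
      then show "integrable P (\<lambda>x. g (X x) * complex_of_real (v x))"
        using v0 by (subst (asm) integrable_density) (auto simp: scaleR_conv_of_real mult.commute)
      have "(\<integral>x. g (X x) * complex_of_real (v x) \<partial>P) = (\<integral>x. g (X x) \<partial>density P v)"
        using v0 by (subst integral_density) (auto simp: scaleR_conv_of_real mult.commute)
      also have "\<dots> = (\<integral>n. g n \<partial>density N D)" unfolding eq[symmetric] by (subst integral_distr) auto
      also have "\<dots> = (\<integral>n. g n * complex_of_real (D n) \<partial>N)"
        using D0 by (subst integral_density) (auto simp: scaleR_conv_of_real mult.commute)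
      finally show "(\<integral>x. g (X x) * complex_of_real (v x) \<partial>P) = (\<integral>n. g n * complex_of_real (D n) \<partial>N)" .
    qed
  qed
  let ?S = "\<lambda>v f. square_integrable N f \<and> (\<forall>g. square_integrable N g \<longrightarrow> integrable P (\<lambda>x. g (X x) * v x) \<and>
      (\<integral>x. g (X x) * v x \<partial>P) = (\<integral>n. g n * f n \<partial>N))"
  have [measurable]: "(\<lambda>x. Re (w x)) \<in> borel_measurable P" "(\<lambda>x. Im (w x)) \<in> borel_measurable P" by auto
  obtain f1 where f1: "?S (\<lambda>x. max 0 (Re (w x))) f1"
    using ex[of "\<lambda>x. max 0 (Re (w x))"] abs_Re_le_cmod by (force simp: abs_le_iff)
  obtain f2 where f2: "?S (\<lambda>x. max 0 (- Re (w x))) f2"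
    using ex[of "\<lambda>x. max 0 (- Re (w x))"] abs_Re_le_cmod by (force simp: abs_le_iff)
  obtain f3 where f3: "?S (\<lambda>x. max 0 (Im (w x))) f3"
    using ex[of "\<lambda>x. max 0 (Im (w x))"] abs_Im_le_cmod by (force simp: abs_le_iff)
  obtain f4 where f4: "?S (\<lambda>x. max 0 (- Im (w x))) f4"
    using ex[of "\<lambda>x. max 0 (- Im (w x))"] abs_Im_le_cmod by (force simp: abs_le_iff)
  have comb: "?S (\<lambda>x. u x + b * v x) (\<lambda>x. f x + b * h x)" if "?S u f" "?S v h" for u v f h b
  proof -
    have "integrable N (\<lambda>n. g n * f n)" "integrable N (\<lambda>n. g n * h n)" if "square_integrable N g" for g
      using that \<open>?S u f\<close> \<open>?S v h\<close> by (auto intro: sqi_mult_integrable)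
    then show ?thesis using that by (auto simp: ring_distribs mult.left_commute[of _ b] intro!: sqi_add sqi_cmult)
  qed
  have weq: "w x = ((complex_of_real (max 0 (Re (w x))) + (-1) * complex_of_real (max 0 (- Re (w x)))) +
     \<i> * (complex_of_real (max 0 (Im (w x))) + (-1) * complex_of_real (max 0 (- Im (w x)))))" for x
    by (auto simp: complex_eq_iff max_def)
  have "?S w (\<lambda>x. (f1 x + (-1) * f2 x) + \<i> * (f3 x + (-1) * f4 x))"
    using comb[OF comb[OF f1 f2, of "-1"] comb[OF f3 f4, of "-1"], of \<i>] unfolding weq[symmetric] .
  then show ?thesis using that by blast
qed

section \<open>Mellin forms of polymorphisms\<close>

lemma sets_Pol: "p \<in> Pol M N \<Longrightarrow> sets p = sets (pol_space M N)" by (simp add: Pol_def)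

lemma space_Pol: "p \<in> Pol M N \<Longrightarrow> space p = space M \<times> space N \<times> {0<..}"
  using sets_eq_imp_space_eq[OF sets_Pol] by (auto simp: space_pair_measure)

lemma PolI:
  assumes s: "sets p = sets (pol_space M N)"
    and 1: "\<And>B. B \<in> sets M \<Longrightarrow> (\<integral>\<^sup>+z. indicator B (fst z) \<partial>p) = emeasure M B"
    and 2: "\<And>C. C \<in> sets N \<Longrightarrow> (\<integral>\<^sup>+z. ennreal (snd (snd z)) * indicator C (fst (snd z)) \<partial>p) = emeasure N C"
  shows "p \<in> Pol M N"
proof -
  note [measurable_cong] = s
  have a: "distr p M fst = M"
  proof (rule measure_eqI)
    fix B assume B: "B \<in> sets (distr p M fst)"
    then have [measurable]: "B \<in> sets M" by simp
    have "emeasure (distr p M fst) B = (\<integral>\<^sup>+m. indicator B m \<partial>distr p M fst)" using B by simp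
    also have "\<dots> = (\<integral>\<^sup>+z. indicator B (fst z) \<partial>p)" by (rule nn_integral_distr) auto
    finally show "emeasure (distr p M fst) B = emeasure M B" using 1 by simp
  qed simp
  have b: "distr (density p (\<lambda>z. ennreal (snd (snd z)))) N (\<lambda>z. fst (snd z)) = N" (is "?d = N")
  proof (rule measure_eqI)
    fix B assume B: "B \<in> sets ?d"
    then have [measurable]: "B \<in> sets N" by simp
    have [measurable]: "(\<lambda>z. snd (snd z)) \<in> p \<rightarrow>\<^sub>M borel" by (rule measurable_Rpos_D) measurable
    have "emeasure ?d B = (\<integral>\<^sup>+m. indicator B m \<partial>?d)" using B by simp
    also have "\<dots> = (\<integral>\<^sup>+z. indicator B (fst (snd z)) \<partial>density p (\<lambda>z. ennreal (snd (snd z))))" by (rule nn_integral_distr) auto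
    also have "\<dots> = (\<integral>\<^sup>+z. ennreal (snd (snd z)) * indicator B (fst (snd z)) \<partial>p)" by (rule nn_integral_density) auto
    finally show "emeasure ?d B = emeasure N B" using 2 by simp
  qed simp
  show ?thesis using a b s by (simp add: Pol_def case_prod_beta')
qed

lemma measurable_t:
  assumes "p \<in> Pol M N" shows "(\<lambda>z. snd (snd z)) \<in> borel_measurable p"
proof -
  note [measurable_cong] = sets_Pol[OF assms]
  show ?thesis by (rule measurable_Rpos_D) measurable
qed

lemma measurable_mel_t:
  assumes "p \<in> Pol M N" shows "(\<lambda>z. mel s (snd (snd z))) \<in> borel_measurable p"
proof -
  note [measurable_cong] = sets_Pol[OF assms]
  show ?thesis by measurable
qed

lemma Pol_nn1:
  assumes p: "p \<in> Pol M N" and [measurable]: "h \<in> borel_measurable M"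
  shows "(\<integral>\<^sup>+z. h (fst z) \<partial>p) = (\<integral>\<^sup>+m. h m \<partial>M)"
proof -
  note [measurable_cong] = sets_Pol[OF p]
  have "distr p M fst = M" using p by (simp add: Pol_def case_prod_beta')
  then have "(\<integral>\<^sup>+m. h m \<partial>M) = (\<integral>\<^sup>+m. h m \<partial>distr p M fst)" by simp
  also have "\<dots> = (\<integral>\<^sup>+z. h (fst z) \<partial>p)" by (rule nn_integral_distr) auto
  finally show ?thesis by simp
qed

lemma Pol_nn2:
  assumes p: "p \<in> Pol M N" and [measurable]: "h \<in> borel_measurable N"
  shows "(\<integral>\<^sup>+z. ennreal (snd (snd z)) * h (fst (snd z)) \<partial>p) = (\<integral>\<^sup>+m. h m \<partial>N)"
proof -
  note [measurable_cong] = sets_Pol[OF p] and [measurable] = measurable_t[OF p]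
  have "distr (density p (\<lambda>z. ennreal (snd (snd z)))) N (\<lambda>z. fst (snd z)) = N" using p by (simp add: Pol_def case_prod_beta')
  then have "(\<integral>\<^sup>+m. h m \<partial>N) = (\<integral>\<^sup>+m. h m \<partial>distr (density p (\<lambda>z. ennreal (snd (snd z)))) N (\<lambda>z. fst (snd z)))" by simp
  also have "\<dots> = (\<integral>\<^sup>+z. h (fst (snd z)) \<partial>density p (\<lambda>z. ennreal (snd (snd z))))" by (rule nn_integral_distr) auto
  also have "\<dots> = (\<integral>\<^sup>+z. ennreal (snd (snd z)) * h (fst (snd z)) \<partial>p)" by (rule nn_integral_density) auto
  finally show ?thesis by simp
qed

lemma Pol_prob:
  assumes "p \<in> Pol M N" "prob_space M" shows "prob_space p"
proof
  interpret prob_space M by fact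
  show "emeasure p (space p) = 1" using Pol_nn1[OF assms(1), of "\<lambda>_. 1"] emeasure_space_1 by simp
qed

lemma Pol_AE1:
  assumes p: "p \<in> Pol M N" and "AE m in M. Q m"
  shows "AE z in p. Q (fst z)"
proof -
  note [measurable_cong] = sets_Pol[OF p]
  have "distr p M fst = M" using p by (simp add: Pol_def case_prod_beta')
  from arg_cong[OF this, of "\<lambda>M. AE m in M. Q m"] assms(2)
  have "AE m in distr p M fst. Q m" by blast
  moreover have "fst \<in> p \<rightarrow>\<^sub>M M" by measurable
  ultimately show ?thesis using AE_distrD[of fst p M Q] by blast
qed

lemma Pol_AE2:
  assumes p: "p \<in> Pol M N" and Q: "AE n in N. Q n"
  shows "AE z in p. Q (fst (snd z))"
proof -
  note [measurable_cong] = sets_Pol[OF p] and [measurable] = measurable_t[OF p]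
  have "distr (density p (\<lambda>z. ennreal (snd (snd z)))) N (\<lambda>z. fst (snd z)) = N" using p by (simp add: Pol_def case_prod_beta')
  from arg_cong[OF this, of "\<lambda>N. AE n in N. Q n"] Q
  have "AE n in distr (density p (\<lambda>z. ennreal (snd (snd z)))) N (\<lambda>z. fst (snd z)). Q n" by blast
  then have "AE z in density p (\<lambda>z. ennreal (snd (snd z))). Q (fst (snd z))"
    by (intro AE_distrD[of "\<lambda>z. fst (snd z)" "density p (\<lambda>z. ennreal (snd (snd z)))" N Q]) measurable
  then have "AE z in p. 0 < ennreal (snd (snd z)) \<longrightarrow> Q (fst (snd z))"
    by (subst (asm) AE_density) auto
  with AE_space show ?thesis
    by eventually_elim (auto simp: space_Pol[OF p])
qed

text \<open>The reason for the exponent \<open>1/2\<close>: in the Cauchy-Schwarz inequality one factor meets the first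
marginal condition, the other one absorbs \<open>t\<close> and meets the second.\<close>

lemma Pol_CS:
  assumes p: "p \<in> Pol M N" and [measurable]: "h \<in> borel_measurable M" "f \<in> borel_measurable N"
  shows "(\<integral>\<^sup>+z. h (fst z) * (f (fst (snd z)) * ennreal (sqrt (snd (snd z)))) \<partial>p)\<^sup>2 \<le> (\<integral>\<^sup>+m. (h m)\<^sup>2 \<partial>M) * (\<integral>\<^sup>+n. (f n)\<^sup>2 \<partial>N)"
proof -
  note [measurable_cong] = sets_Pol[OF p] and [measurable] = measurable_t[OF p]
  have "(\<integral>\<^sup>+z. h (fst z) * (f (fst (snd z)) * ennreal (sqrt (snd (snd z)))) \<partial>p)\<^sup>2 \<le>
     (\<integral>\<^sup>+z. (h (fst z))\<^sup>2 \<partial>p) * (\<integral>\<^sup>+z. (f (fst (snd z)) * ennreal (sqrt (snd (snd z))))\<^sup>2 \<partial>p)"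
    by (rule Cauchy_Schwarz_nn_integral) measurable
  also have "(\<integral>\<^sup>+z. (f (fst (snd z)) * ennreal (sqrt (snd (snd z))))\<^sup>2 \<partial>p) = (\<integral>\<^sup>+z. ennreal (snd (snd z)) * (f (fst (snd z)))\<^sup>2 \<partial>p)"
    by (intro nn_integral_cong) (auto simp: power_mult_distrib ennreal_power space_Pol[OF p] mult.commute)
  also have "\<dots> = (\<integral>\<^sup>+n. (f n)\<^sup>2 \<partial>N)" by (rule Pol_nn2[OF p]) measurable
  also have "(\<integral>\<^sup>+z. (h (fst z))\<^sup>2 \<partial>p) = (\<integral>\<^sup>+m. (h m)\<^sup>2 \<partial>M)" by (rule Pol_nn1[OF p]) measurable
  finally show ?thesis .
qed

definition pol_form :: "real \<Rightarrow> ('m \<times> 'n \<times> real) measure \<Rightarrow> ('m \<Rightarrow> complex) \<Rightarrow> ('n \<Rightarrow> complex) \<Rightarrow> complex" where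
  "pol_form s p h f = (\<integral>z. h (fst z) * (f (fst (snd z)) * mel s (snd (snd z))) \<partial>p)"

lemma pol_form_bound:
  assumes p: "p \<in> Pol M N" and h: "square_integrable M h" and f: "square_integrable N f"
  shows pol_form_integrable: "integrable p (\<lambda>z. h (fst z) * (f (fst (snd z)) * mel s (snd (snd z))))" (is ?A)
    and pol_form_le: "cmod (pol_form s p h f) \<le> L2n M h * L2n N f" (is ?B)
proof -
  note [measurable_cong] = sets_Pol[OF p] and [measurable] = measurable_t[OF p] measurable_mel_t[OF p]
  have [measurable]: "h \<in> borel_measurable M" "f \<in> borel_measurable N" using h f by (auto simp: square_integrable_def)
  let ?I = "\<integral>\<^sup>+z. ennreal (norm (h (fst z) * (f (fst (snd z)) * mel s (snd (snd z))))) \<partial>p"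
  have "?I = (\<integral>\<^sup>+z. ennreal (cmod (h (fst z))) * (ennreal (cmod (f (fst (snd z)))) * ennreal (sqrt (snd (snd z)))) \<partial>p)"
    by (intro nn_integral_cong) (auto simp: norm_mult norm_mel ennreal_mult space_Pol[OF p])
  then have "?I\<^sup>2 \<le> (\<integral>\<^sup>+m. (ennreal (cmod (h m)))\<^sup>2 \<partial>M) * (\<integral>\<^sup>+n. (ennreal (cmod (f n)))\<^sup>2 \<partial>N)"
    using Pol_CS[OF p, of "\<lambda>m. ennreal (cmod (h m))" "\<lambda>n. ennreal (cmod (f n))"] by simp
  also have "\<dots> = ennreal ((L2n M h * L2n N f)\<^sup>2)"
    using h f by (simp add: nn_L2n power_mult_distrib ennreal_mult)
  finally have I: "?I\<^sup>2 \<le> ennreal ((L2n M h * L2n N f)\<^sup>2)" .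
  then have "?I\<^sup>2 < \<infinity>" by (rule le_less_trans) simp
  then have "?I < \<infinity>" by (rule ennreal_square_less_top)
  then show ?A unfolding integrable_iff_bounded by simp
  have "(ennreal (cmod (pol_form s p h f)))\<^sup>2 \<le> ?I\<^sup>2"
    unfolding pol_form_def by (intro power_mono integral_norm_bound_ennreal \<open>?A\<close>) auto
  with I have "(ennreal (cmod (pol_form s p h f)))\<^sup>2 \<le> ennreal ((L2n M h * L2n N f)\<^sup>2)" by (rule order_trans[rotated])
  then have "(cmod (pol_form s p h f))\<^sup>2 \<le> (L2n M h * L2n N f)\<^sup>2"
    by (simp add: ennreal_power ennreal_le_iff)
  then show ?B by (rule power2_le_imp_le) (simp add: L2n_nonneg)
qed

lemma pol_form_functional2:
  assumes p: "p \<in> Pol M N" and h: "square_integrable M h"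
  shows "L2_functional N (pol_form s p h) (L2n M h)"
proof (rule L2_functionalI)
  fix f g c assume fg: "square_integrable N f" "square_integrable N g"
  show "pol_form s p h (\<lambda>x. f x + c * g x) = pol_form s p h f + c * pol_form s p h g"
    using pol_form_integrable[OF p h fg(1), of s] pol_form_integrable[OF p h fg(2), of s]
    by (simp add: pol_form_def ring_distribs mult.assoc mult.left_commute[of _ c])
qed (rule pol_form_le[OF p h])

lemma pol_form_functional1:
  assumes p: "p \<in> Pol M N" and h: "square_integrable N h"
  shows "L2_functional M (\<lambda>f. pol_form s p f h) (L2n N h)"
proof (rule L2_functionalI)
  fix f g c assume fg: "square_integrable M f" "square_integrable M g"
  show "pol_form s p (\<lambda>x. f x + c * g x) h = pol_form s p f h + c * pol_form s p g h"
    using pol_form_integrable[OF p fg(1) h, of s] pol_form_integrable[OF p fg(2) h, of s]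
    by (simp add: pol_form_def ring_distribs mult.assoc)
qed (use pol_form_le[OF p _ h] in \<open>simp add: mult.commute\<close>)

text \<open>\<open>F\<close> is the image of \<open>f\<close> under the contraction \<open>T s p\<close>.\<close>

lemma pol_operator_exists:
  assumes p: "p \<in> Pol M N" and M: "finite_measure M" and f: "square_integrable N f"
  obtains F where "square_integrable M F" "\<And>h. square_integrable M h \<Longrightarrow> pol_form s p h f = (\<integral>m. h m * F m \<partial>M)"
proof -
  note [measurable_cong] = sets_Pol[OF p] and [measurable] = measurable_t[OF p] measurable_mel_t[OF p]
  have [measurable]: "f \<in> borel_measurable N" using f by (auto simp: square_integrable_def)
  have "(\<integral>\<^sup>+ z. g (fst z) * ennreal (cmod (f (fst (snd z)) * mel s (snd (snd z)))) \<partial>p)\<^sup>2 \<le> ennreal ((L2n N f)\<^sup>2) * (\<integral>\<^sup>+ m. (g m)\<^sup>2 \<partial>M)"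
    if [measurable]: "g \<in> borel_measurable M" for g
  proof -
    have "(\<integral>\<^sup>+ z. g (fst z) * ennreal (cmod (f (fst (snd z)) * mel s (snd (snd z)))) \<partial>p) =
      (\<integral>\<^sup>+z. g (fst z) * (ennreal (cmod (f (fst (snd z)))) * ennreal (sqrt (snd (snd z)))) \<partial>p)"
      by (intro nn_integral_cong) (auto simp: norm_mult norm_mel ennreal_mult space_Pol[OF p])
    then show ?thesis using Pol_CS[OF p, of g "\<lambda>n. ennreal (cmod (f n))"] nn_L2n[OF f] by (simp add: mult.commute)
  qed
  note bd = this
  obtain F where "square_integrable M F" "\<And>g. square_integrable M g \<Longrightarrow>
      (\<integral>z. g (fst z) * (f (fst (snd z)) * mel s (snd (snd z))) \<partial>p) = (\<integral>n. g n * F n \<partial>M)"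
  proof (rule riesz_representation[OF M, of fst p "\<lambda>z. f (fst (snd z)) * mel s (snd (snd z))" "ennreal ((L2n N f)\<^sup>2)"])
  qed (use bd in auto)
  then show ?thesis using that unfolding pol_form_def by blast
qed

lemma Pol_spaceD:
  assumes "p \<in> Pol M N" "z \<in> space p"
  shows "fst z \<in> space M" "fst (snd z) \<in> space N" "0 < snd (snd z)"
  using assms(2) by (auto simp: space_Pol[OF assms(1)])

section \<open>Injectivity of the Mellin transform\<close>

text \<open>Levy's continuity theorem for finite measures. After division by the total mass, which is the value of
the characteristic function at \<open>0\<close>, it is the theorem for probability measures; a limit of mass \<open>0\<close> has to
be treated apart.\<close>

lemma finite_measure_charfun_conv:
  fixes \<omega> :: "nat \<Rightarrow> real measure" and \<omega>' :: "real measure" and \<phi> :: "real \<Rightarrow> real"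
  assumes \<omega>: "\<And>j. finite_measure (\<omega> j)" "\<And>j. sets (\<omega> j) = sets borel"
    and \<omega>': "finite_measure \<omega>'" "sets \<omega>' = sets borel"
    and conv: "\<And>s. (\<lambda>j. \<integral>x. iexp (s * x) \<partial>\<omega> j) \<longlonglongrightarrow> (\<integral>x. iexp (s * x) \<partial>\<omega>')"
    and \<phi>: "continuous_on UNIV \<phi>" "\<And>x. \<bar>\<phi> x\<bar> \<le> B"
  shows "(\<lambda>j. \<integral>x. \<phi> x \<partial>\<omega> j) \<longlonglongrightarrow> (\<integral>x. \<phi> x \<partial>\<omega>')"
proof -
  interpret W: finite_measure "\<omega> j" for j by (rule \<omega>)
  interpret W': finite_measure \<omega>' by (rule \<omega>')
  note [measurable_cong] = \<omega>(2) \<omega>'(2)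
  have sp: "space (\<omega> j) = UNIV" "space \<omega>' = UNIV" for j
    using sets_eq_imp_space_eq[OF \<omega>(2)] sets_eq_imp_space_eq[OF \<omega>'(2)] by auto
  let ?c = "\<lambda>j. measure (\<omega> j) UNIV" and ?c' = "measure \<omega>' UNIV"
  have [measurable]: "\<phi> \<in> borel_measurable borel" using \<phi>(1) by (rule borel_measurable_continuous_onI)
  have c: "?c \<longlonglongrightarrow> ?c'"
  proof -
    have "(\<lambda>j. Re (\<integral>x. iexp (0 * x) \<partial>\<omega> j)) \<longlonglongrightarrow> Re (\<integral>x. iexp (0 * x) \<partial>\<omega>')"
      by (intro tendsto_Re conv)
    then show ?thesis by (simp add: sp)
  qed
  have phim: "\<phi> \<in> borel_measurable (\<omega> j)" "\<phi> \<in> borel_measurable \<omega>'" for j by measurable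
  have B0: "0 \<le> B" using \<phi>(2)[of 0] by simp
  have bnd: "\<bar>\<integral>x. \<phi> x \<partial>\<omega> j\<bar> \<le> B * ?c j" for j
  proof -
    have "\<bar>\<integral>x. \<phi> x \<partial>\<omega> j\<bar> \<le> (\<integral>x. B \<partial>\<omega> j)"
      using \<phi>(2) by (intro integral_abs_bound[THEN order_trans] integral_mono integrable_abs W.integrable_const_bound[of _ B]) (auto simp: phim B0)
    then show ?thesis by (simp add: sp mult.commute)
  qed
  have bnd': "\<bar>\<integral>x. \<phi> x \<partial>\<omega>'\<bar> \<le> B * ?c'"
  proof -
    have "\<bar>\<integral>x. \<phi> x \<partial>\<omega>'\<bar> \<le> (\<integral>x. B \<partial>\<omega>')"
      using \<phi>(2) by (intro integral_abs_bound[THEN order_trans] integral_mono integrable_abs W'.integrable_const_bound[of _ B]) (auto simp: phim B0)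
    then show ?thesis by (simp add: sp mult.commute)
  qed
  show ?thesis
  proof (cases "?c' = 0")
    case True
    have "(\<lambda>j. B * ?c j) \<longlonglongrightarrow> B * 0" using c True by (intro tendsto_intros) simp
    then have lim0: "(\<lambda>j. B * ?c j) \<longlonglongrightarrow> 0" by simp
    have "(\<lambda>j. \<integral>x. \<phi> x \<partial>\<omega> j) \<longlonglongrightarrow> 0"
      by (rule Lim_null_comparison[OF always_eventually[OF allI] lim0]) (simp add: bnd)
    moreover have "(\<integral>x. \<phi> x \<partial>\<omega>') = 0" using bnd' True by simp
    ultimately show ?thesis by simp
  next
    case False
    then have c'0: "0 < ?c'" by (simp add: zero_less_measure_iff)
    let ?n = "\<lambda>w. density w (\<lambda>_. ennreal (1 / measure w UNIV))"
    have rd: "real_distribution (?n w)" if "finite_measure w" "sets w = sets borel" "0 < measure w UNIV" for w :: "real measure"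
    proof -
      interpret w: finite_measure w by fact
      have "space w = UNIV" using sets_eq_imp_space_eq[OF that(2)] by simp
      then have "emeasure (?n w) (space (?n w)) = ennreal (1 / measure w UNIV) * emeasure w UNIV"
        by (subst emeasure_density) (auto simp: that(2))
      also have "\<dots> = 1" using that(3) by (simp add: w.emeasure_eq_measure ennreal_mult[symmetric])
      finally have "prob_space (?n w)" by (rule prob_spaceI)
      then show ?thesis using that(2) by (simp add: real_distribution_def real_distribution_axioms_def)
    qed
    have int: "(\<integral>x. f x \<partial>?n w) = (1 / measure w UNIV) *\<^sub>R (\<integral>x. f x \<partial>w)"
      if "sets w = sets borel" "f \<in> borel_measurable borel" for w :: "real measure" and f :: "real \<Rightarrow> 'c::{banach, second_countable_topology}"
    proof -
      note [measurable_cong] = that(1)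
      have "(\<integral>x. f x \<partial>?n w) = (\<integral>x. (1 / measure w UNIV) *\<^sub>R f x \<partial>w)"
        using that by (subst integral_density) auto
      also have "\<dots> = (1 / measure w UNIV) *\<^sub>R (\<integral>x. f x \<partial>w)" by (rule integral_scaleR_right)
      finally show ?thesis .
    qed
    have iexp_m: "(\<lambda>x. iexp (s * x)) \<in> borel_measurable borel" for s by measurable
    define \<nu> where "\<nu> j = (if 0 < ?c j then ?n (\<omega> j) else ?n \<omega>')" for j
    have ev: "\<forall>\<^sub>F j in sequentially. 0 < ?c j" using order_tendstoD(1)[OF c c'0] .
    have r\<nu>: "real_distribution (\<nu> j)" for j unfolding \<nu>_def using rd \<omega> \<omega>' c'0 by auto
    have r': "real_distribution (?n \<omega>')" using rd \<omega>' c'0 by auto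
    have "weak_conv_m \<nu> (?n \<omega>')"
    proof (rule levy_continuity[OF r\<nu> r'])
      fix s
      have "(\<lambda>j. (1 / ?c j) *\<^sub>R (\<integral>x. iexp (s * x) \<partial>\<omega> j)) \<longlonglongrightarrow> (1 / ?c') *\<^sub>R (\<integral>x. iexp (s * x) \<partial>\<omega>')"
        using False by (intro tendsto_intros conv c)
      then have "(\<lambda>j. char (?n (\<omega> j)) s) \<longlonglongrightarrow> char (?n \<omega>') s"
        unfolding char_def int[OF \<omega>(2) iexp_m] int[OF \<omega>'(2) iexp_m] .
      then show "(\<lambda>j. char (\<nu> j) s) \<longlonglongrightarrow> char (?n \<omega>') s"
        by (rule Lim_transform_eventually) (use ev in eventually_elim, simp add: \<nu>_def)
    qed
    then have "(\<lambda>j. \<integral>x. \<phi> x \<partial>\<nu> j) \<longlonglongrightarrow> (\<integral>x. \<phi> x \<partial>?n \<omega>')"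
      using \<phi> by (intro weak_conv_imp_integral_bdd_continuous_conv[where B=B] r\<nu> r')
        (auto simp: continuous_on_eq_continuous_at)
    then have "(\<lambda>j. \<integral>x. \<phi> x \<partial>?n (\<omega> j)) \<longlonglongrightarrow> (\<integral>x. \<phi> x \<partial>?n \<omega>')"
      by (rule Lim_transform_eventually) (use ev in eventually_elim, simp add: \<nu>_def)
    then have "(\<lambda>j. (1 / ?c j) *\<^sub>R (\<integral>x. \<phi> x \<partial>\<omega> j)) \<longlonglongrightarrow> (1 / ?c') *\<^sub>R (\<integral>x. \<phi> x \<partial>\<omega>')"
      unfolding int[OF \<omega>(2) \<open>\<phi> \<in> borel_measurable borel\<close>] int[OF \<omega>'(2) \<open>\<phi> \<in> borel_measurable borel\<close>] .
    from tendsto_scaleR[OF c this] have "(\<lambda>j. ?c j *\<^sub>R (1 / ?c j) *\<^sub>R (\<integral>x. \<phi> x \<partial>\<omega> j)) \<longlonglongrightarrow> (\<integral>x. \<phi> x \<partial>\<omega>')"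
      using False by simp
    then show ?thesis
      by (rule Lim_transform_eventually) (use ev in eventually_elim, simp)
  qed
qed

lemma finite_measure_charfun_eq:
  fixes \<omega> \<omega>' :: "real measure"
  assumes \<omega>: "finite_measure \<omega>" "sets \<omega> = sets borel" and \<omega>': "finite_measure \<omega>'" "sets \<omega>' = sets borel"
    and eq: "\<And>s. (\<integral>x. iexp (s * x) \<partial>\<omega>) = (\<integral>x. iexp (s * x) \<partial>\<omega>')"
  shows "\<omega> = \<omega>'"
proof -
  have subset_Pow_UNIV: "X \<subseteq> Pow UNIV" for X :: "real set set" by simp
  show ?thesis
proof (rule measure_eqI_generator_eq[where E="range (\<lambda>a::real. {..<a})" and \<Omega>=UNIV and A="\<lambda>n. {..<real n}"])
  interpret W: finite_measure \<omega> by fact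
  interpret W': finite_measure \<omega>' by fact
  note [measurable_cong] = \<omega>(2) \<omega>'(2)
  show "Int_stable (range (\<lambda>a::real. {..<a}))"
  proof -
    have "{..<a} \<inter> {..<b} = {..<min a b}" for a b :: real by auto
    then show ?thesis by (auto simp: Int_stable_def)
  qed
  show "sets \<omega> = sigma_sets UNIV (range (\<lambda>a::real. {..<a}))" "sets \<omega>' = sigma_sets UNIV (range (\<lambda>a::real. {..<a}))"
    unfolding \<omega>(2) \<omega>'(2) by (simp_all only: borel_Iio sets_measure_of[OF subset_Pow_UNIV])
  show "(\<Union>n. {..<real n}) = UNIV" using reals_Archimedean2 by auto
  show "emeasure \<omega> {..<real n} \<noteq> \<infinity>" for n by simp
  fix X assume "X \<in> range (\<lambda>a::real. {..<a})"
  then obtain a where X: "X = {..<a}" by auto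
  let ?\<phi> = "\<lambda>n x. min 1 (max 0 (real n * (a - x)))"
  have e: "(\<integral>x. ?\<phi> n x \<partial>\<omega>) = (\<integral>x. ?\<phi> n x \<partial>\<omega>')" for n
  proof -
    have "(\<lambda>j::nat. \<integral>x. ?\<phi> n x \<partial>\<omega>) \<longlonglongrightarrow> (\<integral>x. ?\<phi> n x \<partial>\<omega>')"
    proof (rule finite_measure_charfun_conv[OF \<omega> \<omega>', where B=1])
      show "(\<lambda>j::nat. \<integral>x. iexp (s * x) \<partial>\<omega>) \<longlonglongrightarrow> (\<integral>x. iexp (s * x) \<partial>\<omega>')" for s
        by (simp only: eq tendsto_const)
      show "continuous_on UNIV (?\<phi> n)" by (intro continuous_intros)
    qed simp
    then show ?thesis by (simp only: LIMSEQ_const_iff)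
  qed
  have lim: "(\<lambda>n. \<integral>x. ?\<phi> n x \<partial>w) \<longlonglongrightarrow> measure w {..<a}" if "finite_measure w" "sets w = sets borel" for w :: "real measure"
  proof -
    interpret w: finite_measure w by fact
    note [measurable_cong] = that(2)
    have "(\<lambda>n. \<integral>x. ?\<phi> n x \<partial>w) \<longlonglongrightarrow> (\<integral>x. indicator {..<a} x \<partial>w)"
    proof (rule integral_dominated_convergence[where w="\<lambda>_. 1"])
      show "AE x in w. (\<lambda>n. ?\<phi> n x) \<longlonglongrightarrow> indicator {..<a} x"
      proof (rule AE_I2)
        fix x
        show "(\<lambda>n. ?\<phi> n x) \<longlonglongrightarrow> indicator {..<a} x"
        proof (cases "x < a")
          case True
          obtain n0 :: nat where n0: "1 / (a - x) < real n0" using reals_Archimedean2 by blast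
          have "\<forall>\<^sub>F n in sequentially. 1 = ?\<phi> n x"
            using eventually_ge_at_top[of n0]
          proof eventually_elim
            case (elim n)
            have "1 / (a - x) \<le> real n" using n0 elim by linarith
            then have "1 \<le> real n * (a - x)" using True by (simp add: field_simps)
            then show ?case by simp
          qed
          then have "(\<lambda>n. ?\<phi> n x) \<longlonglongrightarrow> 1" by (rule Lim_transform_eventually[OF tendsto_const])
          then show ?thesis using True by simp
        next
          case False
          then have "real n * (a - x) \<le> 0" for n by (simp add: mult_nonneg_nonpos)
          then have "?\<phi> n x = 0" for n by (metis max.absorb1 min.absorb2 zero_le_one)
          then show ?thesis using False by simp
        qed
      qed
    qed auto
    then show ?thesis by (simp add: sets_eq_imp_space_eq[OF that(2)])
  qed
  have "measure \<omega> {..<a} = measure \<omega>' {..<a}"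
    using lim[OF \<omega>] lim[OF \<omega>'] e by (simp add: LIMSEQ_unique)
  then show "emeasure \<omega> X = emeasure \<omega>' X" by (simp add: X W.emeasure_eq_measure W'.emeasure_eq_measure)
qed auto
qed

text \<open>The weight \<open>sqrt t\<close> and the coordinate \<open>ln t\<close> turn the Mellin form of two indicators into a
characteristic function.\<close>

definition log_slice :: "('m \<times> 'n \<times> real) measure \<Rightarrow> 'm set \<Rightarrow> 'n set \<Rightarrow> real measure" where
  "log_slice p B C = distr (density p (\<lambda>z. ennreal (indicator B (fst z) * (indicator C (fst (snd z)) * sqrt (snd (snd z)))))) borel
     (\<lambda>z. ln (snd (snd z)))"

lemma integrable_t:
  assumes p: "p \<in> Pol M N" and N: "prob_space N"
  shows "integrable p (\<lambda>z. snd (snd z))" "(\<integral>z. snd (snd z) \<partial>p) = 1"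
proof -
  note [measurable] = measurable_t[OF p]
  interpret N: prob_space N by fact
  have "(\<integral>\<^sup>+z. ennreal (snd (snd z)) \<partial>p) = 1"
    using Pol_nn2[OF p, of "\<lambda>_. 1"] by (simp add: N.emeasure_space_1)
  moreover have nn: "AE z in p. 0 \<le> snd (snd z)" by (intro AE_I2 less_imp_le Pol_spaceD(3)[OF p])
  ultimately have "has_bochner_integral p (\<lambda>z. snd (snd z)) 1"
    by (intro has_bochner_integral_nn_integral) (auto simp: measurable_t[OF p])
  then show "integrable p (\<lambda>z. snd (snd z))" "(\<integral>z. snd (snd z) \<partial>p) = 1"
    by (auto simp: has_bochner_integral_iff)
qed

lemma integrable_sqrt_t:
  assumes p: "p \<in> Pol M N" and M: "prob_space M" and N: "prob_space N"
  shows "integrable p (\<lambda>z. sqrt (snd (snd z)))"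
proof -
  note [measurable] = measurable_t[OF p]
  interpret p: prob_space p by (rule Pol_prob[OF p M])
  show ?thesis
  proof (rule Bochner_Integration.integrable_bound)
    show "integrable p (\<lambda>z. 1 + snd (snd z))" using integrable_t[OF p N] by auto
    show "AE z in p. norm (sqrt (snd (snd z))) \<le> norm (1 + snd (snd z))"
    proof (rule AE_I2)
      fix z assume "z \<in> space p"
      then have "0 < snd (snd z)" by (simp add: Pol_spaceD[OF p])
      moreover have "sqrt (snd (snd z)) \<le> 1 + snd (snd z)"
        using \<open>0 < snd (snd z)\<close> by (intro real_le_lsqrt) (auto simp: power2_eq_square algebra_simps)
      ultimately show "norm (sqrt (snd (snd z))) \<le> norm (1 + snd (snd z))" by simp
    qed
  qed measurable
qed

lemma log_slice:
  assumes p: "p \<in> Pol M N" and M: "prob_space M" and N: "prob_space N"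
    and B[measurable]: "B \<in> sets M" and C[measurable]: "C \<in> sets N"
  shows finite_log_slice: "finite_measure (log_slice p B C)" and sets_log_slice: "sets (log_slice p B C) = sets borel"
    and integral_log_slice: "\<And>f::real \<Rightarrow> 'c::{banach, second_countable_topology}. f \<in> borel_measurable borel \<Longrightarrow>
       (\<integral>x. f x \<partial>log_slice p B C) = (\<integral>z. (indicator B (fst z) * (indicator C (fst (snd z)) * sqrt (snd (snd z)))) *\<^sub>R f (ln (snd (snd z))) \<partial>p)"
proof -
  note [measurable_cong] = sets_Pol[OF p] and [measurable] = measurable_t[OF p]
  show "sets (log_slice p B C) = sets borel" by (simp add: log_slice_def)
  show "finite_measure (log_slice p B C)"
  proof (rule finite_measureI)
    have "emeasure (log_slice p B C) (space (log_slice p B C)) = (\<integral>\<^sup>+z. ennreal (indicator B (fst z) * (indicator C (fst (snd z)) * sqrt (snd (snd z)))) \<partial>p)"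
      unfolding log_slice_def by (simp add: emeasure_distr emeasure_density cong: nn_integral_cong)
    also have "\<dots> \<le> (\<integral>\<^sup>+z. ennreal (sqrt (snd (snd z))) \<partial>p)"
      by (intro nn_integral_mono ennreal_leI) (auto simp: indicator_def space_Pol[OF p])
    also have "\<dots> < \<infinity>"
      using integrable_sqrt_t[OF p M N] unfolding integrable_iff_bounded
      by (simp add: Pol_spaceD[OF p] less_imp_le cong: nn_integral_cong_simp)
    finally show "emeasure (log_slice p B C) (space (log_slice p B C)) \<noteq> \<infinity>" by simp
  qed
  fix f :: "real \<Rightarrow> 'c" assume [measurable]: "f \<in> borel_measurable borel"
  have "(\<integral>x. f x \<partial>log_slice p B C) = (\<integral>z. f (ln (snd (snd z))) \<partial>density p (\<lambda>z. ennreal (indicator B (fst z) * (indicator C (fst (snd z)) * sqrt (snd (snd z))))))"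
    unfolding log_slice_def by (rule integral_distr) auto
  also have "\<dots> = (\<integral>z. (indicator B (fst z) * (indicator C (fst (snd z)) * sqrt (snd (snd z)))) *\<^sub>R f (ln (snd (snd z))) \<partial>p)"
    by (rule integral_density) (measurable, intro AE_I2, simp add: Pol_spaceD[OF p] less_imp_le)
  finally show "(\<integral>x. f x \<partial>log_slice p B C) = (\<integral>z. (indicator B (fst z) * (indicator C (fst (snd z)) * sqrt (snd (snd z)))) *\<^sub>R f (ln (snd (snd z))) \<partial>p)" .
qed

lemma log_slice_char:
  assumes p: "p \<in> Pol M N" and M: "prob_space M" and N: "prob_space N"
    and B[measurable]: "B \<in> sets M" and C[measurable]: "C \<in> sets N"
  shows "(\<integral>x. iexp (s * x) \<partial>log_slice p B C) = pol_form s p (indicator B) (indicator C)"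
proof -
  have "(\<integral>x. iexp (s * x) \<partial>log_slice p B C) = (\<integral>z. (indicator B (fst z) * (indicator C (fst (snd z)) * sqrt (snd (snd z)))) *\<^sub>R iexp (s * ln (snd (snd z))) \<partial>p)"
    by (rule integral_log_slice[OF assms]) auto
  also have "\<dots> = pol_form s p (indicator B) (indicator C)"
    unfolding pol_form_def
    by (intro Bochner_Integration.integral_cong refl)
      (simp add: mel_eq Pol_spaceD[OF p] scaleR_conv_of_real mult.assoc of_real_indicator)
  finally show ?thesis .
qed

lemma pol_space_eqI:
  assumes sp: "sets p = sets (pol_space M N)" and sp': "sets p' = sets (pol_space M N)" and fin: "finite_measure p"
    and eq: "\<And>B C D. B \<in> sets M \<Longrightarrow> C \<in> sets N \<Longrightarrow> D \<in> sets Rpos \<Longrightarrow> emeasure p (B \<times> C \<times> D) = emeasure p' (B \<times> C \<times> D)"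
  shows "p = p'"
proof -
  interpret p: finite_measure p by fact
  let ?E2 = "{C \<times> D | C D. C \<in> sets N \<and> D \<in> sets Rpos}"
  let ?E = "{B \<times> Y | B Y. B \<in> sets M \<and> Y \<in> ?E2}"
  let ?\<Omega> = "space M \<times> space N \<times> space Rpos"
  have "sets (pol_space M N) = sigma_sets ?\<Omega> ?E"
  proof -
    have "sets (pol_space M N) = sets (sigma (space M \<times> space (N \<Otimes>\<^sub>M Rpos)) ?E)"
      by (rule sets_pair_eq[where Ca="{space M}" and Cb="{space N \<times> space Rpos}"])
        (auto simp: sets.sigma_sets_eq space_pair_measure sets_pair_measure simp del: space_Rpos dest: sets.sets_into_space)
    also have "\<dots> = sigma_sets ?\<Omega> ?E"
      by (simp only: space_pair_measure) (rule sets_measure_of, auto dest!: sets.sets_into_space simp del: space_Rpos)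
    finally show ?thesis .
  qed
  then have sE: "sets p = sigma_sets ?\<Omega> ?E" "sets p' = sigma_sets ?\<Omega> ?E" using sp sp' by (simp_all only:)
  show ?thesis
  proof (rule measure_eqI_generator_eq[OF _ _ _ sE, where A="\<lambda>_. ?\<Omega>"])
    show "Int_stable ?E"
      unfolding Int_stable_def
    proof (intro ballI)
      fix a b assume "a \<in> ?E" "b \<in> ?E"
      then obtain B C D B' C' D' where "a = B \<times> C \<times> D" "b = B' \<times> C' \<times> D'"
        "B \<in> sets M" "C \<in> sets N" "D \<in> sets Rpos" "B' \<in> sets M" "C' \<in> sets N" "D' \<in> sets Rpos" by auto
      moreover have "a \<inter> b = (B \<inter> B') \<times> (C \<inter> C') \<times> (D \<inter> D')" using \<open>a = _\<close> \<open>b = _\<close> by auto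
      ultimately show "a \<inter> b \<in> ?E" by blast
    qed
    show "range (\<lambda>_. ?\<Omega>) \<subseteq> ?E" by (auto simp del: space_Rpos)
    show "?E \<subseteq> Pow ?\<Omega>" by (auto dest!: sets.sets_into_space simp del: space_Rpos)
    show "emeasure p X = emeasure p' X" if "X \<in> ?E" for X using that eq by auto
    show "emeasure p ?\<Omega> \<noteq> \<infinity>" by simp
  qed auto
qed

lemma Pol_eqI:
  assumes p: "p \<in> Pol M N" and p': "p' \<in> Pol M N" and M: "prob_space M"
    and eq: "\<And>B C D. B \<in> sets M \<Longrightarrow> C \<in> sets N \<Longrightarrow> D \<in> sets Rpos \<Longrightarrow> emeasure p (B \<times> C \<times> D) = emeasure p' (B \<times> C \<times> D)"
  shows "p = p'"
  by (rule pol_space_eqI[OF sets_Pol[OF p] sets_Pol[OF p'] prob_space.finite_measure[OF Pol_prob[OF p M]]]) (rule eq)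

lemma pol_slice_measurable[measurable]:
  assumes p: "p \<in> Pol M N" and B[measurable]: "B \<in> sets M" and C[measurable]: "C \<in> sets N"
  shows "(indicator (B \<times> C \<times> UNIV) :: _ \<Rightarrow> ennreal) \<in> borel_measurable p"
proof -
  note [measurable_cong] = sets_Pol[OF p]
  have "(\<lambda>z. indicator B (fst z) * indicator C (fst (snd z)) :: ennreal) \<in> borel_measurable p" by measurable
  also have "(\<lambda>z. indicator B (fst z) * indicator C (fst (snd z))) = (indicator (B \<times> C \<times> UNIV) :: _ \<Rightarrow> ennreal)"
    by (auto simp: indicator_def fun_eq_iff)
  finally show ?thesis .
qed

text \<open>The characteristic functions of the logarithmic slices agree, and a slice determines the measure of
all boxes over its base.\<close>

lemma Pol_mellin_eqI:
  assumes p: "p \<in> Pol M N" and p': "p' \<in> Pol M N" and M: "prob_space M" and N: "prob_space N"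
    and eq: "\<And>s B C. B \<in> sets M \<Longrightarrow> C \<in> sets N \<Longrightarrow> pol_form s p (indicator B) (indicator C) = pol_form s p' (indicator B) (indicator C)"
  shows "p = p'"
proof (rule Pol_eqI[OF p p' M])
  fix B C D assume B[measurable]: "B \<in> sets M" and C[measurable]: "C \<in> sets N" and D[measurable]: "D \<in> sets Rpos"
  have ls: "log_slice p B C = log_slice p' B C"
    by (rule finite_measure_charfun_eq[OF finite_log_slice[OF p M N B C] sets_log_slice[OF p M N B C] finite_log_slice[OF p' M N B C] sets_log_slice[OF p' M N B C]])
      (simp only: log_slice_char[OF p M N B C] log_slice_char[OF p' M N B C] eq[OF B C])
  have "emeasure q (B \<times> C \<times> D) = (\<integral>\<^sup>+x. indicator D (exp x) * ennreal (exp (- (x/2))) \<partial>log_slice q B C)" if q: "q \<in> Pol M N" for q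
  proof -
    note [measurable_cong] = sets_Pol[OF q] and [measurable] = measurable_t[OF q]
    have [measurable]: "exp \<in> borel \<rightarrow>\<^sub>M Rpos" by (rule measurable_into_Rpos) auto
    have "(\<integral>\<^sup>+x. indicator D (exp x) * ennreal (exp (- (x/2))) \<partial>log_slice q B C) =
      (\<integral>\<^sup>+z. ennreal (indicator B (fst z) * (indicator C (fst (snd z)) * sqrt (snd (snd z)))) *
         (indicator D (exp (ln (snd (snd z)))) * ennreal (exp (- (ln (snd (snd z))/2)))) \<partial>q)"
      unfolding log_slice_def by (subst nn_integral_distr, simp, measurable, subst nn_integral_density, auto)
    also have "\<dots> = (\<integral>\<^sup>+z. indicator (B \<times> C \<times> D) z \<partial>q)"
    proof (rule nn_integral_cong)
      fix z assume "z \<in> space q"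
      then have t: "0 < snd (snd z)" by (simp add: Pol_spaceD[OF q])
      have "exp (- (ln (snd (snd z))/2)) = 1 / sqrt (snd (snd z))"
        using t by (simp add: exp_minus powr_half_sqrt[symmetric] powr_def inverse_eq_divide)
      then have "ennreal (sqrt (snd (snd z))) * ennreal (exp (- (ln (snd (snd z))/2))) = 1"
        using t by (simp add: ennreal_mult[symmetric])
      then show "ennreal (indicator B (fst z) * (indicator C (fst (snd z)) * sqrt (snd (snd z)))) *
         (indicator D (exp (ln (snd (snd z)))) * ennreal (exp (- (ln (snd (snd z))/2)))) = indicator (B \<times> C \<times> D) z"
        using t by (cases z) (auto simp: indicator_def)
    qed
    also have "\<dots> = emeasure q (B \<times> C \<times> D)" using sets_Pol[OF q] by (intro nn_integral_indicator) simp
    finally show ?thesis by simp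
  qed
  from this[OF p] this[OF p'] ls show "emeasure p (B \<times> C \<times> D) = emeasure p' (B \<times> C \<times> D)" by simp
qed

section \<open>Convergence of polymorphisms and of Mellin forms\<close>

lemma measurable_Rpos_continuous:
  fixes \<phi> :: "real \<Rightarrow> 'c::{second_countable_topology, banach}"
  assumes "continuous_on {0<..} \<phi>" shows "\<phi> \<in> borel_measurable Rpos"
  unfolding Rpos_def using assms by (rule borel_measurable_continuous_on_restrict)

lemma integral_pol_slice:
  fixes \<phi> :: "real \<Rightarrow> 'c::{second_countable_topology, banach}"
  assumes p: "p \<in> Pol M N" and B[measurable]: "B \<in> sets M" and C[measurable]: "C \<in> sets N"
    and [measurable]: "\<phi> \<in> borel_measurable Rpos"
  shows "(\<integral>t. \<phi> t \<partial>pol_slice p B C) = (\<integral>z. (indicator B (fst z) * indicator C (fst (snd z))) *\<^sub>R \<phi> (snd (snd z)) \<partial>p)"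
    and "(\<integral>t. \<phi> t \<partial>density (pol_slice p B C) ennreal) = (\<integral>z. (indicator B (fst z) * indicator C (fst (snd z)) * snd (snd z)) *\<^sub>R \<phi> (snd (snd z)) \<partial>p)"
proof -
  note [measurable_cong] = sets_Pol[OF p] and [measurable] = measurable_id_Rpos
  have tm[measurable]: "(\<lambda>z. snd (snd z)) \<in> p \<rightarrow>\<^sub>M Rpos" by measurable
  have eqd: "density p (indicator (B \<times> C \<times> UNIV)) = density p (\<lambda>z. ennreal (indicator B (fst z) * indicator C (fst (snd z))))"
    by (rule arg_cong[where f="density p"]) (auto simp: fun_eq_iff indicator_def)
  have 1: "(\<integral>t. \<psi> t \<partial>pol_slice p B C) = (\<integral>z. (indicator B (fst z) * indicator C (fst (snd z))) *\<^sub>R \<psi> (snd (snd z)) \<partial>p)"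
    if [measurable]: "\<psi> \<in> borel_measurable Rpos" for \<psi> :: "real \<Rightarrow> 'c"
  proof -
    have "(\<integral>t. \<psi> t \<partial>pol_slice p B C) = (\<integral>z. \<psi> (snd (snd z)) \<partial>density p (\<lambda>z. ennreal (indicator B (fst z) * indicator C (fst (snd z)))))"
      unfolding pol_slice_def eqd case_prod_beta' by (rule integral_distr) auto
    also have "\<dots> = (\<integral>z. (indicator B (fst z) * indicator C (fst (snd z))) *\<^sub>R \<psi> (snd (snd z)) \<partial>p)"
      by (rule integral_density) auto
    finally show ?thesis .
  qed
  show "(\<integral>t. \<phi> t \<partial>pol_slice p B C) = (\<integral>z. (indicator B (fst z) * indicator C (fst (snd z))) *\<^sub>R \<phi> (snd (snd z)) \<partial>p)"
    by (rule 1) measurable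
  have s: "sets (pol_slice p B C) = sets Rpos" by (simp add: pol_slice_def)
  have sp: "space (pol_slice p B C) = {0<..}" by (simp add: pol_slice_def)
  note [measurable_cong] = s
  have "(\<integral>t. \<phi> t \<partial>density (pol_slice p B C) ennreal) = (\<integral>t. t *\<^sub>R \<phi> t \<partial>pol_slice p B C)"
    by (rule integral_density[where g="\<lambda>t. t"]) (auto simp: sp)
  also have "\<dots> = (\<integral>z. (indicator B (fst z) * indicator C (fst (snd z))) *\<^sub>R (snd (snd z) *\<^sub>R \<phi> (snd (snd z))) \<partial>p)"
    by (rule 1) measurable
  finally show "(\<integral>t. \<phi> t \<partial>density (pol_slice p B C) ennreal) = (\<integral>z. (indicator B (fst z) * indicator C (fst (snd z)) * snd (snd z)) *\<^sub>R \<phi> (snd (snd z)) \<partial>p)"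
    by simp
qed

lemma integrable_pol_weight:
  fixes \<phi> :: "real \<Rightarrow> 'c::{second_countable_topology, banach}"
  assumes p: "p \<in> Pol M N" and M: "prob_space M" and N: "prob_space N"
    and B[measurable]: "B \<in> sets M" and C[measurable]: "C \<in> sets N"
    and [measurable]: "\<phi> \<in> borel_measurable Rpos" and b: "\<And>t. 0 < t \<Longrightarrow> norm (\<phi> t) \<le> b * (1 + t)"
  shows "integrable p (\<lambda>z. (indicator B (fst z) * indicator C (fst (snd z))) *\<^sub>R \<phi> (snd (snd z)))"
proof -
  note [measurable_cong] = sets_Pol[OF p]
  interpret p: prob_space p by (rule Pol_prob[OF p M])
  show ?thesis
  proof (rule Bochner_Integration.integrable_bound)
    show "integrable p (\<lambda>z. b * (1 + snd (snd z)))" using integrable_t[OF p N] by auto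
    show "AE z in p. norm ((indicator B (fst z) * indicator C (fst (snd z))) *\<^sub>R \<phi> (snd (snd z))) \<le> norm (b * (1 + snd (snd z)))"
    proof (rule AE_I2)
      fix z assume "z \<in> space p"
      then have "0 < snd (snd z)" by (rule Pol_spaceD[OF p])
      from b[OF this] have "norm (\<phi> (snd (snd z))) \<le> \<bar>b * (1 + snd (snd z))\<bar>" by linarith
      then show "norm ((indicator B (fst z) * indicator C (fst (snd z))) *\<^sub>R \<phi> (snd (snd z))) \<le> norm (b * (1 + snd (snd z)))"
        by (auto simp: indicator_def)
    qed
  qed measurable
qed

text \<open>The modulus \<open>sqrt t\<close> of the Mellin character is unbounded, so it is divided by \<open>1 + t\<close>. The
quotient \<open>\<psi>\<close> is bounded and continuous, and the two weak limits of the definition apply to the two summands of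
the character \<open>\<psi> t + t \<psi> t\<close>.\<close>

lemma pol_conv_imp_mellin:
  assumes p: "\<And>j. p j \<in> Pol M N" and p': "p' \<in> Pol M N" and M: "prob_space M" and N: "prob_space N"
    and conv: "pol_conv M N p p'"
    and B[measurable]: "B \<in> sets M" and C[measurable]: "C \<in> sets N"
  shows "(\<lambda>j. pol_form s (p j) (indicator B) (indicator C)) \<longlonglongrightarrow> pol_form s p' (indicator B) (indicator C)"
proof -
  let ?\<psi> = "\<lambda>t. complex_of_real (sqrt t) * iexp (s * ln t) / of_real (1 + t)"
  have cont: "continuous_on {0<..} ?\<psi>"
    by (intro continuous_intros) (auto simp: complex_eq_iff)
  have \<psi>b: "cmod (?\<psi> t) \<le> 1" if "0 < t" for t
  proof -
    have "sqrt t \<le> 1 + t" using that by (intro real_le_lsqrt) (auto simp: power2_eq_square algebra_simps)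
    moreover have "cmod (?\<psi> t) = sqrt t / (1 + t)" using that unfolding norm_divide norm_mult norm_exp_i_times norm_of_real by simp
    ultimately show ?thesis using that by simp
  qed
  have [measurable]: "?\<psi> \<in> borel_measurable Rpos" by (rule measurable_Rpos_continuous[OF cont])
  let ?w = "\<lambda>z. indicator B (fst z) * indicator C (fst (snd z)) :: real"
  have eq: "pol_form s q (indicator B) (indicator C) =
     (\<integral>z. ?w z *\<^sub>R ?\<psi> (snd (snd z)) \<partial>q) + (\<integral>z. (?w z * snd (snd z)) *\<^sub>R ?\<psi> (snd (snd z)) \<partial>q)"
    and i1: "integrable q (\<lambda>z. ?w z *\<^sub>R ?\<psi> (snd (snd z)))"
    and i2: "integrable q (\<lambda>z. (?w z * snd (snd z)) *\<^sub>R ?\<psi> (snd (snd z)))" if q: "q \<in> Pol M N" for q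
  proof -
    show i1: "integrable q (\<lambda>z. ?w z *\<^sub>R ?\<psi> (snd (snd z)))"
    proof (rule integrable_pol_weight[OF q M N B C, of _ 1])
      show "?\<psi> \<in> borel_measurable Rpos" by (rule measurable_Rpos_continuous[OF cont])
      fix t :: real assume t: "0 < t"
      show "cmod (?\<psi> t) \<le> 1 * (1 + t)" by (rule order_trans[OF \<psi>b[OF t]]) (use t in simp)
    qed
    have "integrable q (\<lambda>z. ?w z *\<^sub>R (of_real (snd (snd z)) * ?\<psi> (snd (snd z))))"
    proof (rule integrable_pol_weight[OF q M N B C, of _ 1])
      show "(\<lambda>t. of_real t * ?\<psi> t) \<in> borel_measurable Rpos"
        by (intro measurable_Rpos_continuous continuous_intros cont)
      fix t :: real assume t: "0 < t"
      have "cmod (of_real t * ?\<psi> t) \<le> t * 1" unfolding norm_mult using t \<psi>b[OF t] by (intro mult_mono) auto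
      then show "cmod (of_real t * ?\<psi> t) \<le> 1 * (1 + t)" by simp
    qed
    then show i2: "integrable q (\<lambda>z. (?w z * snd (snd z)) *\<^sub>R ?\<psi> (snd (snd z)))"
      by (simp add: scaleR_conv_of_real mult.assoc)
    have "pol_form s q (indicator B) (indicator C) = (\<integral>z. ?w z *\<^sub>R ?\<psi> (snd (snd z)) + (?w z * snd (snd z)) *\<^sub>R ?\<psi> (snd (snd z)) \<partial>q)"
      unfolding pol_form_def
    proof (rule Bochner_Integration.integral_cong[OF refl])
      fix z assume z: "z \<in> space q"
      let ?t = "snd (snd z)"
      have t: "0 < ?t" using z by (rule Pol_spaceD[OF q])
      then have "complex_of_real (1 + ?t) \<noteq> 0" by (simp add: of_real_eq_0_iff del: of_real_add)
      then have m: "mel s ?t = of_real (1 + ?t) * ?\<psi> ?t" using mel_eq[OF t] by simp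
      have "?w z *\<^sub>R ?\<psi> ?t + (?w z * ?t) *\<^sub>R ?\<psi> ?t = of_real (?w z) * (of_real (1 + ?t) * ?\<psi> ?t)"
        unfolding scaleR_conv_of_real of_real_add of_real_mult of_real_1 by (simp add: ring_distribs mult.assoc del: times_divide_eq_right)
      then show "indicator B (fst z) * (indicator C (fst (snd z)) * mel s ?t) = ?w z *\<^sub>R ?\<psi> ?t + (?w z * ?t) *\<^sub>R ?\<psi> ?t"
        unfolding m[symmetric] by (simp add: of_real_indicator mult.assoc)
    qed
    also have "\<dots> = (\<integral>z. ?w z *\<^sub>R ?\<psi> (snd (snd z)) \<partial>q) + (\<integral>z. (?w z * snd (snd z)) *\<^sub>R ?\<psi> (snd (snd z)) \<partial>q)"
      by (rule Bochner_Integration.integral_add[OF i1 i2])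
    finally show "pol_form s q (indicator B) (indicator C) =
     (\<integral>z. ?w z *\<^sub>R ?\<psi> (snd (snd z)) \<partial>q) + (\<integral>z. (?w z * snd (snd z)) *\<^sub>R ?\<psi> (snd (snd z)) \<partial>q)" .
  qed
  have wk: "weakly_conv (\<lambda>j. pol_slice (p j) B C) (pol_slice p' B C)"
    "weakly_conv (\<lambda>j. density (pol_slice (p j) B C) ennreal) (density (pol_slice p' B C) ennreal)"
    using conv B C by (auto simp: pol_conv_def)
  have real: "(\<lambda>j. \<integral>z. ?w z *\<^sub>R f (snd (snd z)) \<partial>p j) \<longlonglongrightarrow> (\<integral>z. ?w z *\<^sub>R f (snd (snd z)) \<partial>p')"
    "(\<lambda>j. \<integral>z. (?w z * snd (snd z)) *\<^sub>R f (snd (snd z)) \<partial>p j) \<longlonglongrightarrow> (\<integral>z. (?w z * snd (snd z)) *\<^sub>R f (snd (snd z)) \<partial>p')"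
    if f: "continuous_on {0<..} f" "\<And>t. 0 < t \<Longrightarrow> \<bar>f t\<bar> \<le> 1" for f :: "real \<Rightarrow> real"
  proof -
    have bd: "bounded (f ` {0<..})" using f(2) by (auto intro!: boundedI[of _ 1])
    have [measurable]: "f \<in> borel_measurable Rpos" by (rule measurable_Rpos_continuous[OF f(1)])
    note sl = integral_pol_slice[OF _ B C \<open>f \<in> borel_measurable Rpos\<close>]
    show "(\<lambda>j. \<integral>z. ?w z *\<^sub>R f (snd (snd z)) \<partial>p j) \<longlonglongrightarrow> (\<integral>z. ?w z *\<^sub>R f (snd (snd z)) \<partial>p')"
      using wk(1)[unfolded weakly_conv_def, rule_format, OF conjI[OF f(1) bd]]
      unfolding sl(1)[OF p] sl(1)[OF p'] .
    show "(\<lambda>j. \<integral>z. (?w z * snd (snd z)) *\<^sub>R f (snd (snd z)) \<partial>p j) \<longlonglongrightarrow> (\<integral>z. (?w z * snd (snd z)) *\<^sub>R f (snd (snd z)) \<partial>p')"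
      using wk(2)[unfolded weakly_conv_def, rule_format, OF conjI[OF f(1) bd]]
      unfolding sl(2)[OF p] sl(2)[OF p'] .
  qed
  let ?R = "\<lambda>t. Re (?\<psi> t)" and ?J = "\<lambda>t. Im (?\<psi> t)"
  have RI: "continuous_on {0<..} ?R" "continuous_on {0<..} ?J"
    by (intro continuous_on_Re continuous_on_Im cont)+
  have RIb: "\<bar>?R t\<bar> \<le> 1" "\<bar>?J t\<bar> \<le> 1" if "0 < t" for t
    using \<psi>b[OF that] abs_Re_le_cmod[of "?\<psi> t"] abs_Im_le_cmod[of "?\<psi> t"] by linarith+
  note rR = real[OF RI(1) RIb(1)] and rJ = real[OF RI(2) RIb(2)]
  have split: "(\<integral>z. a z *\<^sub>R ?\<psi> (snd (snd z)) \<partial>q) = Complex (\<integral>z. a z *\<^sub>R ?R (snd (snd z)) \<partial>q) (\<integral>z. a z *\<^sub>R ?J (snd (snd z)) \<partial>q)"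
    if "integrable q (\<lambda>z. a z *\<^sub>R ?\<psi> (snd (snd z)))" for q and a :: "'a \<times> 'b \<times> real \<Rightarrow> real"
    unfolding complex_eq_iff complex.sel using integral_Re[OF that] integral_Im[OF that] by (simp only: scaleR_complex.sel real_scaleR_def)
  have "(\<lambda>j. (\<integral>z. ?w z *\<^sub>R ?\<psi> (snd (snd z)) \<partial>p j) + (\<integral>z. (?w z * snd (snd z)) *\<^sub>R ?\<psi> (snd (snd z)) \<partial>p j))
    \<longlonglongrightarrow> (\<integral>z. ?w z *\<^sub>R ?\<psi> (snd (snd z)) \<partial>p') + (\<integral>z. (?w z * snd (snd z)) *\<^sub>R ?\<psi> (snd (snd z)) \<partial>p')"
    unfolding split[OF i1[OF p]] split[OF i2[OF p]] split[OF i1[OF p']] split[OF i2[OF p']]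
    by (intro tendsto_add tendsto_Complex rR rJ)
  then show ?thesis unfolding eq[OF p] eq[OF p'] .
qed

text \<open>The weights \<open>W t = 1\<close> and \<open>W t = t\<close> give the two weak limits that define the convergence of
polymorphisms. On compact sets the limit follows from the continuity theorem. No mass escapes to \<open>0\<close> or to
infinity, because by the marginal conditions the total mass of \<open>W\<close> is \<open>1\<close> for each of the measures and also for
the limit.\<close>

lemma mellin_imp_weight_conv:
  assumes p: "\<And>j. p j \<in> Pol M N" and p': "p' \<in> Pol M N" and M: "prob_space M" and N: "prob_space N"
    and conv: "\<And>s B C. B \<in> sets M \<Longrightarrow> C \<in> sets N \<Longrightarrow>
      (\<lambda>j. pol_form s (p j) (indicator B) (indicator C)) \<longlonglongrightarrow> pol_form s p' (indicator B) (indicator C)"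
    and W: "continuous_on {0<..} W" "\<And>t. 0 < t \<Longrightarrow> 0 \<le> W t" "\<And>t. 0 < t \<Longrightarrow> W t \<le> 1 + t"
    and W1: "\<And>q. q \<in> Pol M N \<Longrightarrow> (\<integral>z. W (snd (snd z)) \<partial>q) = 1"
    and \<phi>: "continuous_on {0<..} \<phi>" "\<And>t. 0 < t \<Longrightarrow> \<bar>\<phi> t\<bar> \<le> b"
    and B[measurable]: "B \<in> sets M" and C[measurable]: "C \<in> sets N"
  shows "(\<lambda>j. \<integral>z. (indicator B (fst z) * indicator C (fst (snd z))) *\<^sub>R (W (snd (snd z)) * \<phi> (snd (snd z))) \<partial>p j) \<longlonglongrightarrow>
     (\<integral>z. (indicator B (fst z) * indicator C (fst (snd z))) *\<^sub>R (W (snd (snd z)) * \<phi> (snd (snd z))) \<partial>p')"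
proof -
  define cut where "cut R t = max 0 (min 1 (R - \<bar>ln t\<bar>))" for R t :: real
  have cut01: "0 \<le> cut R t" "cut R t \<le> 1" for R t by (auto simp: cut_def)
  have cutc: "continuous_on {0<..} (cut R)" for R unfolding cut_def by (intro continuous_intros) auto
  note mR = measurable_Rpos_continuous
  have [measurable]: "W \<in> borel_measurable Rpos" "\<phi> \<in> borel_measurable Rpos" "cut R \<in> borel_measurable Rpos" for R
    by (rule mR W \<phi> cutc)+
  have b0: "0 \<le> b" using \<phi>(2)[of 1] by simp
  \<comment> \<open>For test functions with compact support the factor \<open>exp (- x / 2)\<close> compensates the weight of the
    logarithmic slice, and the continuity theorem applies.\<close>
  have cpt: "(\<lambda>j. \<integral>z. (indicator B (fst z) * indicator C (fst (snd z))) *\<^sub>R (W (snd (snd z)) * f (snd (snd z)) * cut R (snd (snd z))) \<partial>p j) \<longlonglongrightarrow>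
     (\<integral>z. (indicator B (fst z) * indicator C (fst (snd z))) *\<^sub>R (W (snd (snd z)) * f (snd (snd z)) * cut R (snd (snd z))) \<partial>p')"
    if f: "continuous_on {0<..} f" "\<And>t. 0 < t \<Longrightarrow> \<bar>f t\<bar> \<le> c" and B[measurable]: "B \<in> sets M" and C[measurable]: "C \<in> sets N" for f c R B C
  proof -
    let ?g = "\<lambda>x. W (exp x) * f (exp x) * cut R (exp x) * exp (- x / 2)"
    have c0: "0 \<le> c" using f(2)[of 1] by simp
    have ce: "continuous_on UNIV (\<lambda>x. h (exp x))" if "continuous_on {0<..} h" for h :: "real \<Rightarrow> real"
      by (rule continuous_on_compose2[OF that]) (auto intro!: continuous_intros)
    have gc: "continuous_on UNIV ?g" by (intro continuous_intros ce W f cutc) auto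
    have gb: "\<bar>?g x\<bar> \<le> (1 + exp \<bar>R\<bar>) * c * 1 * exp \<bar>R\<bar>" for x
    proof (cases "\<bar>x\<bar> \<le> R")
      case True
      then have "W (exp x) \<le> 1 + exp \<bar>R\<bar>" using W(3)[of "exp x"] by (smt (verit) exp_gt_zero exp_le_cancel_iff)
      then show ?thesis unfolding abs_mult using True c0 cut01[of R "exp x"] W(2)[of "exp x"] f(2)[of "exp x"]
        by (intro mult_mono) (auto intro!: mult_nonneg_nonneg)
    next
      case False
      then have "cut R (exp x) = 0" by (simp add: cut_def)
      then show ?thesis using c0 by simp
    qed
    have gm: "?g \<in> borel_measurable borel" using gc by (rule borel_measurable_continuous_onI)
    have "(\<lambda>j. \<integral>x. ?g x \<partial>log_slice (p j) B C) \<longlonglongrightarrow> (\<integral>x. ?g x \<partial>log_slice p' B C)"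
    proof (rule finite_measure_charfun_conv[OF finite_log_slice[OF p M N B C] sets_log_slice[OF p M N B C] finite_log_slice[OF p' M N B C] sets_log_slice[OF p' M N B C] _ gc gb])
      show "(\<lambda>j. \<integral>x. iexp (s * x) \<partial>log_slice (p j) B C) \<longlonglongrightarrow> (\<integral>x. iexp (s * x) \<partial>log_slice p' B C)" for s
        unfolding log_slice_char[OF p M N B C] log_slice_char[OF p' M N B C] by (rule conv[OF B C])
    qed
    moreover have "(\<integral>x. ?g x \<partial>log_slice q B C) =
       (\<integral>z. (indicator B (fst z) * indicator C (fst (snd z))) *\<^sub>R (W (snd (snd z)) * f (snd (snd z)) * cut R (snd (snd z))) \<partial>q)"
      if q: "q \<in> Pol M N" for q
      unfolding integral_log_slice[OF q M N B C gm]
    proof (rule Bochner_Integration.integral_cong[OF refl])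
      fix z assume "z \<in> space q"
      let ?t = "snd (snd z)"
      have t: "0 < ?t" using \<open>z \<in> space q\<close> by (rule Pol_spaceD[OF q])
      have "exp (- ln ?t / 2) = 1 / sqrt ?t"
        using t by (simp add: exp_minus powr_half_sqrt[symmetric] powr_def inverse_eq_divide)
      then have e: "sqrt ?t * exp (- ln ?t / 2) = 1" using t by simp
      have "(indicator B (fst z) * (indicator C (fst (snd z)) * sqrt ?t)) *\<^sub>R ?g (ln ?t) =
        (indicator B (fst z) * indicator C (fst (snd z))) *\<^sub>R (W ?t * f ?t * cut R ?t) * (sqrt ?t * exp (- ln ?t / 2))"
        using t by (simp only: exp_ln real_scaleR_def mult_ac)
      then show "(indicator B (fst z) * (indicator C (fst (snd z)) * sqrt ?t)) *\<^sub>R ?g (ln ?t) =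
        (indicator B (fst z) * indicator C (fst (snd z))) *\<^sub>R (W ?t * f ?t * cut R ?t)" unfolding e by simp
    qed
    ultimately show ?thesis using p p' by simp
  qed
  have int: "integrable q (\<lambda>z. (indicator B (fst z) * indicator C (fst (snd z))) *\<^sub>R (W (snd (snd z)) * f (snd (snd z))))"
    if f: "f \<in> borel_measurable Rpos" "\<And>t. 0 < t \<Longrightarrow> \<bar>f t\<bar> \<le> c" and q: "q \<in> Pol M N" and B: "B \<in> sets M" and C: "C \<in> sets N" for q f c B C
  proof (rule integrable_pol_weight[OF q M N B C, of _ c])
    have [measurable]: "f \<in> borel_measurable Rpos" by fact
    show "(\<lambda>t. W t * f t) \<in> borel_measurable Rpos" by measurable
    fix t :: real assume t: "0 < t"
    have "\<bar>W t * f t\<bar> \<le> (1 + t) * c" unfolding abs_mult using t W(2,3)[OF t] f(2)[OF t] by (intro mult_mono) auto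
    then show "norm (W t * f t) \<le> c * (1 + t)" by (simp add: mult.commute)
  qed
  let ?o = "\<lambda>z :: 'a \<times> 'b \<times> real. indicator (space M) (fst z) * indicator (space N) (fst (snd z)) :: real"
  let ?i = "\<lambda>z :: 'a \<times> 'b \<times> real. indicator B (fst z) * indicator C (fst (snd z)) :: real"
  let ?I = "\<lambda>q. \<integral>z. ?i z *\<^sub>R (W (snd (snd z)) * \<phi> (snd (snd z))) \<partial>q"
  let ?J = "\<lambda>R q. \<integral>z. ?i z *\<^sub>R (W (snd (snd z)) * \<phi> (snd (snd z)) * cut R (snd (snd z))) \<partial>q"
  let ?T = "\<lambda>R q. \<integral>z. ?o z *\<^sub>R (W (snd (snd z)) * 1 * cut R (snd (snd z))) \<partial>q"
  have T: "(\<lambda>j. ?T R (p j)) \<longlonglongrightarrow> ?T R p'" for R by (rule cpt[where c=1]) auto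
  have T': "(\<lambda>n. ?T (real n) p') \<longlonglongrightarrow> 1"
  proof -
    have "(\<lambda>n. ?T (real n) p') \<longlonglongrightarrow> (\<integral>z. ?o z *\<^sub>R (W (snd (snd z)) * 1) \<partial>p')"
    proof (rule integral_dominated_convergence[where w="\<lambda>z. ?o z *\<^sub>R (W (snd (snd z)) * 1)"])
      note [measurable_cong] = sets_Pol[OF p']
      show "(\<lambda>z. ?o z *\<^sub>R (W (snd (snd z)) * 1)) \<in> borel_measurable p'"
        "(\<lambda>z. ?o z *\<^sub>R (W (snd (snd z)) * 1 * cut (real n) (snd (snd z)))) \<in> borel_measurable p'" for n
        by measurable
      show "integrable p' (\<lambda>z. ?o z *\<^sub>R (W (snd (snd z)) * 1))"
        by (rule int[where c=1]) (auto simp: p')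
      show "AE z in p'. (\<lambda>n. ?o z *\<^sub>R (W (snd (snd z)) * 1 * cut (real n) (snd (snd z))))
        \<longlonglongrightarrow> ?o z *\<^sub>R (W (snd (snd z)) * 1)"
      proof (rule AE_I2)
        fix z :: "'a \<times> 'b \<times> real"
        have "(\<lambda>n. cut (real n) (snd (snd z))) \<longlonglongrightarrow> 1"
        proof (rule Lim_transform_eventually[OF tendsto_const])
          obtain n0 :: nat where "1 + \<bar>ln (snd (snd z))\<bar> < real n0" using reals_Archimedean2 by blast
          then show "\<forall>\<^sub>F n in sequentially. 1 = cut (real n) (snd (snd z))"
            by (intro eventually_sequentiallyI[of n0]) (auto simp: cut_def)
        qed
        from tendsto_mult[OF tendsto_const this, of "?o z *\<^sub>R (W (snd (snd z)) * 1)"]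
        show "(\<lambda>n. ?o z *\<^sub>R (W (snd (snd z)) * 1 * cut (real n) (snd (snd z))))
        \<longlonglongrightarrow> ?o z *\<^sub>R (W (snd (snd z)) * 1)" by (simp add: mult.assoc)
      qed
      show "AE z in p'. norm (?o z *\<^sub>R (W (snd (snd z)) * 1 * cut (real n) (snd (snd z))))
         \<le> ?o z *\<^sub>R (W (snd (snd z)) * 1)" for n
      proof (rule AE_I2)
        fix z assume "z \<in> space p'"
        then have "0 < snd (snd z)" by (rule Pol_spaceD[OF p'])
        from W(2)[OF this] show "norm (?o z *\<^sub>R (W (snd (snd z)) * 1 * cut (real n) (snd (snd z))))
         \<le> ?o z *\<^sub>R (W (snd (snd z)) * 1)"
          using cut01[of "real n" "snd (snd z)"] by (auto simp: indicator_def abs_mult intro: mult_right_le_one_le)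
      qed
    qed
    moreover have "(\<integral>z. ?o z *\<^sub>R (W (snd (snd z)) * 1) \<partial>p') = (\<integral>z. W (snd (snd z)) \<partial>p')"
      by (rule Bochner_Integration.integral_cong[OF refl]) (simp add: Pol_spaceD[OF p'])
    ultimately show ?thesis using W1[OF p'] by simp
  qed
  have tail: "\<bar>?I q - ?J R q\<bar> \<le> b * (1 - ?T R q)" if q: "q \<in> Pol M N" for q R
  proof -
    have i1: "integrable q (\<lambda>z. ?i z *\<^sub>R (W (snd (snd z)) * \<phi> (snd (snd z))))"
      by (rule int[OF _ \<phi>(2)]) (auto simp: q)
    have i2: "integrable q (\<lambda>z. ?i z *\<^sub>R (W (snd (snd z)) * (\<phi> (snd (snd z)) * cut R (snd (snd z)))))"
    proof (rule int[OF _ _ q B C, where c=b])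
      fix t :: real assume "0 < t"
      have "\<bar>\<phi> t * cut R t\<bar> \<le> b * 1" unfolding abs_mult using \<phi>(2)[OF \<open>0 < t\<close>] cut01[of R t] by (intro mult_mono) auto
      then show "\<bar>\<phi> t * cut R t\<bar> \<le> b" by simp
    qed measurable
    have i3: "integrable q (\<lambda>z. ?o z *\<^sub>R (W (snd (snd z)) * 1))"
      by (rule int[where c=1]) (auto simp: q)
    have i4: "integrable q (\<lambda>z. ?o z *\<^sub>R (W (snd (snd z)) * cut R (snd (snd z))))"
      by (rule int[where c=1]) (auto simp: q cut01)
    have e3: "(\<integral>z. ?o z *\<^sub>R (W (snd (snd z)) * 1) \<partial>q) = 1"
      using W1[OF q] by (subst Bochner_Integration.integral_cong[where N=q and g="\<lambda>z. W (snd (snd z))", OF refl]) (auto simp: Pol_spaceD[OF q])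
    have "\<bar>?I q - ?J R q\<bar> = \<bar>\<integral>z. ?i z *\<^sub>R (W (snd (snd z)) * \<phi> (snd (snd z))) -
      ?i z *\<^sub>R (W (snd (snd z)) * (\<phi> (snd (snd z)) * cut R (snd (snd z)))) \<partial>q\<bar>"
      by (subst Bochner_Integration.integral_diff[OF i1 i2]) (simp add: mult.assoc)
    also have "\<dots> \<le> (\<integral>z. b * (?o z *\<^sub>R (W (snd (snd z)) * 1) -
      ?o z *\<^sub>R (W (snd (snd z)) * cut R (snd (snd z)))) \<partial>q)"
    proof (rule order_trans[OF integral_abs_bound], rule integral_mono)
      fix z assume z: "z \<in> space q"
      let ?t = "snd (snd z)"
      have t: "0 < ?t" using z by (rule Pol_spaceD[OF q])
      have "\<bar>indicator B (fst z) * indicator C (fst (snd z)) * (W ?t * (\<phi> ?t * (1 - cut R ?t)))\<bar> \<le> 1 * (W ?t * (b * (1 - cut R ?t)))"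
        unfolding abs_mult[of "indicator B (fst z) * indicator C (fst (snd z))"]
      proof (rule mult_mono)
        show "\<bar>indicator B (fst z) * indicator C (fst (snd z)) :: real\<bar> \<le> 1" by (simp add: indicator_def)
        show "\<bar>W ?t * (\<phi> ?t * (1 - cut R ?t))\<bar> \<le> W ?t * (b * (1 - cut R ?t))"
          unfolding abs_mult using W(2)[OF t] \<phi>(2)[OF t] cut01[of R ?t] by (intro mult_mono) (auto intro!: mult_nonneg_nonneg)
      qed auto
      then show "\<bar>?i z *\<^sub>R (W ?t * \<phi> ?t) -
        ?i z *\<^sub>R (W ?t * (\<phi> ?t * cut R ?t))\<bar> \<le>
        b * (?o z *\<^sub>R (W ?t * 1) -
      ?o z *\<^sub>R (W ?t * cut R ?t))"
        using Pol_spaceD[OF q z] by (simp add: algebra_simps)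
    qed (intro integrable_abs Bochner_Integration.integrable_diff i1 i2 i3 i4 integrable_mult_right)+
    also have "\<dots> = b * (1 - ?T R q)"
      unfolding integral_mult_right_zero Bochner_Integration.integral_diff[OF i3 i4] e3 by simp
    finally show ?thesis .
  qed
  show ?thesis
  proof (rule LIMSEQ_I)
    fix r :: real assume r: "0 < r"
    have "(\<lambda>n. b * (1 - ?T (real n) p')) \<longlonglongrightarrow> b * (1 - 1)" by (intro tendsto_intros T')
    then have "\<forall>\<^sub>F n in sequentially. b * (1 - ?T (real n) p') < r / 3" using r by (intro order_tendstoD) auto
    then obtain R where R: "b * (1 - ?T (real R) p') < r / 3" by (auto simp: eventually_sequentially)
    have "(\<lambda>j. b * (1 - ?T (real R) (p j))) \<longlonglongrightarrow> b * (1 - ?T (real R) p')" by (intro tendsto_intros T)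
    then have e1: "\<forall>\<^sub>F j in sequentially. b * (1 - ?T (real R) (p j)) < r / 3" using R by (rule order_tendstoD)
    have e2: "\<forall>\<^sub>F j in sequentially. dist (?J (real R) (p j)) (?J (real R) p') < r / 3"
      by (rule tendstoD[OF cpt[OF \<phi> B C]]) (use r in auto)
    from e1 e2 have "\<forall>\<^sub>F j in sequentially. norm (?I (p j) - ?I p') < r"
    proof eventually_elim
      case (elim j)
      have *: "\<bar>x - y\<bar> < r" if "\<bar>x - x'\<bar> \<le> u" "\<bar>y - y'\<bar> \<le> v" "u < r/3" "v < r/3" "\<bar>x' - y'\<bar> < r/3" for x y x' y' u v :: real
        using that by arith
      from *[OF tail[OF p] tail[OF p'] elim(1) R] elim(2) show ?case by (simp only: dist_real_def real_norm_def)
    qed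
    then show "\<exists>no. \<forall>n\<ge>no. norm (?I (p n) - ?I p') < r" by (simp add: eventually_sequentially)
  qed
qed

lemma mellin_imp_pol_conv:
  assumes p: "\<And>j. p j \<in> Pol M N" and p': "p' \<in> Pol M N" and M: "prob_space M" and N: "prob_space N"
    and conv: "\<And>s B C. B \<in> sets M \<Longrightarrow> C \<in> sets N \<Longrightarrow>
      (\<lambda>j. pol_form s (p j) (indicator B) (indicator C)) \<longlonglongrightarrow> pol_form s p' (indicator B) (indicator C)"
  shows "pol_conv M N p p'"
  unfolding pol_conv_def weakly_conv_def
proof (intro ballI conjI allI impI)
  fix B C and \<phi> :: "real \<Rightarrow> real" assume B: "B \<in> sets M" and C: "C \<in> sets N" and \<phi>: "continuous_on {0<..} \<phi> \<and> bounded (\<phi> ` {0<..})"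
  then obtain b where b: "\<And>t. 0 < t \<Longrightarrow> \<bar>\<phi> t\<bar> \<le> b" by (auto simp: bounded_iff)
  have m: "\<phi> \<in> borel_measurable Rpos" using \<phi> by (intro measurable_Rpos_continuous) auto
  note w = mellin_imp_weight_conv[OF p p' M N conv _ _ _ _ conjunct1[OF \<phi>] b B C]
  have 1: "(\<integral>z. 1 \<partial>q) = (1::real)" if "q \<in> Pol M N" for q
  proof -
    interpret prob_space q by (rule Pol_prob[OF that M])
    show ?thesis by (simp add: prob_space)
  qed
  show "(\<lambda>j. \<integral>t. \<phi> t \<partial>pol_slice (p j) B C) \<longlonglongrightarrow> (\<integral>t. \<phi> t \<partial>pol_slice p' B C)"
    unfolding integral_pol_slice(1)[OF p B C m] integral_pol_slice(1)[OF p' B C m]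
    by (rule w[where W="\<lambda>_. 1", unfolded mult_1_left]) (assumption | rule 1 continuous_on_const | simp)+
  show "(\<lambda>j. \<integral>t. \<phi> t \<partial>density (pol_slice (p j) B C) ennreal) \<longlonglongrightarrow> (\<integral>t. \<phi> t \<partial>density (pol_slice p' B C) ennreal)"
    unfolding integral_pol_slice(2)[OF p B C m] integral_pol_slice(2)[OF p' B C m]
    unfolding real_scaleR_def mult.assoc
    by (rule w[where W="\<lambda>t. t", unfolded real_scaleR_def mult.assoc]) (assumption | rule integrable_t(2)[OF _ N] continuous_on_id | simp)+
qed

lemma pol_conv_form2:
  assumes p: "\<And>j. p j \<in> Pol M N" and p': "p' \<in> Pol M N" and M: "prob_space M" and N: "prob_space N"
    and conv: "pol_conv M N p p'" and B: "B \<in> sets M" and f: "square_integrable N f"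
  shows "(\<lambda>j. pol_form s (p j) (indicator B) f) \<longlonglongrightarrow> pol_form s p' (indicator B) f"
proof -
  interpret M: prob_space M by fact
  interpret N: prob_space N by fact
  note iB = M.sqi_indicator[OF B]
  show ?thesis
    by (rule N.L2_functional_conv[OF pol_form_functional2[OF p iB] pol_form_functional2[OF p' iB] _ f])
      (rule pol_conv_imp_mellin[OF p p' M N conv B])
qed

lemma pol_conv_form1:
  assumes p: "\<And>j. p j \<in> Pol M N" and p': "p' \<in> Pol M N" and M: "prob_space M" and N: "prob_space N"
    and conv: "pol_conv M N p p'" and C: "C \<in> sets N" and h: "square_integrable M h"
  shows "(\<lambda>j. pol_form s (p j) h (indicator C)) \<longlonglongrightarrow> pol_form s p' h (indicator C)"
proof -
  interpret M: prob_space M by fact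
  interpret N: prob_space N by fact
  note iC = N.sqi_indicator[OF C]
  show ?thesis
    by (rule M.L2_functional_conv[OF pol_form_functional1[OF p iC] pol_form_functional1[OF p' iC] _ h])
      (rule pol_conv_imp_mellin[OF p p' M N conv _ C])
qed

section \<open>Coordinates and generators of Lebesgue spaces\<close>

text \<open>An isomorphism modulo null sets with a measure on the line is turned into everywhere defined maps. The
inverse \<open>j\<close> is measurable only with respect to the completion, which is why completions occur below.\<close>

lemma lebesgue_coordinate:
  assumes L: "lebesgue_prob_space L"
  obtains e :: "'l \<Rightarrow> real" and j where "e \<in> L \<rightarrow>\<^sub>M borel"
    "j \<in> completion (distr L borel e) \<rightarrow>\<^sub>M L" "AE k in L. j (e k) = k"
proof -
  interpret L: prob_space L using L by (simp add: lebesgue_prob_space_def)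
  obtain \<nu> :: "real measure" where \<nu>: "prob_space \<nu>" "sets \<nu> = sets borel" and iso: "mod0_isomorphic L (completion \<nu>)"
    using L by (auto simp: lebesgue_prob_space_def)
  interpret \<nu>: prob_space \<nu> by fact
  define V where "V = completion \<nu>"
  have sp\<nu>: "space \<nu> = UNIV" using sets_eq_imp_space_eq[OF \<nu>(2)] by simp
  have spV: "space V = UNIV" and sub: "sets borel \<subseteq> sets V" using sp\<nu> \<nu>(2) by (auto simp: V_def)
  have emV: "emeasure V S = emeasure \<nu> S" if "S \<in> sets borel" for S
    using \<nu>(2) that by (simp add: V_def)
  obtain X Y f where X: "X \<in> sets L" and Y: "Y \<in> sets V" and XY: "space L - X \<in> null_sets L \<and>
      space V - Y \<in> null_sets V \<and> bij_betw f X Y \<and>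
      (\<forall>B\<subseteq>X. B \<in> sets L \<longleftrightarrow> f ` B \<in> sets V) \<and>
      (\<forall>B\<in>sets L. B \<subseteq> X \<longrightarrow> emeasure V (f ` B) = emeasure L B)"
    using iso unfolding V_def[symmetric] mod0_isomorphic_def by (elim bexE exE) (rule that)
  have nX: "space L - X \<in> null_sets L" and nY: "space V - Y \<in> null_sets V" and bij: "bij_betw f X Y"
    using XY by simp_all
  have sts: "B \<in> sets L \<longleftrightarrow> f ` B \<in> sets V" if "B \<subseteq> X" for B using XY that by simp
  have em: "emeasure V (f ` B) = emeasure L B" if "B \<in> sets L" "B \<subseteq> X" for B using XY that by simp
  have XL: "X \<subseteq> space L" using X by (rule sets.sets_into_space)
  have fX: "f ` X = Y" and inj: "inj_on f X" using bij by (auto simp: bij_betw_def)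
  obtain k0 where k0: "k0 \<in> space L" using L.not_empty by blast
  define e where "e k = (if k \<in> X then f k else 0)" for k
  define j where "j y = (if y \<in> Y then inv_into X f y else k0)" for y
  have pre: "{k \<in> X. f k \<in> S} \<in> sets L" and pre_em: "emeasure L {k \<in> X. f k \<in> S} = emeasure V S" if S: "S \<in> sets V" for S
  proof -
    have im: "f ` {k \<in> X. f k \<in> S} = S \<inter> Y" using fX by auto
    have 1: "S \<inter> Y \<in> sets V" using S Y by auto
    then show a: "{k \<in> X. f k \<in> S} \<in> sets L" using sts[of "{k \<in> X. f k \<in> S}"] im by auto
    have "AE y in V. y \<in> S \<longleftrightarrow> y \<in> S \<inter> Y"
      using AE_not_in[OF nY] by eventually_elim (auto simp: spV)
    then have "emeasure V S = emeasure V (S \<inter> Y)" by (rule emeasure_eq_AE) (use S 1 in auto)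
    then show "emeasure L {k \<in> X. f k \<in> S} = emeasure V S" using em[OF a] im by auto
  qed
  have e_vim: "e -` S \<inter> space L = {k \<in> X. f k \<in> S} \<union> (if 0 \<in> S then space L - X else {})" for S
    using XL by (auto simp: e_def split: if_splits)
  have e1: "e \<in> L \<rightarrow>\<^sub>M V"
    by (rule measurableI) (use X pre e_vim in \<open>auto simp: spV\<close>)
  have e2: "e \<in> L \<rightarrow>\<^sub>M borel"
    by (rule measurableI) (use measurable_sets[OF e1] sub in auto)
  have d: "distr L borel e = \<nu>"
  proof (rule measure_eqI)
    fix S assume "S \<in> sets (distr L borel e)"
    then have S: "S \<in> sets borel" by simp
    then have SV: "S \<in> sets V" using sub by auto
    have "emeasure (distr L borel e) S = emeasure L (e -` S \<inter> space L)" using S e2 by (simp add: emeasure_distr)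
    also have "\<dots> = emeasure L {k \<in> X. f k \<in> S}"
      unfolding e_vim using nX pre[OF SV] by (auto simp: emeasure_Un_null_set)
    also have "\<dots> = emeasure \<nu> S" using pre_em[OF SV] emV[OF S] by simp
    finally show "emeasure (distr L borel e) S = emeasure \<nu> S" .
  qed (simp add: \<nu>)
  have j1: "j \<in> V \<rightarrow>\<^sub>M L"
  proof (rule measurableI)
    fix y show "j y \<in> space L" using XL k0 fX by (auto simp: j_def intro: subsetD[OF XL inv_into_into])
  next
    fix B assume B: "B \<in> sets L"
    have key: "inv_into X f y \<in> B \<longleftrightarrow> y \<in> f ` (B \<inter> X)" if y: "y \<in> Y" for y
    proof -
      obtain x where x: "x \<in> X" "y = f x" using y fX by blast
      then have "inv_into X f y = x" using inj by (simp add: inv_into_f_f)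
      then show ?thesis using x inj by (auto simp: inj_on_def)
    qed
    have sub: "f ` (B \<inter> X) \<subseteq> Y" using fX by blast
    have "j -` B \<inter> space V = f ` (B \<inter> X) \<union> (if k0 \<in> B then space V - Y else {})"
    proof (rule Set.set_eqI)
      fix y show "y \<in> j -` B \<inter> space V \<longleftrightarrow> y \<in> f ` (B \<inter> X) \<union> (if k0 \<in> B then space V - Y else {})"
        using key[of y] sub by (cases "y \<in> Y") (auto simp: j_def spV)
    qed
    moreover have "f ` (B \<inter> X) \<in> sets V" using sts[of "B \<inter> X"] B X by auto
    ultimately show "j -` B \<inter> space V \<in> sets V" using Y by auto
  qed
  have "AE k in L. j (e k) = k"
  proof (rule AE_I'[OF nX])
    show "{k \<in> space L. j (e k) \<noteq> k} \<subseteq> space L - X"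
      using fX inj by (auto simp: e_def j_def inv_into_f_f)
  qed
  with that[OF e2] j1 show ?thesis unfolding d V_def by blast
qed

lemma lebesgue_mod0_borel:
  assumes L: "prob_space L" and e: "e \<in> L \<rightarrow>\<^sub>M borel"
    and j: "j \<in> completion (distr L borel e) \<rightarrow>\<^sub>M L" and je: "AE k in L. j (e k) = k"
    and B: "B \<in> sets L"
  obtains S where "S \<in> sets borel" "AE y in distr L borel e. y \<in> S \<longleftrightarrow> j y \<in> B" "AE k in L. e k \<in> S \<longleftrightarrow> k \<in> B"
proof -
  interpret L: prob_space L by fact
  let ?D = "distr L borel e"
  let ?J = "j -` B"
  have J: "?J \<in> sets (completion ?D)" using measurable_sets[OF j B] by simp
  define S where "S = main_part ?D ?J"
  have S: "S \<in> sets ?D" unfolding S_def by (rule main_part_sets[OF J])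
  have "AE y in ?D. y \<in> S \<longleftrightarrow> j y \<in> B"
  proof -
    obtain N' where N': "N' \<in> null_sets ?D" "null_part ?D ?J \<subseteq> N'" using null_part[OF J] by blast
    have "?J = S \<union> null_part ?D ?J" unfolding S_def using main_part_null_part_Un[OF J] by simp
    then have "{y \<in> space ?D. \<not> (y \<in> S \<longleftrightarrow> j y \<in> B)} \<subseteq> N'" using N' by auto
    then show ?thesis using N' by (intro AE_I')
  qed
  moreover have "AE k in L. e k \<in> S \<longleftrightarrow> k \<in> B"
    using AE_distrD[OF e calculation] je by eventually_elim auto
  ultimately show ?thesis using that S by simp
qed

text \<open>Points with the same cell are not separated by the first \<open>n\<close> sets.\<close>

definition cell :: "(nat \<Rightarrow> 'm set) \<Rightarrow> nat \<Rightarrow> 'm \<Rightarrow> nat set" where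
  "cell A n m = {i. i < n \<and> m \<in> A i}"

definition cellset :: "'m measure \<Rightarrow> (nat \<Rightarrow> 'm set) \<Rightarrow> nat \<Rightarrow> nat set set \<Rightarrow> 'm set" where
  "cellset M A n S = {m \<in> space M. cell A n m \<in> S}"

lemma cell_mono: "n \<le> n' \<Longrightarrow> cell A n m = cell A n' m \<inter> {..<n}"
  by (auto simp: cell_def)

lemma cell_Pow: "cell A n m \<in> Pow {..<n}" by (auto simp: cell_def)

lemma cellset_lift: "n \<le> n' \<Longrightarrow> cellset M A n S = cellset M A n' {c. c \<inter> {..<n} \<in> S}"
  using cell_mono[of n n' A] by (auto simp: cellset_def)

lemma sets_cellset1:
  assumes "\<And>i. A i \<in> sets M" shows "cellset M A n {c} \<in> sets M"
proof -
  note [measurable] = assms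
  have "cellset M A n {c} = (if c \<subseteq> {..<n} then {m \<in> space M. \<forall>i\<in>{..<n}. m \<in> A i \<longleftrightarrow> i \<in> c} else {})"
    by (auto simp: cellset_def cell_def split: if_splits)
  moreover have "{m \<in> space M. \<forall>i\<in>{..<n}. m \<in> A i \<longleftrightarrow> i \<in> c} \<in> sets M" by measurable
  ultimately show ?thesis by auto
qed

lemma cellset_eq_UN: "cellset M A n S = (\<Union>c\<in>S \<inter> Pow {..<n}. cellset M A n {c})"
  using cell_Pow[of A n] by (auto simp: cellset_def)

lemma sets_cellset:
  assumes "\<And>i. A i \<in> sets M" shows "cellset M A n S \<in> sets M"
  unfolding cellset_eq_UN[of M A n S] by (intro sets.finite_UN sets_cellset1 assms) auto

definition approximable :: "'m measure \<Rightarrow> (nat \<Rightarrow> 'm set) \<Rightarrow> 'm set \<Rightarrow> bool" where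
  "approximable M A B \<longleftrightarrow> B \<in> sets M \<and> (\<forall>\<epsilon>>0. \<exists>n S. measure M (sym_diff B (cellset M A n S)) < \<epsilon>)"

lemma (in prob_space) approximable_UN:
  assumes A: "\<And>i. A i \<in> sets M" and B: "\<And>i::nat. approximable M A (B i)"
  shows "approximable M A (\<Union>i. B i)"
  unfolding approximable_def
proof (intro conjI allI impI)
  have Bs[measurable]: "B i \<in> sets M" for i using B by (simp add: approximable_def)
  note [measurable] = sets_cellset[where M=M and A=A, OF A]
  show "(\<Union>i. B i) \<in> sets M" by auto
  fix \<epsilon> :: real assume \<epsilon>: "0 < \<epsilon>"
  let ?U = "\<lambda>k. \<Union>i<k. B i"
  have "(\<lambda>k. prob (?U k)) \<longlonglongrightarrow> prob (\<Union>k. ?U k)"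
    by (rule finite_Lim_measure_incseq) (auto simp: incseq_def intro: less_le_trans)
  also have "(\<Union>k. ?U k) = (\<Union>i. B i)" by auto
  finally have "\<forall>\<^sub>F k in sequentially. prob (\<Union>i. B i) - \<epsilon> / 2 < prob (?U k)"
    using \<epsilon> by (intro order_tendstoD) auto
  then obtain k where k: "prob (\<Union>i. B i) - \<epsilon> / 2 < prob (?U k)" by (auto simp: eventually_sequentially)
  have d: "prob ((\<Union>i. B i) - ?U k) < \<epsilon> / 2"
    using k by (subst finite_measure_Diff) auto
  have "\<forall>i. \<exists>n S. prob (sym_diff (B i) (cellset M A n S)) < \<epsilon> / (2 * (real k + 1))"
    using B \<epsilon> by (auto simp: approximable_def)
  then obtain n S where nS: "\<And>i. prob (sym_diff (B i) (cellset M A (n i) (S i))) < \<epsilon> / (2 * (real k + 1))" by metis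
  define n' where "n' = Max (insert 0 (n ` {..<k}))"
  have nn': "n i \<le> n'" if "i < k" for i using that by (auto simp: n'_def)
  define S' where "S' = (\<Union>i<k. {c. c \<inter> {..<n i} \<in> S i})"
  have S': "cellset M A n' S' = (\<Union>i<k. cellset M A (n i) (S i))"
  proof -
    have "cellset M A n' S' = (\<Union>i<k. cellset M A n' {c. c \<inter> {..<n i} \<in> S i})" by (auto simp: cellset_def S'_def)
    also have "\<dots> = (\<Union>i<k. cellset M A (n i) (S i))" by (intro SUP_cong refl cellset_lift[symmetric] nn') simp
    finally show ?thesis .
  qed
  have "prob (sym_diff (\<Union>i. B i) (cellset M A n' S')) \<le> prob (((\<Union>i. B i) - ?U k) \<union> (\<Union>i<k. sym_diff (B i) (cellset M A (n i) (S i))))"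
    unfolding S' by (rule finite_measure_mono) auto
  also have "\<dots> \<le> prob ((\<Union>i. B i) - ?U k) + prob (\<Union>i<k. sym_diff (B i) (cellset M A (n i) (S i)))"
    by (rule measure_Un_le) auto
  also have "prob (\<Union>i<k. sym_diff (B i) (cellset M A (n i) (S i))) \<le> (\<Sum>i<k. prob (sym_diff (B i) (cellset M A (n i) (S i))))"
    by (rule measure_UNION_le) auto
  also have "\<dots> \<le> (\<Sum>i<k. \<epsilon> / (2 * (real k + 1)))" using nS by (intro sum_mono less_imp_le)
  also have "\<dots> \<le> \<epsilon> / 2" using \<epsilon> by (simp add: field_simps)
  finally have "prob (sym_diff (\<Union>i. B i) (cellset M A n' S')) < \<epsilon>" using d by linarith
  then show "\<exists>n S. prob (sym_diff (\<Union>i. B i) (cellset M A n S)) < \<epsilon>" by blast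
qed

text \<open>The preimages of a countable basis of open sets under a real coordinate. The approximable sets form a
\<open>\<sigma>\<close>-algebra, and every measurable set is the preimage of a Borel set modulo null sets.\<close>

lemma lebesgue_generators:
  assumes L: "lebesgue_prob_space L"
  obtains A :: "nat \<Rightarrow> 'l set" where "\<And>i. A i \<in> sets L" "\<And>B. B \<in> sets L \<Longrightarrow> approximable L A B"
proof -
  interpret L: prob_space L using L by (simp add: lebesgue_prob_space_def)
  obtain e j where e[measurable]: "e \<in> L \<rightarrow>\<^sub>M (borel :: real measure)" and j: "j \<in> completion (distr L borel e) \<rightarrow>\<^sub>M L"
    and je: "AE k in L. j (e k) = k" by (rule lebesgue_coordinate[OF L])
  obtain E :: "real set set" where E: "countable E" "topological_basis E"
    using ex_countable_basis by blast
  have ne: "insert {} E \<noteq> {}" by simp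
  let ?g = "from_nat_into (insert {} E)"
  have rg: "range ?g = insert {} E" using E by (intro range_from_nat_into) auto
  have E_open: "open X" if "X \<in> E" for X using E(2) that by (auto simp: topological_basis_def)
  have g_open: "open (?g i)" for i using rg E_open by (metis insertE open_empty rangeI)
  define A where "A i = e -` ?g i \<inter> space L" for i
  have A: "A i \<in> sets L" for i unfolding A_def using g_open[of i] by measurable
  have cov: "approximable L A (e -` S \<inter> space L)" if "S \<in> sigma_sets UNIV E" for S
    using that
  proof induction
    case (Basic X)
    then obtain i where i: "?g i = X" using rg by (metis insertI2 rangeE)
    have "cellset L A (Suc i) {c. i \<in> c} = e -` X \<inter> space L"
      using i by (auto simp: cellset_def cell_def A_def)
    then have "measure L (sym_diff (e -` X \<inter> space L) (cellset L A (Suc i) {c. i \<in> c})) = 0" by simp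
    then show ?case unfolding approximable_def using A[of i] i by (auto simp: A_def) (metis)
  next
    case Empty
    have "measure L (sym_diff {} (cellset L A 0 {})) = 0" by (simp add: cellset_def)
    then show ?case unfolding approximable_def by (auto) (metis)
  next
    case (Compl X)
    have "e -` (UNIV - X) \<inter> space L = space L - (e -` X \<inter> space L)" by auto
    moreover have "\<exists>n S. measure L (sym_diff (space L - (e -` X \<inter> space L)) (cellset L A n S)) < \<epsilon>" if "0 < \<epsilon>" for \<epsilon>
    proof -
      obtain n S where "measure L (sym_diff (e -` X \<inter> space L) (cellset L A n S)) < \<epsilon>"
        using Compl.IH \<open>0 < \<epsilon>\<close> by (auto simp: approximable_def)
      moreover have "sym_diff (space L - (e -` X \<inter> space L)) (cellset L A n (- S)) = sym_diff (e -` X \<inter> space L) (cellset L A n S)"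
        by (auto simp: cellset_def)
      ultimately show ?thesis by metis
    qed
    ultimately show ?case using Compl.IH by (auto simp: approximable_def)
  next
    case (Union X)
    have "e -` (\<Union>i. X i) \<inter> space L = (\<Union>i. e -` X i \<inter> space L)" by auto
    then show ?case using L.approximable_UN[of A "\<lambda>i. e -` X i \<inter> space L", OF A Union.IH] by simp
  qed
  have "approximable L A B" if B: "B \<in> sets L" for B
  proof -
    obtain S where S: "S \<in> sets borel" "AE k in L. e k \<in> S \<longleftrightarrow> k \<in> B"
      using lebesgue_mod0_borel[OF L.prob_space_axioms e j je B] by metis
    have "S \<in> sigma_sets UNIV E"
      using S(1) borel_eq_countable_basis[OF E] by (metis sets_measure_of Pow_UNIV top_greatest)
    from cov[OF this] have *: "approximable L A (e -` S \<inter> space L)" .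
    note [measurable] = S(1) B sets_cellset[where M=L and A=A, OF A]
    have eq: "measure L (sym_diff B (cellset L A n T)) = measure L (sym_diff (e -` S \<inter> space L) (cellset L A n T))" for n T
      by (rule measure_eq_AE) (use S(2) AE_space in \<open>eventually_elim, auto\<close>)
    show ?thesis using * B unfolding approximable_def eq by auto
  qed
  with that A show ?thesis by blast
qed

section \<open>Density of continuous polymorphisms\<close>

text \<open>The kernel of the conditional expectation with respect to the partition into cells. Cells of measure
\<open>0\<close> are harmless because division by \<open>0\<close> gives \<open>0\<close>.\<close>

definition cell_avg :: "'m measure \<Rightarrow> (nat \<Rightarrow> 'm set) \<Rightarrow> nat \<Rightarrow> 'm \<Rightarrow> 'm \<Rightarrow> real" where
  "cell_avg M A n m' m = (\<Sum>c\<in>Pow {..<n}. indicator (cellset M A n {c}) m' * indicator (cellset M A n {c}) m / measure M (cellset M A n {c}))"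

text \<open>A bounded symmetric Markov kernel that has a density.\<close>

locale averaging = prob_space M for M :: "'m measure" +
  fixes a :: "'m \<Rightarrow> 'm \<Rightarrow> real" and K :: real
  assumes a_measurable[measurable]: "(\<lambda>(x, y). a x y) \<in> borel_measurable (M \<Otimes>\<^sub>M M)"
    and a_nonneg: "\<And>x y. 0 \<le> a x y" and a_le: "\<And>x y. a x y \<le> K"
    and a_sym: "\<And>x y. a x y = a y x"
    and a_int: "AE y in M. (\<integral>x. a x y \<partial>M) = 1"
begin

definition avg :: "('m \<Rightarrow> real) \<Rightarrow> 'm \<Rightarrow> real" where
  "avg h y = (\<integral>x. a x y * h x \<partial>M)"

lemma a_measurable1[measurable (raw)]: "f \<in> N \<rightarrow>\<^sub>M M \<Longrightarrow> g \<in> N \<rightarrow>\<^sub>M M \<Longrightarrow> (\<lambda>z. a (f z) (g z)) \<in> borel_measurable N"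
  using measurable_compose[OF measurable_Pair[of f N M g M] a_measurable] by simp

lemma integrable_a: "y \<in> space M \<Longrightarrow> h \<in> borel_measurable M \<Longrightarrow> (\<And>x. \<bar>h x\<bar> \<le> 1) \<Longrightarrow> integrable M (\<lambda>x. a x y * h x)"
proof (rule integrable_const_bound[where B=K])
  assume "y \<in> space M" and [measurable]: "h \<in> borel_measurable M" and h: "\<And>x. \<bar>h x\<bar> \<le> 1"
  then show "(\<lambda>x. a x y * h x) \<in> borel_measurable M" by measurable
  show "AE x in M. norm (a x y * h x) \<le> K"
  proof (rule AE_I2)
    fix x
    have "\<bar>a x y\<bar> * \<bar>h x\<bar> \<le> K * 1" using a_nonneg[of x y] a_le[of x y] h[of x] by (intro mult_mono) auto
    then show "norm (a x y * h x) \<le> K" by (simp add: abs_mult)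
  qed
qed

lemma measurable_avg[measurable]:
  assumes [measurable]: "h \<in> borel_measurable M" shows "avg h \<in> borel_measurable M"
  unfolding avg_def by measurable

lemma nn_a_int: "AE y in M. (\<integral>\<^sup>+x. ennreal (a x y) \<partial>M) = 1"
  using a_int AE_space
proof eventually_elim
  case (elim y)
  have "(\<integral>\<^sup>+x. ennreal (a x y) \<partial>M) = ennreal (\<integral>x. a x y \<partial>M)"
    using integrable_a[OF elim(2), of "\<lambda>_. 1"] a_nonneg by (intro nn_integral_eq_integral) auto
  then show ?case using elim by simp
qed

lemma nn_avg:
  assumes y: "y \<in> space M" and [measurable]: "h \<in> borel_measurable M" and h: "\<And>x. 0 \<le> h x" "\<And>x. h x \<le> 1"
  shows "(\<integral>\<^sup>+x. ennreal (a x y) * ennreal (h x) \<partial>M) = ennreal (avg h y)"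
proof -
  have "(\<integral>\<^sup>+x. ennreal (a x y) * ennreal (h x) \<partial>M) = (\<integral>\<^sup>+x. ennreal (a x y * h x) \<partial>M)"
    using a_nonneg h by (intro nn_integral_cong) (simp add: ennreal_mult)
  also have "\<dots> = ennreal (avg h y)" unfolding avg_def
  proof (intro nn_integral_eq_integral AE_I2 mult_nonneg_nonneg a_nonneg h integrable_a y assms(2))
    show "\<bar>h x\<bar> \<le> 1" for x using h by simp
  qed
  finally show ?thesis .
qed

lemma avg_nonneg: "(\<And>x. 0 \<le> h x) \<Longrightarrow> 0 \<le> avg h y"
  unfolding avg_def using a_nonneg by (intro integral_nonneg_AE AE_I2 mult_nonneg_nonneg) auto

lemma avg_le1:
  assumes "h \<in> borel_measurable M" "\<And>x. 0 \<le> h x" "\<And>x. h x \<le> 1"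
  shows "AE y in M. avg h y \<le> 1"
  using a_int AE_space
proof eventually_elim
  case (elim y)
  have "\<bar>h x\<bar> \<le> 1" for x using assms by simp
  then have "avg h y \<le> (\<integral>x. a x y * 1 \<partial>M)" unfolding avg_def
    using assms elim a_nonneg by (intro integral_mono integrable_a mult_left_mono) auto
  then show ?case using elim by simp
qed

text \<open>A symmetric Markov kernel preserves the measure; this is why smoothing keeps the marginal conditions.\<close>

lemma nn_integral_avg:
  assumes [measurable]: "h \<in> borel_measurable M"
  shows "(\<integral>\<^sup>+y. \<integral>\<^sup>+x. ennreal (a x y) * h x \<partial>M \<partial>M) = (\<integral>\<^sup>+x. h x \<partial>M)"
proof -
  interpret P: pair_prob_space M M ..
  have "(\<integral>\<^sup>+y. \<integral>\<^sup>+x. ennreal (a x y) * h x \<partial>M \<partial>M) = (\<integral>\<^sup>+x. \<integral>\<^sup>+y. ennreal (a x y) * h x \<partial>M \<partial>M)"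
    by (rule P.Fubini') measurable
  also have "\<dots> = (\<integral>\<^sup>+x. (\<integral>\<^sup>+y. ennreal (a y x) \<partial>M) * h x \<partial>M)"
  proof (rule nn_integral_cong)
    fix x assume [measurable]: "x \<in> space M"
    show "(\<integral>\<^sup>+y. ennreal (a x y) * h x \<partial>M) = (\<integral>\<^sup>+y. ennreal (a y x) \<partial>M) * h x"
      by (subst nn_integral_multc) (auto simp: a_sym[of x])
  qed
  also have "\<dots> = (\<integral>\<^sup>+x. h x \<partial>M)"
    by (rule nn_integral_cong_AE) (use nn_a_int in \<open>eventually_elim, simp\<close>)
  finally show ?thesis .
qed

end

lemma sqi_real_bounded:
  assumes "prob_space M" "f \<in> borel_measurable M" "AE x in M. \<bar>f x\<bar> \<le> 1"
  shows "square_integrable M (\<lambda>x. complex_of_real (f x))"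
proof (rule sqi_bound)
  interpret prob_space M by fact
  show "integrable M (\<lambda>x. 1::real)" by simp
  show "AE x in M. (cmod (complex_of_real (f x)))\<^sup>2 \<le> 1"
    using assms(3) by eventually_elim (simp add: abs_square_le_1)
  show "(\<lambda>x. complex_of_real (f x)) \<in> borel_measurable M" using assms(2) by measurable
qed

text \<open>Averaging both coordinates of a polymorphism produces a continuous one.\<close>

locale smoothing = M: averaging M a K + N: averaging N b K'
  for M :: "'m measure" and a K and N :: "'n measure" and b K' +
  fixes p :: "('m \<times> 'n \<times> real) measure"
  assumes p: "p \<in> Pol M N"
begin

sublocale p: prob_space p by (rule Pol_prob[OF p M.prob_space_axioms])

sublocale MN: pair_prob_space M N ..

definition smooth_weight :: "('m \<times> 'n \<times> real) \<Rightarrow> 'm \<Rightarrow> 'n \<Rightarrow> real" where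
  "smooth_weight z m n = a m (fst z) * b n (fst (snd z))"

lemma w_nonneg: "0 \<le> smooth_weight z m n" by (simp add: smooth_weight_def M.a_nonneg N.a_nonneg)

lemma w_le: "smooth_weight z m n \<le> K * K'"
  unfolding smooth_weight_def
  using M.a_nonneg M.a_le N.a_nonneg N.a_le by (intro mult_mono) (auto intro: order_trans[OF M.a_nonneg])

lemma w_measurable[measurable (raw)]:
  assumes "f \<in> X \<rightarrow>\<^sub>M p" "g \<in> X \<rightarrow>\<^sub>M M" "h \<in> X \<rightarrow>\<^sub>M N"
  shows "(\<lambda>x. smooth_weight (f x) (g x) (h x)) \<in> borel_measurable X"
proof -
  have [measurable]: "f \<in> X \<rightarrow>\<^sub>M pol_space M N"
    using assms(1) measurable_cong_sets[OF refl sets_Pol[OF p], of X] by blast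
  note [measurable] = assms(2,3)
  show ?thesis unfolding smooth_weight_def by measurable
qed

definition smoothed :: "('m \<times> 'n \<times> real) measure" where
  "smoothed = distr (density (p \<Otimes>\<^sub>M (M \<Otimes>\<^sub>M N)) (\<lambda>(z, m, n). ennreal (smooth_weight z m n))) (pol_space M N)
     (\<lambda>(z, m, n). (m, n, snd (snd z)))"

lemma t_meas: "(\<lambda>z. snd (snd z)) \<in> p \<rightarrow>\<^sub>M Rpos"
proof -
  note [measurable_cong] = sets_Pol[OF p]
  show ?thesis by measurable
qed

lemma sets_smoothed: "sets smoothed = sets (pol_space M N)" by (simp add: smoothed_def)

lemma nn_smoothed:
  assumes [measurable]: "G \<in> borel_measurable (pol_space M N)"
  shows "(\<integral>\<^sup>+y. G y \<partial>smoothed) = (\<integral>\<^sup>+z. \<integral>\<^sup>+m. \<integral>\<^sup>+n. ennreal (smooth_weight z m n) * G (m, n, snd (snd z)) \<partial>N \<partial>M \<partial>p)"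
proof -
  note [measurable] = t_meas
  have "(\<integral>\<^sup>+y. G y \<partial>smoothed) = (\<integral>\<^sup>+x. (case x of (z, m, n) \<Rightarrow> ennreal (smooth_weight z m n)) * G (case x of (z, m, n) \<Rightarrow> (m, n, snd (snd z))) \<partial>(p \<Otimes>\<^sub>M (M \<Otimes>\<^sub>M N)))"
    unfolding smoothed_def by (subst nn_integral_distr, measurable, subst nn_integral_density, measurable)
  also have "\<dots> = (\<integral>\<^sup>+z. \<integral>\<^sup>+x. (case x of (m, n) \<Rightarrow> ennreal (smooth_weight z m n)) * G (case x of (m, n) \<Rightarrow> (m, n, snd (snd z))) \<partial>(M \<Otimes>\<^sub>M N) \<partial>p)"
    by (subst MN.nn_integral_fst[symmetric]) (auto simp: case_prod_beta')
  also have "\<dots> = (\<integral>\<^sup>+z. \<integral>\<^sup>+m. \<integral>\<^sup>+n. ennreal (smooth_weight z m n) * G (m, n, snd (snd z)) \<partial>N \<partial>M \<partial>p)"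
  proof (rule nn_integral_cong)
    fix z assume [measurable]: "z \<in> space p"
    show "(\<integral>\<^sup>+x. (case x of (m, n) \<Rightarrow> ennreal (smooth_weight z m n)) * G (case x of (m, n) \<Rightarrow> (m, n, snd (snd z))) \<partial>(M \<Otimes>\<^sub>M N))
      = (\<integral>\<^sup>+m. \<integral>\<^sup>+n. ennreal (smooth_weight z m n) * G (m, n, snd (snd z)) \<partial>N \<partial>M)"
      by (subst N.nn_integral_fst[symmetric]) (auto simp: case_prod_beta')
  qed
  finally show ?thesis .
qed

lemma nn_smoothed_prod:
  assumes [measurable]: "g \<in> borel_measurable M" "h \<in> borel_measurable N" "c \<in> borel_measurable Rpos"
  shows "(\<integral>\<^sup>+y. g (fst y) * h (fst (snd y)) * c (snd (snd y)) \<partial>smoothed) =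
    (\<integral>\<^sup>+z. (\<integral>\<^sup>+m. ennreal (a m (fst z)) * g m \<partial>M) * (\<integral>\<^sup>+n. ennreal (b n (fst (snd z))) * h n \<partial>N) * c (snd (snd z)) \<partial>p)"
proof -
  have "(\<integral>\<^sup>+y. g (fst y) * h (fst (snd y)) * c (snd (snd y)) \<partial>smoothed) =
    (\<integral>\<^sup>+z. \<integral>\<^sup>+m. \<integral>\<^sup>+n. ennreal (smooth_weight z m n) * (g m * h n * c (snd (snd z))) \<partial>N \<partial>M \<partial>p)"
    by (subst nn_smoothed) auto
  also have "\<dots> = (\<integral>\<^sup>+z. (\<integral>\<^sup>+m. ennreal (a m (fst z)) * g m \<partial>M) * (\<integral>\<^sup>+n. ennreal (b n (fst (snd z))) * h n \<partial>N) * c (snd (snd z)) \<partial>p)"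
  proof (rule nn_integral_cong)
    fix z assume z: "z \<in> space p"
    have [measurable]: "fst z \<in> space M" "fst (snd z) \<in> space N" using Pol_spaceD[OF p z] by auto
    have "(\<integral>\<^sup>+m. \<integral>\<^sup>+n. ennreal (smooth_weight z m n) * (g m * h n * c (snd (snd z))) \<partial>N \<partial>M) =
      (\<integral>\<^sup>+m. \<integral>\<^sup>+n. (ennreal (a m (fst z)) * g m * c (snd (snd z))) * (ennreal (b n (fst (snd z))) * h n) \<partial>N \<partial>M)"
      by (intro nn_integral_cong) (simp add: smooth_weight_def ennreal_mult M.a_nonneg N.a_nonneg mult_ac)
    also have "\<dots> = (\<integral>\<^sup>+m. (ennreal (a m (fst z)) * g m * c (snd (snd z))) * (\<integral>\<^sup>+n. ennreal (b n (fst (snd z))) * h n \<partial>N) \<partial>M)"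
      by (intro nn_integral_cong nn_integral_cmult) measurable
    also have "\<dots> = (\<integral>\<^sup>+m. (ennreal (a m (fst z)) * g m) * (c (snd (snd z)) * (\<integral>\<^sup>+n. ennreal (b n (fst (snd z))) * h n \<partial>N)) \<partial>M)"
      by (simp add: mult.assoc)
    also have "\<dots> = (\<integral>\<^sup>+m. ennreal (a m (fst z)) * g m \<partial>M) * (c (snd (snd z)) * (\<integral>\<^sup>+n. ennreal (b n (fst (snd z))) * h n \<partial>N))"
      by (rule nn_integral_multc) measurable
    finally show "(\<integral>\<^sup>+m. \<integral>\<^sup>+n. ennreal (smooth_weight z m n) * (g m * h n * c (snd (snd z))) \<partial>N \<partial>M) =
       (\<integral>\<^sup>+m. ennreal (a m (fst z)) * g m \<partial>M) * (\<integral>\<^sup>+n. ennreal (b n (fst (snd z))) * h n \<partial>N) * c (snd (snd z))"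
      by (simp add: mult_ac)
  qed
  finally show ?thesis .
qed

lemma smoothed_Pol: "smoothed \<in> Pol M N"
proof (rule PolI[OF sets_smoothed])
  have aM: "AE z in p. (\<integral>\<^sup>+m. ennreal (a m (fst z)) \<partial>M) = 1" by (rule Pol_AE1[OF p M.nn_a_int])
  have aN: "AE z in p. (\<integral>\<^sup>+n. ennreal (b n (fst (snd z))) \<partial>N) = 1" by (rule Pol_AE2[OF p N.nn_a_int])
  note [measurable] = measurable_id_Rpos
  fix B assume [measurable]: "B \<in> sets M"
  have "(\<integral>\<^sup>+y. indicator B (fst y) \<partial>smoothed) = (\<integral>\<^sup>+y. indicator B (fst y) * 1 * 1 \<partial>smoothed)" by simp
  also have "\<dots> = (\<integral>\<^sup>+z. (\<integral>\<^sup>+m. ennreal (a m (fst z)) * indicator B m \<partial>M) * (\<integral>\<^sup>+n. ennreal (b n (fst (snd z))) * 1 \<partial>N) * 1 \<partial>p)"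
    by (rule nn_smoothed_prod) measurable
  also have "\<dots> = (\<integral>\<^sup>+z. (\<integral>\<^sup>+m. ennreal (a m (fst z)) * indicator B m \<partial>M) \<partial>p)"
    by (rule nn_integral_cong_AE) (use aN in \<open>eventually_elim, simp\<close>)
  also have "\<dots> = (\<integral>\<^sup>+y. (\<integral>\<^sup>+m. ennreal (a m y) * indicator B m \<partial>M) \<partial>M)"
    by (rule Pol_nn1[OF p]) measurable
  also have "\<dots> = emeasure M B" by (subst M.nn_integral_avg) auto
  finally show "(\<integral>\<^sup>+y. indicator B (fst y) \<partial>smoothed) = emeasure M B" .
next
  have aM: "AE z in p. (\<integral>\<^sup>+m. ennreal (a m (fst z)) \<partial>M) = 1" by (rule Pol_AE1[OF p M.nn_a_int])
  note [measurable] = measurable_id_Rpos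
  fix C assume [measurable]: "C \<in> sets N"
  have "(\<integral>\<^sup>+y. ennreal (snd (snd y)) * indicator C (fst (snd y)) \<partial>smoothed) = (\<integral>\<^sup>+y. 1 * indicator C (fst (snd y)) * ennreal (snd (snd y)) \<partial>smoothed)"
    by (simp add: mult.commute)
  also have "\<dots> = (\<integral>\<^sup>+z. (\<integral>\<^sup>+m. ennreal (a m (fst z)) * 1 \<partial>M) * (\<integral>\<^sup>+n. ennreal (b n (fst (snd z))) * indicator C n \<partial>N) * ennreal (snd (snd z)) \<partial>p)"
    by (rule nn_smoothed_prod) measurable
  also have "\<dots> = (\<integral>\<^sup>+z. ennreal (snd (snd z)) * (\<integral>\<^sup>+n. ennreal (b n (fst (snd z))) * indicator C n \<partial>N) \<partial>p)"
    by (rule nn_integral_cong_AE) (use aM in \<open>eventually_elim, simp add: mult.commute\<close>)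
  also have "\<dots> = (\<integral>\<^sup>+y. (\<integral>\<^sup>+n. ennreal (b n y) * indicator C n \<partial>N) \<partial>N)"
    by (rule Pol_nn2[OF p]) measurable
  also have "\<dots> = emeasure N C" by (subst N.nn_integral_avg) auto
  finally show "(\<integral>\<^sup>+y. ennreal (snd (snd y)) * indicator C (fst (snd y)) \<partial>smoothed) = emeasure N C" .
qed

lemma smoothed_density: "\<exists>u. pol_density M N u smoothed"
proof -
  note [measurable] = t_meas measurable_id_Rpos
  define u where "u m n = distr (density p (\<lambda>z. ennreal (smooth_weight z m n))) Rpos (\<lambda>z. snd (snd z))" for m n
  have nn: "(\<integral>\<^sup>+t. c t \<partial>u m n) = (\<integral>\<^sup>+z. ennreal (smooth_weight z m n) * c (snd (snd z)) \<partial>p)"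
    if [measurable]: "m \<in> space M" "n \<in> space N" "c \<in> borel_measurable Rpos" for m n c
    unfolding u_def by (subst nn_integral_distr, measurable, subst nn_integral_density, measurable)
  have em: "emeasure (u m n) D = (\<integral>\<^sup>+z. ennreal (smooth_weight z m n) * indicator D (snd (snd z)) \<partial>p)"
    if [measurable]: "m \<in> space M" "n \<in> space N" "D \<in> sets Rpos" for m n D
  proof -
    have "emeasure (u m n) D = (\<integral>\<^sup>+t. indicator D t \<partial>u m n)" by (rule nn_integral_indicator[symmetric]) (simp add: u_def)
    also have "\<dots> = (\<integral>\<^sup>+z. ennreal (smooth_weight z m n) * indicator D (snd (snd z)) \<partial>p)" by (rule nn) measurable
    finally show ?thesis .
  qed
  have KK: "0 \<le> K * K'" using w_nonneg w_le order_trans by blast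
  have "pol_density M N u smoothed"
    unfolding pol_density_def
  proof (intro conjI ballI)
    show "smoothed \<in> Pol M N" by (rule smoothed_Pol)
    fix m n assume m: "m \<in> space M" and n: "n \<in> space N"
    show "sets (u m n) = sets Rpos" by (simp add: u_def)
    have bd: "(\<integral>\<^sup>+z. ennreal (smooth_weight z m n) * c z \<partial>p) < \<infinity>" if [measurable]: "c \<in> borel_measurable p" and c: "(\<integral>\<^sup>+z. c z \<partial>p) < \<infinity>" for c
    proof -
      have "(\<integral>\<^sup>+z. ennreal (smooth_weight z m n) * c z \<partial>p) \<le> (\<integral>\<^sup>+z. ennreal (K * K') * c z \<partial>p)"
        by (intro nn_integral_mono mult_right_mono ennreal_leI w_le) auto
      also have "\<dots> = ennreal (K * K') * (\<integral>\<^sup>+z. c z \<partial>p)" by (rule nn_integral_cmult) measurable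
      also have "\<dots> < \<infinity>" using c by (simp add: ennreal_mult_less_top)
      finally show ?thesis .
    qed
    show "finite_measure (u m n)"
    proof (rule finite_measureI)
      have "(\<integral>\<^sup>+t. 1 \<partial>u m n) < \<infinity>"
        using bd[of "\<lambda>_. 1"] m n by (subst nn) (auto simp: p.emeasure_space_1)
      then show "emeasure (u m n) (space (u m n)) \<noteq> \<infinity>" by simp
    qed
    have "(\<integral>\<^sup>+z. ennreal (snd (snd z)) \<partial>p) = 1" using Pol_nn2[OF p, of "\<lambda>_. 1"] by (simp add: N.emeasure_space_1)
    then show "(\<integral>\<^sup>+t. ennreal t \<partial>u m n) < \<infinity>"
      using bd[of "\<lambda>z. ennreal (snd (snd z))"] m n measurable_t[OF p] by (subst nn) auto
  next
    fix D assume D[measurable]: "D \<in> sets Rpos"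
    have "(\<lambda>x. \<integral>\<^sup>+z. ennreal (smooth_weight z (fst x) (snd x)) * indicator D (snd (snd z)) \<partial>p) \<in> borel_measurable (M \<Otimes>\<^sub>M N)"
      by measurable
    then show "(\<lambda>(m, n). emeasure (u m n) D) \<in> borel_measurable (M \<Otimes>\<^sub>M N)"
      by (subst measurable_cong[where g="\<lambda>x. \<integral>\<^sup>+z. ennreal (smooth_weight z (fst x) (snd x)) * indicator D (snd (snd z)) \<partial>p"])
        (auto simp: space_pair_measure em D)
  next
    fix B C D assume [measurable]: "B \<in> sets M" "C \<in> sets N" and D[measurable]: "D \<in> sets Rpos"
    have "emeasure smoothed (B \<times> C \<times> D) = (\<integral>\<^sup>+y. indicator (B \<times> C \<times> D) y \<partial>smoothed)"
      by (rule nn_integral_indicator[symmetric]) (simp add: sets_smoothed)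
    also have "\<dots> = (\<integral>\<^sup>+z. \<integral>\<^sup>+m. \<integral>\<^sup>+n. ennreal (smooth_weight z m n) * indicator (B \<times> C \<times> D) (m, n, snd (snd z)) \<partial>N \<partial>M \<partial>p)"
      by (rule nn_smoothed) measurable
    also have "\<dots> = (\<integral>\<^sup>+z. \<integral>\<^sup>+x. ennreal (smooth_weight z (fst x) (snd x)) * indicator (B \<times> C \<times> D) (fst x, snd x, snd (snd z)) \<partial>(M \<Otimes>\<^sub>M N) \<partial>p)"
    proof (rule nn_integral_cong)
      fix z assume [measurable]: "z \<in> space p"
      show "(\<integral>\<^sup>+m. \<integral>\<^sup>+n. ennreal (smooth_weight z m n) * indicator (B \<times> C \<times> D) (m, n, snd (snd z)) \<partial>N \<partial>M) =
         (\<integral>\<^sup>+x. ennreal (smooth_weight z (fst x) (snd x)) * indicator (B \<times> C \<times> D) (fst x, snd x, snd (snd z)) \<partial>(M \<Otimes>\<^sub>M N))"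
        by (subst N.nn_integral_fst[symmetric]) auto
    qed
    also have "\<dots> = (\<integral>\<^sup>+x. \<integral>\<^sup>+z. ennreal (smooth_weight z (fst x) (snd x)) * indicator (B \<times> C \<times> D) (fst x, snd x, snd (snd z)) \<partial>p \<partial>(M \<Otimes>\<^sub>M N))"
    proof -
      interpret Q: pair_prob_space p "M \<Otimes>\<^sub>M N" ..
      show ?thesis by (rule Q.Fubini'[symmetric]) measurable
    qed
    also have "\<dots> = (\<integral>\<^sup>+z\<in>B \<times> C. emeasure (u (fst z) (snd z)) D \<partial>(M \<Otimes>\<^sub>M N))"
    proof (rule nn_integral_cong)
      fix x assume "x \<in> space (M \<Otimes>\<^sub>M N)"
      then have x: "fst x \<in> space M" "snd x \<in> space N" by (auto simp: space_pair_measure)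
      show "(\<integral>\<^sup>+z. ennreal (smooth_weight z (fst x) (snd x)) * indicator (B \<times> C \<times> D) (fst x, snd x, snd (snd z)) \<partial>p) =
         emeasure (u (fst x) (snd x)) D * indicator (B \<times> C) x"
        unfolding em[OF x D] by (cases "x \<in> B \<times> C") (auto simp: indicator_def mem_Times_iff intro!: nn_integral_cong)
    qed
    finally show "emeasure smoothed (B \<times> C \<times> D) = (\<integral>\<^sup>+z\<in>B \<times> C. emeasure (u (fst z) (snd z)) D \<partial>(M \<Otimes>\<^sub>M N))" .
  qed
  then show ?thesis by blast
qed

lemma smoothed_form:
  assumes B[measurable]: "B \<in> sets M" and C[measurable]: "C \<in> sets N"
  shows "pol_form s smoothed (indicator B) (indicator C) =
    pol_form s p (\<lambda>m. complex_of_real (M.avg (indicator B) m)) (\<lambda>n. complex_of_real (N.avg (indicator C) n))"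
proof -
  note [measurable] = measurable_id_Rpos
  let ?g = "\<lambda>z. M.avg (indicator B) (fst z) * N.avg (indicator C) (fst (snd z))"
  have g0: "0 \<le> ?g z" for z by (intro mult_nonneg_nonneg M.avg_nonneg N.avg_nonneg) auto
  note [measurable_cong] = sets_Pol[OF p] sets_smoothed
  have gm[measurable]: "?g \<in> borel_measurable p" by measurable
  let ?w = "\<lambda>y. indicator B (fst y) * indicator C (fst (snd y)) :: real"
  have wm[measurable]: "?w \<in> borel_measurable smoothed" by measurable
  have tm: "(\<lambda>y. snd (snd y)) \<in> smoothed \<rightarrow>\<^sub>M Rpos" by measurable
  have eq: "distr (density smoothed ?w) Rpos (\<lambda>y. snd (snd y)) = distr (density p ?g) Rpos (\<lambda>z. snd (snd z))"
  proof (rule measure_eqI)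
    fix D assume "D \<in> sets (distr (density smoothed ?w) Rpos (\<lambda>y. snd (snd y)))"
    then have D[measurable]: "D \<in> sets Rpos" by simp
    have "emeasure (distr (density smoothed ?w) Rpos (\<lambda>y. snd (snd y))) D = (\<integral>\<^sup>+t. indicator D t \<partial>distr (density smoothed ?w) Rpos (\<lambda>y. snd (snd y)))"
      by (rule nn_integral_indicator[symmetric]) simp
    also have "\<dots> = (\<integral>\<^sup>+y. ennreal (?w y) * indicator D (snd (snd y)) \<partial>smoothed)"
      using tm by (subst nn_integral_distr, simp, measurable, subst nn_integral_density, measurable)
    also have "\<dots> = (\<integral>\<^sup>+y. indicator B (fst y) * indicator C (fst (snd y)) * indicator D (snd (snd y)) \<partial>smoothed)"
      by (intro nn_integral_cong) (auto simp: indicator_def)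
    also have "\<dots> = (\<integral>\<^sup>+z. (\<integral>\<^sup>+m. ennreal (a m (fst z)) * indicator B m \<partial>M) * (\<integral>\<^sup>+n. ennreal (b n (fst (snd z))) * indicator C n \<partial>N) * indicator D (snd (snd z)) \<partial>p)"
      by (rule nn_smoothed_prod) measurable
    also have "\<dots> = (\<integral>\<^sup>+z. ennreal (?g z) * indicator D (snd (snd z)) \<partial>p)"
    proof (rule nn_integral_cong)
      fix z assume z: "z \<in> space p"
      have "(\<integral>\<^sup>+m. ennreal (a m (fst z)) * indicator B m \<partial>M) = ennreal (M.avg (indicator B) (fst z))"
        using M.nn_avg[OF Pol_spaceD(1)[OF p z], of "indicator B"] by (simp add: ennreal_indicator)
      moreover have "(\<integral>\<^sup>+n. ennreal (b n (fst (snd z))) * indicator C n \<partial>N) = ennreal (N.avg (indicator C) (fst (snd z)))"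
        using N.nn_avg[OF Pol_spaceD(2)[OF p z], of "indicator C"] by (simp add: ennreal_indicator)
      ultimately show "(\<integral>\<^sup>+m. ennreal (a m (fst z)) * indicator B m \<partial>M) * (\<integral>\<^sup>+n. ennreal (b n (fst (snd z))) * indicator C n \<partial>N) * indicator D (snd (snd z)) =
        ennreal (?g z) * indicator D (snd (snd z))" by (simp add: ennreal_mult M.avg_nonneg N.avg_nonneg)
    qed
    also have "\<dots> = (\<integral>\<^sup>+t. indicator D t \<partial>distr (density p ?g) Rpos (\<lambda>z. snd (snd z)))"
      using t_meas by (subst nn_integral_distr, simp, measurable, subst nn_integral_density, measurable)
    also have "\<dots> = emeasure (distr (density p ?g) Rpos (\<lambda>z. snd (snd z))) D" by (rule nn_integral_indicator) simp
    finally show "emeasure (distr (density smoothed ?w) Rpos (\<lambda>y. snd (snd y))) D = emeasure (distr (density p ?g) Rpos (\<lambda>z. snd (snd z))) D" .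
  qed simp
  have "pol_form s smoothed (indicator B) (indicator C) = (\<integral>y. ?w y *\<^sub>R mel s (snd (snd y)) \<partial>smoothed)"
    unfolding pol_form_def by (intro Bochner_Integration.integral_cong refl) (auto simp: indicator_def)
  also have "\<dots> = (\<integral>y. mel s (snd (snd y)) \<partial>density smoothed ?w)"
    using measurable_mel_t[OF smoothed_Pol] by (intro integral_density[symmetric]) auto
  also have "\<dots> = (\<integral>t. mel s t \<partial>distr (density smoothed ?w) Rpos (\<lambda>y. snd (snd y)))"
    using tm by (intro integral_distr[symmetric]) auto
  also have "\<dots> = (\<integral>z. mel s (snd (snd z)) \<partial>density p ?g)"
    unfolding eq using t_meas by (intro integral_distr) auto
  also have "\<dots> = (\<integral>z. ?g z *\<^sub>R mel s (snd (snd z)) \<partial>p)"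
    using measurable_mel_t[OF p] g0 by (intro integral_density) auto
  also have "\<dots> = pol_form s p (\<lambda>m. complex_of_real (M.avg (indicator B) m)) (\<lambda>n. complex_of_real (N.avg (indicator C) n))"
    unfolding pol_form_def by (intro Bochner_Integration.integral_cong refl) (auto simp: scaleR_conv_of_real)
  finally show ?thesis .
qed

end

lemma cell_averaging:
  assumes M: "prob_space M" and A: "\<And>i. A i \<in> sets M"
  shows "averaging M (cell_avg M A n) (\<Sum>c\<in>Pow {..<n}. 1 / measure M (cellset M A n {c}))"
proof -
  interpret prob_space M by fact
  have [measurable]: "cellset M A n {c} \<in> sets M" for c using sets_cellset[OF A] .
  show ?thesis
  proof
    show "(\<lambda>(x, y). cell_avg M A n x y) \<in> borel_measurable (M \<Otimes>\<^sub>M M)" unfolding cell_avg_def by measurable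
    show "0 \<le> cell_avg M A n x y" for x y unfolding cell_avg_def by (intro sum_nonneg) auto
    show "cell_avg M A n x y \<le> (\<Sum>c\<in>Pow {..<n}. 1 / measure M (cellset M A n {c}))" for x y
      unfolding cell_avg_def by (intro sum_mono divide_right_mono) (auto simp: indicator_def)
    show "cell_avg M A n x y = cell_avg M A n y x" for x y unfolding cell_avg_def by (simp add: mult.commute)
    have "AE y in M. \<forall>c\<in>Pow {..<n}. measure M (cellset M A n {c}) = 0 \<longrightarrow> y \<notin> cellset M A n {c}"
    proof (rule AE_finite_allI)
      fix c assume "c \<in> Pow {..<n}"
      show "AE y in M. measure M (cellset M A n {c}) = 0 \<longrightarrow> y \<notin> cellset M A n {c}"
        by (cases "measure M (cellset M A n {c}) = 0") (auto intro!: AE_not_in simp: null_sets_def emeasure_eq_measure)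
    qed simp
    then show "AE y in M. (\<integral>x. cell_avg M A n x y \<partial>M) = 1"
      using AE_space
    proof eventually_elim
      case (elim y)
      have "(\<integral>x. cell_avg M A n x y \<partial>M) = (\<Sum>c\<in>Pow {..<n}. (\<integral>x. indicator (cellset M A n {c}) x * (indicator (cellset M A n {c}) y / measure M (cellset M A n {c})) \<partial>M))"
        unfolding cell_avg_def times_divide_eq_right[symmetric] by (rule Bochner_Integration.integral_sum, rule integrable_mult_left, rule integrable_real_indicator)
           (measurable, simp add: emeasure_eq_measure)
      also have "\<dots> = (\<Sum>c\<in>Pow {..<n}. measure M (cellset M A n {c}) * (indicator (cellset M A n {c}) y / measure M (cellset M A n {c})))"
        by (intro sum.cong refl) simp
      also have "\<dots> = (\<Sum>c\<in>Pow {..<n}. if c = cell A n y then 1 else 0)"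
        using elim by (intro sum.cong refl) (auto simp: indicator_def cellset_def)
      also have "\<dots> = 1" using cell_Pow[of A n y] by simp
      finally show ?case .
    qed
  qed
qed

lemma cell_avg_fix:
  assumes M: "prob_space M" and A: "\<And>i. A i \<in> sets M" and n: "n0 \<le> n"
  shows "AE y in M. averaging.avg M (cell_avg M A n) (indicator (cellset M A n0 S)) y = indicator (cellset M A n0 S) y"
proof -
  interpret averaging M "cell_avg M A n" "\<Sum>c\<in>Pow {..<n}. 1 / measure M (cellset M A n {c})"
    by (rule cell_averaging[OF M A])
  show ?thesis
    using a_int AE_space
  proof eventually_elim
    case (elim y)
    let ?B = "cellset M A n0 S"
    have "avg (indicator ?B) y = (\<integral>x. cell_avg M A n x y * indicator ?B y \<partial>M)"
      unfolding avg_def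
    proof (rule Bochner_Integration.integral_cong[OF refl])
      fix x assume x: "x \<in> space M"
      show "cell_avg M A n x y * indicator ?B x = cell_avg M A n x y * indicator ?B y"
      proof (cases "cell A n x = cell A n y")
        case True
        then have "cell A n0 x = cell A n0 y" unfolding cell_mono[OF n] by simp
        then show ?thesis using x elim by (simp add: cellset_def indicator_def)
      next
        case False
        then have "cell_avg M A n x y = 0" unfolding cell_avg_def by (intro sum.neutral) (auto simp: cellset_def indicator_def)
        then show ?thesis by simp
      qed
    qed
    then show ?case using elim by simp
  qed
qed

lemma enn2real_lessI: "x < ennreal r \<Longrightarrow> enn2real x < r"
  by (cases x) (auto simp: ennreal_less_iff)

text \<open>An approximable set is close to a union \<open>E\<close> of cells, on which averaging acts as the identity for
all larger \<open>n\<close>; averaging is a contraction for the \<open>L\<^sup>1\<close> norm, and the functions are bounded by \<open>1\<close>.\<close>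

lemma cell_avg_conv:
  assumes M: "prob_space M" and A: "\<And>i. A i \<in> sets M" and B: "approximable M A B"
  shows "(\<lambda>n. L2n M (\<lambda>m. complex_of_real (averaging.avg M (cell_avg M A n) (indicator B) m) - indicator B m)) \<longlonglongrightarrow> 0"
proof -
  interpret M: prob_space M by fact
  interpret a: averaging M "cell_avg M A n" "\<Sum>c\<in>Pow {..<n}. 1 / measure M (cellset M A n {c})" for n
    by (rule cell_averaging[OF M A])
  have [measurable]: "B \<in> sets M" using B by (simp add: approximable_def)
  have [measurable]: "cellset M A n S \<in> sets M" for n S using sets_cellset[OF A] .
  let ?d = "\<lambda>n m. a.avg n (indicator B) m - indicator B m"
  have sq: "(\<lambda>n. \<integral>m. (cmod (complex_of_real (a.avg n (indicator B) m) - indicator B m))\<^sup>2 \<partial>M) \<longlonglongrightarrow> 0"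
  proof (rule LIMSEQ_I)
    fix r :: real assume r: "0 < r"
    then obtain n0 S where nS: "measure M (sym_diff B (cellset M A n0 S)) < r / 2"
      using B unfolding approximable_def by (meson half_gt_zero)
    let ?B = "cellset M A n0 S" and ?D = "sym_diff B (cellset M A n0 S)"
    have "(\<integral>m. (cmod (complex_of_real (a.avg n (indicator B) m) - indicator B m))\<^sup>2 \<partial>M) < r" if n: "n0 \<le> n" for n
    proof -
      have "(\<integral>\<^sup>+m. ennreal ((cmod (complex_of_real (a.avg n (indicator B) m) - indicator B m))\<^sup>2) \<partial>M) \<le>
        (\<integral>\<^sup>+m. (\<integral>\<^sup>+x. ennreal (cell_avg M A n x m) * indicator ?D x \<partial>M) + indicator ?D m \<partial>M)"
      proof (rule nn_integral_mono_AE)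
        have le: "AE y in M. a.avg n (indicator B) y \<le> 1" by (rule a.avg_le1) auto
        show "AE m in M. ennreal ((cmod (complex_of_real (a.avg n (indicator B) m) - indicator B m))\<^sup>2) \<le>
           (\<integral>\<^sup>+x. ennreal (cell_avg M A n x m) * indicator ?D x \<partial>M) + indicator ?D m"
          using cell_avg_fix[of M A n0 n S, OF M A n] le AE_space
        proof eventually_elim
          case (elim m)
          have i: "integrable M (\<lambda>x. cell_avg M A n x m * indicator X x)" if "X \<in> sets M" for X
            using that elim by (intro a.integrable_a) (auto simp: indicator_def)
          have "\<bar>a.avg n (indicator B) m - a.avg n (indicator ?B) m\<bar> = \<bar>\<integral>x. cell_avg M A n x m * indicator B x - cell_avg M A n x m * indicator ?B x \<partial>M\<bar>"
            unfolding a.avg_def by (subst Bochner_Integration.integral_diff[OF i i]) auto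
          also have "\<dots> \<le> (\<integral>x. cell_avg M A n x m * indicator ?D x \<partial>M)"
            using a.a_nonneg by (intro order_trans[OF integral_abs_bound] integral_mono integrable_abs Bochner_Integration.integrable_diff i)
              (auto simp: indicator_def)
          finally have d1: "\<bar>a.avg n (indicator B) m - a.avg n (indicator ?B) m\<bar> \<le> a.avg n (indicator ?D) m" by (simp add: a.avg_def)
          have d: "\<bar>?d n m\<bar> \<le> a.avg n (indicator ?D) m + indicator ?D m"
            using d1 elim(1) by (auto simp: indicator_def split: if_splits)
          have "\<bar>?d n m\<bar> \<le> 1" using elim(2) a.avg_nonneg[of "indicator B" n m] by (auto simp: indicator_def)
          then have "\<bar>?d n m\<bar>\<^sup>2 \<le> \<bar>?d n m\<bar>" unfolding power2_eq_square by (intro mult_left_le) auto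
          moreover have "complex_of_real (a.avg n (indicator B) m) - indicator B m = complex_of_real (?d n m)"
            by (simp add: of_real_indicator)
          then have "cmod (complex_of_real (a.avg n (indicator B) m) - indicator B m) = \<bar>?d n m\<bar>"
            by (simp only: norm_of_real)
          ultimately have "ennreal ((cmod (complex_of_real (a.avg n (indicator B) m) - indicator B m))\<^sup>2) \<le> ennreal (a.avg n (indicator ?D) m + indicator ?D m)"
            using d by (intro ennreal_leI) simp
          also have "\<dots> = (\<integral>\<^sup>+x. ennreal (cell_avg M A n x m) * indicator ?D x \<partial>M) + indicator ?D m"
            using a.nn_avg[OF elim(3), of "indicator ?D" n] a.avg_nonneg[of "indicator ?D" n m] by (simp add: ennreal_indicator)
          finally show ?case .
        qed
      qed
      also have "\<dots> = (\<integral>\<^sup>+m. (\<integral>\<^sup>+x. ennreal (cell_avg M A n x m) * indicator ?D x \<partial>M) \<partial>M) + (\<integral>\<^sup>+m. indicator ?D m \<partial>M)"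
        by (rule nn_integral_add) measurable
      also have "\<dots> = ennreal (2 * measure M ?D)"
        by (subst a.nn_integral_avg) (auto simp: M.emeasure_eq_measure simp flip: ennreal_plus)
      also have "\<dots> < ennreal r" using nS r by (intro ennreal_lessI) auto
      finally have lt: "(\<integral>\<^sup>+m. ennreal ((cmod (complex_of_real (a.avg n (indicator B) m) - indicator B m))\<^sup>2) \<partial>M) < ennreal r" .
      have "(\<integral>m. (cmod (complex_of_real (a.avg n (indicator B) m) - indicator B m))\<^sup>2 \<partial>M) = enn2real (\<integral>\<^sup>+m. ennreal ((cmod (complex_of_real (a.avg n (indicator B) m) - indicator B m))\<^sup>2) \<partial>M)"
        by (rule integral_eq_nn_integral) auto
      then show ?thesis using enn2real_lessI[OF lt] by simp
    qed
    moreover have "0 \<le> (\<integral>m. (cmod (complex_of_real (a.avg n (indicator B) m) - indicator B m))\<^sup>2 \<partial>M)" for n by simp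
    ultimately show "\<exists>no. \<forall>n\<ge>no. norm ((\<integral>m. (cmod (complex_of_real (a.avg n (indicator B) m) - indicator B m))\<^sup>2 \<partial>M) - 0) < r"
      by (intro exI[of _ n0]) auto
  qed
  then have "(\<lambda>n. L2n M (\<lambda>m. complex_of_real (a.avg n (indicator B) m) - indicator B m)) \<longlonglongrightarrow> sqrt 0"
    unfolding L2n_def by (rule tendsto_real_sqrt)
  then show ?thesis by simp
qed

text \<open>The Mellin forms of the smoothed polymorphisms are those of \<open>p\<close> at averaged indicators, and these
converge in \<open>L\<^sup>2\<close>.\<close>

lemma continuous_Pol_dense:
  assumes M: "lebesgue_prob_space M" and N: "lebesgue_prob_space N" and p: "p \<in> Pol M N"
  obtains q u where "\<And>j::nat. q j \<in> Pol M N" "\<And>j. pol_density M N (u j) (q j)" "pol_conv M N q p"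
proof -
  have M1: "prob_space M" and N1: "prob_space N" using M N by (auto simp: lebesgue_prob_space_def)
  interpret M: prob_space M by fact
  interpret N: prob_space N by fact
  obtain A where A: "\<And>i. A i \<in> sets M" "\<And>B. B \<in> sets M \<Longrightarrow> approximable M A B"
    using lebesgue_generators[OF M] by blast
  obtain A' where A': "\<And>i. A' i \<in> sets N" "\<And>B. B \<in> sets N \<Longrightarrow> approximable N A' B"
    using lebesgue_generators[OF N] by blast
  interpret S: smoothing M "cell_avg M A n" "\<Sum>c\<in>Pow {..<n}. 1 / measure M (cellset M A n {c})"
     N "cell_avg N A' n" "\<Sum>c\<in>Pow {..<n}. 1 / measure N (cellset N A' n {c})" p for n
    by (intro smoothing.intro smoothing_axioms.intro cell_averaging M1 N1 A(1) A'(1) p)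
  obtain u where u: "\<And>n. pol_density M N (u n) (S.smoothed n)" using S.smoothed_density by metis
  have "pol_conv M N (\<lambda>n. S.smoothed n) p"
  proof (rule mellin_imp_pol_conv[OF S.smoothed_Pol p M1 N1])
    fix s B C assume B[measurable]: "B \<in> sets M" and C[measurable]: "C \<in> sets N"
    let ?b = "\<lambda>n m. complex_of_real (S.M.avg n (indicator B) m)" and ?c = "\<lambda>n m. complex_of_real (S.N.avg n (indicator C) m)"
    have iB: "square_integrable M (indicator B)" and iC: "square_integrable N (indicator C)"
      using M.sqi_indicator N.sqi_indicator B C by auto
    have b: "square_integrable M (?b n)" for n
    proof (rule sqi_real_bounded[OF M1])
      show "AE x in M. \<bar>S.M.avg n (indicator B) x\<bar> \<le> 1"
        using S.M.avg_le1[of "indicator B" n] S.M.avg_nonneg[of "indicator B" n] by (auto elim!: eventually_mono)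
    qed measurable
    have cle: "AE x in N. \<bar>S.N.avg n (indicator C) x\<bar> \<le> 1" for n
        using S.N.avg_le1[of "indicator C" n] S.N.avg_nonneg[of "indicator C" n] by (auto elim!: eventually_mono)
    have c: "square_integrable N (?c n)" for n
      by (rule sqi_real_bounded[OF N1 _ cle]) measurable
    have c1: "L2n N (?c n) \<le> 1" for n
    proof -
      have "(\<integral>x. (cmod (?c n x))\<^sup>2 \<partial>N) \<le> (\<integral>x. 1 \<partial>N)"
        using cle[of n] by (intro integral_mono_AE sqi_integrable c) (auto simp: abs_square_le_1)
      then show ?thesis unfolding L2n_def by (simp add: N.prob_space)
    qed
    \<comment> \<open>Both summands tend to \<open>0\<close> because the forms are bounded and the averages converge in \<open>L\<^sup>2\<close>.\<close>
    have eq: "pol_form s (S.smoothed n) (indicator B) (indicator C) - pol_form s p (indicator B) (indicator C) =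
       pol_form s p (\<lambda>m. ?b n m - indicator B m) (?c n) + pol_form s p (indicator B) (\<lambda>m. ?c n m - indicator C m)" for n
      unfolding S.smoothed_form[OF B C] L2_functional_diff[OF pol_form_functional1[OF p c] b iB]
        L2_functional_diff[OF pol_form_functional2[OF p iB] c iC] by simp
    have bnd: "cmod (pol_form s (S.smoothed n) (indicator B) (indicator C) - pol_form s p (indicator B) (indicator C)) \<le>
       L2n M (\<lambda>m. ?b n m - indicator B m) + L2n M (indicator B) * L2n N (\<lambda>m. ?c n m - indicator C m)" for n
    proof -
      have "cmod (pol_form s p (\<lambda>m. ?b n m - indicator B m) (?c n)) \<le> L2n M (\<lambda>m. ?b n m - indicator B m) * L2n N (?c n)"
        by (rule pol_form_le[OF p sqi_diff[OF b iB] c])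
      also have "\<dots> \<le> L2n M (\<lambda>m. ?b n m - indicator B m) * 1" by (intro mult_left_mono c1 L2n_nonneg)
      finally have 1: "cmod (pol_form s p (\<lambda>m. ?b n m - indicator B m) (?c n)) \<le> L2n M (\<lambda>m. ?b n m - indicator B m)" by simp
      show ?thesis unfolding eq
        by (intro order_trans[OF norm_triangle_ineq] add_mono 1 pol_form_le[OF p iB sqi_diff[OF c iC]])
    qed
    have "(\<lambda>n. L2n M (\<lambda>m. ?b n m - indicator B m) + L2n M (indicator B) * L2n N (\<lambda>m. ?c n m - indicator C m)) \<longlonglongrightarrow> 0 + L2n M (indicator B) * 0"
      by (intro tendsto_intros cell_avg_conv M1 N1 A A' B C)
    then have lim0: "(\<lambda>n. L2n M (\<lambda>m. ?b n m - indicator B m) + L2n M (indicator B) * L2n N (\<lambda>m. ?c n m - indicator C m)) \<longlonglongrightarrow> 0"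
      by (simp only: mult_zero_right add_0_right)
    have "(\<lambda>n. pol_form s (S.smoothed n) (indicator B) (indicator C) - pol_form s p (indicator B) (indicator C)) \<longlonglongrightarrow> 0"
      by (rule Lim_null_comparison[OF always_eventually lim0]) (intro allI bnd)
    then show "(\<lambda>n. pol_form s (S.smoothed n) (indicator B) (indicator C)) \<longlonglongrightarrow> pol_form s p (indicator B) (indicator C)"
      by (rule LIM_zero_cancel)
  qed
  from that[of "\<lambda>n. S.smoothed n" u, OF S.smoothed_Pol u this] show ?thesis .
qed

section \<open>Realisation of kernels by random parameters\<close>

text \<open>A finite kernel is normalised by its mass, which reduces the claim to subprobability kernels.\<close>

lemma finite_kernel_measurable:
  fixes \<kappa> :: "'x \<Rightarrow> 'y measure"
  assumes s: "\<And>x. x \<in> space X \<Longrightarrow> sets (\<kappa> x) = sets Y" and f: "\<And>x. x \<in> space X \<Longrightarrow> finite_measure (\<kappa> x)"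
    and m: "\<And>D. D \<in> sets Y \<Longrightarrow> (\<lambda>x. emeasure (\<kappa> x) D) \<in> borel_measurable X"
    and ne: "space Y \<noteq> {}"
    and G: "(\<lambda>(x, y). G x y) \<in> borel_measurable (X \<Otimes>\<^sub>M Y)"
  shows "(\<lambda>x. \<integral>\<^sup>+y. G x y \<partial>\<kappa> x) \<in> borel_measurable X"
proof -
  define c where "c x = emeasure (\<kappa> x) (space Y)" for x
  define \<kappa>' where "\<kappa>' x = scale_measure (inverse (c x)) (\<kappa> x)" for x
  have [measurable]: "c \<in> borel_measurable X" unfolding c_def by (rule m) simp
  have sp: "space (\<kappa> x) = space Y" if "x \<in> space X" for x using sets_eq_imp_space_eq[OF s[OF that]] .
  have cfin: "c x < \<top>" if "x \<in> space X" for x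
  proof -
    interpret finite_measure "\<kappa> x" by (rule f[OF that])
    show ?thesis unfolding c_def by (rule emeasure_less_top)
  qed
  have \<kappa>': "\<kappa>' \<in> X \<rightarrow>\<^sub>M subprob_algebra Y"
  proof (rule measurable_subprob_algebra)
    fix x assume x: "x \<in> space X"
    show "sets (\<kappa>' x) = sets Y" by (simp add: \<kappa>'_def s[OF x])
    show "subprob_space (\<kappa>' x)"
    proof (rule subprob_spaceI)
      have "inverse (c x) * c x \<le> 1"
        using cfin[OF x] by (cases "c x = 0") (auto simp: ennreal_inverse_mult mult.commute ennreal_divide_self simp flip: divide_ennreal_def)
      then show "emeasure (\<kappa>' x) (space (\<kappa>' x)) \<le> 1"
        by (simp add: \<kappa>'_def space_scale_measure sp[OF x] c_def)
      show "space (\<kappa>' x) \<noteq> {}" using ne by (simp add: \<kappa>'_def space_scale_measure sp[OF x])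
    qed
  next
    fix D assume [measurable]: "D \<in> sets Y"
    have [measurable]: "(\<lambda>x. emeasure (\<kappa> x) D) \<in> borel_measurable X" by (rule m) simp
    show "(\<lambda>x. emeasure (\<kappa>' x) D) \<in> borel_measurable X" unfolding \<kappa>'_def by simp
  qed
  have "(\<integral>\<^sup>+y. G x y \<partial>\<kappa> x) = c x * (\<integral>\<^sup>+y. G x y \<partial>\<kappa>' x)" if x: "x \<in> space X" for x
  proof -
    have "G x \<in> borel_measurable Y" using measurable_compose[OF measurable_Pair1'[OF x] G] by simp
    then have Gx: "G x \<in> borel_measurable (\<kappa> x)"
      by (subst measurable_cong_sets[OF s[OF x] refl])
    have i: "(\<integral>\<^sup>+y. G x y \<partial>\<kappa>' x) = inverse (c x) * (\<integral>\<^sup>+y. G x y \<partial>\<kappa> x)"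
      unfolding \<kappa>'_def by (rule nn_integral_scale_measure[OF Gx])
    show ?thesis
    proof (cases "c x = 0")
      case True
      then have "AE y in \<kappa> x. False"
        by (intro AE_I[of _ _ "space Y"]) (auto simp: sp[OF x] c_def s[OF x])
      then have "(\<integral>\<^sup>+y. G x y \<partial>\<kappa> x) = (\<integral>\<^sup>+y. 0 \<partial>\<kappa> x)" by (intro nn_integral_cong_AE) auto
      then show ?thesis using True by simp
    next
      case False
      then have "c x * inverse (c x) = 1" using cfin[OF x] by (simp add: ennreal_divide_self flip: divide_ennreal_def)
      then show ?thesis unfolding i by (simp add: mult.assoc[symmetric])
    qed
  qed
  moreover have "(\<lambda>x. c x * (\<integral>\<^sup>+y. G x y \<partial>\<kappa>' x)) \<in> borel_measurable X"
    using nn_integral_measurable_subprob_algebra2[OF G \<kappa>'] by simp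
  ultimately show ?thesis by (subst measurable_cong) auto
qed

lemma nn_integral_le_imp_AE_le:
  assumes [measurable]: "f \<in> borel_measurable N" "g \<in> borel_measurable N" and g: "(\<integral>\<^sup>+x. g x \<partial>N) < \<infinity>"
    and le: "\<And>A. A \<in> sets N \<Longrightarrow> (\<integral>\<^sup>+x\<in>A. f x \<partial>N) \<le> (\<integral>\<^sup>+x\<in>A. g x \<partial>N)"
  shows "AE x in N. f x \<le> g x"
proof -
  define A where "A = {x \<in> space N. g x < f x}"
  have [measurable]: "A \<in> sets N" unfolding A_def by measurable
  have gfin: "(\<integral>\<^sup>+x\<in>A. g x \<partial>N) < \<infinity>"
    by (rule le_less_trans[OF nn_integral_mono g]) (auto simp: indicator_def)
  have "(\<integral>\<^sup>+x. f x * indicator A x - g x * indicator A x \<partial>N) = (\<integral>\<^sup>+x\<in>A. f x \<partial>N) - (\<integral>\<^sup>+x\<in>A. g x \<partial>N)"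
    using gfin by (intro nn_integral_diff AE_I2) (auto simp: indicator_def A_def)
  also have "\<dots> = 0" using le[of A] le_less_trans[OF le[OF \<open>A \<in> sets N\<close>] gfin] by (simp add: diff_eq_0_iff_ennreal)
  finally have "AE x in N. f x * indicator A x - g x * indicator A x = 0"
    by (subst (asm) nn_integral_0_iff_AE) measurable
  moreover have "AE x in N. g x * indicator A x \<noteq> \<infinity>"
    by (rule nn_integral_noteq_infinite) (use gfin in auto)
  ultimately show ?thesis using AE_space
  proof eventually_elim
    case (elim x)
    show ?case
    proof (rule ccontr)
      assume "\<not> f x \<le> g x"
      then have "x \<in> A" "g x < f x" using elim by (auto simp: A_def)
      then show False using elim by (auto simp: diff_eq_0_iff_ennreal)
    qed
  qed
qed

definition unif :: "real measure" where "unif = uniform_measure lborel {0<..<1}"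

lemma sets_unif [simp, measurable_cong]: "sets unif = sets borel" by (simp add: unif_def)
lemma space_unif [simp]: "space unif = UNIV" by (simp add: unif_def)
lemma prob_unif: "prob_space unif" unfolding unif_def by (rule prob_space_uniform_measure) auto

lemma emeasure_unif_less: "s \<le> 1 \<Longrightarrow> emeasure unif {u. ennreal u < s} = s"
proof -
  assume s: "s \<le> 1"
  then obtain r where r: "s = ennreal r" "0 \<le> r" "r \<le> 1" by (cases s) (auto simp: top_unique)
  have [measurable]: "{u. ennreal u < s} \<in> sets borel" by measurable
  have "{0<..<1} \<inter> {u. ennreal u < s} = {0<..<r}" using r by (auto simp: ennreal_less_iff)
  then have "emeasure unif {u. ennreal u < s} = emeasure lborel {0<..<r}"
    unfolding unif_def by (subst emeasure_uniform_measure) (auto simp: divide_ennreal_def)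
  then show ?thesis using r by simp
qed

text \<open>The inverse distribution function trick without disintegration. The conditional distribution function at
\<open>x\<close> is a Radon-Nikodym derivative \<open>D {..x}\<close>, defined only almost everywhere for each \<open>x\<close>. Taking rational
\<open>x\<close> only, \<open>\<kappa> (n, u)\<close> is the infimum of those \<open>x\<close> at which the distribution function exceeds \<open>u\<close>.\<close>

lemma randomization_unit:
  fixes P :: "('n \<times> real) measure"
  assumes N: "prob_space N" and sP: "sets P = sets (N \<Otimes>\<^sub>M borel)" and mP: "distr P N fst = N"
    and P01: "AE z in P. 0 < snd z \<and> snd z < 1"
  obtains \<kappa> where "\<kappa> \<in> borel_measurable (N \<Otimes>\<^sub>M borel)"
    "distr (N \<Otimes>\<^sub>M unif) (N \<Otimes>\<^sub>M borel) (\<lambda>z. (fst z, \<kappa> z)) = P"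
proof -
  interpret N: prob_space N by fact
  interpret U: prob_space unif by (rule prob_unif)
  interpret NU: pair_prob_space N unif ..
  note [measurable_cong] = sP
  have emP: "emeasure P (A \<times> UNIV) = emeasure N A" if [measurable]: "A \<in> sets N" for A
  proof -
    have "emeasure N A = emeasure (distr P N fst) A" by (simp only: mP)
    also have "\<dots> = emeasure P (fst -` A \<inter> space P)" by (rule emeasure_distr) auto
    also have "fst -` A \<inter> space P = A \<times> UNIV"
      using sets_eq_imp_space_eq[OF sP] sets.sets_into_space[OF that] by (auto simp: space_pair_measure)
    finally show ?thesis by simp
  qed
  define \<nu> where "\<nu> S = distr (restrict_space P (space N \<times> S)) N fst" for S :: "real set"
  have m\<nu>: "fst \<in> restrict_space P (space N \<times> S) \<rightarrow>\<^sub>M N" for S by (rule measurable_restrict_space1) measurable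
  have em\<nu>: "emeasure (\<nu> S) A = emeasure P (A \<times> S)" if S[measurable]: "S \<in> sets borel" and A[measurable]: "A \<in> sets N" for S A
  proof -
    have "emeasure (\<nu> S) A = emeasure (restrict_space P (space N \<times> S)) (fst -` A \<inter> space (restrict_space P (space N \<times> S)))"
      unfolding \<nu>_def using m\<nu> A by (rule emeasure_distr)
    also have "fst -` A \<inter> space (restrict_space P (space N \<times> S)) = A \<times> S"
      using sets_eq_imp_space_eq[OF sP] sets.sets_into_space[OF A] by (auto simp: space_pair_measure space_restrict_space)
    also have "emeasure (restrict_space P (space N \<times> S)) (A \<times> S) = emeasure P (A \<times> S)"
      using sets.sets_into_space[OF A] by (intro emeasure_restrict_space) (auto simp: sP)
    finally show ?thesis .
  qed
  have s\<nu>: "sets (\<nu> S) = sets N" for S by (simp add: \<nu>_def)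
  have ac: "absolutely_continuous N (\<nu> S)" if S[measurable]: "S \<in> sets borel" for S
    unfolding absolutely_continuous_def
  proof
    fix A assume "A \<in> null_sets N"
    then have A[measurable]: "A \<in> sets N" "emeasure N A = 0" by auto
    have "emeasure P (A \<times> S) \<le> emeasure P (A \<times> UNIV)" by (rule emeasure_mono) (auto simp: sP)
    then show "A \<in> null_sets (\<nu> S)" using A emP[OF A(1)] em\<nu>[OF S A(1)] by (auto simp: null_sets_def s\<nu>)
  qed
  define D where "D S = RN_deriv N (\<nu> S)" for S
  have Dm[measurable]: "D S \<in> borel_measurable N" for S unfolding D_def by simp
  have D: "(\<integral>\<^sup>+n\<in>A. D S n \<partial>N) = emeasure P (A \<times> S)" if S[measurable]: "S \<in> sets borel" and A[measurable]: "A \<in> sets N" for S A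
  proof -
    have "density N (D S) = \<nu> S" unfolding D_def by (rule N.density_RN_deriv[OF ac[OF S] s\<nu>])
    then have "emeasure (\<nu> S) A = emeasure (density N (D S)) A" by simp
    also have "\<dots> = (\<integral>\<^sup>+n\<in>A. D S n \<partial>N)" by (rule emeasure_density) auto
    finally show ?thesis using em\<nu>[OF S A] by simp
  qed
  have Dle: "AE n in N. D S n \<le> D S' n" if [measurable]: "S \<in> sets borel" "S' \<in> sets borel" and sub: "S \<subseteq> S'" for S S'
  proof (rule nn_integral_le_imp_AE_le)
    have "(\<integral>\<^sup>+n. D S' n \<partial>N) = (\<integral>\<^sup>+n\<in>space N. D S' n \<partial>N)" by (intro nn_integral_cong) auto
    also have "\<dots> \<le> emeasure P (space N \<times> UNIV)" unfolding D[OF that(2) sets.top] by (rule emeasure_mono) (auto simp: sP)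
    also have "\<dots> < \<infinity>" by (simp add: emP N.emeasure_space_1)
    finally show "(\<integral>\<^sup>+n. D S' n \<partial>N) < \<infinity>" .
    fix A assume [measurable]: "A \<in> sets N"
    show "(\<integral>\<^sup>+n\<in>A. D S n \<partial>N) \<le> (\<integral>\<^sup>+n\<in>A. D S' n \<partial>N)"
      using sub by (subst (1 2) D) (auto intro!: emeasure_mono simp: sP)
  qed measurable
  have D1: "AE n in N. D UNIV n \<le> 1"
    by (rule nn_integral_le_imp_AE_le) (auto simp: D emP N.emeasure_space_1)
  define I where "I = \<rat> \<inter> {0..1::real}"
  have cI: "countable I" and neI: "I \<noteq> {}" unfolding I_def using countable_rat by (auto intro: countable_Int1)
  define \<kappa> where "\<kappa> z = (INF q\<in>I. if ennreal (snd z) < D {..q} (fst z) then q else 1)" for z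
  have bb: "bdd_below ((\<lambda>q. if ennreal (snd z) < D {..q} (fst z) then q else 1) ` I)" for z
    by (rule bdd_belowI[of _ 0]) (auto simp: I_def)
  have \<kappa>m[measurable]: "\<kappa> \<in> borel_measurable (N \<Otimes>\<^sub>M borel)"
    unfolding \<kappa>_def by (rule borel_measurable_cINF[OF cI _ bb]) measurable
  have \<kappa>_less: "\<kappa> z < x \<longleftrightarrow> 1 < x \<or> (\<exists>q\<in>I. q < x \<and> ennreal (snd z) < D {..q} (fst z))" for z x
  proof -
    have "\<kappa> z < x \<longleftrightarrow> (\<exists>q\<in>I. (if ennreal (snd z) < D {..q} (fst z) then q else 1) < x)"
      unfolding \<kappa>_def by (rule cINF_less_iff[OF neI bb])
    also have "\<dots> \<longleftrightarrow> 1 < x \<or> (\<exists>q\<in>I. q < x \<and> ennreal (snd z) < D {..q} (fst z))"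
    proof
      assume "\<exists>q\<in>I. (if ennreal (snd z) < D {..q} (fst z) then q else 1) < x"
      then obtain q where "q \<in> I" "(if ennreal (snd z) < D {..q} (fst z) then q else 1) < x" by blast
      then show "1 < x \<or> (\<exists>q\<in>I. q < x \<and> ennreal (snd z) < D {..q} (fst z))"
        by (cases "ennreal (snd z) < D {..q} (fst z)") auto
    next
      have q1: "q \<le> 1" if "q \<in> I" for q using that by (simp add: I_def)
      assume "1 < x \<or> (\<exists>q\<in>I. q < x \<and> ennreal (snd z) < D {..q} (fst z))"
      then show "\<exists>q\<in>I. (if ennreal (snd z) < D {..q} (fst z) then q else 1) < x"
      proof
        assume x: "1 < x"
        obtain q where q: "q \<in> I" using neI by blast
        have "(if ennreal (snd z) < D {..q} (fst z) then q else 1) < x" using q1[OF q] x by simp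
        then show ?thesis using q by blast
      next
        assume "\<exists>q\<in>I. q < x \<and> ennreal (snd z) < D {..q} (fst z)"
        then obtain q where "q \<in> I" "q < x" "ennreal (snd z) < D {..q} (fst z)" by blast
        then show ?thesis by (intro bexI[of _ q]) auto
      qed
    qed
    finally show ?thesis .
  qed
  let ?R = "distr (N \<Otimes>\<^sub>M unif) (N \<Otimes>\<^sub>M borel) (\<lambda>z. (fst z, \<kappa> z))"
  have R: "emeasure ?R (A \<times> {..<x}) = emeasure P (A \<times> {..<x})" if A[measurable]: "A \<in> sets N" for A x
  proof -
    have Asp: "A \<subseteq> space N" using A by (rule sets.sets_into_space)
    have 1: "emeasure ?R (A \<times> {..<x}) = (\<integral>\<^sup>+n\<in>A. emeasure unif {u. \<kappa> (n, u) < x} \<partial>N)"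
    proof -
      have "emeasure ?R (A \<times> {..<x}) = emeasure (N \<Otimes>\<^sub>M unif) {z \<in> space (N \<Otimes>\<^sub>M unif). fst z \<in> A \<and> \<kappa> z < x}"
        by (subst emeasure_distr) (auto intro!: arg_cong2[where f=emeasure])
      also have "\<dots> = (\<integral>\<^sup>+n. emeasure unif (Pair n -` {z \<in> space (N \<Otimes>\<^sub>M unif). fst z \<in> A \<and> \<kappa> z < x}) \<partial>N)"
        by (rule U.emeasure_pair_measure_alt) measurable
      also have "\<dots> = (\<integral>\<^sup>+n\<in>A. emeasure unif {u. \<kappa> (n, u) < x} \<partial>N)"
        by (intro nn_integral_cong) (auto simp: indicator_def space_pair_measure vimage_def)
      finally show ?thesis .
    qed
    show ?thesis
    proof (cases "1 < x")
      case True
      then have "{u. \<kappa> (n, u) < x} = UNIV" for n using \<kappa>_less by auto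
      then have "emeasure ?R (A \<times> {..<x}) = emeasure N A" unfolding 1 using U.emeasure_space_1 by simp
      moreover have "AE z in P. z \<in> A \<times> {..<x} \<longleftrightarrow> z \<in> A \<times> UNIV"
        using P01 by eventually_elim (use True in auto)
      then have "emeasure P (A \<times> {..<x}) = emeasure P (A \<times> UNIV)"
        by (rule emeasure_eq_AE) (auto simp: sP)
      ultimately show ?thesis by (simp add: emP)
    next
      case False
      show ?thesis
      proof (cases "0 < x")
        case True
        define J where "J = {q \<in> I. q < x}"
        have "0 \<in> J" using True by (simp add: J_def I_def)
        then have neJ: "J \<noteq> {}" by auto
        have cJ: "countable J" unfolding J_def using cI by (rule countable_subset[rotated]) auto
        have eq: "AE n in N. emeasure unif {u. \<kappa> (n, u) < x} = (SUP q\<in>J. D {..q} n)"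
        proof -
          have "AE n in N. \<forall>q\<in>J. D {..q} n \<le> D UNIV n"
            by (rule AE_ball_countable[OF cJ, THEN iffD2]) (auto intro: Dle)
          then show ?thesis using D1
          proof eventually_elim
            case (elim n)
            have "(SUP q\<in>J. D {..q} n) \<le> 1" using elim by (intro SUP_least) (auto intro: order_trans)
            moreover have "{u. \<kappa> (n, u) < x} = {u. ennreal u < (SUP q\<in>J. D {..q} n)}"
              using False by (auto simp: \<kappa>_less less_SUP_iff J_def)
            ultimately show ?case using emeasure_unif_less by simp
          qed
        qed
        have "AE n in N. \<forall>q\<in>J. D {..q} n \<le> D {..<x} n"
          by (rule AE_ball_countable[OF cJ, THEN iffD2]) (auto intro!: Dle simp: J_def)
        then have "AE n in N. (SUP q\<in>J. D {..q} n) \<le> D {..<x} n" by eventually_elim (auto intro: SUP_least)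
        then have up: "(\<integral>\<^sup>+n\<in>A. (SUP q\<in>J. D {..q} n) \<partial>N) \<le> emeasure P (A \<times> {..<x})"
          by (subst D[symmetric]) (auto intro!: nn_integral_mono_AE elim!: eventually_mono mult_right_mono)
        \<comment> \<open>The half line up to \<open>x\<close> is exhausted by an increasing sequence of rational half lines.\<close>
        have lo: "emeasure P (A \<times> {..<x}) \<le> (\<integral>\<^sup>+n\<in>A. (SUP q\<in>J. D {..q} n) \<partial>N)"
        proof -
          have "\<exists>q. q \<in> J \<and> x - inverse (real (Suc k)) < q" for k
          proof -
            have "max 0 (x - inverse (real (Suc k))) < x" using True by simp
            then obtain q where "q \<in> \<rat>" "max 0 (x - inverse (real (Suc k))) < q" "q < x" using Rats_dense_in_real by blast
            then show ?thesis using False by (intro exI[of _ q]) (auto simp: J_def I_def)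
          qed
          then obtain qk where qk: "\<And>k. qk k \<in> J" "\<And>k. x - inverse (real (Suc k)) < qk k" by metis
          define Qk where "Qk k = Max (qk ` {..k})" for k
          have Qk: "Qk k \<in> J" for k
          proof -
            have "Qk k \<in> qk ` {..k}" unfolding Qk_def by (rule Max_in) auto
            then show ?thesis using qk by auto
          qed
          have Qk_ge: "qk k \<le> Qk k" for k unfolding Qk_def by (rule Max_ge) auto
          have Qk_mono: "Qk k \<le> Qk k'" if "k \<le> k'" for k k' unfolding Qk_def using that by (intro Max_mono) auto
          have U: "(\<Union>k. A \<times> {..Qk k}) = A \<times> {..<x}"
          proof (intro equalityI subsetI)
            fix z assume "z \<in> (\<Union>k. A \<times> {..Qk k})"
            then obtain k where "fst z \<in> A" "snd z \<le> Qk k" by auto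
            moreover have "Qk k < x" using Qk[of k] by (simp add: J_def)
            ultimately show "z \<in> A \<times> {..<x}" by (auto simp: mem_Times_iff)
          next
            fix z assume "z \<in> A \<times> {..<x}"
            then have z: "fst z \<in> A" "snd z < x" by (auto simp: mem_Times_iff)
            then obtain k where "inverse (real (Suc k)) < x - snd z" using reals_Archimedean[of "x - snd z"] by auto
            then have "snd z \<le> Qk k" using qk(2)[of k] Qk_ge[of k] by linarith
            then show "z \<in> (\<Union>k. A \<times> {..Qk k})" using z by (auto simp: mem_Times_iff)
          qed
          have "emeasure P (A \<times> {..<x}) = (SUP k. emeasure P (A \<times> {..Qk k}))"
            unfolding U[symmetric] by (rule SUP_emeasure_incseq[symmetric]) (use Qk_mono in \<open>auto simp: sP incseq_def intro: order_trans\<close>)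
          also have "\<dots> \<le> (\<integral>\<^sup>+n\<in>A. (SUP q\<in>J. D {..q} n) \<partial>N)"
          proof (rule SUP_least)
            fix k
            show "emeasure P (A \<times> {..Qk k}) \<le> (\<integral>\<^sup>+n\<in>A. (SUP q\<in>J. D {..q} n) \<partial>N)"
              using Qk[of k] by (subst D[symmetric]) (auto intro!: nn_integral_mono mult_right_mono SUP_upper)
          qed
          finally show ?thesis .
        qed
        have "emeasure ?R (A \<times> {..<x}) = (\<integral>\<^sup>+n\<in>A. (SUP q\<in>J. D {..q} n) \<partial>N)"
          unfolding 1 by (rule nn_integral_cong_AE) (use eq in \<open>auto elim!: eventually_mono\<close>)
        then show ?thesis using up lo by simp
      next
        case False
        have "{u. \<kappa> (n, u) < x} = {}" for n using False by (auto simp: \<kappa>_less I_def)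
        then have "emeasure ?R (A \<times> {..<x}) = 0" unfolding 1 by simp
        moreover have "AE z in P. z \<in> A \<times> {..<x} \<longleftrightarrow> z \<in> {}"
          using P01 by eventually_elim (use False in auto)
        then have "emeasure P (A \<times> {..<x}) = emeasure P {}"
          by (rule emeasure_eq_AE) (auto simp: sP)
        ultimately show ?thesis by simp
      qed
    qed
  qed
  have "?R = P"
  proof (rule measure_eqI_generator_eq[where E="{A \<times> {..<x} | A x. A \<in> sets N}" and \<Omega>="space N \<times> UNIV" and A="\<lambda>n. space N \<times> {..<real n}"])
    show "Int_stable {A \<times> {..<x::real} | A x. A \<in> sets N}"
      unfolding Int_stable_def
    proof (intro ballI)
      fix a b assume "a \<in> {A \<times> {..<x::real} | A x. A \<in> sets N}" "b \<in> {A \<times> {..<x::real} | A x. A \<in> sets N}"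
      then obtain A x A' x' where "a = A \<times> {..<x}" "b = A' \<times> {..<x'}" "A \<in> sets N" "A' \<in> sets N" by auto
      moreover have "a \<inter> b = (A \<inter> A') \<times> {..<min x x'}" using \<open>a = _\<close> \<open>b = _\<close> by auto
      ultimately show "a \<inter> b \<in> {A \<times> {..<x::real} | A x. A \<in> sets N}" by blast
    qed
    have "sets (N \<Otimes>\<^sub>M (borel::real measure)) = sets (sigma (space N \<times> space (borel::real measure)) {a \<times> b |a b. a \<in> sets N \<and> b \<in> range lessThan})"
    proof (rule sets_pair_eq[where Ca="{space N}" and Cb="range (\<lambda>n. {..<real n})"])
      show "sets (borel::real measure) = sigma_sets (space borel) (range lessThan)"
        by (subst borel_Iio) (auto intro: sets_measure_of)
      show "\<Union> (range (\<lambda>n. {..<real n})) = space borel" using reals_Archimedean2 by auto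
    qed (auto simp: sets.sigma_sets_eq dest: sets.sets_into_space)
    also have "{a \<times> b |a b. a \<in> sets N \<and> b \<in> range lessThan} = {A \<times> {..<x::real} | A x. A \<in> sets N}" by auto
    also have "sets (sigma (space N \<times> space (borel::real measure)) {A \<times> {..<x::real} | A x. A \<in> sets N}) = sigma_sets (space N \<times> UNIV) {A \<times> {..<x} | A x. A \<in> sets N}"
      by (subst sets_measure_of) (auto dest: sets.sets_into_space)
    finally have *: "sets (N \<Otimes>\<^sub>M (borel::real measure)) = sigma_sets (space N \<times> UNIV) {A \<times> {..<x} | A x. A \<in> sets N}" .
    show "sets ?R = sigma_sets (space N \<times> UNIV) {A \<times> {..<x} | A x. A \<in> sets N}" unfolding *[symmetric] by simp
    show "sets P = sigma_sets (space N \<times> UNIV) {A \<times> {..<x} | A x. A \<in> sets N}" unfolding *[symmetric] by (rule sP)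
    show "(\<Union>n. space N \<times> {..<real n}) = space N \<times> UNIV" using reals_Archimedean2 by auto
    show "emeasure ?R (space N \<times> {..<real n}) \<noteq> \<infinity>" for n
    proof -
      have "emeasure P (space N \<times> {..<real n}) \<le> emeasure P (space N \<times> UNIV)" by (rule emeasure_mono) (auto simp: sP)
      then show ?thesis unfolding R[OF sets.top] using emP[OF sets.top] by (auto simp: top_unique N.emeasure_space_1)
    qed
    show "range (\<lambda>n. space N \<times> {..<real n}) \<subseteq> {A \<times> {..<x} | A x. A \<in> sets N}" by blast
    show "{A \<times> {..<x::real} | A x. A \<in> sets N} \<subseteq> Pow (space N \<times> UNIV)" by (auto dest: sets.sets_into_space)
    fix X assume "X \<in> {A \<times> {..<x::real} | A x. A \<in> sets N}"
    then show "emeasure ?R X = emeasure P X" using R by auto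
  qed
  with that \<kappa>m show ?thesis by blast
qed

text \<open>The general case is transported to the unit interval by an increasing homeomorphism of the line.\<close>

lemma randomization:
  fixes P :: "('n \<times> real) measure"
  assumes N: "prob_space N" and sP: "sets P = sets (N \<Otimes>\<^sub>M borel)" and mP: "distr P N fst = N"
  obtains \<kappa> where "\<kappa> \<in> borel_measurable (N \<Otimes>\<^sub>M borel)"
    "distr (N \<Otimes>\<^sub>M unif) (N \<Otimes>\<^sub>M borel) (\<lambda>z. (fst z, \<kappa> z)) = P"
proof -
  note [measurable_cong] = sP
  define \<phi> where "\<phi> y = 1 / (1 + exp (- y))" for y :: real
  define \<psi> where "\<psi> z = ln (z / (1 - z))" for z :: real
  have [measurable]: "\<phi> \<in> borel_measurable borel" "\<psi> \<in> borel_measurable borel" unfolding \<phi>_def \<psi>_def by measurable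
  have \<phi>01: "0 < \<phi> y" "\<phi> y < 1" for y by (auto simp: \<phi>_def add_pos_pos)
  have \<psi>\<phi>: "\<psi> (\<phi> y) = y" for y
  proof -
    have p: "1 + exp (- y) > 0" by (simp add: add_pos_pos)
    then have "1 - \<phi> y = exp (- y) / (1 + exp (- y))" by (simp add: \<phi>_def field_simps)
    then have "\<phi> y / (1 - \<phi> y) = 1 / exp (- y)" using p by (simp add: \<phi>_def)
    then show ?thesis by (simp add: \<psi>_def exp_minus divide_inverse)
  qed
  let ?P' = "distr P (N \<Otimes>\<^sub>M borel) (\<lambda>z. (fst z, \<phi> (snd z)))"
  have "distr ?P' N fst = distr P N fst" by (subst distr_distr) (auto simp: comp_def)
  then have m': "distr ?P' N fst = N" by (simp only: mP)
  have s': "sets ?P' = sets (N \<Otimes>\<^sub>M borel)" by simp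
  have a': "AE z in ?P'. 0 < snd z \<and> snd z < 1" by (subst AE_distr_iff) (auto simp: \<phi>01)
  obtain \<kappa> where \<kappa>[measurable]: "\<kappa> \<in> borel_measurable (N \<Otimes>\<^sub>M borel)"
    and eq: "distr (N \<Otimes>\<^sub>M unif) (N \<Otimes>\<^sub>M borel) (\<lambda>z. (fst z, \<kappa> z)) = ?P'"
    by (rule randomization_unit[OF N s' m' a'])
  have "distr (N \<Otimes>\<^sub>M unif) (N \<Otimes>\<^sub>M borel) (\<lambda>z. (fst z, \<psi> (\<kappa> z))) = distr (distr (N \<Otimes>\<^sub>M unif) (N \<Otimes>\<^sub>M borel) (\<lambda>z. (fst z, \<kappa> z))) (N \<Otimes>\<^sub>M borel) (\<lambda>z. (fst z, \<psi> (snd z)))"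
    by (subst distr_distr) (auto simp: comp_def)
  also have "\<dots> = distr P (N \<Otimes>\<^sub>M borel) (\<lambda>z. (fst z, \<psi> (\<phi> (snd z))))"
    unfolding eq by (subst distr_distr) (auto simp: comp_def)
  also have "\<dots> = distr P (N \<Otimes>\<^sub>M borel) (\<lambda>z. z)" by (simp add: \<psi>\<phi>)
  also have "\<dots> = P" by (rule distr_id2) (rule sP[symmetric])
  finally show ?thesis using that[of "\<lambda>z. \<psi> (\<kappa> z)"] by simp
qed

lemma density_kernel_measurable:
  assumes u: "pol_density M N u p"
    and f: "f \<in> X \<rightarrow>\<^sub>M M" and g: "g \<in> X \<rightarrow>\<^sub>M N" and G: "(\<lambda>(x, t). G x t) \<in> borel_measurable (X \<Otimes>\<^sub>M Rpos)"
  shows "(\<lambda>x. \<integral>\<^sup>+t. G x t \<partial>u (f x) (g x)) \<in> borel_measurable X"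
proof (rule finite_kernel_measurable[OF _ _ _ _ G])
  fix x assume "x \<in> space X"
  then have "f x \<in> space M" "g x \<in> space N" using f g by (auto dest: measurable_space)
  then show "sets (u (f x) (g x)) = sets Rpos" "finite_measure (u (f x) (g x))" using u by (auto simp: pol_density_def)
next
  fix D assume D: "D \<in> sets Rpos"
  have "(\<lambda>(m, n). emeasure (u m n) D) \<in> borel_measurable (M \<Otimes>\<^sub>M N)" using u D by (auto simp: pol_density_def)
  from measurable_compose[OF measurable_Pair[OF f g] this]
  show "(\<lambda>x. emeasure (u (f x) (g x)) D) \<in> borel_measurable X" by simp
qed simp

text \<open>The definition gives this for indicators of boxes, and boxes generate the \<open>\<sigma>\<close>-algebra.\<close>

lemma pol_density_nn:
  assumes M: "prob_space M" and N: "prob_space N" and u: "pol_density M N u p"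
    and G[measurable]: "G \<in> borel_measurable (pol_space M N)"
  shows "(\<integral>\<^sup>+z. G z \<partial>p) = (\<integral>\<^sup>+x. (\<integral>\<^sup>+t. G (fst x, snd x, t) \<partial>u (fst x) (snd x)) \<partial>(M \<Otimes>\<^sub>M N))"
proof -
  have p: "p \<in> Pol M N" using u by (simp add: pol_density_def)
  have su: "sets (u (fst x) (snd x)) = sets Rpos" if "x \<in> space (M \<Otimes>\<^sub>M N)" for x
    using u that by (auto simp: pol_density_def space_pair_measure)
  have km: "(\<lambda>x. \<integral>\<^sup>+t. H x t \<partial>u (fst x) (snd x)) \<in> borel_measurable (M \<Otimes>\<^sub>M N)"
    if "(\<lambda>(x, t). H x t) \<in> borel_measurable ((M \<Otimes>\<^sub>M N) \<Otimes>\<^sub>M Rpos)" for H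
    by (rule density_kernel_measurable[OF u _ _ that]) auto
  define E where "E X = (\<integral>\<^sup>+x. (\<integral>\<^sup>+t. indicator X (fst x, snd x, t) \<partial>u (fst x) (snd x)) \<partial>(M \<Otimes>\<^sub>M N))" for X
  define p2 where "p2 = measure_of (space (pol_space M N)) (sets (pol_space M N)) E"
  have cm: "(\<lambda>t. F (fst x, snd x, t)) \<in> borel_measurable (u (fst x) (snd x))"
    if x: "x \<in> space (M \<Otimes>\<^sub>M N)" and [measurable]: "F \<in> borel_measurable (pol_space M N)" for x and F :: "_ \<Rightarrow> ennreal"
  proof -
    have [measurable]: "fst x \<in> space M" "snd x \<in> space N" using x by (auto simp: space_pair_measure)
    show ?thesis unfolding measurable_cong_sets[OF su[OF x] refl] by measurable
  qed
  have ca: "countably_additive (sets (pol_space M N)) E"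
  proof (rule countably_additiveI)
    fix A :: "nat \<Rightarrow> _" assume A: "range A \<subseteq> sets (pol_space M N)" and dis: "disjoint_family A"
    have [measurable]: "A i \<in> sets (pol_space M N)" for i using A by auto
    have "(\<Sum>i. E (A i)) = (\<integral>\<^sup>+x. (\<Sum>i. \<integral>\<^sup>+t. indicator (A i) (fst x, snd x, t) \<partial>u (fst x) (snd x)) \<partial>(M \<Otimes>\<^sub>M N))"
      unfolding E_def by (rule nn_integral_suminf[symmetric]) (rule km, measurable)
    also have "\<dots> = E (\<Union>i. A i)"
      unfolding E_def
    proof (rule nn_integral_cong)
      fix x assume x: "x \<in> space (M \<Otimes>\<^sub>M N)"
      have "(\<Sum>i. \<integral>\<^sup>+t. indicator (A i) (fst x, snd x, t) \<partial>u (fst x) (snd x)) = (\<integral>\<^sup>+t. (\<Sum>i. indicator (A i) (fst x, snd x, t)) \<partial>u (fst x) (snd x))"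
        by (rule nn_integral_suminf[symmetric]) (rule cm[OF x], measurable)
      also have "\<dots> = (\<integral>\<^sup>+t. indicator (\<Union>i. A i) (fst x, snd x, t) \<partial>u (fst x) (snd x))"
        by (intro nn_integral_cong suminf_indicator dis)
      finally show "(\<Sum>i. \<integral>\<^sup>+t. indicator (A i) (fst x, snd x, t) \<partial>u (fst x) (snd x)) = (\<integral>\<^sup>+t. indicator (\<Union>i. A i) (fst x, snd x, t) \<partial>u (fst x) (snd x))" .
    qed
    finally show "(\<Sum>i. E (A i)) = E (\<Union>i. A i)" .
  qed
  have sp2: "sets p2 = sets (pol_space M N)" unfolding p2_def by (simp add: sets.space_closed sets.sigma_sets_eq)
  have em2: "emeasure p2 X = E X" if "X \<in> sets (pol_space M N)" for X
    unfolding p2_def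
    by (rule emeasure_measure_of_sigma) (auto simp: ca that positive_def E_def sets.sigma_algebra_axioms)
  have "p = p2"
  proof (rule pol_space_eqI[OF sets_Pol[OF p] sp2])
    interpret prob_space p by (rule Pol_prob[OF p M])
    show "finite_measure p" by (rule finite_measure_axioms)
    fix B C D assume [measurable]: "B \<in> sets M" "C \<in> sets N" and D[measurable]: "D \<in> sets Rpos"
    have "emeasure p (B \<times> C \<times> D) = (\<integral>\<^sup>+z\<in>B \<times> C. emeasure (u (fst z) (snd z)) D \<partial>(M \<Otimes>\<^sub>M N))"
      using u by (simp add: pol_density_def)
    also have "\<dots> = E (B \<times> C \<times> D)"
      unfolding E_def
    proof (rule nn_integral_cong)
      fix x assume x: "x \<in> space (M \<Otimes>\<^sub>M N)"
      have "(\<integral>\<^sup>+t. indicator (B \<times> C \<times> D) (fst x, snd x, t) \<partial>u (fst x) (snd x)) = (\<integral>\<^sup>+t. indicator (B \<times> C) x * indicator D t \<partial>u (fst x) (snd x))"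
        by (intro nn_integral_cong) (auto simp: indicator_def mem_Times_iff)
      also have "\<dots> = indicator (B \<times> C) x * emeasure (u (fst x) (snd x)) D"
        using su[OF x] by (subst nn_integral_cmult) (auto simp: measurable_cong_sets[OF su[OF x] refl])
      finally show "emeasure (u (fst x) (snd x)) D * indicator (B \<times> C) x = (\<integral>\<^sup>+t. indicator (B \<times> C \<times> D) (fst x, snd x, t) \<partial>u (fst x) (snd x))"
        by (simp add: mult.commute)
    qed
    finally show "emeasure p (B \<times> C \<times> D) = emeasure p2 (B \<times> C \<times> D)" by (subst em2) auto
  qed
  have meas: "measurable p X = measurable (pol_space M N) X" for X :: "ennreal measure" by (rule measurable_cong_sets[OF sets_Pol[OF p] refl])
  from G show ?thesis
  proof induction
    case (cong f g)
    have "(\<integral>\<^sup>+z. f z \<partial>p) = (\<integral>\<^sup>+z. g z \<partial>p)"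
      using cong(3) sets_eq_imp_space_eq[OF sets_Pol[OF p]] by (intro nn_integral_cong) auto
    moreover have "(\<integral>\<^sup>+x. (\<integral>\<^sup>+t. f (fst x, snd x, t) \<partial>u (fst x) (snd x)) \<partial>(M \<Otimes>\<^sub>M N)) = (\<integral>\<^sup>+x. (\<integral>\<^sup>+t. g (fst x, snd x, t) \<partial>u (fst x) (snd x)) \<partial>(M \<Otimes>\<^sub>M N))"
      using cong(3) sets_eq_imp_space_eq[OF su] by (intro nn_integral_cong) (auto simp: space_pair_measure)
    ultimately show ?case using cong(4) by simp
  next
    case (set A)
    have "(\<integral>\<^sup>+z. indicator A z \<partial>p) = emeasure p A" using set sets_Pol[OF p] by (intro nn_integral_indicator) simp
    also have "\<dots> = E A" using \<open>p = p2\<close> em2[OF set] by simp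
    finally show ?case by (simp add: E_def)
  next
    case (mult f c)
    note [measurable] = mult.hyps(2)
    have "(\<integral>\<^sup>+z. c * f z \<partial>p) = c * (\<integral>\<^sup>+z. f z \<partial>p)" using mult.hyps(2) by (intro nn_integral_cmult) (simp add: meas)
    also have "\<dots> = (\<integral>\<^sup>+x. c * (\<integral>\<^sup>+t. f (fst x, snd x, t) \<partial>u (fst x) (snd x)) \<partial>(M \<Otimes>\<^sub>M N))"
      unfolding mult by (rule nn_integral_cmult[symmetric]) (rule km, measurable)
    also have "\<dots> = (\<integral>\<^sup>+x. (\<integral>\<^sup>+t. c * f (fst x, snd x, t) \<partial>u (fst x) (snd x)) \<partial>(M \<Otimes>\<^sub>M N))"
      by (intro nn_integral_cong nn_integral_cmult[symmetric] cm) measurable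
    finally show ?case .
  next
    case (add f g)
    note [measurable] = add.hyps(1,3)
    have "(\<integral>\<^sup>+z. g z + f z \<partial>p) = (\<integral>\<^sup>+z. g z \<partial>p) + (\<integral>\<^sup>+z. f z \<partial>p)" using add.hyps(1,3) by (intro nn_integral_add) (simp_all add: meas)
    also have "\<dots> = (\<integral>\<^sup>+x. (\<integral>\<^sup>+t. g (fst x, snd x, t) \<partial>u (fst x) (snd x)) + (\<integral>\<^sup>+t. f (fst x, snd x, t) \<partial>u (fst x) (snd x)) \<partial>(M \<Otimes>\<^sub>M N))"
      unfolding add by (rule nn_integral_add[symmetric]; rule km, measurable)
    also have "\<dots> = (\<integral>\<^sup>+x. (\<integral>\<^sup>+t. g (fst x, snd x, t) + f (fst x, snd x, t) \<partial>u (fst x) (snd x)) \<partial>(M \<Otimes>\<^sub>M N))"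
      by (intro nn_integral_cong nn_integral_add[symmetric] cm) measurable
    finally show ?case .
  next
    case (seq U)
    note [measurable] = seq.hyps(1)
    have inc: "incseq (\<lambda>i. U i z)" for z using seq.hyps(3) unfolding incseq_def le_fun_def by blast
    have "(\<integral>\<^sup>+z. (SUP i. U i) z \<partial>p) = (\<integral>\<^sup>+z. (SUP i. U i z) \<partial>p)" by (simp add: SUP_apply image_comp)
    also have "\<dots> = (SUP i. \<integral>\<^sup>+z. U i z \<partial>p)" using seq.hyps(1,3) by (intro nn_integral_monotone_convergence_SUP) (simp_all add: meas)
    also have "\<dots> = (SUP i. \<integral>\<^sup>+x. (\<integral>\<^sup>+t. U i (fst x, snd x, t) \<partial>u (fst x) (snd x)) \<partial>(M \<Otimes>\<^sub>M N))" using seq by simp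
    also have "\<dots> = (\<integral>\<^sup>+x. (SUP i. \<integral>\<^sup>+t. U i (fst x, snd x, t) \<partial>u (fst x) (snd x)) \<partial>(M \<Otimes>\<^sub>M N))"
    proof (rule nn_integral_monotone_convergence_SUP[symmetric])
      show "incseq (\<lambda>i x. \<integral>\<^sup>+t. U i (fst x, snd x, t) \<partial>u (fst x) (snd x))"
        unfolding incseq_def le_fun_def using inc by (intro allI impI nn_integral_mono) (rule incseqD)
      show "(\<lambda>x. \<integral>\<^sup>+t. U i (fst x, snd x, t) \<partial>u (fst x) (snd x)) \<in> borel_measurable (M \<Otimes>\<^sub>M N)" for i
        by (rule km) measurable
    qed
    also have "\<dots> = (\<integral>\<^sup>+x. (\<integral>\<^sup>+t. (SUP i. U i) (fst x, snd x, t) \<partial>u (fst x) (snd x)) \<partial>(M \<Otimes>\<^sub>M N))"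
    proof (rule nn_integral_cong)
      fix x assume x: "x \<in> space (M \<Otimes>\<^sub>M N)"
      have "(SUP i. \<integral>\<^sup>+t. U i (fst x, snd x, t) \<partial>u (fst x) (snd x)) = (\<integral>\<^sup>+t. (SUP i. U i (fst x, snd x, t)) \<partial>u (fst x) (snd x))"
      proof (rule nn_integral_monotone_convergence_SUP[symmetric])
        show "incseq (\<lambda>i t. U i (fst x, snd x, t))" unfolding incseq_def le_fun_def using incseqD[OF inc] by blast
      qed (rule cm[OF x], measurable)
      then show "(SUP i. \<integral>\<^sup>+t. U i (fst x, snd x, t) \<partial>u (fst x) (snd x)) = (\<integral>\<^sup>+t. (SUP i. U i) (fst x, snd x, t) \<partial>u (fst x) (snd x))"
        by (simp add: SUP_apply image_comp)
    qed
    finally show ?case .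
  qed
qed

definition unif2 :: "(real \<times> real) measure" where "unif2 = unif \<Otimes>\<^sub>M unif"

lemma prob_unif2: "prob_space unif2"
proof -
  interpret U: prob_space unif by (rule prob_unif)
  interpret UU: pair_prob_space unif unif ..
  show ?thesis unfolding unif2_def by (rule UU.prob_space_axioms)
qed

text \<open>The randomisation lemma is applied twice: first to the real coordinate \<open>e\<close> of the target, then to the
logarithm of the factor given the source and that coordinate.\<close>

lemma Pol_randomization:
  assumes N: "prob_space N" and q: "q \<in> Pol N L" and e[measurable]: "e \<in> borel_measurable L"
  obtains y \<tau> where "y \<in> borel_measurable (N \<Otimes>\<^sub>M unif2)" "\<tau> \<in> N \<Otimes>\<^sub>M unif2 \<rightarrow>\<^sub>M Rpos"
    "distr q (N \<Otimes>\<^sub>M (borel \<Otimes>\<^sub>M Rpos)) (\<lambda>z. (fst z, e (fst (snd z)) :: real, snd (snd z))) =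
     distr (N \<Otimes>\<^sub>M unif2) (N \<Otimes>\<^sub>M (borel \<Otimes>\<^sub>M Rpos)) (\<lambda>x. (fst x, y x, \<tau> x))"
proof -
  note [measurable_cong] = sets_Pol[OF q] and [measurable] = measurable_t[OF q] measurable_id_Rpos
  interpret N: prob_space N by fact
  interpret U: prob_space unif by (rule prob_unif)
  interpret q: prob_space q by (rule Pol_prob[OF q N])
  define P1 where "P1 = distr q (N \<Otimes>\<^sub>M borel) (\<lambda>z. (fst z, e (fst (snd z))))"
  have sP1[measurable_cong, simp]: "sets P1 = sets (N \<Otimes>\<^sub>M borel)" by (simp add: P1_def)
  have "distr P1 N fst = distr q N fst" unfolding P1_def by (subst distr_distr) (auto simp: comp_def)
  also have "\<dots> = N" using q by (simp add: Pol_def case_prod_beta')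
  finally have mP1: "distr P1 N fst = N" .
  obtain \<kappa>1 where \<kappa>1[measurable]: "\<kappa>1 \<in> borel_measurable (N \<Otimes>\<^sub>M borel)"
    and eq1: "distr (N \<Otimes>\<^sub>M unif) (N \<Otimes>\<^sub>M borel) (\<lambda>z. (fst z, \<kappa>1 z)) = P1"
    by (rule randomization[OF N sP1 mP1])
  interpret P1: prob_space P1 unfolding P1_def by (rule q.prob_space_distr) measurable
  define P2 where "P2 = distr q (P1 \<Otimes>\<^sub>M borel) (\<lambda>z. ((fst z, e (fst (snd z))), ln (snd (snd z))))"
  have sP2: "sets P2 = sets (P1 \<Otimes>\<^sub>M borel)" by (simp add: P2_def)
  have "distr P2 P1 fst = distr q P1 (\<lambda>z. (fst z, e (fst (snd z))))" unfolding P2_def by (subst distr_distr) (auto simp: comp_def)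
  also have "\<dots> = P1" unfolding P1_def by (rule distr_cong) auto
  finally have mP2: "distr P2 P1 fst = P1" .
  obtain \<kappa>2 where \<kappa>2[measurable]: "\<kappa>2 \<in> borel_measurable (P1 \<Otimes>\<^sub>M borel)"
    and eq2: "distr (P1 \<Otimes>\<^sub>M unif) (P1 \<Otimes>\<^sub>M borel) (\<lambda>z. (fst z, \<kappa>2 z)) = P2"
    by (rule randomization[OF P1.prob_space_axioms sP2 mP2])
  have [measurable]: "\<kappa>2 \<in> borel_measurable ((N \<Otimes>\<^sub>M borel) \<Otimes>\<^sub>M borel)"
    using \<kappa>2 by (subst measurable_cong_sets[where M'="P1 \<Otimes>\<^sub>M borel", OF _ refl]) (auto intro: sets_pair_measure_cong)
  define y where "y x = \<kappa>1 (fst x, fst (snd x))" for x :: "'a \<times> real \<times> real"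
  define \<tau> where "\<tau> x = exp (\<kappa>2 ((fst x, y x), snd (snd x)))" for x :: "'a \<times> real \<times> real"
  have ym[measurable]: "y \<in> borel_measurable (N \<Otimes>\<^sub>M unif2)" unfolding y_def unif2_def by measurable
  have \<tau>m[measurable]: "\<tau> \<in> N \<Otimes>\<^sub>M unif2 \<rightarrow>\<^sub>M Rpos"
  proof (rule measurable_into_Rpos)
    show "\<tau> \<in> borel_measurable (N \<Otimes>\<^sub>M unif2)" unfolding \<tau>_def y_def unif2_def by measurable
  qed (simp add: \<tau>_def)
  interpret U2: prob_space unif2 by (rule prob_unif2)
  have ex: "exp \<in> borel \<rightarrow>\<^sub>M Rpos" by (rule measurable_into_Rpos) auto
  have "distr q (N \<Otimes>\<^sub>M (borel \<Otimes>\<^sub>M Rpos)) (\<lambda>z. (fst z, e (fst (snd z)) :: real, snd (snd z))) =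
     distr (N \<Otimes>\<^sub>M unif2) (N \<Otimes>\<^sub>M (borel \<Otimes>\<^sub>M Rpos)) (\<lambda>x. (fst x, y x, \<tau> x))" (is "?l = ?r")
  proof (rule measure_eqI)
    fix E assume "E \<in> sets ?l"
    then have E[measurable]: "E \<in> sets (N \<Otimes>\<^sub>M (borel \<Otimes>\<^sub>M Rpos))" by simp
    note [measurable] = ex
    let ?H = "\<lambda>z. indicator E (fst (fst z), snd (fst z), exp (snd z)) :: ennreal"
    have Hm: "?H \<in> borel_measurable ((N \<Otimes>\<^sub>M borel) \<Otimes>\<^sub>M borel)" by measurable
    then have Hm': "?H \<in> borel_measurable (P1 \<Otimes>\<^sub>M borel)" by measurable
    have "emeasure ?l E = (\<integral>\<^sup>+z. indicator E z \<partial>?l)" by (rule nn_integral_indicator[symmetric]) simp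
    also have "\<dots> = (\<integral>\<^sup>+z. indicator E (fst z, e (fst (snd z)), snd (snd z)) \<partial>q)" by (rule nn_integral_distr) auto
    also have "\<dots> = (\<integral>\<^sup>+z. ?H ((fst z, e (fst (snd z))), ln (snd (snd z))) \<partial>q)"
      by (intro nn_integral_cong) (simp add: Pol_spaceD[OF q])
    also have "\<dots> = (\<integral>\<^sup>+z. ?H z \<partial>P2)" unfolding P2_def using Hm' by (intro nn_integral_distr[symmetric]) auto
    also have "\<dots> = (\<integral>\<^sup>+z. ?H (fst z, \<kappa>2 z) \<partial>(P1 \<Otimes>\<^sub>M unif))" unfolding eq2[symmetric] using Hm' by (intro nn_integral_distr) auto
    also have "\<dots> = (\<integral>\<^sup>+a. \<integral>\<^sup>+v. ?H (a, \<kappa>2 (a, v)) \<partial>unif \<partial>P1)"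
      by (subst U.nn_integral_fst[symmetric]) auto
    also have "\<dots> = (\<integral>\<^sup>+x. \<integral>\<^sup>+v. ?H ((fst x, \<kappa>1 x), \<kappa>2 ((fst x, \<kappa>1 x), v)) \<partial>unif \<partial>(N \<Otimes>\<^sub>M unif))"
      unfolding eq1[symmetric] by (subst nn_integral_distr) auto
    also have "\<dots> = (\<integral>\<^sup>+n. \<integral>\<^sup>+u. \<integral>\<^sup>+v. ?H ((n, \<kappa>1 (n, u)), \<kappa>2 ((n, \<kappa>1 (n, u)), v)) \<partial>unif \<partial>unif \<partial>N)"
      by (subst U.nn_integral_fst[symmetric]) auto
    also have "\<dots> = (\<integral>\<^sup>+n. \<integral>\<^sup>+w. indicator E (n, y (n, w), \<tau> (n, w)) \<partial>unif2 \<partial>N)"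
    proof (rule nn_integral_cong)
      fix n assume [measurable]: "n \<in> space N"
      show "(\<integral>\<^sup>+u. \<integral>\<^sup>+v. ?H ((n, \<kappa>1 (n, u)), \<kappa>2 ((n, \<kappa>1 (n, u)), v)) \<partial>unif \<partial>unif) = (\<integral>\<^sup>+w. indicator E (n, y (n, w), \<tau> (n, w)) \<partial>unif2)"
        unfolding unif2_def by (subst U.nn_integral_fst[symmetric]) (auto simp: y_def \<tau>_def)
    qed
    also have "\<dots> = (\<integral>\<^sup>+x. indicator E (fst x, y x, \<tau> x) \<partial>(N \<Otimes>\<^sub>M unif2))"
      by (subst U2.nn_integral_fst[symmetric]) auto
    also have "\<dots> = (\<integral>\<^sup>+z. indicator E z \<partial>?r)" by (rule nn_integral_distr[symmetric]) auto
    also have "\<dots> = emeasure ?r E" by (rule nn_integral_indicator) simp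
    finally show "emeasure ?l E = emeasure ?r E" .
  qed simp
  with that ym \<tau>m show ?thesis by blast
qed

section \<open>Existence of composites\<close>

text \<open>\<open>e\<close> and \<open>j\<close> are a real coordinate on \<open>L\<close> and its inverse; the point \<open>n\<close> and the random parameter \<open>w\<close> are sent
by \<open>q\<close> to the point with coordinate \<open>y (n, w)\<close>, with factor \<open>\<tau> (n, w)\<close>.\<close>

locale pol_composition =
  fixes M :: "'m measure" and N :: "'n measure" and L :: "'l measure" and p q
    and e :: "'l \<Rightarrow> real" and j :: "real \<Rightarrow> 'l" and y \<tau> :: "'n \<times> real \<times> real \<Rightarrow> real"
  assumes M1: "prob_space M" and N1: "prob_space N" and L1: "prob_space L"
    and p: "p \<in> Pol M N" and q: "q \<in> Pol N L"
    and e[measurable]: "e \<in> borel_measurable L" and j: "j \<in> completion (distr L borel e) \<rightarrow>\<^sub>M L"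
    and je: "AE k in L. j (e k) = k"
    and y: "y \<in> borel_measurable (N \<Otimes>\<^sub>M unif2)" and \<tau>: "\<tau> \<in> N \<Otimes>\<^sub>M unif2 \<rightarrow>\<^sub>M Rpos"
    and rand: "distr q (N \<Otimes>\<^sub>M (borel \<Otimes>\<^sub>M Rpos)) (\<lambda>z. (fst z, e (fst (snd z)) :: real, snd (snd z))) =
     distr (N \<Otimes>\<^sub>M unif2) (N \<Otimes>\<^sub>M (borel \<Otimes>\<^sub>M Rpos)) (\<lambda>x. (fst x, y x, \<tau> x))"
begin

sublocale M: prob_space M by (rule M1)
sublocale N: prob_space N by (rule N1)
sublocale L: prob_space L by (rule L1)
sublocale p: prob_space p by (rule Pol_prob[OF p M1])
sublocale q: prob_space q by (rule Pol_prob[OF q N1])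
sublocale V: prob_space unif2 by (rule prob_unif2)
sublocale pV: pair_prob_space p unif2 ..
sublocale NV: pair_prob_space N unif2 ..

declare y[measurable] \<tau>[measurable]

lemma y_meas[measurable (raw)]: "f \<in> X \<rightarrow>\<^sub>M N \<Longrightarrow> g \<in> X \<rightarrow>\<^sub>M unif2 \<Longrightarrow> (\<lambda>x. y (f x, g x)) \<in> borel_measurable X"
  using measurable_compose[OF measurable_Pair y] .

lemma \<tau>_meas[measurable (raw)]: "f \<in> X \<rightarrow>\<^sub>M N \<Longrightarrow> g \<in> X \<rightarrow>\<^sub>M unif2 \<Longrightarrow> (\<lambda>x. \<tau> (f x, g x)) \<in> X \<rightarrow>\<^sub>M Rpos"
  using measurable_compose[OF measurable_Pair \<tau>] .

lemma \<tau>_pos: "n \<in> space N \<Longrightarrow> w \<in> space unif2 \<Longrightarrow> 0 < \<tau> (n, w)"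
  using measurable_space[OF \<tau>, of "(n, w)"] by (simp add: space_pair_measure)

lemma rand_nn:
  assumes G[measurable]: "G \<in> borel_measurable (N \<Otimes>\<^sub>M (borel \<Otimes>\<^sub>M Rpos))"
  shows "(\<integral>\<^sup>+z. G (fst z, e (fst (snd z)), snd (snd z)) \<partial>q) = (\<integral>\<^sup>+n. \<integral>\<^sup>+w. G (n, y (n, w), \<tau> (n, w)) \<partial>unif2 \<partial>N)"
proof -
  note [measurable_cong] = sets_Pol[OF q]
  have "(\<integral>\<^sup>+z. G (fst z, e (fst (snd z)), snd (snd z)) \<partial>q) = (\<integral>\<^sup>+z. G z \<partial>distr q (N \<Otimes>\<^sub>M (borel \<Otimes>\<^sub>M Rpos)) (\<lambda>z. (fst z, e (fst (snd z)) :: real, snd (snd z))))"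
    by (rule nn_integral_distr[symmetric]) auto
  also have "\<dots> = (\<integral>\<^sup>+x. G (fst x, y x, \<tau> x) \<partial>(N \<Otimes>\<^sub>M unif2))"
    unfolding rand by (rule nn_integral_distr) auto
  also have "\<dots> = (\<integral>\<^sup>+n. \<integral>\<^sup>+w. G (n, y (n, w), \<tau> (n, w)) \<partial>unif2 \<partial>N)"
    by (subst V.nn_integral_fst[symmetric]) auto
  finally show ?thesis .
qed

text \<open>The coordinate of the target, and in \<open>S\<close> the product of the factors, as functions of a point of \<open>p\<close> and
a random parameter.\<close>

definition Y :: "('m \<times> 'n \<times> real) \<times> (real \<times> real) \<Rightarrow> real" where
  "Y x = y (fst (snd (fst x)), snd x)"

definition S :: "('m \<times> 'n \<times> real) \<times> (real \<times> real) \<Rightarrow> real" where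
  "S x = snd (snd (fst x)) * \<tau> (fst (snd (fst x)), snd x)"

lemma p_meas[measurable]: "fst \<in> p \<rightarrow>\<^sub>M M" "(\<lambda>z. fst (snd z)) \<in> p \<rightarrow>\<^sub>M N" "(\<lambda>z. snd (snd z)) \<in> p \<rightarrow>\<^sub>M Rpos"
proof -
  note [measurable_cong] = sets_Pol[OF p]
  show "fst \<in> p \<rightarrow>\<^sub>M M" "(\<lambda>z. fst (snd z)) \<in> p \<rightarrow>\<^sub>M N" "(\<lambda>z. snd (snd z)) \<in> p \<rightarrow>\<^sub>M Rpos" by measurable
qed

lemma p_meas_raw[measurable (raw)]:
  assumes "f \<in> X \<rightarrow>\<^sub>M p"
  shows "(\<lambda>x. fst (f x)) \<in> X \<rightarrow>\<^sub>M M" "(\<lambda>x. fst (snd (f x))) \<in> X \<rightarrow>\<^sub>M N" "(\<lambda>x. snd (snd (f x))) \<in> X \<rightarrow>\<^sub>M Rpos"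
  using measurable_compose[OF assms p_meas(1)] measurable_compose[OF assms p_meas(2)] measurable_compose[OF assms p_meas(3)] .

lemma Y_meas[measurable]: "Y \<in> borel_measurable (p \<Otimes>\<^sub>M unif2)" unfolding Y_def by measurable

lemma Rpos_mult[measurable (raw)]:
  assumes "f \<in> X \<rightarrow>\<^sub>M Rpos" "g \<in> X \<rightarrow>\<^sub>M Rpos" shows "(\<lambda>x. f x * g x) \<in> X \<rightarrow>\<^sub>M Rpos"
proof (rule measurable_into_Rpos)
  show "(\<lambda>x. f x * g x) \<in> borel_measurable X" using measurable_Rpos_D[OF assms(1)] measurable_Rpos_D[OF assms(2)] by measurable
  fix x assume "x \<in> space X"
  then show "0 < f x * g x" using measurable_space[OF assms(1)] measurable_space[OF assms(2)] by simp
qed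

lemma S_meas[measurable]: "S \<in> p \<Otimes>\<^sub>M unif2 \<rightarrow>\<^sub>M Rpos" unfolding S_def by measurable

text \<open>The factors are positive, so the image of \<open>q\<close> on \<open>L\<close> has the same null sets as the measure of \<open>L\<close>. Null sets
of \<open>N\<close> are null for the second marginal of \<open>p\<close> for the same reason.\<close>

lemma Y_AE:
  assumes Q: "AE t in distr L borel e. Q t"
  shows "AE x in p \<Otimes>\<^sub>M unif2. Q (Y x)" and "\<exists>Z\<in>null_sets (distr L borel e). {t. \<not> Q t} \<subseteq> Z \<and> (AE x in p \<Otimes>\<^sub>M unif2. Y x \<notin> Z)"
proof -
  obtain Z where Z: "Z \<in> null_sets (distr L borel e)" "{t \<in> space (distr L borel e). \<not> Q t} \<subseteq> Z"
    using Q unfolding eventually_ae_filter by blast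
  then have Zb[measurable]: "Z \<in> sets borel" by auto
  have "AE k in L. e k \<notin> Z"
    using AE_not_in[OF Z(1)] by (subst (asm) AE_distr_iff) auto
  then have qZ: "AE z in q. e (fst (snd z)) \<notin> Z" by (rule Pol_AE2[OF q])
  have "(\<integral>\<^sup>+n. \<integral>\<^sup>+w. indicator Z (y (n, w)) \<partial>unif2 \<partial>N) = (\<integral>\<^sup>+z. indicator Z (e (fst (snd z))) \<partial>q)"
    using rand_nn[of "\<lambda>z. indicator Z (fst (snd z))"] by simp
  also have "\<dots> = (\<integral>\<^sup>+z. 0 \<partial>q)" by (rule nn_integral_cong_AE) (use qZ in \<open>auto elim!: eventually_mono\<close>)
  finally have "(\<integral>\<^sup>+n. \<integral>\<^sup>+w. indicator Z (y (n, w)) \<partial>unif2 \<partial>N) = 0" by simp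
  then have "AE n in N. (\<integral>\<^sup>+w. indicator Z (y (n, w)) \<partial>unif2) = 0"
    by (subst (asm) nn_integral_0_iff_AE) measurable
  then have pZ: "AE z in p. (\<integral>\<^sup>+w. indicator Z (y (fst (snd z), w)) \<partial>unif2) = 0" by (rule Pol_AE2[OF p])
  have "(\<integral>\<^sup>+x. indicator Z (Y x) \<partial>(p \<Otimes>\<^sub>M unif2)) = (\<integral>\<^sup>+z. \<integral>\<^sup>+w. indicator Z (y (fst (snd z), w)) \<partial>unif2 \<partial>p)"
    by (subst V.nn_integral_fst[symmetric]) (auto simp: Y_def)
  also have "\<dots> = (\<integral>\<^sup>+z. 0 \<partial>p)" by (rule nn_integral_cong_AE) (use pZ in \<open>auto elim!: eventually_mono\<close>)
  finally have "(\<integral>\<^sup>+x. indicator Z (Y x) \<partial>(p \<Otimes>\<^sub>M unif2)) = 0" by simp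
  then have "AE x in p \<Otimes>\<^sub>M unif2. indicator Z (Y x) = (0::ennreal)"
    by (subst (asm) nn_integral_0_iff_AE) measurable
  then have a: "AE x in p \<Otimes>\<^sub>M unif2. Y x \<notin> Z" by eventually_elim (simp add: indicator_def split: if_splits)
  have sub: "{t. \<not> Q t} \<subseteq> Z" using Z(2) by auto
  show "\<exists>Z\<in>null_sets (distr L borel e). {t. \<not> Q t} \<subseteq> Z \<and> (AE x in p \<Otimes>\<^sub>M unif2. Y x \<notin> Z)" using Z(1) sub a by blast
  show "AE x in p \<Otimes>\<^sub>M unif2. Q (Y x)" using a by eventually_elim (use sub in blast)
qed

definition W :: "('m \<times> real \<times> real) measure" where
  "W = distr (p \<Otimes>\<^sub>M unif2) (M \<Otimes>\<^sub>M (borel \<Otimes>\<^sub>M Rpos)) (\<lambda>x. (fst (fst x), Y x, S x))"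

lemma sets_W: "sets W = sets (M \<Otimes>\<^sub>M (borel \<Otimes>\<^sub>M Rpos))" by (simp add: W_def)

lemma W_AE:
  assumes Q: "AE t in distr L borel e. Q t" shows "AE z in W. Q (fst (snd z))"
proof -
  obtain Z where Z: "Z \<in> null_sets (distr L borel e)" "{t. \<not> Q t} \<subseteq> Z" "AE x in p \<Otimes>\<^sub>M unif2. Y x \<notin> Z"
    using Y_AE(2)[OF Q] by blast
  then have [measurable]: "Z \<in> sets borel" by auto
  have "AE z in W. fst (snd z) \<notin> Z"
    unfolding W_def using Z(3) by (subst AE_distr_iff) auto
  then show ?thesis by eventually_elim (use Z(2) in blast)
qed

text \<open>A Borel set of coordinates that agrees with \<open>C\<close> modulo null sets; it replaces the preimage of \<open>C\<close> under \<open>j\<close>,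
which need not be Borel.\<close>

definition base :: "'l set \<Rightarrow> real set" where
  "base C = (SOME A. A \<in> sets borel \<and> (AE t in distr L borel e. t \<in> A \<longleftrightarrow> j t \<in> C) \<and> (AE k in L. e k \<in> A \<longleftrightarrow> k \<in> C))"

lemma base:
  assumes "C \<in> sets L"
  shows "base C \<in> sets borel" "AE t in distr L borel e. t \<in> base C \<longleftrightarrow> j t \<in> C" "AE k in L. e k \<in> base C \<longleftrightarrow> k \<in> C"
proof -
  obtain A where "A \<in> sets borel" "AE t in distr L borel e. t \<in> A \<longleftrightarrow> j t \<in> C" "AE k in L. e k \<in> A \<longleftrightarrow> k \<in> C"
    by (rule lebesgue_mod0_borel[OF L1 e j je assms])
  then have "\<exists>A. A \<in> sets borel \<and> (AE t in distr L borel e. t \<in> A \<longleftrightarrow> j t \<in> C) \<and> (AE k in L. e k \<in> A \<longleftrightarrow> k \<in> C)" by blast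
  from someI_ex[OF this] show "base C \<in> sets borel" "AE t in distr L borel e. t \<in> base C \<longleftrightarrow> j t \<in> C" "AE k in L. e k \<in> base C \<longleftrightarrow> k \<in> C"
    unfolding base_def by blast+
qed

lemma j_meas: "(\<lambda>z. j (fst (snd z))) \<in> completion W \<rightarrow>\<^sub>M L"
proof (rule measurableI)
  fix z show "j (fst (snd z)) \<in> space L" using measurable_space[OF j] by simp
next
  fix C assume C: "C \<in> sets L"
  note [measurable] = base(1)[OF C]
  have m: "{z \<in> space W. fst (snd z) \<in> base C} \<in> sets W"
  proof -
    note [measurable_cong] = sets_W
    show ?thesis by measurable
  qed
  show "(\<lambda>z. j (fst (snd z))) -` C \<inter> space (completion W) \<in> sets (completion W)"
  proof (rule completion.in_sets_AE[where A="{z \<in> space W. fst (snd z) \<in> base C}"])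
    show "AE z in completion W. (z \<in> {z \<in> space W. fst (snd z) \<in> base C}) = (z \<in> (\<lambda>z. j (fst (snd z))) -` C \<inter> space (completion W))"
      using AE_completion[OF W_AE[OF base(2)[OF C]]] AE_space by eventually_elim auto
  qed (use m in auto)
qed

definition composite :: "('m \<times> 'l \<times> real) measure" where
  "composite = distr (completion W) (pol_space M L) (\<lambda>z. (fst z, j (fst (snd z)), snd (snd z)))"

lemma comp_meas: "(\<lambda>z. (fst z, j (fst (snd z)), snd (snd z))) \<in> completion W \<rightarrow>\<^sub>M pol_space M L"
proof -
  note [measurable_cong] = sets_W and [measurable] = j_meas
  have [measurable]: "fst \<in> completion W \<rightarrow>\<^sub>M M" "(\<lambda>z. snd (snd z)) \<in> completion W \<rightarrow>\<^sub>M Rpos" by (rule measurable_completion, measurable)+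
  show ?thesis by measurable
qed

lemma sets_composite: "sets composite = sets (pol_space M L)" by (simp add: composite_def)

lemma emeasure_composite:
  assumes B[measurable]: "B \<in> sets M" and C: "C \<in> sets L" and D[measurable]: "D \<in> sets Rpos"
  shows "emeasure composite (B \<times> C \<times> D) = (\<integral>\<^sup>+x. indicator B (fst (fst x)) * indicator (base C) (Y x) * indicator D (S x) \<partial>(p \<Otimes>\<^sub>M unif2))"
proof -
  note [measurable] = base(1)[OF C]
  have BD: "B \<times> base C \<times> D \<in> sets W" unfolding sets_W by measurable
  have BCD: "B \<times> C \<times> D \<in> sets (pol_space M L)" using C by auto
  have "emeasure composite (B \<times> C \<times> D) = emeasure (completion W) ((\<lambda>z. (fst z, j (fst (snd z)), snd (snd z))) -` (B \<times> C \<times> D) \<inter> space (completion W))"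
    unfolding composite_def by (rule emeasure_distr[OF comp_meas BCD])
  also have "\<dots> = emeasure (completion W) (B \<times> base C \<times> D)"
  proof (rule emeasure_eq_AE)
    have sp: "B \<times> base C \<times> D \<subseteq> space W" using sets.sets_into_space[OF BD] .
    show "AE z in completion W. (z \<in> (\<lambda>z. (fst z, j (fst (snd z)), snd (snd z))) -` (B \<times> C \<times> D) \<inter> space (completion W)) = (z \<in> B \<times> base C \<times> D)"
      using AE_completion[OF W_AE[OF base(2)[OF C]]] AE_space by eventually_elim (use sp in \<open>auto simp: mem_Times_iff\<close>)
    show "(\<lambda>z. (fst z, j (fst (snd z)), snd (snd z))) -` (B \<times> C \<times> D) \<inter> space (completion W) \<in> sets (completion W)"
      by (rule measurable_sets[OF comp_meas BCD])
    show "B \<times> base C \<times> D \<in> sets (completion W)" using BD by auto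
  qed
  also have "\<dots> = emeasure W (B \<times> base C \<times> D)" using BD by simp
  also have "\<dots> = (\<integral>\<^sup>+z. indicator (B \<times> base C \<times> D) z \<partial>W)" using BD by (rule nn_integral_indicator[symmetric])
  also have "\<dots> = (\<integral>\<^sup>+x. indicator (B \<times> base C \<times> D) (fst (fst x), Y x, S x) \<partial>(p \<Otimes>\<^sub>M unif2))"
    unfolding W_def by (rule nn_integral_distr) auto
  also have "\<dots> = (\<integral>\<^sup>+x. indicator B (fst (fst x)) * indicator (base C) (Y x) * indicator D (S x) \<partial>(p \<Otimes>\<^sub>M unif2))"
    by (intro nn_integral_cong) (auto simp: indicator_def)
  finally show ?thesis .
qed

lemma composite_slice:
  assumes B[measurable]: "B \<in> sets M" and C[measurable]: "C \<in> sets L"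
  shows "distr (density composite (\<lambda>z. ennreal (indicator B (fst z) * indicator C (fst (snd z))))) Rpos (\<lambda>z. snd (snd z)) =
    distr (density (p \<Otimes>\<^sub>M unif2) (\<lambda>x. ennreal (indicator B (fst (fst x)) * indicator (base C) (Y x)))) Rpos S" (is "?l = ?r")
proof (rule measure_eqI)
  note [measurable_cong] = sets_composite and [measurable] = base(1)[OF C]
  fix D assume "D \<in> sets ?l"
  then have D[measurable]: "D \<in> sets Rpos" by simp
  have "emeasure ?l D = (\<integral>\<^sup>+t. indicator D t \<partial>?l)" by (rule nn_integral_indicator[symmetric]) simp
  also have "\<dots> = (\<integral>\<^sup>+z. ennreal (indicator B (fst z) * indicator C (fst (snd z))) * indicator D (snd (snd z)) \<partial>composite)"
    by (subst nn_integral_distr, simp, measurable, subst nn_integral_density, measurable)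
  also have "\<dots> = (\<integral>\<^sup>+z. indicator (B \<times> C \<times> D) z \<partial>composite)"
    by (intro nn_integral_cong) (auto simp: indicator_def)
  also have "\<dots> = emeasure composite (B \<times> C \<times> D)" by (rule nn_integral_indicator) (simp add: sets_composite)
  also have "\<dots> = (\<integral>\<^sup>+x. indicator B (fst (fst x)) * indicator (base C) (Y x) * indicator D (S x) \<partial>(p \<Otimes>\<^sub>M unif2))"
    by (rule emeasure_composite[OF B C D])
  also have "\<dots> = (\<integral>\<^sup>+x. ennreal (indicator B (fst (fst x)) * indicator (base C) (Y x)) * indicator D (S x) \<partial>(p \<Otimes>\<^sub>M unif2))"
    by (intro nn_integral_cong) (auto simp: indicator_def)
  also have "\<dots> = (\<integral>\<^sup>+t. indicator D t \<partial>?r)"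
    by (subst nn_integral_distr, simp, measurable, subst nn_integral_density, measurable)
  also have "\<dots> = emeasure ?r D" by (rule nn_integral_indicator) simp
  finally show "emeasure ?l D = emeasure ?r D" .
qed simp

lemma composite_nn:
  assumes B[measurable]: "B \<in> sets M" and C[measurable]: "C \<in> sets L" and c[measurable]: "c \<in> borel_measurable Rpos"
  shows "(\<integral>\<^sup>+z. ennreal (indicator B (fst z) * indicator C (fst (snd z))) * c (snd (snd z)) \<partial>composite) =
    (\<integral>\<^sup>+x. ennreal (indicator B (fst (fst x)) * indicator (base C) (Y x)) * c (S x) \<partial>(p \<Otimes>\<^sub>M unif2))"
proof -
  note [measurable_cong] = sets_composite and [measurable] = base(1)[OF C]
  have "(\<integral>\<^sup>+z. ennreal (indicator B (fst z) * indicator C (fst (snd z))) * c (snd (snd z)) \<partial>composite) =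
    (\<integral>\<^sup>+t. c t \<partial>distr (density composite (\<lambda>z. ennreal (indicator B (fst z) * indicator C (fst (snd z))))) Rpos (\<lambda>z. snd (snd z)))"
    by (subst nn_integral_distr, simp, measurable, subst nn_integral_density, measurable)
  also have "\<dots> = (\<integral>\<^sup>+x. ennreal (indicator B (fst (fst x)) * indicator (base C) (Y x)) * c (S x) \<partial>(p \<Otimes>\<^sub>M unif2))"
    unfolding composite_slice[OF B C]
    by (subst nn_integral_distr, simp, measurable, subst nn_integral_density, measurable)
  finally show ?thesis .
qed

lemma composite_Pol: "composite \<in> Pol M L"
proof (rule PolI[OF sets_composite])
  note [measurable] = measurable_id_Rpos
  fix B assume B[measurable]: "B \<in> sets M"
  have spc: "space composite = space M \<times> space L \<times> {0<..}" using sets_eq_imp_space_eq[OF sets_composite] by (auto simp: space_pair_measure)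
  note [measurable] = base(1)[OF sets.top]
  have "AE t in distr L borel e. t \<in> base (space L)"
    using base(2)[OF sets.top] by eventually_elim (use measurable_space[OF j] in auto)
  then have bt: "AE x in p \<Otimes>\<^sub>M unif2. Y x \<in> base (space L)" by (rule Y_AE(1))
  have "(\<integral>\<^sup>+z. indicator B (fst z) \<partial>composite) = (\<integral>\<^sup>+z. ennreal (indicator B (fst z) * indicator (space L) (fst (snd z))) * 1 \<partial>composite)"
    by (intro nn_integral_cong) (auto simp: spc indicator_def)
  also have "\<dots> = (\<integral>\<^sup>+x. ennreal (indicator B (fst (fst x)) * indicator (base (space L)) (Y x)) * 1 \<partial>(p \<Otimes>\<^sub>M unif2))"
    by (rule composite_nn) auto
  also have "\<dots> = (\<integral>\<^sup>+x. indicator B (fst (fst x)) \<partial>(p \<Otimes>\<^sub>M unif2))"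
    by (rule nn_integral_cong_AE) (use bt in eventually_elim, auto simp: indicator_def)
  also have "\<dots> = (\<integral>\<^sup>+z. indicator B (fst z) \<partial>p)"
    by (subst V.nn_integral_fst[symmetric]) (auto simp: V.emeasure_space_1)
  also have "\<dots> = emeasure M B" by (subst Pol_nn1[OF p]) auto
  finally show "(\<integral>\<^sup>+z. indicator B (fst z) \<partial>composite) = emeasure M B" .
next
  note [measurable] = measurable_id_Rpos
  fix C assume C[measurable]: "C \<in> sets L"
  note [measurable] = base(1)[OF C]
  have spc: "space composite = space M \<times> space L \<times> {0<..}" using sets_eq_imp_space_eq[OF sets_composite] by (auto simp: space_pair_measure)
  have "(\<integral>\<^sup>+z. ennreal (snd (snd z)) * indicator C (fst (snd z)) \<partial>composite) =
    (\<integral>\<^sup>+z. ennreal (indicator (space M) (fst z) * indicator C (fst (snd z))) * ennreal (snd (snd z)) \<partial>composite)"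
    by (intro nn_integral_cong) (auto simp: spc indicator_def)
  also have "\<dots> = (\<integral>\<^sup>+x. ennreal (indicator (space M) (fst (fst x)) * indicator (base C) (Y x)) * ennreal (S x) \<partial>(p \<Otimes>\<^sub>M unif2))"
    by (rule composite_nn) auto
  also have "\<dots> = (\<integral>\<^sup>+z. \<integral>\<^sup>+w. ennreal (snd (snd z)) * (indicator (base C) (y (fst (snd z), w)) * ennreal (\<tau> (fst (snd z), w))) \<partial>unif2 \<partial>p)"
  proof -
    have "(\<integral>\<^sup>+x. ennreal (indicator (space M) (fst (fst x)) * indicator (base C) (Y x)) * ennreal (S x) \<partial>(p \<Otimes>\<^sub>M unif2)) =
      (\<integral>\<^sup>+z. \<integral>\<^sup>+w. ennreal (indicator (space M) (fst z) * indicator (base C) (Y (z, w))) * ennreal (S (z, w)) \<partial>unif2 \<partial>p)"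
      by (subst V.nn_integral_fst[symmetric]) auto
    also have "\<dots> = (\<integral>\<^sup>+z. \<integral>\<^sup>+w. ennreal (snd (snd z)) * (indicator (base C) (y (fst (snd z), w)) * ennreal (\<tau> (fst (snd z), w))) \<partial>unif2 \<partial>p)"
    proof (intro nn_integral_cong)
      fix z w assume z: "z \<in> space p" and w: "w \<in> space unif2"
      have "0 < \<tau> (fst (snd z), w)" by (rule \<tau>_pos[OF Pol_spaceD(2)[OF p z] w])
      then have "ennreal (S (z, w)) = ennreal (snd (snd z)) * ennreal (\<tau> (fst (snd z), w))"
        unfolding S_def using Pol_spaceD(3)[OF p z] by (simp add: ennreal_mult)
      then show "ennreal (indicator (space M) (fst z) * indicator (base C) (Y (z, w))) * ennreal (S (z, w)) =
        ennreal (snd (snd z)) * (indicator (base C) (y (fst (snd z), w)) * ennreal (\<tau> (fst (snd z), w)))"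
        using Pol_spaceD(1)[OF p z] by (simp add: Y_def ennreal_indicator mult_ac)
    qed
    finally show ?thesis .
  qed
  also have "\<dots> = (\<integral>\<^sup>+z. ennreal (snd (snd z)) * (\<integral>\<^sup>+w. indicator (base C) (y (fst (snd z), w)) * ennreal (\<tau> (fst (snd z), w)) \<partial>unif2) \<partial>p)"
  proof (rule nn_integral_cong)
    fix z assume z: "z \<in> space p"
    have [measurable]: "fst (snd z) \<in> space N" by (rule Pol_spaceD[OF p z])
    show "(\<integral>\<^sup>+w. ennreal (snd (snd z)) * (indicator (base C) (y (fst (snd z), w)) * ennreal (\<tau> (fst (snd z), w))) \<partial>unif2) =
      ennreal (snd (snd z)) * (\<integral>\<^sup>+w. indicator (base C) (y (fst (snd z), w)) * ennreal (\<tau> (fst (snd z), w)) \<partial>unif2)"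
      by (rule nn_integral_cmult) measurable
  qed
  also have "\<dots> = (\<integral>\<^sup>+n. \<integral>\<^sup>+w. indicator (base C) (y (n, w)) * ennreal (\<tau> (n, w)) \<partial>unif2 \<partial>N)"
    by (rule Pol_nn2[OF p]) measurable
  also have "\<dots> = (\<integral>\<^sup>+z. indicator (base C) (e (fst (snd z))) * ennreal (snd (snd z)) \<partial>q)"
    using rand_nn[of "\<lambda>z. indicator (base C) (fst (snd z)) * ennreal (snd (snd z))"] by simp
  also have "\<dots> = (\<integral>\<^sup>+z. ennreal (snd (snd z)) * indicator C (fst (snd z)) \<partial>q)"
    by (rule nn_integral_cong_AE) (use Pol_AE2[OF q base(3)[OF C]] in eventually_elim, auto simp: indicator_def)
  also have "\<dots> = emeasure L C" by (subst Pol_nn2[OF q]) auto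
  finally show "(\<integral>\<^sup>+z. ennreal (snd (snd z)) * indicator C (fst (snd z)) \<partial>composite) = emeasure L C" .
qed

text \<open>Multiplicativity of the Mellin character: integrating first over the random parameter yields the
function \<open>f\<close> that represents the functional of \<open>q\<close>, multiplied by the character of the factor of \<open>p\<close>.\<close>

lemma composite_form:
  assumes B[measurable]: "B \<in> sets M" and C[measurable]: "C \<in> sets L" and f: "square_integrable N f"
    and rep: "\<And>A. A \<in> sets N \<Longrightarrow> pol_form s q (indicator A) (indicator C) = (\<integral>n. indicator A n * f n \<partial>N)"
  shows "pol_form s composite (indicator B) (indicator C) = pol_form s p (indicator B) f"
proof -
  note [measurable] = base(1)[OF C] and [measurable_cong] = sets_composite sets_Pol[OF q]
  define f0 where "f0 n = (\<integral>w. indicator (base C) (y (n, w)) *\<^sub>R mel s (\<tau> (n, w)) \<partial>unif2)" for n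
  have f0m[measurable]: "f0 \<in> borel_measurable N" unfolding f0_def by measurable
  \<comment> \<open>Both \<open>f0\<close>, computed from the random parameters, and \<open>f\<close> represent the functional
    \<open>pol_form s q (\<cdot>) (indicator C)\<close>, so they agree almost everywhere.\<close>
  let ?H = "\<lambda>z. indicator (base C) (fst (snd z)) *\<^sub>R mel s (snd (snd z)) :: complex"
  let ?DD = "distr q (N \<Otimes>\<^sub>M (borel \<Otimes>\<^sub>M Rpos)) (\<lambda>z. (fst z, e (fst (snd z)) :: real, snd (snd z)))"
  have HD: "integrable ?DD ?H"
  proof (subst integrable_distr_eq)
    show "integrable q (\<lambda>x. ?H (fst x, e (fst (snd x)), snd (snd x)))"
    proof (rule Bochner_Integration.integrable_bound[OF integrable_sqrt_t[OF q N1 L1]])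
      show "AE z in q. norm (?H (fst z, e (fst (snd z)), snd (snd z))) \<le> norm (sqrt (snd (snd z)))"
      proof (rule AE_I2)
        fix z assume z: "z \<in> space q"
        have "0 < snd (snd z)" by (rule Pol_spaceD[OF q z])
        then show "norm (?H (fst z, e (fst (snd z)), snd (snd z))) \<le> norm (sqrt (snd (snd z)))"
          by (simp add: norm_mel indicator_def)
      qed
    qed measurable
  qed measurable
  have HN: "integrable (N \<Otimes>\<^sub>M unif2) (\<lambda>x. ?H (fst x, y x, \<tau> x))"
    using HD unfolding rand by (subst (asm) integrable_distr_eq) auto
  have f0i: "integrable N f0"
    using NV.integrable_fst'[OF HN] unfolding f0_def by simp
  have AA: "(\<integral>n. indicator A n * f0 n \<partial>N) = pol_form s q (indicator A) (indicator C)" if A[measurable]: "A \<in> sets N" for A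
  proof -
    have i: "integrable (N \<Otimes>\<^sub>M unif2) (\<lambda>x. indicator A (fst x) *\<^sub>R ?H (fst x, y x, \<tau> x))"
      by (rule Bochner_Integration.integrable_bound[OF HN]) (measurable, auto simp: indicator_def)
    have "(\<integral>n. indicator A n * f0 n \<partial>N) = (\<integral>n. \<integral>w. indicator A n *\<^sub>R ?H (n, y (n, w), \<tau> (n, w)) \<partial>unif2 \<partial>N)"
      unfolding f0_def by (intro Bochner_Integration.integral_cong refl) (simp add: indicator_def)
    also have "\<dots> = (\<integral>x. indicator A (fst x) *\<^sub>R ?H (fst x, y x, \<tau> x) \<partial>(N \<Otimes>\<^sub>M unif2))"
      using NV.integral_fst'[OF i] by simp
    also have "\<dots> = (\<integral>z. indicator A (fst z) *\<^sub>R ?H z \<partial>?DD)"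
      unfolding rand by (subst integral_distr) auto
    also have "\<dots> = (\<integral>z. indicator A (fst z) *\<^sub>R ?H (fst z, e (fst (snd z)), snd (snd z)) \<partial>q)"
      by (subst integral_distr) auto
    also have "\<dots> = pol_form s q (indicator A) (indicator C)"
      unfolding pol_form_def
    proof (rule integral_cong_AE)
      show "AE z in q. indicator A (fst z) *\<^sub>R ?H (fst z, e (fst (snd z)), snd (snd z)) = indicator A (fst z) * (indicator C (fst (snd z)) * mel s (snd (snd z)))"
        using Pol_AE2[OF q base(3)[OF C]] by eventually_elim (auto simp: indicator_def)
    qed measurable
    finally show ?thesis .
  qed
  have "AE n in N. f0 n = f n"
  proof (rule N.density_unique_banach[OF f0i N.sqi_integrable1[OF f]])
    fix A assume A: "A \<in> sets N"
    have "set_lebesgue_integral N A g = (\<integral>n. indicator A n * g n \<partial>N)" for g :: "'n \<Rightarrow> complex"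
      unfolding set_lebesgue_integral_def by (intro Bochner_Integration.integral_cong refl) (simp add: indicator_def)
    then show "set_lebesgue_integral N A f0 = set_lebesgue_integral N A f" using AA[OF A] rep[OF A] by simp
  qed
  then have f0f: "AE z in p. f0 (fst (snd z)) = f (fst (snd z))" by (rule Pol_AE2[OF p])
  let ?g = "\<lambda>z. indicator B (fst z) * indicator C (fst (snd z)) :: real"
  let ?h = "\<lambda>x. indicator B (fst (fst x)) * indicator (base C) (Y x) :: real"
  note sl = composite_slice[OF B C]
  have ic: "integrable composite (\<lambda>z. ?g z *\<^sub>R mel s (snd (snd z)))"
    by (rule Bochner_Integration.integrable_bound[OF integrable_sqrt_t[OF composite_Pol M1 L1]])
      (measurable, auto simp: norm_mel Pol_spaceD[OF composite_Pol] indicator_def intro!: AE_I2)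
  have "integrable (density composite ?g) (\<lambda>z. mel s (snd (snd z)))"
    using ic by (subst integrable_density) auto
  then have "integrable (distr (density composite ?g) Rpos (\<lambda>z. snd (snd z))) (mel s)"
    by (subst integrable_distr_eq) auto
  then have "integrable (density (p \<Otimes>\<^sub>M unif2) ?h) (\<lambda>x. mel s (S x))"
    unfolding sl by (subst (asm) integrable_distr_eq) auto
  then have ih: "integrable (p \<Otimes>\<^sub>M unif2) (\<lambda>x. ?h x *\<^sub>R mel s (S x))"
    by (subst (asm) integrable_density) auto
  have "pol_form s composite (indicator B) (indicator C) = (\<integral>z. ?g z *\<^sub>R mel s (snd (snd z)) \<partial>composite)"
    unfolding pol_form_def by (intro Bochner_Integration.integral_cong refl) (simp add: indicator_def)
  also have "\<dots> = (\<integral>z. mel s (snd (snd z)) \<partial>density composite ?g)"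
    by (rule integral_density[symmetric]) auto
  also have "\<dots> = (\<integral>t. mel s t \<partial>distr (density composite ?g) Rpos (\<lambda>z. snd (snd z)))"
    by (rule integral_distr[symmetric]) auto
  also have "\<dots> = (\<integral>x. mel s (S x) \<partial>density (p \<Otimes>\<^sub>M unif2) ?h)" unfolding sl by (rule integral_distr) auto
  also have "\<dots> = (\<integral>x. ?h x *\<^sub>R mel s (S x) \<partial>(p \<Otimes>\<^sub>M unif2))" by (rule integral_density) auto
  also have "\<dots> = (\<integral>z. \<integral>w. ?h (z, w) *\<^sub>R mel s (S (z, w)) \<partial>unif2 \<partial>p)" using pV.integral_fst'[OF ih] by simp
  also have "\<dots> = (\<integral>z. indicator B (fst z) * (f0 (fst (snd z)) * mel s (snd (snd z))) \<partial>p)"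
  proof (rule Bochner_Integration.integral_cong[OF refl])
    fix z assume z: "z \<in> space p"
    note zs = Pol_spaceD[OF p z]
    have "(\<integral>w. ?h (z, w) *\<^sub>R mel s (S (z, w)) \<partial>unif2) = (\<integral>w. (indicator B (fst z) * mel s (snd (snd z))) * (indicator (base C) (y (fst (snd z), w)) *\<^sub>R mel s (\<tau> (fst (snd z), w))) \<partial>unif2)"
    proof (rule Bochner_Integration.integral_cong[OF refl])
      fix w assume w: "w \<in> space unif2"
      have "mel s (S (z, w)) = mel s (snd (snd z)) * mel s (\<tau> (fst (snd z), w))"
        unfolding S_def using mel_mult[OF zs(3) \<tau>_pos[OF zs(2) w]] by simp
      then show "?h (z, w) *\<^sub>R mel s (S (z, w)) = (indicator B (fst z) * mel s (snd (snd z))) * (indicator (base C) (y (fst (snd z), w)) *\<^sub>R mel s (\<tau> (fst (snd z), w)))"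
        by (simp add: Y_def indicator_def)
    qed
    also have "\<dots> = (indicator B (fst z) * mel s (snd (snd z))) * f0 (fst (snd z))" unfolding f0_def by (rule integral_mult_right_zero)
    finally show "(\<integral>w. ?h (z, w) *\<^sub>R mel s (S (z, w)) \<partial>unif2) = indicator B (fst z) * (f0 (fst (snd z)) * mel s (snd (snd z)))"
      by (simp add: mult_ac)
  qed
  also have "\<dots> = pol_form s p (indicator B) f"
    unfolding pol_form_def
  proof (rule integral_cong_AE)
    have [measurable]: "f \<in> borel_measurable N" using f by (rule sqi_measurable)
    show "(\<lambda>z. indicator B (fst z) * (f0 (fst (snd z)) * mel s (snd (snd z)))) \<in> borel_measurable p"
      "(\<lambda>z. indicator B (fst z) * (f (fst (snd z)) * mel s (snd (snd z)))) \<in> borel_measurable p" by measurable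
    show "AE z in p. indicator B (fst z) * (f0 (fst (snd z)) * mel s (snd (snd z))) = indicator B (fst z) * (f (fst (snd z)) * mel s (snd (snd z)))"
      using f0f by eventually_elim simp
  qed
  finally show ?thesis .
qed

text \<open>For continuous polymorphisms the random map is integrated out with Fubini's theorem, which leaves the
convolution formula.\<close>

lemma composite_density:
  assumes u: "pol_density M N u p" and v: "pol_density N L v q"
    and B[measurable]: "B \<in> sets M" and C[measurable]: "C \<in> sets L" and D[measurable]: "D \<in> sets Rpos"
  shows "emeasure composite (B \<times> C \<times> D) =
     (\<integral>\<^sup>+z\<in>B \<times> C. (\<integral>\<^sup>+n. emeasure (mult_convolution (u (fst z) n) (v n (snd z))) D \<partial>N) \<partial>(M \<Otimes>\<^sub>M L))"
proof -
  note [measurable] = base(1)[OF C] and [measurable_cong] = sets_Pol[OF q] sets_Pol[OF p]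
  interpret MxL: pair_prob_space M L ..
  interpret NL: pair_prob_space N L ..
  define h where "h m n t = (\<integral>\<^sup>+s. indicator D (s * t) \<partial>u m n)" for m n t
  have hm[measurable (raw)]: "(\<lambda>x. h (f x) (g x) (k x)) \<in> borel_measurable X"
    if [measurable]: "f \<in> X \<rightarrow>\<^sub>M M" "g \<in> X \<rightarrow>\<^sub>M N" "k \<in> X \<rightarrow>\<^sub>M Rpos" for f g k and X :: "'z measure"
    unfolding h_def by (rule density_kernel_measurable[OF u that(1,2)]) measurable
  have conv: "emeasure (mult_convolution (u m n) (v n k)) D = (\<integral>\<^sup>+t. h m n t \<partial>v n k)"
    if m: "m \<in> space M" and n: "n \<in> space N" and k: "k \<in> space L" for m n k
  proof -
    have su[measurable_cong]: "sets (u m n) = sets Rpos" and fu: "finite_measure (u m n)" using u m n by (auto simp: pol_density_def)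
    have sv[measurable_cong]: "sets (v n k) = sets Rpos" and fv: "finite_measure (v n k)" using v n k by (auto simp: pol_density_def)
    interpret u: finite_measure "u m n" by fact
    interpret v: finite_measure "v n k" by fact
    interpret uv: pair_sigma_finite "u m n" "v n k" ..
    have "emeasure (mult_convolution (u m n) (v n k)) D = (\<integral>\<^sup>+t. indicator D t \<partial>mult_convolution (u m n) (v n k))"
      by (rule nn_integral_indicator[symmetric]) (simp add: mult_convolution_def)
    also have "\<dots> = (\<integral>\<^sup>+x. indicator D (fst x * snd x) \<partial>(u m n \<Otimes>\<^sub>M v n k))"
      unfolding mult_convolution_def case_prod_beta' by (rule nn_integral_distr) auto
    also have "\<dots> = (\<integral>\<^sup>+t. \<integral>\<^sup>+s. indicator D (s * t) \<partial>u m n \<partial>v n k)"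
      by (subst uv.nn_integral_snd[symmetric]) auto
    finally show ?thesis by (simp add: h_def)
  qed
  have "emeasure composite (B \<times> C \<times> D) = (\<integral>\<^sup>+x. indicator B (fst (fst x)) * indicator (base C) (Y x) * indicator D (S x) \<partial>(p \<Otimes>\<^sub>M unif2))"
    by (rule emeasure_composite[OF B C D])
  also have "\<dots> = (\<integral>\<^sup>+z. \<integral>\<^sup>+w. indicator B (fst z) * indicator (base C) (y (fst (snd z), w)) * indicator D (snd (snd z) * \<tau> (fst (snd z), w)) \<partial>unif2 \<partial>p)"
    by (subst V.nn_integral_fst[symmetric]) (auto simp: Y_def S_def)
  also have "\<dots> = (\<integral>\<^sup>+x. (\<integral>\<^sup>+s. (\<integral>\<^sup>+w. indicator B (fst x) * indicator (base C) (y (snd x, w)) * indicator D (s * \<tau> (snd x, w)) \<partial>unif2) \<partial>u (fst x) (snd x)) \<partial>(M \<Otimes>\<^sub>M N))"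
    by (subst pol_density_nn[OF M1 N1 u]) auto
  also have "\<dots> = (\<integral>\<^sup>+x. (\<integral>\<^sup>+w. indicator B (fst x) * (indicator (base C) (y (snd x, w)) * h (fst x) (snd x) (\<tau> (snd x, w))) \<partial>unif2) \<partial>(M \<Otimes>\<^sub>M N))"
  proof (rule nn_integral_cong)
    fix x assume x: "x \<in> space (M \<Otimes>\<^sub>M N)"
    then have xs[measurable]: "fst x \<in> space M" "snd x \<in> space N" by (auto simp: space_pair_measure)
    have su[measurable_cong]: "sets (u (fst x) (snd x)) = sets Rpos" and fu: "finite_measure (u (fst x) (snd x))" using u xs by (auto simp: pol_density_def)
    interpret u: finite_measure "u (fst x) (snd x)" by fact
    interpret uV: pair_sigma_finite "u (fst x) (snd x)" unif2 ..
    have "(\<integral>\<^sup>+s. (\<integral>\<^sup>+w. indicator B (fst x) * indicator (base C) (y (snd x, w)) * indicator D (s * \<tau> (snd x, w)) \<partial>unif2) \<partial>u (fst x) (snd x)) =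
      (\<integral>\<^sup>+w. (\<integral>\<^sup>+s. indicator B (fst x) * indicator (base C) (y (snd x, w)) * indicator D (s * \<tau> (snd x, w)) \<partial>u (fst x) (snd x)) \<partial>unif2)"
      by (rule uV.Fubini'[symmetric]) measurable
    also have "\<dots> = (\<integral>\<^sup>+w. indicator B (fst x) * (indicator (base C) (y (snd x, w)) * h (fst x) (snd x) (\<tau> (snd x, w))) \<partial>unif2)"
    proof (rule nn_integral_cong)
      fix w assume w: "w \<in> space unif2"
      have "\<tau> (snd x, w) \<in> space Rpos" using \<tau>_pos[OF xs(2) w] by simp
      note [measurable] = this
      have "(\<integral>\<^sup>+s. indicator B (fst x) * indicator (base C) (y (snd x, w)) * indicator D (s * \<tau> (snd x, w)) \<partial>u (fst x) (snd x)) =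
        (indicator B (fst x) * indicator (base C) (y (snd x, w))) * (\<integral>\<^sup>+s. indicator D (s * \<tau> (snd x, w)) \<partial>u (fst x) (snd x))"
        by (rule nn_integral_cmult) measurable
      then show "(\<integral>\<^sup>+s. indicator B (fst x) * indicator (base C) (y (snd x, w)) * indicator D (s * \<tau> (snd x, w)) \<partial>u (fst x) (snd x)) =
         indicator B (fst x) * (indicator (base C) (y (snd x, w)) * h (fst x) (snd x) (\<tau> (snd x, w)))" by (simp add: h_def mult.assoc)
    qed
    finally show "(\<integral>\<^sup>+s. (\<integral>\<^sup>+w. indicator B (fst x) * indicator (base C) (y (snd x, w)) * indicator D (s * \<tau> (snd x, w)) \<partial>unif2) \<partial>u (fst x) (snd x)) =
       (\<integral>\<^sup>+w. indicator B (fst x) * (indicator (base C) (y (snd x, w)) * h (fst x) (snd x) (\<tau> (snd x, w))) \<partial>unif2)" .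
  qed
  also have "\<dots> = (\<integral>\<^sup>+m. \<integral>\<^sup>+n. \<integral>\<^sup>+w. indicator B m * (indicator (base C) (y (n, w)) * h m n (\<tau> (n, w))) \<partial>unif2 \<partial>N \<partial>M)"
    by (subst N.nn_integral_fst[symmetric]) auto
  also have "\<dots> = (\<integral>\<^sup>+m. \<integral>\<^sup>+x. indicator B m * (indicator C (snd x) * (\<integral>\<^sup>+t. h m (fst x) t \<partial>v (fst x) (snd x))) \<partial>(N \<Otimes>\<^sub>M L) \<partial>M)"
  proof (rule nn_integral_cong)
    fix m assume m[measurable]: "m \<in> space M"
    have "(\<integral>\<^sup>+n. \<integral>\<^sup>+w. indicator B m * (indicator (base C) (y (n, w)) * h m n (\<tau> (n, w))) \<partial>unif2 \<partial>N) =
      (\<integral>\<^sup>+z. indicator B m * (indicator (base C) (e (fst (snd z))) * h m (fst z) (snd (snd z))) \<partial>q)"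
      using rand_nn[of "\<lambda>z. indicator B m * (indicator (base C) (fst (snd z)) * h m (fst z) (snd (snd z)))"] by simp
    also have "\<dots> = (\<integral>\<^sup>+z. indicator B m * (indicator C (fst (snd z)) * h m (fst z) (snd (snd z))) \<partial>q)"
      by (rule nn_integral_cong_AE) (use Pol_AE2[OF q base(3)[OF C]] in eventually_elim, auto simp: indicator_def)
    also have "\<dots> = (\<integral>\<^sup>+x. (\<integral>\<^sup>+t. indicator B m * (indicator C (snd x) * h m (fst x) t) \<partial>v (fst x) (snd x)) \<partial>(N \<Otimes>\<^sub>M L))"
      by (subst pol_density_nn[OF N1 L1 v]) auto
    also have "\<dots> = (\<integral>\<^sup>+x. indicator B m * (indicator C (snd x) * (\<integral>\<^sup>+t. h m (fst x) t \<partial>v (fst x) (snd x))) \<partial>(N \<Otimes>\<^sub>M L))"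
    proof (rule nn_integral_cong)
      fix x assume x: "x \<in> space (N \<Otimes>\<^sub>M L)"
      then have xs[measurable]: "fst x \<in> space N" "snd x \<in> space L" by (auto simp: space_pair_measure)
      have sv[measurable_cong]: "sets (v (fst x) (snd x)) = sets Rpos" using v xs by (auto simp: pol_density_def)
      have "(\<integral>\<^sup>+t. indicator B m * (indicator C (snd x) * h m (fst x) t) \<partial>v (fst x) (snd x)) = (\<integral>\<^sup>+t. (indicator B m * indicator C (snd x)) * h m (fst x) t \<partial>v (fst x) (snd x))"
        by (simp add: mult.assoc)
      also have "\<dots> = (indicator B m * indicator C (snd x)) * (\<integral>\<^sup>+t. h m (fst x) t \<partial>v (fst x) (snd x))"
        by (rule nn_integral_cmult) measurable
      finally show "(\<integral>\<^sup>+t. indicator B m * (indicator C (snd x) * h m (fst x) t) \<partial>v (fst x) (snd x)) = indicator B m * (indicator C (snd x) * (\<integral>\<^sup>+t. h m (fst x) t \<partial>v (fst x) (snd x)))"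
        by (simp add: mult.assoc)
    qed
    finally show "(\<integral>\<^sup>+n. \<integral>\<^sup>+w. indicator B m * (indicator (base C) (y (n, w)) * h m n (\<tau> (n, w))) \<partial>unif2 \<partial>N) =
       (\<integral>\<^sup>+x. indicator B m * (indicator C (snd x) * (\<integral>\<^sup>+t. h m (fst x) t \<partial>v (fst x) (snd x))) \<partial>(N \<Otimes>\<^sub>M L))" .
  qed
  also have "\<dots> = (\<integral>\<^sup>+m. \<integral>\<^sup>+k. \<integral>\<^sup>+n. indicator B m * (indicator C k * (\<integral>\<^sup>+t. h m n t \<partial>v n k)) \<partial>N \<partial>L \<partial>M)"
  proof (rule nn_integral_cong)
    fix m assume m[measurable]: "m \<in> space M"
    have [measurable]: "(\<lambda>x. \<integral>\<^sup>+t. h m (fst x) t \<partial>v (fst x) (snd x)) \<in> borel_measurable (N \<Otimes>\<^sub>M L)"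
      by (rule density_kernel_measurable[OF v]) measurable
    show "(\<integral>\<^sup>+x. indicator B m * (indicator C (snd x) * (\<integral>\<^sup>+t. h m (fst x) t \<partial>v (fst x) (snd x))) \<partial>(N \<Otimes>\<^sub>M L)) =
      (\<integral>\<^sup>+k. \<integral>\<^sup>+n. indicator B m * (indicator C k * (\<integral>\<^sup>+t. h m n t \<partial>v n k)) \<partial>N \<partial>L)"
      by (subst NL.nn_integral_snd[symmetric]) auto
  qed
  also have "\<dots> = (\<integral>\<^sup>+m. \<integral>\<^sup>+k. (\<integral>\<^sup>+n. emeasure (mult_convolution (u m n) (v n k)) D \<partial>N) * indicator (B \<times> C) (m, k) \<partial>L \<partial>M)"
  proof (intro nn_integral_cong)
    fix m k assume m[measurable]: "m \<in> space M" and k[measurable]: "k \<in> space L"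
    have [measurable]: "(\<lambda>n. \<integral>\<^sup>+t. h m n t \<partial>v n k) \<in> borel_measurable N"
      by (rule density_kernel_measurable[OF v]) measurable
    have "(\<integral>\<^sup>+n. indicator B m * (indicator C k * (\<integral>\<^sup>+t. h m n t \<partial>v n k)) \<partial>N) = (\<integral>\<^sup>+n. (indicator B m * indicator C k) * (\<integral>\<^sup>+t. h m n t \<partial>v n k) \<partial>N)"
      by (simp add: mult.assoc)
    also have "\<dots> = (indicator B m * indicator C k) * (\<integral>\<^sup>+n. (\<integral>\<^sup>+t. h m n t \<partial>v n k) \<partial>N)"
      by (rule nn_integral_cmult) measurable
    also have "(\<integral>\<^sup>+n. (\<integral>\<^sup>+t. h m n t \<partial>v n k) \<partial>N) = (\<integral>\<^sup>+n. emeasure (mult_convolution (u m n) (v n k)) D \<partial>N)"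
      by (intro nn_integral_cong) (simp add: conv[OF m _ k])
    finally show "(\<integral>\<^sup>+n. indicator B m * (indicator C k * (\<integral>\<^sup>+t. h m n t \<partial>v n k)) \<partial>N) =
       (\<integral>\<^sup>+n. emeasure (mult_convolution (u m n) (v n k)) D \<partial>N) * indicator (B \<times> C) (m, k)"
      by (simp add: indicator_times mult.commute)
  qed
  also have "\<dots> = (\<integral>\<^sup>+z\<in>B \<times> C. (\<integral>\<^sup>+n. emeasure (mult_convolution (u (fst z) n) (v n (snd z))) D \<partial>N) \<partial>(M \<Otimes>\<^sub>M L))"
  proof -
    have km[measurable]: "(\<lambda>x. \<integral>\<^sup>+t. h (fst (fst x)) (snd x) t \<partial>v (snd x) (snd (fst x))) \<in> borel_measurable ((M \<Otimes>\<^sub>M L) \<Otimes>\<^sub>M N)"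
      by (rule density_kernel_measurable[OF v]) measurable
    have "(\<lambda>z. (\<integral>\<^sup>+n. (\<integral>\<^sup>+t. h (fst z) n t \<partial>v n (snd z)) \<partial>N) * indicator (B \<times> C) z) \<in> borel_measurable (M \<Otimes>\<^sub>M L)"
      using N.borel_measurable_nn_integral_fst[OF km] by measurable
    moreover have "(\<integral>\<^sup>+n. emeasure (mult_convolution (u (fst z) n) (v n (snd z))) D \<partial>N) * indicator (B \<times> C) z =
        (\<integral>\<^sup>+n. (\<integral>\<^sup>+t. h (fst z) n t \<partial>v n (snd z)) \<partial>N) * indicator (B \<times> C) z" if "z \<in> space (M \<Otimes>\<^sub>M L)" for z
      using that by (intro arg_cong2[where f="(*)"] nn_integral_cong refl conv) (auto simp: space_pair_measure)
    ultimately have "(\<lambda>z. (\<integral>\<^sup>+n. emeasure (mult_convolution (u (fst z) n) (v n (snd z))) D \<partial>N) * indicator (B \<times> C) z) \<in> borel_measurable (M \<Otimes>\<^sub>M L)"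
      by (subst measurable_cong)
    from L.nn_integral_fst[OF this] show ?thesis by simp
  qed
  finally show ?thesis .
qed

end

section \<open>The product of polymorphisms\<close>

text \<open>The adjoint of the operator \<open>T s p\<close>, needed for continuity of the product in the second argument.\<close>

lemma pol_transpose_exists:
  assumes p: "p \<in> Pol M N" and N: "finite_measure N" and h: "square_integrable M h"
  obtains F where "square_integrable N F" "\<And>f. square_integrable N f \<Longrightarrow> pol_form s p h f = (\<integral>n. f n * F n \<partial>N)"
proof -
  note [measurable_cong] = sets_Pol[OF p] and [measurable] = measurable_t[OF p] measurable_mel_t[OF p]
  have [measurable]: "h \<in> borel_measurable M" using h by (auto simp: square_integrable_def)
  have bd: "(\<integral>\<^sup>+ z. g (fst (snd z)) * ennreal (cmod (h (fst z) * mel s (snd (snd z)))) \<partial>p)\<^sup>2 \<le> ennreal ((L2n M h)\<^sup>2) * (\<integral>\<^sup>+ m. (g m)\<^sup>2 \<partial>N)"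
    if [measurable]: "g \<in> borel_measurable N" for g
  proof -
    have "(\<integral>\<^sup>+ z. g (fst (snd z)) * ennreal (cmod (h (fst z) * mel s (snd (snd z)))) \<partial>p) =
      (\<integral>\<^sup>+z. ennreal (cmod (h (fst z))) * (g (fst (snd z)) * ennreal (sqrt (snd (snd z)))) \<partial>p)"
      by (intro nn_integral_cong, simp add: norm_mult norm_mel ennreal_mult Pol_spaceD[OF p] less_imp_le)
        (simp add: mult_ac)
    then show ?thesis using Pol_CS[OF p, of "\<lambda>m. ennreal (cmod (h m))" g] nn_L2n[OF h] by simp
  qed
  obtain F where "square_integrable N F" "\<And>g. square_integrable N g \<Longrightarrow>
      (\<integral>z. g (fst (snd z)) * (h (fst z) * mel s (snd (snd z))) \<partial>p) = (\<integral>n. g n * F n \<partial>N)"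
  proof (rule riesz_representation[OF N, of "\<lambda>z. fst (snd z)" p "\<lambda>z. h (fst z) * mel s (snd (snd z))" "ennreal ((L2n M h)\<^sup>2)"])
  qed (use bd in auto)
  then show ?thesis using that unfolding pol_form_def by (simp add: mult.left_commute)
qed

lemma pol_conv_unique:
  assumes p: "\<And>j. p j \<in> Pol M N" and a: "a \<in> Pol M N" and b: "b \<in> Pol M N" and M: "prob_space M" and N: "prob_space N"
    and ca: "pol_conv M N p a" and cb: "pol_conv M N p b"
  shows "a = b"
proof (rule Pol_mellin_eqI[OF a b M N])
  fix s B C assume B: "B \<in> sets M" and C: "C \<in> sets N"
  show "pol_form s a (indicator B) (indicator C) = pol_form s b (indicator B) (indicator C)"
    by (rule LIMSEQ_unique[OF pol_conv_imp_mellin[OF p a M N ca B C] pol_conv_imp_mellin[OF p b M N cb B C]])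
qed

text \<open>The first property, with \<open>f\<close> in the role of \<open>T s q (indicator C)\<close>, determines \<open>r\<close>; the second one is the formula
that the product has to satisfy on continuous polymorphisms.\<close>

definition is_composite :: "'m measure \<Rightarrow> 'n measure \<Rightarrow> 'l measure \<Rightarrow> ('m \<times> 'n \<times> real) measure \<Rightarrow> ('n \<times> 'l \<times> real) measure
    \<Rightarrow> ('m \<times> 'l \<times> real) measure \<Rightarrow> bool" where
  "is_composite M N L p q r \<longleftrightarrow> r \<in> Pol M L \<and>
     (\<forall>s B C f. B \<in> sets M \<longrightarrow> C \<in> sets L \<longrightarrow> square_integrable N f \<longrightarrow>
        (\<forall>A\<in>sets N. pol_form s q (indicator A) (indicator C) = (\<integral>n. indicator A n * f n \<partial>N)) \<longrightarrow>
        pol_form s r (indicator B) (indicator C) = pol_form s p (indicator B) f) \<and>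
     (\<forall>u v. pol_density M N u p \<and> pol_density N L v q \<longrightarrow>
        (\<forall>B\<in>sets M. \<forall>C\<in>sets L. \<forall>D\<in>sets Rpos.
           emeasure r (B \<times> C \<times> D) =
             (\<integral>\<^sup>+z\<in>B \<times> C. (\<integral>\<^sup>+n. emeasure (mult_convolution (u (fst z) n) (v n (snd z))) D \<partial>N)
                \<partial>(M \<Otimes>\<^sub>M L))))"

lemma composite_exists:
  assumes M: "prob_space M" and N: "prob_space N" and L: "lebesgue_prob_space L" and p: "p \<in> Pol M N" and q: "q \<in> Pol N L"
  shows "\<exists>r. is_composite M N L p q r"
proof -
  have L1: "prob_space L" using L by (simp add: lebesgue_prob_space_def)
  obtain e :: "'c \<Rightarrow> real" and j where e: "e \<in> L \<rightarrow>\<^sub>M borel" and j: "j \<in> completion (distr L borel e) \<rightarrow>\<^sub>M L" and je: "AE k in L. j (e k) = k"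
    by (rule lebesgue_coordinate[OF L])
  obtain y \<tau> where y: "y \<in> borel_measurable (N \<Otimes>\<^sub>M unif2)" and \<tau>: "\<tau> \<in> N \<Otimes>\<^sub>M unif2 \<rightarrow>\<^sub>M Rpos" and
    r: "distr q (N \<Otimes>\<^sub>M (borel \<Otimes>\<^sub>M Rpos)) (\<lambda>z. (fst z, e (fst (snd z)) :: real, snd (snd z))) =
     distr (N \<Otimes>\<^sub>M unif2) (N \<Otimes>\<^sub>M (borel \<Otimes>\<^sub>M Rpos)) (\<lambda>x. (fst x, y x, \<tau> x))"
    by (rule Pol_randomization[OF N q e])
  interpret pol_composition M N L p q e j y \<tau>
    by (rule pol_composition.intro[OF M N L1 p q e j je y \<tau> r])
  show ?thesis
    unfolding is_composite_def
  proof (intro exI[of _ composite] conjI allI impI ballI)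
    show "composite \<in> Pol M L" by (rule composite_Pol)
    show "pol_form s composite (indicator B) (indicator C) = pol_form s p (indicator B) f"
      if "B \<in> sets M" "C \<in> sets L" "square_integrable N f"
        "\<forall>A\<in>sets N. pol_form s q (indicator A) (indicator C) = (\<integral>n. indicator A n * f n \<partial>N)" for s B C f
      using that by (intro composite_form) auto
    show "emeasure composite (B \<times> C \<times> D) =
             (\<integral>\<^sup>+z\<in>B \<times> C. (\<integral>\<^sup>+n. emeasure (mult_convolution (u (fst z) n) (v n (snd z))) D \<partial>N)
                \<partial>(M \<Otimes>\<^sub>M L))"
      if "pol_density M N u p \<and> pol_density N L v q" "B \<in> sets M" "C \<in> sets L" "D \<in> sets Rpos" for u v B C D
      using that by (intro composite_density) auto
  qed
qed

text \<open>Separate continuity: a Mellin form of the composite is a Mellin form of one factor at a function that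
is determined by the other factor, through the operator or its adjoint.\<close>

lemma composite_is_product:
  assumes M: "prob_space M" and N: "prob_space N" and L: "prob_space L"
    and F: "F \<in> Pol M N \<rightarrow>\<^sub>E Pol N L \<rightarrow>\<^sub>E Pol M L"
    and comp: "\<And>p q. p \<in> Pol M N \<Longrightarrow> q \<in> Pol N L \<Longrightarrow> is_composite M N L p q (F p q)"
  shows "is_pol_product M N L F"
  unfolding is_pol_product_def
proof (intro conjI allI impI ballI)
  interpret N: prob_space N by fact
  interpret M: prob_space M by fact
  interpret L: prob_space L by fact
  show "F \<in> Pol M N \<rightarrow>\<^sub>E Pol N L \<rightarrow>\<^sub>E Pol M L" by fact
  have FP: "F p q \<in> Pol M L" if "p \<in> Pol M N" "q \<in> Pol N L" for p q using comp[OF that] by (simp add: is_composite_def)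
  have form: "pol_form s (F p q) (indicator B) (indicator C) = pol_form s p (indicator B) f"
    if "p \<in> Pol M N" "q \<in> Pol N L" "B \<in> sets M" "C \<in> sets L" "square_integrable N f"
      "\<And>h. square_integrable N h \<Longrightarrow> pol_form s q h (indicator C) = (\<integral>n. h n * f n \<partial>N)" for s p q B C f
  proof -
    have "\<forall>A\<in>sets N. pol_form s q (indicator A) (indicator C) = (\<integral>n. indicator A n * f n \<partial>N)"
      using that(6) N.sqi_indicator by blast
    then show ?thesis using comp[OF that(1,2)] that(3-5) unfolding is_composite_def by blast
  qed
  show "emeasure (F p q) (B \<times> C \<times> D) =
             (\<integral>\<^sup>+z\<in>B \<times> C. (\<integral>\<^sup>+n. emeasure (mult_convolution (u (fst z) n) (v n (snd z))) D \<partial>N)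
                \<partial>(M \<Otimes>\<^sub>M L))"
    if "pol_density M N u p \<and> pol_density N L v q" "B \<in> sets M" "C \<in> sets L" "D \<in> sets Rpos" for u v p q B C D
  proof -
    have "p \<in> Pol M N" "q \<in> Pol N L" using that(1) by (auto simp: pol_density_def)
    then show ?thesis using comp that unfolding is_composite_def by blast
  qed
  show "pol_conv M L (\<lambda>j. F (p j) q) (F p' q)"
    if q: "q \<in> Pol N L" and p: "p \<in> UNIV \<rightarrow> Pol M N" and p': "p' \<in> Pol M N" and c: "pol_conv M N p p'" for q p p'
  proof -
    have pj: "p j \<in> Pol M N" for j using p by auto
    show ?thesis
    proof (rule mellin_imp_pol_conv[OF FP[OF pj q] FP[OF p' q] M L])
      fix s B C assume B: "B \<in> sets M" and C: "C \<in> sets L"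
      obtain f where f: "square_integrable N f" "\<And>h. square_integrable N h \<Longrightarrow> pol_form s q h (indicator C) = (\<integral>n. h n * f n \<partial>N)"
        using pol_operator_exists[OF q N.finite_measure_axioms L.sqi_indicator[OF C]] by blast
      show "(\<lambda>j. pol_form s (F (p j) q) (indicator B) (indicator C)) \<longlonglongrightarrow> pol_form s (F p' q) (indicator B) (indicator C)"
      proof -
        have eq: "pol_form s (F p0 q) (indicator B) (indicator C) = pol_form s p0 (indicator B) f" if "p0 \<in> Pol M N" for p0
          by (rule form[OF that q B C f(1)]) (rule f(2))
        show ?thesis unfolding eq[OF pj] eq[OF p'] by (rule pol_conv_form2[OF pj p' M N c B f(1)])
      qed
    qed
  qed
  show "pol_conv M L (\<lambda>j. F p (q j)) (F p q')"
    if p: "p \<in> Pol M N" and q: "q \<in> UNIV \<rightarrow> Pol N L" and q': "q' \<in> Pol N L" and c: "pol_conv N L q q'" for p q q'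
  proof -
    have qj: "q j \<in> Pol N L" for j using q by auto
    show ?thesis
    proof (rule mellin_imp_pol_conv[OF FP[OF p qj] FP[OF p q'] M L])
      fix s B C assume B: "B \<in> sets M" and C: "C \<in> sets L"
      obtain h where h: "square_integrable N h" "\<And>f. square_integrable N f \<Longrightarrow> pol_form s p (indicator B) f = (\<integral>n. f n * h n \<partial>N)"
        using pol_transpose_exists[OF p N.finite_measure_axioms M.sqi_indicator[OF B]] by blast
      have eq: "pol_form s (F p q0) (indicator B) (indicator C) = pol_form s q0 h (indicator C)" if q0: "q0 \<in> Pol N L" for q0
      proof -
        obtain f where f: "square_integrable N f" "\<And>h. square_integrable N h \<Longrightarrow> pol_form s q0 h (indicator C) = (\<integral>n. h n * f n \<partial>N)"
          using pol_operator_exists[OF q0 N.finite_measure_axioms L.sqi_indicator[OF C]] by blast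
        have "pol_form s (F p q0) (indicator B) (indicator C) = pol_form s p (indicator B) f"
          by (rule form[OF p q0 B C f(1)]) (rule f(2))
        then show ?thesis unfolding h(2)[OF f(1)] f(2)[OF h(1)] by (simp add: mult.commute)
      qed
      show "(\<lambda>j. pol_form s (F p (q j)) (indicator B) (indicator C)) \<longlonglongrightarrow> pol_form s (F p q') (indicator B) (indicator C)"
        unfolding eq[OF qj] eq[OF q'] by (rule pol_conv_form1[OF qj q' N L c C h(1)])
    qed
  qed
qed

text \<open>Two products agree if both factors are continuous, and density allows to pass to the limit in one factor
after the other.\<close>

lemma pol_product_unique:
  assumes M: "lebesgue_prob_space M" and N: "lebesgue_prob_space N" and L: "lebesgue_prob_space L"
    and F: "is_pol_product M N L F" and F': "is_pol_product M N L F'"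
  shows "F = F'"
proof -
  have M1: "prob_space M" and N1: "prob_space N" and L1: "prob_space L" using M N L by (auto simp: lebesgue_prob_space_def)
  have FE: "H \<in> Pol M N \<rightarrow>\<^sub>E Pol N L \<rightarrow>\<^sub>E Pol M L" if "is_pol_product M N L H" for H
    using that unfolding is_pol_product_def by blast
  have FP: "H p q \<in> Pol M L" if "is_pol_product M N L H" "p \<in> Pol M N" "q \<in> Pol N L" for H p q
    using PiE_mem[OF PiE_mem[OF FE[OF that(1)] that(2)] that(3)] .
  have dens: "emeasure (H p q) (B \<times> C \<times> D) =
             (\<integral>\<^sup>+z\<in>B \<times> C. (\<integral>\<^sup>+n. emeasure (mult_convolution (u (fst z) n) (v n (snd z))) D \<partial>N) \<partial>(M \<Otimes>\<^sub>M L))"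
    if "is_pol_product M N L H" "pol_density M N u p" "pol_density N L v q" "B \<in> sets M" "C \<in> sets L" "D \<in> sets Rpos" for H u v p q B C D
    using that unfolding is_pol_product_def by blast
  have c1: "pol_conv M L (\<lambda>j. H (p j) q) (H p' q)"
    if "is_pol_product M N L H" "q \<in> Pol N L" "\<And>j. p j \<in> Pol M N" "p' \<in> Pol M N" "pol_conv M N p p'" for H q p p'
    using that unfolding is_pol_product_def by blast
  have c2: "pol_conv M L (\<lambda>j. H p (q j)) (H p q')"
    if "is_pol_product M N L H" "p \<in> Pol M N" "\<And>j. q j \<in> Pol N L" "q' \<in> Pol N L" "pol_conv N L q q'" for H q p q'
    using that unfolding is_pol_product_def by blast
  have eq: "F p q = F' p q" if p: "p \<in> Pol M N" and q: "q \<in> Pol N L" for p q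
  proof -
    obtain pj u where pj: "\<And>j::nat. pj j \<in> Pol M N" "\<And>j. pol_density M N (u j) (pj j)" "pol_conv M N pj p"
      using continuous_Pol_dense[OF M N p] by blast
    obtain qj v where qj: "\<And>j::nat. qj j \<in> Pol N L" "\<And>j. pol_density N L (v j) (qj j)" "pol_conv N L qj q"
      using continuous_Pol_dense[OF N L q] by blast
    have 1: "F (pj i) (qj k) = F' (pj i) (qj k)" for i k
      by (rule Pol_eqI[OF FP[OF F pj(1) qj(1)] FP[OF F' pj(1) qj(1)] M1])
        (simp only: dens[OF F pj(2) qj(2)] dens[OF F' pj(2) qj(2)])
    have 2: "F (pj i) q = F' (pj i) q" for i
    proof (rule pol_conv_unique[OF FP[OF F pj(1) qj(1)] FP[OF F pj(1) q] FP[OF F' pj(1) q] M1 L1])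
      show "pol_conv M L (\<lambda>k. F (pj i) (qj k)) (F (pj i) q)" by (rule c2[OF F pj(1) qj(1) q qj(3)])
      show "pol_conv M L (\<lambda>k. F (pj i) (qj k)) (F' (pj i) q)" unfolding 1 by (rule c2[OF F' pj(1) qj(1) q qj(3)])
    qed
    show ?thesis
    proof (rule pol_conv_unique[OF FP[OF F pj(1) q] FP[OF F p q] FP[OF F' p q] M1 L1])
      show "pol_conv M L (\<lambda>k. F (pj k) q) (F p q)" by (rule c1[OF F q pj(1) p pj(3)])
      show "pol_conv M L (\<lambda>k. F (pj k) q) (F' p q)" unfolding 2 by (rule c1[OF F' q pj(1) p pj(3)])
    qed
  qed
  show ?thesis
  proof (rule PiE_ext[OF FE[OF F] FE[OF F']])
    fix p assume p: "p \<in> Pol M N"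
    show "F p = F' p"
      by (rule PiE_ext[OF PiE_mem[OF FE[OF F] p] PiE_mem[OF FE[OF F'] p]]) (rule eq[OF p])
  qed
qed

lemma pol_prod_is_composite:
  assumes M: "lebesgue_prob_space M" and N: "lebesgue_prob_space N" and L: "lebesgue_prob_space L"
    and p: "p \<in> Pol M N" and q: "q \<in> Pol N L"
  shows "is_composite M N L p q (pol_prod M N L p q)"
proof -
  have M1: "prob_space M" and N1: "prob_space N" and L1: "prob_space L" using M N L by (auto simp: lebesgue_prob_space_def)
  define F where "F = (\<lambda>p\<in>Pol M N. \<lambda>q\<in>Pol N L. SOME r. is_composite M N L p q r)"
  have comp: "is_composite M N L p q (F p q)" if "p \<in> Pol M N" "q \<in> Pol N L" for p q
    using someI_ex[OF composite_exists[OF M1 N1 L that]] that by (simp add: F_def)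
  have "F \<in> Pol M N \<rightarrow>\<^sub>E Pol N L \<rightarrow>\<^sub>E Pol M L"
  proof (rule PiE_I)
    fix p assume p: "p \<in> Pol M N"
    show "F p \<in> Pol N L \<rightarrow>\<^sub>E Pol M L"
    proof (rule PiE_I)
      show "F p q \<in> Pol M L" if "q \<in> Pol N L" for q using comp[OF p that] by (simp add: is_composite_def)
      show "F p q = undefined" if "q \<notin> Pol N L" for q using p that by (simp add: F_def)
    qed
  next
    show "F p = undefined" if "p \<notin> Pol M N" for p using that by (simp add: F_def)
  qed
  then have F: "is_pol_product M N L F" by (rule composite_is_product[OF M1 N1 L1 _ comp])
  have "pol_prod M N L = F"
    unfolding pol_prod_def by (rule the_equality[where P="is_pol_product M N L", OF F]) (rule pol_product_unique[OF M N L _ F])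
  then show ?thesis using comp[OF p q] by simp
qed

lemma pol_prod_Pol:
  assumes "lebesgue_prob_space M" "lebesgue_prob_space N" "lebesgue_prob_space L" "p \<in> Pol M N" "q \<in> Pol N L"
  shows "pol_prod M N L p q \<in> Pol M L"
  using pol_prod_is_composite[OF assms] by (simp add: is_composite_def)

lemma pol_prod_form:
  assumes "lebesgue_prob_space M" "lebesgue_prob_space N" "lebesgue_prob_space L" "p \<in> Pol M N" "q \<in> Pol N L"
    and "B \<in> sets M" "C \<in> sets L" "square_integrable N f"
    and "\<And>A. A \<in> sets N \<Longrightarrow> pol_form s q (indicator A) (indicator C) = (\<integral>n. indicator A n * f n \<partial>N)"
  shows "pol_form s (pol_prod M N L p q) (indicator B) (indicator C) = pol_form s p (indicator B) f"
proof -
  have H: "\<forall>s B C f. B \<in> sets M \<longrightarrow> C \<in> sets L \<longrightarrow> square_integrable N f \<longrightarrow>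
        (\<forall>A\<in>sets N. pol_form s q (indicator A) (indicator C) = (\<integral>n. indicator A n * f n \<partial>N)) \<longrightarrow>
        pol_form s (pol_prod M N L p q) (indicator B) (indicator C) = pol_form s p (indicator B) f"
    using pol_prod_is_composite[OF assms(1-5)] unfolding is_composite_def by (elim conjE)
  show ?thesis by (rule H[rule_format, OF assms(6-8)]) (rule assms(9))
qed

text \<open>To recognise a product it suffices to compose Mellin forms, the function \<open>f\<close> being the image
of \<open>indicator C\<close> under the operator of the second factor.\<close>

lemma pol_prod_eqI:
  assumes M: "lebesgue_prob_space M" and N: "lebesgue_prob_space N" and L: "lebesgue_prob_space L"
    and p: "p \<in> Pol M N" and q: "q \<in> Pol N L" and r: "r \<in> Pol M L"
    and ex: "\<And>s C. C \<in> sets L \<Longrightarrow> \<exists>f. square_integrable N f \<and>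
       (\<forall>A\<in>sets N. pol_form s q (indicator A) (indicator C) = (\<integral>n. indicator A n * f n \<partial>N)) \<and>
       (\<forall>B\<in>sets M. pol_form s p (indicator B) f = pol_form s r (indicator B) (indicator C))"
  shows "pol_prod M N L p q = r"
proof (rule Pol_mellin_eqI[OF pol_prod_Pol[OF M N L p q] r])
  show "prob_space M" "prob_space L" using M L by (auto simp: lebesgue_prob_space_def)
  fix s B C assume B: "B \<in> sets M" and C: "C \<in> sets L"
  obtain f where f: "square_integrable N f"
       "\<And>A. A \<in> sets N \<Longrightarrow> pol_form s q (indicator A) (indicator C) = (\<integral>n. indicator A n * f n \<partial>N)"
       "\<And>B. B \<in> sets M \<Longrightarrow> pol_form s p (indicator B) f = pol_form s r (indicator B) (indicator C)"
    using ex[OF C] by blast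
  show "pol_form s (pol_prod M N L p q) (indicator B) (indicator C) = pol_form s r (indicator B) (indicator C)"
    using pol_prod_form[OF M N L p q B C f(1) f(2)] f(3)[OF B] by simp
qed

section \<open>Nonsingular transformations\<close>

lemma Gms_dom:
  assumes "g \<in> Gms M"
  obtains X where "gms_on M g X" "\<And>B. gms_image M g B = g ` (B \<inter> X)"
proof -
  obtain X0 where "gms_on M g X0" using assms by (auto simp: Gms_def)
  then have "gms_on M g (SOME X. gms_on M g X)" by (rule someI)
  then show ?thesis using that by (simp add: gms_image_def)
qed

lemma Gms_measurable: "g \<in> Gms M \<Longrightarrow> g \<in> M \<rightarrow>\<^sub>M M"
  by (auto simp: Gms_def gms_on_def)

lemma gms_onD:
  assumes "gms_on M g X"
  shows "g \<in> M \<rightarrow>\<^sub>M M" "X \<in> sets M" "space M - X \<in> null_sets M" "space M - g ` X \<in> null_sets M" "inj_on g X"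
    "\<And>B. B \<in> sets M \<Longrightarrow> B \<subseteq> X \<Longrightarrow> g ` B \<in> sets M"
    "\<And>B. B \<in> sets M \<Longrightarrow> B \<subseteq> X \<Longrightarrow> g ` B \<in> null_sets M \<longleftrightarrow> B \<in> null_sets M"
  using assms by (auto simp: gms_on_def)

text \<open>The derivative exists by the Radon-Nikodym theorem for the measure \<open>B \<mapsto> \<mu> (B g)\<close>, which has the same null
sets as \<open>\<mu>\<close>, so that its density can be made positive everywhere.\<close>

lemma gms_deriv:
  assumes M: "finite_measure M" and g: "g \<in> Gms M"
  shows "gms_deriv M g \<in> borel_measurable M" "0 < gms_deriv M g m"
    "\<And>B. B \<in> sets M \<Longrightarrow> emeasure M (gms_image M g B) = (\<integral>\<^sup>+m\<in>B. ennreal (gms_deriv M g m) \<partial>M)"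
proof -
  interpret finite_measure M by fact
  obtain X where X: "gms_on M g X" and im: "\<And>B. gms_image M g B = g ` (B \<inter> X)" using Gms_dom[OF g] by blast
  note Xd = gms_onD[OF X]
  define E where "E B = emeasure M (g ` (B \<inter> X))" for B
  define \<nu> where "\<nu> = measure_of (space M) (sets M) E"
  have gs: "g ` (B \<inter> X) \<in> sets M" if "B \<in> sets M" for B using Xd(2,6) that by auto
  have ca: "countably_additive (sets M) E"
  proof (rule countably_additiveI)
    fix A :: "nat \<Rightarrow> 'a set" assume A: "range A \<subseteq> sets M" and dis: "disjoint_family A"
    have "(\<Sum>i. E (A i)) = emeasure M (\<Union>i. g ` (A i \<inter> X))"
      unfolding E_def
    proof (rule suminf_emeasure)
      show "range (\<lambda>i. g ` (A i \<inter> X)) \<subseteq> sets M" using A gs by auto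
      show "disjoint_family (\<lambda>i. g ` (A i \<inter> X))"
        unfolding disjoint_family_on_def
      proof (intro ballI impI)
        fix m n :: nat assume "m \<noteq> n"
        then have "A m \<inter> A n = {}" using dis by (auto simp: disjoint_family_on_def)
        then show "g ` (A m \<inter> X) \<inter> g ` (A n \<inter> X) = {}" using Xd(5) by (auto simp: inj_on_def)
      qed
    qed
    also have "(\<Union>i. g ` (A i \<inter> X)) = g ` ((\<Union>i. A i) \<inter> X)" by auto
    finally show "(\<Sum>i. E (A i)) = E (\<Union>i. A i)" by (simp add: E_def)
  qed
  have s\<nu>: "sets \<nu> = sets M" unfolding \<nu>_def by (simp add: sets.space_closed sets.sigma_sets_eq)
  have em\<nu>: "emeasure \<nu> B = E B" if "B \<in> sets M" for B
    unfolding \<nu>_def by (rule emeasure_measure_of_sigma) (auto simp: ca that positive_def E_def sets.sigma_algebra_axioms)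
  have fin: "finite_measure \<nu>"
    by (rule finite_measureI) (simp add: sets_eq_imp_space_eq[OF s\<nu>] em\<nu> E_def)
  have ac: "absolutely_continuous M \<nu>"
    unfolding absolutely_continuous_def
  proof
    fix B assume B: "B \<in> null_sets M"
    then have "B \<inter> X \<in> null_sets M" using Xd(2) by (intro null_set_Int2) auto
    then have "g ` (B \<inter> X) \<in> null_sets M" using Xd(7)[of "B \<inter> X"] by auto
    then show "B \<in> null_sets \<nu>" using B by (auto simp: null_sets_def s\<nu> em\<nu> E_def)
  qed
  obtain D where D[measurable]: "D \<in> borel_measurable M" and AE: "AE x in M. RN_deriv M \<nu> x = ennreal (D x)" and D0: "\<And>x. 0 \<le> D x"
    using real_RN_deriv[OF fin ac s\<nu>] by auto
  have dens: "density M D = \<nu>" using density_cong[OF _ _ AE] density_RN_deriv[OF ac s\<nu>] by simp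
  define Z where "Z = {m \<in> space M. D m = 0}"
  have Z[measurable]: "Z \<in> sets M" unfolding Z_def by measurable
  have "emeasure \<nu> Z = (\<integral>\<^sup>+m\<in>Z. ennreal (D m) \<partial>M)" unfolding dens[symmetric] by (rule emeasure_density) auto
  also have "\<dots> = (\<integral>\<^sup>+m. 0 \<partial>M)" by (intro nn_integral_cong) (auto simp: Z_def indicator_def)
  finally have "emeasure M (g ` (Z \<inter> X)) = 0" by (simp add: em\<nu> E_def)
  then have "Z \<inter> X \<in> null_sets M" using Xd(7)[of "Z \<inter> X"] gs[OF Z] Xd(2) Z by (auto simp: null_sets_def)
  from AE_not_in[OF this] AE_not_in[OF Xd(3)] AE_space have pos: "AE m in M. 0 < D m"
  proof eventually_elim
    case (elim m)
    then have "D m \<noteq> 0" by (auto simp: Z_def)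
    then show ?case using D0[of m] by simp
  qed
  define d where "d m = (if 0 < D m then D m else 1)" for m
  have dm[measurable]: "d \<in> borel_measurable M" unfolding d_def by measurable
  define P where "P d \<longleftrightarrow> d \<in> borel_measurable M \<and> (\<forall>m. 0 < d m) \<and>
     (\<forall>B\<in>sets M. emeasure M (gms_image M g B) = (\<integral>\<^sup>+m\<in>B. ennreal (d m) \<partial>M))" for d :: "'a \<Rightarrow> real"
  have "P d" unfolding P_def
  proof (intro conjI allI ballI)
    fix B assume B[measurable]: "B \<in> sets M"
    have "emeasure M (gms_image M g B) = emeasure \<nu> B" using B by (simp add: im em\<nu> E_def)
    also have "\<dots> = (\<integral>\<^sup>+m\<in>B. ennreal (D m) \<partial>M)" unfolding dens[symmetric] by (rule emeasure_density) auto
    also have "\<dots> = (\<integral>\<^sup>+m\<in>B. ennreal (d m) \<partial>M)"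
      by (rule nn_integral_cong_AE) (use pos in \<open>eventually_elim, simp add: d_def\<close>)
    finally show "emeasure M (gms_image M g B) = (\<integral>\<^sup>+m\<in>B. ennreal (d m) \<partial>M)" .
  qed (auto simp: d_def)
  then have "P (SOME d. P d)" by (rule someI[of P])
  moreover have "gms_deriv M g = (SOME d. P d)" by (simp add: gms_deriv_def P_def)
  ultimately have H: "P (gms_deriv M g)" by simp
  show "gms_deriv M g \<in> borel_measurable M" "0 < gms_deriv M g m"
    "\<And>B. B \<in> sets M \<Longrightarrow> emeasure M (gms_image M g B) = (\<integral>\<^sup>+m\<in>B. ennreal (gms_deriv M g m) \<partial>M)"
    using H unfolding P_def by blast+
qed

lemma gms_deriv_measurable_Rpos: "finite_measure M \<Longrightarrow> g \<in> Gms M \<Longrightarrow> gms_deriv M g \<in> M \<rightarrow>\<^sub>M Rpos"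
  by (rule measurable_into_Rpos) (auto simp: gms_deriv)

text \<open>Change of variables; on a set \<open>C\<close> it is the definition of the derivative, applied to the preimage of
\<open>C\<close>.\<close>

lemma gms_distr:
  assumes M: "finite_measure M" and g: "g \<in> Gms M"
  shows "distr (density M (\<lambda>m. ennreal (gms_deriv M g m))) M g = M"
proof -
  interpret finite_measure M by fact
  obtain X where X: "gms_on M g X" and im: "\<And>B. gms_image M g B = g ` (B \<inter> X)" using Gms_dom[OF g] by blast
  note Xd = gms_onD[OF X]
  have [measurable]: "g \<in> M \<rightarrow>\<^sub>M M" "gms_deriv M g \<in> borel_measurable M" using Xd(1) gms_deriv(1)[OF M g] by auto
  show ?thesis
  proof (rule measure_eqI)
    fix C assume "C \<in> sets (distr (density M (\<lambda>m. ennreal (gms_deriv M g m))) M g)"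
    then have C[measurable]: "C \<in> sets M" by simp
    let ?B = "g -` C \<inter> space M"
    have "emeasure (distr (density M (\<lambda>m. ennreal (gms_deriv M g m))) M g) C = (\<integral>\<^sup>+m\<in>?B. ennreal (gms_deriv M g m) \<partial>M)"
      by (subst emeasure_distr) (auto simp: emeasure_density)
    also have "\<dots> = emeasure M (gms_image M g ?B)" by (rule gms_deriv(3)[OF M g, symmetric]) measurable
    also have "gms_image M g ?B = C \<inter> g ` X" using sets.sets_into_space[OF Xd(2)] by (auto simp: im)
    also have "emeasure M (C \<inter> g ` X) = emeasure M C"
    proof (rule emeasure_eq_AE)
      show "AE m in M. m \<in> C \<inter> g ` X \<longleftrightarrow> m \<in> C" using AE_not_in[OF Xd(4)] AE_space by eventually_elim auto
    qed (use C Xd(6)[OF Xd(2)] in auto)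
    finally show "emeasure (distr (density M (\<lambda>m. ennreal (gms_deriv M g m))) M g) C = emeasure M C" .
  qed simp
qed

lemma gms_nn_integral:
  assumes M: "finite_measure M" and g: "g \<in> Gms M" and [measurable]: "F \<in> borel_measurable M"
  shows "(\<integral>\<^sup>+m. ennreal (gms_deriv M g m) * F (g m) \<partial>M) = (\<integral>\<^sup>+m. F m \<partial>M)"
proof -
  note [measurable] = Gms_measurable[OF g] gms_deriv(1)[OF M g]
  have "(\<integral>\<^sup>+m. F m \<partial>M) = (\<integral>\<^sup>+m. F m \<partial>distr (density M (\<lambda>m. ennreal (gms_deriv M g m))) M g)" by (simp only: gms_distr[OF M g])
  also have "\<dots> = (\<integral>\<^sup>+m. ennreal (gms_deriv M g m) * F (g m) \<partial>M)"
    by (subst nn_integral_distr, simp, measurable, subst nn_integral_density, measurable)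
  finally show ?thesis by simp
qed

lemma gms_AE:
  assumes M: "finite_measure M" and g: "g \<in> Gms M" and Q: "AE m in M. Q m"
  shows "AE m in M. Q (g m)"
proof -
  obtain Z where Z: "Z \<in> null_sets M" "{m \<in> space M. \<not> Q m} \<subseteq> Z" using Q unfolding eventually_ae_filter by blast
  have [measurable]: "g \<in> M \<rightarrow>\<^sub>M M" "gms_deriv M g \<in> borel_measurable M" "Z \<in> sets M"
    using Gms_measurable[OF g] gms_deriv(1)[OF M g] Z by auto
  have "(\<integral>\<^sup>+m. ennreal (gms_deriv M g m) * indicator Z (g m) \<partial>M) = emeasure M Z"
    using gms_nn_integral[OF M g, of "indicator Z"] by simp
  also have "\<dots> = 0" using Z by auto
  finally have "AE m in M. ennreal (gms_deriv M g m) * indicator Z (g m) = 0"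
    by (subst (asm) nn_integral_0_iff_AE) measurable
  then show ?thesis using AE_space
  proof eventually_elim
    case (elim m)
    then have "g m \<notin> Z" using gms_deriv(2)[OF M g, of m] by (auto simp: indicator_def ennreal_eq_0_iff split: if_splits)
    moreover have "g m \<in> space M" using measurable_space[OF Gms_measurable[OF g] elim(2)] .
    ultimately show ?case using Z(2) by auto
  qed
qed

text \<open>The change of variables formula characterises the derivative, because every measurable set is a
preimage under \<open>g\<close> modulo null sets.\<close>

lemma gms_deriv_unique:
  assumes M: "finite_measure M" and g: "g \<in> Gms M" and d[measurable]: "d \<in> borel_measurable M" and d0: "\<And>m. 0 \<le> d m"
    and eq: "\<And>C. C \<in> sets M \<Longrightarrow> (\<integral>\<^sup>+m. ennreal (d m) * indicator C (g m) \<partial>M) = emeasure M C"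
  shows "AE m in M. gms_deriv M g m = d m"
proof -
  interpret finite_measure M by fact
  obtain X where X: "gms_on M g X" and im: "\<And>B. gms_image M g B = g ` (B \<inter> X)" using Gms_dom[OF g] by blast
  note Xd = gms_onD[OF X]
  have [measurable]: "g \<in> M \<rightarrow>\<^sub>M M" "gms_deriv M g \<in> borel_measurable M" using Xd(1) gms_deriv(1)[OF M g] by auto
  have e: "(\<integral>\<^sup>+m\<in>B. ennreal (d m) \<partial>M) = (\<integral>\<^sup>+m\<in>B. ennreal (gms_deriv M g m) \<partial>M)" if B[measurable]: "B \<in> sets M" for B
  proof -
    have gB: "g ` (B \<inter> X) \<in> sets M" using Xd(2,6) B by auto
    have "(\<integral>\<^sup>+m\<in>B. ennreal (d m) \<partial>M) = (\<integral>\<^sup>+m. ennreal (d m) * indicator (g ` (B \<inter> X)) (g m) \<partial>M)"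
    proof (rule nn_integral_cong_AE)
      show "AE m in M. ennreal (d m) * indicator B m = ennreal (d m) * indicator (g ` (B \<inter> X)) (g m)"
        using AE_not_in[OF Xd(3)] AE_space
      proof eventually_elim
        case (elim m)
        then have "g m \<in> g ` (B \<inter> X) \<longleftrightarrow> m \<in> B" using Xd(5) by (auto simp: inj_on_def)
        then show ?case by (simp add: indicator_def)
      qed
    qed
    also have "\<dots> = emeasure M (g ` (B \<inter> X))" by (rule eq[OF gB])
    also have "\<dots> = (\<integral>\<^sup>+m\<in>B. ennreal (gms_deriv M g m) \<partial>M)" using gms_deriv(3)[OF M g B] by (simp add: im)
    finally show ?thesis .
  qed
  have fin: "(\<integral>\<^sup>+m. ennreal (gms_deriv M g m) \<partial>M) < \<infinity>"
    using gms_nn_integral[OF M g, of "\<lambda>_. 1"] emeasure_less_top by simp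
  have "(\<integral>\<^sup>+m. ennreal (d m) \<partial>M) = (\<integral>\<^sup>+m\<in>space M. ennreal (d m) \<partial>M)" by (intro nn_integral_cong) auto
  also have "\<dots> = (\<integral>\<^sup>+m. ennreal (gms_deriv M g m) \<partial>M)" unfolding e[OF sets.top] by (intro nn_integral_cong) auto
  finally have fin': "(\<integral>\<^sup>+m. ennreal (d m) \<partial>M) < \<infinity>" using fin by simp
  have "AE m in M. ennreal (d m) \<le> ennreal (gms_deriv M g m)"
    by (rule nn_integral_le_imp_AE_le[OF _ _ fin]) (auto simp: e)
  moreover have "AE m in M. ennreal (gms_deriv M g m) \<le> ennreal (d m)"
    by (rule nn_integral_le_imp_AE_le[OF _ _ fin']) (auto simp: e)
  ultimately show ?thesis
  proof eventually_elim
    case (elim m)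
    then have "ennreal (d m) = ennreal (gms_deriv M g m)" by (rule antisym)
    then show ?case using d0[of m] gms_deriv(2)[OF M g, of m] by simp
  qed
qed

lemma gms_chain:
  assumes M: "finite_measure M" and g: "g \<in> Gms M" and h: "h \<in> Gms M" and k: "k \<in> Gms M"
    and eq: "AE m in M. k m = h (g m)"
  shows "AE m in M. gms_deriv M k m = gms_deriv M g m * gms_deriv M h (g m)"
proof (rule gms_deriv_unique[OF M k])
  have [measurable]: "g \<in> M \<rightarrow>\<^sub>M M" "h \<in> M \<rightarrow>\<^sub>M M" "k \<in> M \<rightarrow>\<^sub>M M" "gms_deriv M g \<in> borel_measurable M" "gms_deriv M h \<in> borel_measurable M"
    using Gms_measurable g h k gms_deriv(1)[OF M] by auto
  show "(\<lambda>m. gms_deriv M g m * gms_deriv M h (g m)) \<in> borel_measurable M" by measurable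
  show "0 \<le> gms_deriv M g m * gms_deriv M h (g m)" for m
    using gms_deriv(2)[OF M g, of m] gms_deriv(2)[OF M h, of "g m"] by simp
  fix C assume [measurable]: "C \<in> sets M"
  have "(\<integral>\<^sup>+m. ennreal (gms_deriv M g m * gms_deriv M h (g m)) * indicator C (k m) \<partial>M) =
    (\<integral>\<^sup>+m. ennreal (gms_deriv M g m) * (ennreal (gms_deriv M h (g m)) * indicator C (h (g m))) \<partial>M)"
  proof (rule nn_integral_cong_AE)
    show "AE m in M. ennreal (gms_deriv M g m * gms_deriv M h (g m)) * indicator C (k m) = ennreal (gms_deriv M g m) * (ennreal (gms_deriv M h (g m)) * indicator C (h (g m)))"
      using eq
    proof eventually_elim
      case (elim m)
      show ?case using gms_deriv(2)[OF M g, of m] gms_deriv(2)[OF M h, of "g m"] elim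
        by (simp add: ennreal_mult mult.assoc less_imp_le)
    qed
  qed
  also have "\<dots> = (\<integral>\<^sup>+m. ennreal (gms_deriv M h m) * indicator C (h m) \<partial>M)"
    by (rule gms_nn_integral[OF M g, of "\<lambda>m. ennreal (gms_deriv M h m) * indicator C (h m)"]) measurable
  also have "\<dots> = emeasure M C" by (subst gms_nn_integral[OF M h]) auto
  finally show "(\<integral>\<^sup>+m. ennreal (gms_deriv M g m * gms_deriv M h (g m)) * indicator C (k m) \<partial>M) = emeasure M C" .
qed

lemma gms_deriv_preserving:
  assumes M: "finite_measure M" and g: "g \<in> Gms M" and eq: "distr M M g = M"
  shows "AE m in M. gms_deriv M g m = 1"
proof (rule gms_deriv_unique[OF M g])
  have [measurable]: "g \<in> M \<rightarrow>\<^sub>M M" using Gms_measurable g by auto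
  fix C assume [measurable]: "C \<in> sets M"
  have "(\<integral>\<^sup>+m. ennreal 1 * indicator C (g m) \<partial>M) = (\<integral>\<^sup>+m. indicator C (g m) \<partial>M)" by simp
  also have "\<dots> = (\<integral>\<^sup>+m. indicator C m \<partial>distr M M g)" by (rule nn_integral_distr[symmetric]) auto
  also have "\<dots> = emeasure M C" by (simp add: eq)
  finally show "(\<integral>\<^sup>+m. ennreal 1 * indicator C (g m) \<partial>M) = emeasure M C" .
qed auto

section \<open>Polymorphisms as joint laws\<close>

text \<open>The projections, their adjoints, the transformations and the products of these are all of this form.\<close>

definition law :: "'m measure \<Rightarrow> 'a measure \<Rightarrow> 'b measure \<Rightarrow> ('m \<Rightarrow> 'a) \<Rightarrow> ('m \<Rightarrow> 'b) \<Rightarrow> ('m \<Rightarrow> real) \<Rightarrow> ('a \<times> 'b \<times> real) measure" where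
  "law M A B a b c = distr M (pol_space A B) (\<lambda>m. (a m, b m, c m))"

lemma pol_form_law:
  assumes [measurable]: "a \<in> M \<rightarrow>\<^sub>M A" "b \<in> M \<rightarrow>\<^sub>M B" "c \<in> M \<rightarrow>\<^sub>M Rpos" "h \<in> borel_measurable A" "f \<in> borel_measurable B"
  shows "pol_form s (law M A B a b c) h f = (\<integral>m. h (a m) * (f (b m) * mel s (c m)) \<partial>M)"
  unfolding pol_form_def law_def by (subst integral_distr) auto

text \<open>The second marginal condition is the change of variables formula.\<close>

lemma law_Pol:
  assumes M: "finite_measure M" and g: "g \<in> Gms M"
    and a[measurable]: "a \<in> M \<rightarrow>\<^sub>M A" and b[measurable]: "b \<in> M \<rightarrow>\<^sub>M B"
    and da: "distr M A a = A" and db: "distr M B b = B"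
  shows "law M A B a (\<lambda>m. b (g m)) (gms_deriv M g) \<in> Pol A B"
proof (rule PolI)
  note [measurable] = Gms_measurable[OF g] gms_deriv_measurable_Rpos[OF M g] gms_deriv(1)[OF M g]
  show "sets (law M A B a (\<lambda>m. b (g m)) (gms_deriv M g)) = sets (pol_space A B)" by (simp add: law_def)
  fix C assume [measurable]: "C \<in> sets A"
  have "(\<integral>\<^sup>+z. indicator C (fst z) \<partial>law M A B a (\<lambda>m. b (g m)) (gms_deriv M g)) = (\<integral>\<^sup>+m. indicator C (a m) \<partial>M)"
    unfolding law_def by (subst nn_integral_distr) auto
  also have "\<dots> = (\<integral>\<^sup>+m. indicator C m \<partial>distr M A a)" by (rule nn_integral_distr[symmetric]) auto
  finally show "(\<integral>\<^sup>+z. indicator C (fst z) \<partial>law M A B a (\<lambda>m. b (g m)) (gms_deriv M g)) = emeasure A C" by (simp add: da)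
next
  note [measurable] = Gms_measurable[OF g] gms_deriv_measurable_Rpos[OF M g] gms_deriv(1)[OF M g] measurable_id_Rpos
  fix C assume [measurable]: "C \<in> sets B"
  have "(\<integral>\<^sup>+z. ennreal (snd (snd z)) * indicator C (fst (snd z)) \<partial>law M A B a (\<lambda>m. b (g m)) (gms_deriv M g)) =
    (\<integral>\<^sup>+m. ennreal (gms_deriv M g m) * indicator C (b (g m)) \<partial>M)"
    unfolding law_def by (subst nn_integral_distr) auto
  also have "\<dots> = (\<integral>\<^sup>+m. indicator C (b m) \<partial>M)"
    by (rule gms_nn_integral[OF M g, of "\<lambda>m. indicator C (b m)"]) measurable
  also have "\<dots> = (\<integral>\<^sup>+m. indicator C m \<partial>distr M B b)" by (rule nn_integral_distr[symmetric]) auto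
  finally show "(\<integral>\<^sup>+z. ennreal (snd (snd z)) * indicator C (fst (snd z)) \<partial>law M A B a (\<lambda>m. b (g m)) (gms_deriv M g)) = emeasure B C"
    by (simp add: db)
qed

lemma law_cong:
  assumes "AE m in M. a m = a' m \<and> b m = b' m \<and> c m = c' m"
    and [measurable]: "a \<in> M \<rightarrow>\<^sub>M A" "b \<in> M \<rightarrow>\<^sub>M B" "c \<in> M \<rightarrow>\<^sub>M Rpos" "a' \<in> M \<rightarrow>\<^sub>M A" "b' \<in> M \<rightarrow>\<^sub>M B" "c' \<in> M \<rightarrow>\<^sub>M Rpos"
  shows "law M A B a b c = law M A B a' b' c'"
  unfolding law_def by (rule distr_cong_AE) (use assms(1) in auto)

lemma pol_star_proj:
  assumes [measurable]: "\<pi> \<in> M \<rightarrow>\<^sub>M Q"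
  shows "pol_star M Q (pol_proj M Q \<pi>) = law M Q M \<pi> (\<lambda>m. m) (\<lambda>_. 1)"
proof -
  have [measurable]: "(\<lambda>m. 1) \<in> M \<rightarrow>\<^sub>M Rpos" by simp
  have [measurable]: "(\<lambda>z. ennreal (snd (snd z))) \<in> borel_measurable (pol_space M Q)"
  proof -
    note [measurable] = measurable_id_Rpos
    show ?thesis by measurable
  qed
  have [measurable]: "inverse \<in> Rpos \<rightarrow>\<^sub>M Rpos"
    by (rule measurable_into_Rpos) (auto intro!: measurable_Rpos_borel)
  have "density (pol_proj M Q \<pi>) (\<lambda>z. ennreal (snd (snd z))) = distr (density M (\<lambda>m. ennreal (snd (snd (m, \<pi> m, 1::real))))) (pol_space M Q) (\<lambda>m. (m, \<pi> m, 1))"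
    unfolding pol_proj_def by (rule density_distr) measurable
  also have "density M (\<lambda>m. ennreal (snd (snd (m, \<pi> m, 1::real)))) = M" by (simp add: density_1)
  finally have 1: "density (pol_proj M Q \<pi>) (\<lambda>z. ennreal (snd (snd z))) = distr M (pol_space M Q) (\<lambda>m. (m, \<pi> m, 1))" .
  show ?thesis
    unfolding pol_star_def law_def case_prod_beta' 1 by (subst distr_distr) (auto simp: comp_def)
qed

lemma mel_deriv_sqi:
  assumes M: "finite_measure M" and g: "g \<in> Gms M" and f: "square_integrable M f"
  shows "square_integrable M (\<lambda>m. f (g m) * mel s (gms_deriv M g m))"
    and "(\<integral>\<^sup>+m. (ennreal (cmod (f (g m) * mel s (gms_deriv M g m))))\<^sup>2 \<partial>M) = (\<integral>\<^sup>+m. (ennreal (cmod (f m)))\<^sup>2 \<partial>M)"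
proof -
  note [measurable] = Gms_measurable[OF g] gms_deriv_measurable_Rpos[OF M g] sqi_measurable[OF f]
  have "(\<integral>\<^sup>+m. (ennreal (cmod (f (g m) * mel s (gms_deriv M g m))))\<^sup>2 \<partial>M) = (\<integral>\<^sup>+m. ennreal (gms_deriv M g m) * (ennreal (cmod (f (g m))))\<^sup>2 \<partial>M)"
  proof (rule nn_integral_cong)
    fix m
    have d: "0 < gms_deriv M g m" by (rule gms_deriv(2)[OF M g])
    then show "(ennreal (cmod (f (g m) * mel s (gms_deriv M g m))))\<^sup>2 = ennreal (gms_deriv M g m) * (ennreal (cmod (f (g m))))\<^sup>2"
      by (simp add: norm_mult norm_mel ennreal_mult power_mult_distrib ennreal_power mult.commute)
  qed
  also have "\<dots> = (\<integral>\<^sup>+m. (ennreal (cmod (f m)))\<^sup>2 \<partial>M)"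
    by (rule gms_nn_integral[OF M g, of "\<lambda>m. (ennreal (cmod (f m)))\<^sup>2"]) measurable
  finally show eq: "(\<integral>\<^sup>+m. (ennreal (cmod (f (g m) * mel s (gms_deriv M g m))))\<^sup>2 \<partial>M) = (\<integral>\<^sup>+m. (ennreal (cmod (f m)))\<^sup>2 \<partial>M)" .
  show "square_integrable M (\<lambda>m. f (g m) * mel s (gms_deriv M g m))"
    using f unfolding sqi_iff_nn eq by auto
qed

lemma one_Rpos: "(\<lambda>m. 1) \<in> M \<rightarrow>\<^sub>M Rpos" by simp

lemma id_Gms:
  assumes "finite_measure M" shows "(\<lambda>m. m) \<in> Gms M"
  unfolding Gms_def gms_on_def by (auto intro!: exI[of _ "space M"])

lemma law_Pol_one:
  assumes M: "finite_measure M" and a: "a \<in> M \<rightarrow>\<^sub>M A" and b: "b \<in> M \<rightarrow>\<^sub>M B" and da: "distr M A a = A" and db: "distr M B b = B"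
  shows "law M A B a b (\<lambda>_. 1) \<in> Pol A B"
proof -
  note idG = id_Gms[OF M]
  have "distr M M (\<lambda>m. m) = M" by simp
  from gms_deriv_preserving[OF M idG this] have "law M A B a (\<lambda>m. b m) (gms_deriv M (\<lambda>m. m)) = law M A B a b (\<lambda>_. 1)"
    by (intro law_cong) (auto simp: a b one_Rpos gms_deriv_measurable_Rpos[OF M idG])
  with law_Pol[OF M idG a b da db] show ?thesis by simp
qed

text \<open>Both products are found with the criterion for products: the operators are composition with \<open>g\<close> times
the Mellin character of the derivative, and composition with the projections.\<close>

lemma Xi_product:
  assumes M: "lebesgue_prob_space M" and A: "lebesgue_prob_space A" and B: "lebesgue_prob_space B" and g: "g \<in> Gms M"
    and a[measurable]: "a \<in> M \<rightarrow>\<^sub>M A" and b[measurable]: "b \<in> M \<rightarrow>\<^sub>M B"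
    and da: "distr M A a = A" and db: "distr M B b = B"
  shows "pol_prod A M B (pol_prod A M M (pol_star M A (pol_proj M A a)) (pol_of_gms M g)) (pol_proj M B b) =
    law M A B a (\<lambda>m. b (g m)) (gms_deriv M g)"
proof -
  interpret M: prob_space M using M by (simp add: lebesgue_prob_space_def)
  interpret A: prob_space A using A by (simp add: lebesgue_prob_space_def)
  interpret B: prob_space B using B by (simp add: lebesgue_prob_space_def)
  have fM: "finite_measure M" by (rule M.finite_measure_axioms)
  note [measurable] = Gms_measurable[OF g] gms_deriv_measurable_Rpos[OF fM g] one_Rpos
  have dM: "distr M M (\<lambda>m. m) = M" by simp
  have p1: "law M A M a (\<lambda>m. m) (\<lambda>_. 1) \<in> Pol A M" by (rule law_Pol_one[OF fM a _ da dM]) simp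
  have q1: "pol_of_gms M g = law M M M (\<lambda>m. m) (\<lambda>m. (\<lambda>m. m) (g m)) (gms_deriv M g)" by (simp add: pol_of_gms_def law_def)
  have q1P: "pol_of_gms M g \<in> Pol M M" unfolding q1 by (rule law_Pol[OF fM g _ _ dM dM]) auto
  have r1: "law M A M a (\<lambda>m. (\<lambda>m. m) (g m)) (gms_deriv M g) \<in> Pol A M" by (rule law_Pol[OF fM g a _ da dM]) simp
  have 1: "pol_prod A M M (pol_star M A (pol_proj M A a)) (pol_of_gms M g) = law M A M a (\<lambda>m. (\<lambda>m. m) (g m)) (gms_deriv M g)"
    unfolding pol_star_proj[OF a]
  proof (rule pol_prod_eqI[OF A M M p1 q1P r1])
    fix s C assume C[measurable]: "C \<in> sets M"
    note f = mel_deriv_sqi(1)[OF fM g M.sqi_indicator[OF C], of s]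
    note [measurable] = sqi_measurable[OF f]
    show "\<exists>f. square_integrable M f \<and> (\<forall>Aa\<in>sets M. pol_form s (pol_of_gms M g) (indicator Aa) (indicator C) = (\<integral>n. indicator Aa n * f n \<partial>M)) \<and>
       (\<forall>Ba\<in>sets A. pol_form s (law M A M a (\<lambda>m. m) (\<lambda>_. 1)) (indicator Ba) f = pol_form s (law M A M a (\<lambda>m. (\<lambda>m. m) (g m)) (gms_deriv M g)) (indicator Ba) (indicator C))"
    proof (intro exI conjI ballI, rule f)
      fix X assume [measurable]: "X \<in> sets M"
      show "pol_form s (pol_of_gms M g) (indicator X) (indicator C) = (\<integral>n. indicator X n * (indicator C (g n) * mel s (gms_deriv M g n)) \<partial>M)"
        unfolding q1 by (rule pol_form_law) measurable
    next
      fix X assume [measurable]: "X \<in> sets A"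
      have "pol_form s (law M A M a (\<lambda>m. m) (\<lambda>_. 1)) (indicator X) (\<lambda>m. indicator C (g m) * mel s (gms_deriv M g m)) =
        (\<integral>m. indicator X (a m) * ((indicator C (g m) * mel s (gms_deriv M g m)) * mel s 1) \<partial>M)"
        by (rule pol_form_law) measurable
      also have "\<dots> = pol_form s (law M A M a (\<lambda>m. (\<lambda>m. m) (g m)) (gms_deriv M g)) (indicator X) (indicator C)"
        by (subst pol_form_law) auto
      finally show "pol_form s (law M A M a (\<lambda>m. m) (\<lambda>_. 1)) (indicator X) (\<lambda>m. indicator C (g m) * mel s (gms_deriv M g m)) =
        pol_form s (law M A M a (\<lambda>m. (\<lambda>m. m) (g m)) (gms_deriv M g)) (indicator X) (indicator C)" .
    qed
  qed
  have q2: "pol_proj M B b = law M M B (\<lambda>m. m) b (\<lambda>_. 1)" by (simp add: pol_proj_def law_def)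
  have q2P: "pol_proj M B b \<in> Pol M B" unfolding q2 by (rule law_Pol_one[OF fM _ b dM db]) simp
  have r2: "law M A B a (\<lambda>m. b (g m)) (gms_deriv M g) \<in> Pol A B" by (rule law_Pol[OF fM g a b da db])
  show ?thesis
    unfolding 1
  proof (rule pol_prod_eqI[OF A M B r1 q2P r2])
    fix s C assume C[measurable]: "C \<in> sets B"
    have f: "square_integrable M (\<lambda>m. indicator C (b m))" by (rule M.sqi_bounded[of _ 1]) (auto simp: indicator_def)
    show "\<exists>f. square_integrable M f \<and> (\<forall>Aa\<in>sets M. pol_form s (pol_proj M B b) (indicator Aa) (indicator C) = (\<integral>n. indicator Aa n * f n \<partial>M)) \<and>
       (\<forall>Ba\<in>sets A. pol_form s (law M A M a (\<lambda>m. (\<lambda>m. m) (g m)) (gms_deriv M g)) (indicator Ba) f = pol_form s (law M A B a (\<lambda>m. b (g m)) (gms_deriv M g)) (indicator Ba) (indicator C))"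
    proof (intro exI conjI ballI, rule f)
      fix X assume [measurable]: "X \<in> sets M"
      have "pol_form s (pol_proj M B b) (indicator X) (indicator C) = (\<integral>n. indicator X n * (indicator C (b n) * mel s 1) \<partial>M)"
        unfolding q2 by (rule pol_form_law) measurable
      then show "pol_form s (pol_proj M B b) (indicator X) (indicator C) = (\<integral>n. indicator X n * indicator C (b n) \<partial>M)" by simp
    next
      fix X assume [measurable]: "X \<in> sets A"
      show "pol_form s (law M A M a (\<lambda>m. (\<lambda>m. m) (g m)) (gms_deriv M g)) (indicator X) (\<lambda>m. indicator C (b m)) =
        pol_form s (law M A B a (\<lambda>m. b (g m)) (gms_deriv M g)) (indicator X) (indicator C)"
        by (subst (1 2) pol_form_law) auto
    qed
  qed
qed

section \<open>The Hilbert space of square integrable functions\<close>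

lemma integral_mult_cnj:
  shows "(\<integral>x. f x * cnj (f x) \<partial>N) = complex_of_real ((L2n N f)\<^sup>2)"
  unfolding L2n_sq complex_norm_square[symmetric] by (rule integral_complex_of_real)

lemma L2n_triangle:
  assumes f: "square_integrable N f" and g: "square_integrable N g"
  shows "L2n N (\<lambda>x. f x + g x) \<le> L2n N f + L2n N g"
proof -
  have i: "integrable N (\<lambda>x. (cmod (f x))\<^sup>2)" "integrable N (\<lambda>x. (cmod (g x))\<^sup>2)" "integrable N (\<lambda>x. f x * cnj (g x))"
    using f g sqi_mult_integrable[OF f sqi_cnj[OF g]] by (auto simp: square_integrable_def)
  have "(L2n N (\<lambda>x. f x + g x))\<^sup>2 = (\<integral>x. (cmod (f x))\<^sup>2 + (cmod (g x))\<^sup>2 + 2 * Re (f x * cnj (g x)) \<partial>N)"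
    unfolding L2n_sq by (intro Bochner_Integration.integral_cong refl) (simp only: cmod_power2, simp add: power2_eq_square algebra_simps)
  also have "\<dots> = (L2n N f)\<^sup>2 + (L2n N g)\<^sup>2 + 2 * Re (\<integral>x. f x * cnj (g x) \<partial>N)"
    by (simp only: L2n_sq Bochner_Integration.integral_add[OF Bochner_Integration.integrable_add[OF i(1,2)] integrable_mult_right[OF integrable_Re[OF i(3)]]] Bochner_Integration.integral_add[OF i(1,2)] integral_mult_right_zero integral_Re[OF i(3)])
  also have "\<dots> \<le> (L2n N f)\<^sup>2 + (L2n N g)\<^sup>2 + 2 * (L2n N f * L2n N g)"
  proof -
    have "Re (\<integral>x. f x * cnj (g x) \<partial>N) \<le> cmod (\<integral>x. f x * cnj (g x) \<partial>N)" by (rule complex_Re_le_cmod)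
    also have "\<dots> \<le> L2n N f * L2n N (\<lambda>x. cnj (g x))" by (rule integral_CS[OF f sqi_cnj[OF g]])
    also have "L2n N (\<lambda>x. cnj (g x)) = L2n N g" by (simp add: L2n_def)
    finally show ?thesis by simp
  qed
  also have "\<dots> = (L2n N f + L2n N g)\<^sup>2" by (simp add: power2_sum)
  finally show ?thesis by (rule power2_le_imp_le) (simp add: L2n_nonneg)
qed

lemma L2n_minus_commute: "L2n N (\<lambda>x. f x - g x) = L2n N (\<lambda>x. g x - f x)"
  unfolding L2n_def by (simp add: norm_minus_commute)

lemma L2n_cmult: "L2n N (\<lambda>x. c * f x) = cmod c * L2n N f"
  unfolding L2n_def by (simp add: norm_mult power_mult_distrib real_sqrt_mult)

lemma L2n_diff_triangle:
  assumes "square_integrable N f" "square_integrable N g" "square_integrable N h"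
  shows "L2n N (\<lambda>x. f x - h x) \<le> L2n N (\<lambda>x. f x - g x) + L2n N (\<lambda>x. g x - h x)"
  using L2n_triangle[OF sqi_diff[OF assms(1,2)] sqi_diff[OF assms(2,3)]] by simp

lemma L2n_0_iff:
  assumes "square_integrable N f" shows "L2n N f = 0 \<longleftrightarrow> (AE x in N. f x = 0)"
proof -
  have "L2n N f = 0 \<longleftrightarrow> (\<integral>x. (cmod (f x))\<^sup>2 \<partial>N) = 0" by (simp add: L2n_def)
  also have "\<dots> \<longleftrightarrow> (AE x in N. (cmod (f x))\<^sup>2 = 0)"
    by (rule integral_nonneg_eq_0_iff_AE[OF sqi_integrable[OF assms]]) simp
  finally show ?thesis by simp
qed

lemma ennreal_power2_le_imp_le: "(x::ennreal)\<^sup>2 \<le> y\<^sup>2 \<Longrightarrow> x \<le> y"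
  proof -
  assume le: "x\<^sup>2 \<le> y\<^sup>2"
  show "x \<le> y"
  proof (cases y)
    case y: (real b)
    show ?thesis
    proof (cases x)
      case x: (real a)
      have "a\<^sup>2 \<le> b\<^sup>2" using le x y by (simp add: ennreal_power)
      then have "a \<le> b" by (rule power2_le_imp_le) (use y in simp)
      then show ?thesis using x y by (simp add: ennreal_leI)
    next
      case top
      then have "x\<^sup>2 = \<top>" by (simp add: power2_eq_square ennreal_top_mult)
      then show ?thesis using le y by (simp add: ennreal_power top_unique)
    qed
  qed simp
qed

text \<open>The Riesz-Fischer argument: along a subsequence with geometrically decreasing increments the functions
converge almost everywhere, and Fatou's lemma bounds the distance to the limit.\<close>

lemma (in finite_measure) L2_complete:
  fixes f :: "nat \<Rightarrow> 'a \<Rightarrow> complex"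
  assumes f: "\<And>n. square_integrable M (f n)"
    and C: "\<And>\<epsilon>. 0 < \<epsilon> \<Longrightarrow> \<exists>N. \<forall>n m. N \<le> n \<longrightarrow> N \<le> m \<longrightarrow> L2n M (\<lambda>x. f n x - f m x) < \<epsilon>"
  obtains F where "square_integrable M F" "(\<lambda>n. L2n M (\<lambda>x. f n x - F x)) \<longlonglongrightarrow> 0"
proof -
  have [measurable]: "f n \<in> borel_measurable M" for n using f by (rule sqi_measurable)
  have "\<forall>k. \<exists>N. \<forall>n m. N \<le> n \<longrightarrow> N \<le> m \<longrightarrow> L2n M (\<lambda>x. f n x - f m x) < (1/2)^k" using C by simp
  then obtain R where R: "\<And>k n m. R k \<le> n \<Longrightarrow> R k \<le> m \<Longrightarrow> L2n M (\<lambda>x. f n x - f m x) < (1/2)^k" by metis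
  \<comment> \<open>Partial sums make the indices increasing and at least \<open>R k\<close>.\<close>
  define r where "r k = (\<Sum>i\<le>k. R i)" for k
  have Rr: "R k \<le> r k" for k unfolding r_def by (rule member_le_sum) auto
  have Rr': "R k \<le> r (Suc k)" for k unfolding r_def by (rule member_le_sum) auto
  define h where "h k x = f (r (Suc k)) x - f (r k) x" for k x
  have [measurable]: "h k \<in> borel_measurable M" for k unfolding h_def by measurable
  have hs: "square_integrable M (h k)" for k unfolding h_def by (intro sqi_diff f)
  have hn: "L2n M (h k) \<le> (1/2)^k" for k using R[of k "r (Suc k)" "r k"] Rr[of k] Rr'[of k] by (simp add: h_def[abs_def])
  define c where "c = L2n M (\<lambda>x. 1)"
  have s1: "square_integrable M (\<lambda>x. 1)" by (simp add: square_integrable_def)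
  have nn: "(\<integral>\<^sup>+x. ennreal (cmod (h k x)) \<partial>M) \<le> ennreal (c * (1/2)^k)" for k
  proof -
    have "(\<integral>\<^sup>+x. ennreal (cmod (h k x)) * ennreal (cmod 1) \<partial>M)\<^sup>2 \<le> ennreal ((L2n M (h k))\<^sup>2) * ennreal (c\<^sup>2)"
      using Cauchy_Schwarz_nn_integral[of "\<lambda>x. ennreal (cmod (h k x))" M "\<lambda>x. ennreal (cmod 1)"] nn_L2n[OF hs[of k]] nn_L2n[OF s1]
      by (simp add: c_def)
    also have "\<dots> = (ennreal (c * L2n M (h k)))\<^sup>2"
      by (simp add: c_def L2n_nonneg ennreal_mult ennreal_power[symmetric] power_mult_distrib mult.commute)
    finally have "(\<integral>\<^sup>+x. ennreal (cmod (h k x)) \<partial>M)\<^sup>2 \<le> (ennreal (c * L2n M (h k)))\<^sup>2" by simp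
    then have "(\<integral>\<^sup>+x. ennreal (cmod (h k x)) \<partial>M) \<le> ennreal (c * L2n M (h k))" by (rule ennreal_power2_le_imp_le)
    also have "\<dots> \<le> ennreal (c * (1/2)^k)" using hn[of k] by (intro ennreal_leI mult_left_mono) (simp_all add: c_def L2n_nonneg)
    finally show ?thesis .
  qed
  have "(\<integral>\<^sup>+x. (\<Sum>k. ennreal (cmod (h k x))) \<partial>M) = (\<Sum>k. \<integral>\<^sup>+x. ennreal (cmod (h k x)) \<partial>M)"
    by (rule nn_integral_suminf) measurable
  also have "\<dots> \<le> (\<Sum>k. ennreal (c * (1/2)^k))" by (intro suminf_le nn summableI)
  also have "\<dots> = ennreal (\<Sum>k. c * (1/2)^k)"
    by (rule suminf_ennreal2) (auto simp: c_def L2n_nonneg intro!: summable_mult)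
  finally have "(\<integral>\<^sup>+x. (\<Sum>k. ennreal (cmod (h k x))) \<partial>M) \<noteq> \<infinity>" by (auto simp: top_unique)
  then have "AE x in M. (\<Sum>k. ennreal (cmod (h k x))) \<noteq> \<infinity>" by (intro nn_integral_noteq_infinite) auto
  then have conv: "AE x in M. convergent (\<lambda>k. f (r k) x)"
  proof eventually_elim
    case (elim x)
    then have "summable (\<lambda>k. cmod (h k x))" by (intro summable_suminf_not_top) auto
    then have "summable (\<lambda>k. h k x)" by (rule summable_norm_cancel)
    then have "convergent (\<lambda>n. \<Sum>k<n. h k x)" by (rule summable_iff_convergent[THEN iffD1])
    moreover have "(\<Sum>k<n. h k x) = f (r n) x - f (r 0) x" for n unfolding h_def by (rule sum_lessThan_telescope)
    ultimately have "convergent (\<lambda>n. (f (r n) x - f (r 0) x) + f (r 0) x)" by (intro convergent_add convergent_const) simp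
    then show ?case by simp
  qed
  define F where "F x = lim (\<lambda>k. f (r k) x)" for x
  have [measurable]: "F \<in> borel_measurable M" unfolding F_def by (rule borel_measurable_lim_metric) measurable
  have lim: "AE x in M. (\<lambda>k. f (r k) x) \<longlonglongrightarrow> F x"
    using conv by eventually_elim (simp add: F_def convergent_LIMSEQ_iff)
  have bound: "(\<integral>\<^sup>+x. ennreal ((cmod (f n x - F x))\<^sup>2) \<partial>M) \<le> ennreal (((1/2)^k)\<^sup>2)" if n: "R k \<le> n" for n k
  proof -
    have "(\<integral>\<^sup>+x. ennreal ((cmod (f n x - F x))\<^sup>2) \<partial>M) = (\<integral>\<^sup>+x. liminf (\<lambda>i. ennreal ((cmod (f n x - f (r i) x))\<^sup>2)) \<partial>M)"
    proof (rule nn_integral_cong_AE)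
      show "AE x in M. ennreal ((cmod (f n x - F x))\<^sup>2) = liminf (\<lambda>i. ennreal ((cmod (f n x - f (r i) x))\<^sup>2))"
        using lim
      proof eventually_elim
        case (elim x)
        then have "(\<lambda>i. ennreal ((cmod (f n x - f (r i) x))\<^sup>2)) \<longlonglongrightarrow> ennreal ((cmod (f n x - F x))\<^sup>2)"
          by (intro tendsto_intros)
        then show ?case by (rule lim_imp_Liminf[OF sequentially_bot, symmetric])
      qed
    qed
    also have "\<dots> \<le> liminf (\<lambda>i. \<integral>\<^sup>+x. ennreal ((cmod (f n x - f (r i) x))\<^sup>2) \<partial>M)"
      by (rule nn_integral_liminf) measurable
    also have "\<dots> \<le> ennreal (((1/2)^k)\<^sup>2)"
    proof -
      have "(\<integral>\<^sup>+x. ennreal ((cmod (f n x - f (r i) x))\<^sup>2) \<partial>M) \<le> ennreal (((1/2)^k)\<^sup>2)" if i: "k \<le> i" for i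
      proof -
        have "R k \<le> r i" unfolding r_def using i by (intro member_le_sum) auto
        then have "L2n M (\<lambda>x. f n x - f (r i) x) \<le> (1/2)^k" using R[OF n, of "r i"] by simp
        then have "(L2n M (\<lambda>x. f n x - f (r i) x))\<^sup>2 \<le> ((1/2)^k)\<^sup>2" by (intro power_mono L2n_nonneg)
        then show ?thesis using nn_L2n[OF sqi_diff[OF f f], of n "r i"] by (simp add: ennreal_power)
      qed
      then show ?thesis by (intro Liminf_le) (auto intro: eventually_sequentiallyI)
    qed
    finally show ?thesis .
  qed
  have "square_integrable M (\<lambda>x. f (R 0) x - F x)"
    unfolding sqi_iff_nn using bound[of 0 "R 0"] by (auto simp: ennreal_power intro: le_less_trans)
  from sqi_diff[OF f this, of "R 0"] have F: "square_integrable M F" by simp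
  have "(\<lambda>n. L2n M (\<lambda>x. f n x - F x)) \<longlonglongrightarrow> 0"
  proof (rule LIMSEQ_I)
    fix e :: real assume e: "0 < e"
    then obtain k where k: "(1/2::real)^k < e" using real_arch_pow_inv[of e "1/2"] by auto
    have "L2n M (\<lambda>x. f n x - F x) < e" if n: "R k \<le> n" for n
    proof -
      have "ennreal ((L2n M (\<lambda>x. f n x - F x))\<^sup>2) \<le> ennreal (((1/2)^k)\<^sup>2)"
        using bound[OF n] nn_L2n[OF sqi_diff[OF f F], of n] by (simp add: ennreal_power)
      then have "(L2n M (\<lambda>x. f n x - F x))\<^sup>2 \<le> ((1/2)^k)\<^sup>2" by (simp add: ennreal_le_iff)
      then have "L2n M (\<lambda>x. f n x - F x) \<le> (1/2)^k" by (rule power2_le_imp_le) simp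
      then show ?thesis using k by simp
    qed
    then show "\<exists>no. \<forall>n\<ge>no. norm (L2n M (\<lambda>x. f n x - F x) - 0) < e"
      by (intro exI[of _ "R k"]) (auto simp: L2n_nonneg)
  qed
  with F that show ?thesis by blast
qed

text \<open>The unions of cells of all levels form a countable family.\<close>

lemma dense_sequence:
  assumes M: "lebesgue_prob_space M"
  obtains D :: "nat \<Rightarrow> 'm set" where "\<And>i. D i \<in> sets M" "\<And>B \<epsilon>. B \<in> sets M \<Longrightarrow> 0 < \<epsilon> \<Longrightarrow> \<exists>i. measure M (sym_diff B (D i)) < \<epsilon>"
proof -
  obtain A where A: "\<And>i. A i \<in> sets M" "\<And>B. B \<in> sets M \<Longrightarrow> approximable M A B"
    using lebesgue_generators[OF M] by blast
  let ?C = "\<Union>n. (\<lambda>S. cellset M A n S) ` Pow (Pow {..<n})"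
  have "countable ?C" by (intro countable_UN[OF countableI_type] countable_finite finite_imageI) simp
  moreover have "?C \<noteq> {}" by auto
  ultimately have rg: "range (from_nat_into ?C) = ?C" by (intro range_from_nat_into)
  have D: "from_nat_into ?C i \<in> sets M" for i
  proof -
    have "from_nat_into ?C i \<in> ?C" using rg by blast
    then show ?thesis using sets_cellset[of A M] A(1) by auto
  qed
  have "\<exists>i. measure M (sym_diff B (from_nat_into ?C i)) < \<epsilon>" if B: "B \<in> sets M" and e: "0 < \<epsilon>" for B \<epsilon>
  proof -
    obtain n S where nS: "measure M (sym_diff B (cellset M A n S)) < \<epsilon>" using A(2)[OF B] e by (auto simp: approximable_def)
    have "cellset M A n S = cellset M A n (S \<inter> Pow {..<n})" using cell_Pow[of A n] by (auto simp: cellset_def)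
    then have "cellset M A n S \<in> ?C" by blast
    then have "cellset M A n S \<in> range (from_nat_into ?C)" unfolding rg .
    then obtain i where i: "cellset M A n S = from_nat_into ?C i" by (rule rangeE)
    from nS show ?thesis unfolding i by (rule exI)
  qed
  with D that show ?thesis by blast
qed

lemma (in finite_measure) L2n_indicator_diff:
  assumes [measurable]: "A \<in> sets M" "B \<in> sets M"
  shows "L2n M (\<lambda>x. indicator A x - indicator B x) = sqrt (measure M (sym_diff A B))"
proof -
  have "(\<integral>x. (cmod (indicator A x - indicator B x))\<^sup>2 \<partial>M) = (\<integral>x. indicator (sym_diff A B) x \<partial>M)"
    by (intro Bochner_Integration.integral_cong refl) (auto simp: indicator_def)
  then show ?thesis unfolding L2n_def by (simp add: measure_def[symmetric] Int_absorb2 sets.sets_into_space)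
qed

text \<open>A separable \<open>L\<^sup>2\<close> space as a Hilbert space of sequences. A dense sequence of sets separates integrable functions, so
their integrals over these sets can serve as coordinates.\<close>

locale L2_space = prob_space M for M :: "'m measure" +
  fixes D :: "nat \<Rightarrow> 'm set"
  assumes D[measurable]: "\<And>i. D i \<in> sets M"
    and D_dense: "\<And>B \<epsilon>. B \<in> sets M \<Longrightarrow> 0 < \<epsilon> \<Longrightarrow> \<exists>i. measure M (sym_diff B (D i)) < \<epsilon>"
begin

abbreviation "sqi \<equiv> square_integrable M"

text \<open>The value that the additive inverse takes at points outside the carrier, where it is a description without
solution. A metric space has a symmetric and nonnegative distance also outside its carrier; this
holds if \<open>c0\<close> is not in the carrier and differences outside the carrier are \<open>c0\<close>, whose
representative is the zero function.\<close>

definition c0 :: hpoint where "c0 = (THE z. False)"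

text \<open>The coordinate \<open>0\<close> keeps \<open>c0\<close> out of the image.\<close>

definition emb :: "('m \<Rightarrow> complex) \<Rightarrow> hpoint" where
  "emb f = (\<lambda>i. case i of 0 \<Rightarrow> c0 0 + 1 | Suc k \<Rightarrow> (\<integral>x. indicator (D k) x * f x \<partial>M))"

definition C :: "hpoint set" where "C = emb ` {f. sqi f}"

definition rep :: "hpoint \<Rightarrow> 'm \<Rightarrow> complex" where
  "rep x = (if x \<in> C then (SOME f. sqi f \<and> emb f = x) else (\<lambda>_. 0))"

lemma c0: "c0 \<notin> C"
proof
  assume "c0 \<in> C"
  then obtain f where "c0 = emb f" by (auto simp: C_def)
  then have "c0 0 = c0 0 + 1" by (metis emb_def nat.case(1))
  then show False by simp
qed

lemma emb_C: "sqi f \<Longrightarrow> emb f \<in> C" by (auto simp: C_def)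

lemma emb_cong: "AE x in M. f x = g x \<Longrightarrow> sqi f \<Longrightarrow> sqi g \<Longrightarrow> emb f = emb g"
proof (rule ext)
  fix i assume ae: "AE x in M. f x = g x" and "sqi f" "sqi g"
  then have [measurable]: "f \<in> borel_measurable M" "g \<in> borel_measurable M" by (auto simp: square_integrable_def)
  show "emb f i = emb g i" unfolding emb_def
    by (cases i) (auto intro!: integral_cong_AE ae[THEN eventually_mono])
qed

text \<open>The integrals over all measurable sets are limits of those over the dense sequence, by the
Cauchy-Schwarz inequality.\<close>

lemma emb_inj:
  assumes f: "sqi f" and g: "sqi g" and eq: "emb f = emb g"
  shows "AE x in M. f x = g x"
proof -
  let ?d = "\<lambda>x. f x - g x"
  have d: "sqi ?d" by (rule sqi_diff[OF f g])
  have Dk: "(\<integral>x. indicator (D k) x * ?d x \<partial>M) = 0" for k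
  proof -
    have "(\<integral>x. indicator (D k) x * f x \<partial>M) = (\<integral>x. indicator (D k) x * g x \<partial>M)"
      using fun_cong[OF eq, of "Suc k"] by (simp add: emb_def)
    then show ?thesis
      using sqi_mult_integrable[OF sqi_indicator[OF D] f, of k] sqi_mult_integrable[OF sqi_indicator[OF D] g, of k]
      by (simp add: right_diff_distrib)
  qed
  have B: "(\<integral>x. indicator B x * ?d x \<partial>M) = 0" if B: "B \<in> sets M" for B
  proof (rule ccontr)
    let ?I = "\<integral>x. indicator B x * ?d x \<partial>M"
    assume "?I \<noteq> 0"
    then have pos: "0 < cmod ?I / (L2n M ?d + 1)" by (simp add: L2n_nonneg add_nonneg_pos)
    then obtain i where i: "measure M (sym_diff B (D i)) < (cmod ?I / (L2n M ?d + 1))\<^sup>2" using D_dense[OF B] by (meson zero_less_power)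
    have "?I = (\<integral>x. (indicator B x - indicator (D i) x) * ?d x \<partial>M)"
      using Dk[of i] sqi_mult_integrable[OF sqi_indicator[OF D] d, of i] sqi_mult_integrable[OF sqi_indicator[OF B] d]
      by (simp add: left_diff_distrib)
    then have "cmod ?I \<le> L2n M (\<lambda>x. indicator B x - indicator (D i) x) * L2n M ?d"
      using integral_CS[OF sqi_diff[OF sqi_indicator[OF B] sqi_indicator[OF D]] d, of i] by simp
    also have "\<dots> \<le> (cmod ?I / (L2n M ?d + 1)) * L2n M ?d"
    proof (rule mult_right_mono[OF _ L2n_nonneg])
      have "sqrt (measure M (sym_diff B (D i))) \<le> sqrt ((cmod ?I / (L2n M ?d + 1))\<^sup>2)" using i by (intro real_sqrt_le_mono) simp
      then show "L2n M (\<lambda>x. indicator B x - indicator (D i) x) \<le> cmod ?I / (L2n M ?d + 1)"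
        using pos less_imp_le[OF pos] by (simp only: L2n_indicator_diff[OF B D] real_sqrt_abs abs_of_nonneg)
    qed
    also have "\<dots> < cmod ?I"
    proof -
      have n: "0 \<le> L2n M ?d" by (rule L2n_nonneg)
      have "L2n M ?d / (L2n M ?d + 1) < 1" using n by simp
      then have "cmod ?I * (L2n M ?d / (L2n M ?d + 1)) < cmod ?I * 1" using \<open>?I \<noteq> 0\<close> by (intro mult_strict_left_mono) auto
      then show ?thesis by simp
    qed
    finally show False by simp
  qed
  have "AE x in M. ?d x = 0"
  proof (rule density_zero[OF sqi_integrable1[OF d]])
    fix B assume B': "B \<in> sets M"
    have "set_lebesgue_integral M B ?d = (\<integral>x. indicator B x * ?d x \<partial>M)"
      unfolding set_lebesgue_integral_def by (intro Bochner_Integration.integral_cong refl) (simp add: indicator_def)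
    then show "set_lebesgue_integral M B ?d = 0" using B[OF B'] by simp
  qed
  then show ?thesis by eventually_elim simp
qed

lemma rep:
  assumes "x \<in> C" shows "sqi (rep x)" "emb (rep x) = x"
proof -
  have ex: "\<exists>f. sqi f \<and> emb f = x" using assms by (auto simp: C_def)
  have eq: "rep x = (SOME f. sqi f \<and> emb f = x)" using assms by (simp add: rep_def)
  show "sqi (rep x)" unfolding eq by (rule someI2_ex[OF ex]) blast
  show "emb (rep x) = x" unfolding eq by (rule someI2_ex[OF ex]) blast
qed

lemma rep_emb: "sqi f \<Longrightarrow> AE x in M. rep (emb f) x = f x"
  using emb_inj[OF rep(1)[OF emb_C] _ rep(2)[OF emb_C]] by blast

lemma rep_sqi: "sqi (rep x)"
proof (cases "x \<in> C")
  case False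
  then have "rep x = (\<lambda>_. 0)" by (simp add: rep_def)
  then show ?thesis by (simp add: sqi_zero)
qed (rule rep(1))

text \<open>The operations act on representatives. Addition is \<open>c0\<close> outside the carrier in order to make the distance
symmetric there.\<close>

definition L2H :: "hpoint hilbert" where
  "L2H = \<lparr>carrier = C, monoid.mult = (\<lambda>x y. x), one = c0, ring.zero = emb (\<lambda>_. 0),
     add = (\<lambda>x y. if x \<in> C \<and> y \<in> C then emb (\<lambda>m. rep x m + rep y m) else c0),
     smult = (\<lambda>c x. emb (\<lambda>m. c * rep x m)),
     hip = (\<lambda>x y. \<integral>m. rep x m * cnj (rep y m) \<partial>M)\<rparr>"

lemma L2H_sel: "carrier L2H = C" "\<zero>\<^bsub>L2H\<^esub> = emb (\<lambda>_. 0)"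
  "hip L2H x y = (\<integral>m. rep x m * cnj (rep y m) \<partial>M)"
  "c \<odot>\<^bsub>L2H\<^esub> x = emb (\<lambda>m. c * rep x m)"
  "x \<oplus>\<^bsub>L2H\<^esub> y = (if x \<in> C \<and> y \<in> C then emb (\<lambda>m. rep x m + rep y m) else c0)"
  by (simp_all add: L2H_def)

lemma add_emb: "sqi f \<Longrightarrow> sqi g \<Longrightarrow> emb f \<oplus>\<^bsub>L2H\<^esub> emb g = emb (\<lambda>m. f m + g m)"
proof -
  assume f: "sqi f" and g: "sqi g"
  have "emb (\<lambda>m. rep (emb f) m + rep (emb g) m) = emb (\<lambda>m. f m + g m)"
    by (rule emb_cong) (use rep_emb[OF f] rep_emb[OF g] in \<open>eventually_elim, simp\<close>, auto intro: sqi_add rep_sqi f g)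
  then show ?thesis using f g by (simp add: L2H_sel emb_C)
qed

lemma smult_emb: "sqi f \<Longrightarrow> c \<odot>\<^bsub>L2H\<^esub> emb f = emb (\<lambda>m. c * f m)"
proof -
  assume f: "sqi f"
  show ?thesis unfolding L2H_sel
    by (rule emb_cong) (use rep_emb[OF f] in \<open>eventually_elim, simp\<close>, auto intro: sqi_cmult rep_sqi f)
qed

lemma hip_emb: "sqi f \<Longrightarrow> sqi g \<Longrightarrow> hip L2H (emb f) (emb g) = (\<integral>m. f m * cnj (g m) \<partial>M)"
proof -
  assume f: "sqi f" and g: "sqi g"
  have [measurable]: "(\<lambda>m. rep (emb f) m * cnj (rep (emb g) m)) \<in> borel_measurable M" "(\<lambda>m. f m * cnj (g m)) \<in> borel_measurable M"
    using sqi_mult_integrable[OF rep_sqi sqi_cnj[OF rep_sqi]] sqi_mult_integrable[OF f sqi_cnj[OF g]] by auto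
  have ae: "AE m in M. rep (emb f) m * cnj (rep (emb g) m) = f m * cnj (g m)"
    using rep_emb[OF f] rep_emb[OF g] by eventually_elim simp
  show ?thesis unfolding L2H_sel by (rule integral_cong_AE[OF _ _ ae]) measurable
qed

lemma C_cases: assumes "x \<in> C" obtains f where "sqi f" "x = emb f"
  using assms by (auto simp: C_def)

lemma abelian: "abelian_group L2H"
proof (rule abelian_groupI, unfold L2H_sel(1,2))
  fix x y assume "x \<in> C" "y \<in> C"
  then show "x \<oplus>\<^bsub>L2H\<^esub> y \<in> C" by (elim C_cases) (simp add: add_emb emb_C sqi_add)
next
  show "emb (\<lambda>_. 0) \<in> C" by (rule emb_C[OF sqi_zero])
next
  fix x y z assume "x \<in> C" "y \<in> C" "z \<in> C"
  then show "x \<oplus>\<^bsub>L2H\<^esub> y \<oplus>\<^bsub>L2H\<^esub> z = x \<oplus>\<^bsub>L2H\<^esub> (y \<oplus>\<^bsub>L2H\<^esub> z)"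
    by (elim C_cases) (simp add: add_emb sqi_add add.assoc)
next
  fix x y assume "x \<in> C" "y \<in> C"
  then show "x \<oplus>\<^bsub>L2H\<^esub> y = y \<oplus>\<^bsub>L2H\<^esub> x" by (elim C_cases) (simp add: add_emb add.commute)
next
  fix x assume "x \<in> C"
  then show "emb (\<lambda>_. 0) \<oplus>\<^bsub>L2H\<^esub> x = x" by (elim C_cases) (simp add: add_emb sqi_zero)
next
  fix x assume "x \<in> C"
  then obtain f where f: "sqi f" "x = emb f" by (rule C_cases)
  have m: "sqi (\<lambda>m. - f m)" using sqi_cmult[OF f(1), of "-1"] by simp
  show "\<exists>y\<in>C. y \<oplus>\<^bsub>L2H\<^esub> x = emb (\<lambda>_. 0)"
    using f m by (intro bexI[of _ "emb (\<lambda>m. - f m)"]) (auto simp: add_emb emb_C)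
qed

lemma cring_complex_ring: "cring complex_ring"
proof (rule cringI)
  show "abelian_group complex_ring"
    by (rule abelian_groupI) (auto simp: complex_ring_def add.assoc add.commute intro: exI[of _ "- x" for x] left_minus)
  show "comm_monoid complex_ring" by (rule comm_monoidI) (auto simp: complex_ring_def mult_ac)
qed (auto simp: complex_ring_def ring_distribs)

lemma module_L2H: "Module.module complex_ring L2H"
proof (rule moduleI[OF cring_complex_ring abelian], unfold L2H_sel(1))
  fix a x assume "x \<in> C"
  then show "a \<odot>\<^bsub>L2H\<^esub> x \<in> C" by (elim C_cases) (simp add: smult_emb emb_C sqi_cmult)
next
  fix a b x assume "x \<in> C"
  then show "(a \<oplus>\<^bsub>complex_ring\<^esub> b) \<odot>\<^bsub>L2H\<^esub> x = a \<odot>\<^bsub>L2H\<^esub> x \<oplus>\<^bsub>L2H\<^esub> b \<odot>\<^bsub>L2H\<^esub> x"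
    by (elim C_cases) (simp add: smult_emb add_emb sqi_cmult complex_ring_def ring_distribs)
next
  fix a x y assume "x \<in> C" "y \<in> C"
  then show "a \<odot>\<^bsub>L2H\<^esub> (x \<oplus>\<^bsub>L2H\<^esub> y) = a \<odot>\<^bsub>L2H\<^esub> x \<oplus>\<^bsub>L2H\<^esub> a \<odot>\<^bsub>L2H\<^esub> y"
    by (elim C_cases) (simp add: smult_emb add_emb sqi_cmult sqi_add ring_distribs)
next
  fix a b x assume "x \<in> C"
  then show "(a \<otimes>\<^bsub>complex_ring\<^esub> b) \<odot>\<^bsub>L2H\<^esub> x = a \<odot>\<^bsub>L2H\<^esub> (b \<odot>\<^bsub>L2H\<^esub> x)"
    by (elim C_cases) (simp add: smult_emb sqi_cmult complex_ring_def mult.assoc)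
next
  fix x assume "x \<in> C"
  then show "\<one>\<^bsub>complex_ring\<^esub> \<odot>\<^bsub>L2H\<^esub> x = x" by (elim C_cases) (simp add: smult_emb complex_ring_def)
qed

lemma minus_emb:
  assumes f: "sqi f" and g: "sqi g" shows "emb f \<ominus>\<^bsub>L2H\<^esub> emb g = emb (\<lambda>m. f m - g m)"
proof -
  interpret abelian_group L2H by (rule abelian)
  have m: "sqi (\<lambda>m. - g m)" using sqi_cmult[OF g, of "-1"] by simp
  have "\<ominus>\<^bsub>L2H\<^esub> emb g = emb (\<lambda>m. - g m)"
    by (rule minus_equality) (simp_all add: L2H_sel(1,2) emb_C g m add_emb)
  then show ?thesis unfolding a_minus_def using f m by (simp add: add_emb)
qed

lemma minus_off: assumes "\<not> (x \<in> C \<and> y \<in> C)" shows "x \<ominus>\<^bsub>L2H\<^esub> y = c0"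
proof (cases "y \<in> C")
  case True
  then show ?thesis using assms by (simp add: a_minus_def L2H_sel(5))
next
  case False
  have "\<And>z. y \<oplus>\<^bsub>L2H\<^esub> z \<noteq> emb (\<lambda>_. 0)" using False c0 emb_C[OF sqi_zero] by (simp add: L2H_sel(5)) metis
  then have "\<ominus>\<^bsub>L2H\<^esub> y = c0" by (simp add: a_inv_def m_inv_def c0_def L2H_sel(2))
  then show ?thesis using c0 by (simp add: a_minus_def L2H_sel(5))
qed

lemma hdist_emb: "sqi f \<Longrightarrow> sqi g \<Longrightarrow> hdist L2H (emb f) (emb g) = L2n M (\<lambda>m. f m - g m)"
  using integral_mult_cnj[of M "\<lambda>m. f m - g m"] unfolding hdist_def
  by (simp add: minus_emb hip_emb sqi_diff L2n_nonneg del: complex_cnj_diff)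

lemma hdist_off: "\<not> (x \<in> C \<and> y \<in> C) \<Longrightarrow> hdist L2H x y = 0"
  unfolding hdist_def using c0 by (simp add: minus_off L2H_sel(3) rep_def)

lemma metric: "Metric_space C (hdist L2H)"
proof
  fix x y
  show "0 \<le> hdist L2H x y"
  proof (cases "x \<in> C \<and> y \<in> C")
    case True
    then show ?thesis by (elim conjE C_cases) (simp add: hdist_emb L2n_nonneg)
  qed (simp add: hdist_off)
  show "hdist L2H x y = hdist L2H y x"
  proof (cases "x \<in> C \<and> y \<in> C")
    case True
    then show ?thesis by (elim conjE C_cases) (simp only: hdist_emb, rule L2n_minus_commute)
  next
    case False
    then have "\<not> (y \<in> C \<and> x \<in> C)" by blast
    then show ?thesis using hdist_off[OF False] hdist_off by simp
  qed
next
  fix x y assume "x \<in> C" "y \<in> C"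
  then obtain f g where f: "sqi f" "x = emb f" and g: "sqi g" "y = emb g" by (elim C_cases) blast
  show "hdist L2H x y = 0 \<longleftrightarrow> x = y"
  proof
    assume "hdist L2H x y = 0"
    then have "AE m in M. f m - g m = 0" using f g L2n_0_iff[OF sqi_diff[OF f(1) g(1)]] by (simp add: hdist_emb)
    then have "AE m in M. f m = g m" by eventually_elim simp
    then show "x = y" using f g emb_cong by simp
  next
    assume "x = y"
    then have "hdist L2H x y = L2n M (\<lambda>m. f m - f m)" using hdist_emb[OF f(1) f(1)] by (simp only: f(2)[symmetric])
    then show "hdist L2H x y = 0" by (simp add: L2n_def)
  qed
next
  fix x y z assume "x \<in> C" "y \<in> C" "z \<in> C"
  then obtain f g h where "sqi f" "x = emb f" "sqi g" "y = emb g" "sqi h" "z = emb h" by (elim C_cases) blast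
  then show "hdist L2H x z \<le> hdist L2H x y + hdist L2H y z" by (simp add: hdist_emb L2n_diff_triangle)
qed

sublocale L2: Metric_space C "hdist L2H" by (rule metric)

lemma complete_L2H: "L2.mcomplete"
  unfolding L2.mcomplete_def
proof (intro allI impI)
  fix \<sigma> assume "L2.MCauchy \<sigma>"
  then have \<sigma>: "\<And>n. \<sigma> n \<in> C" and cau: "\<And>\<epsilon>. 0 < \<epsilon> \<Longrightarrow> \<exists>N. \<forall>n n'. N \<le> n \<longrightarrow> N \<le> n' \<longrightarrow> hdist L2H (\<sigma> n) (\<sigma> n') < \<epsilon>"
    by (auto simp: L2.MCauchy_def)
  define f where "f n = rep (\<sigma> n)" for n
  have f: "sqi (f n)" and \<sigma>f: "\<sigma> n = emb (f n)" for n using rep[OF \<sigma>] by (auto simp: f_def)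
  obtain F where F: "sqi F" "(\<lambda>n. L2n M (\<lambda>x. f n x - F x)) \<longlonglongrightarrow> 0"
  proof (rule L2_complete[of f])
    show "sqi (f n)" for n by (rule f)
    show "\<exists>N. \<forall>n m. N \<le> n \<longrightarrow> N \<le> m \<longrightarrow> L2n M (\<lambda>x. f n x - f m x) < \<epsilon>" if "0 < \<epsilon>" for \<epsilon>
      using cau[OF that] by (simp add: \<sigma>f hdist_emb f)
  qed
  have "limitin L2.mtopology \<sigma> (emb F) sequentially"
    unfolding L2.limitin_metric
  proof (intro conjI allI impI)
    show "emb F \<in> C" using F by (simp add: emb_C)
    fix \<epsilon> :: real assume "0 < \<epsilon>"
    from order_tendstoD(2)[OF F(2) this] show "\<forall>\<^sub>F n in sequentially. \<sigma> n \<in> C \<and> hdist L2H (\<sigma> n) (emb F) < \<epsilon>"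
      by eventually_elim (simp add: \<sigma>f hdist_emb f F emb_C)
  qed
  then show "\<exists>x. limitin L2.mtopology \<sigma> x sequentially" by blast
qed

text \<open>Finite linear combinations of the dense sets; with complex rational coefficients they form the countable dense subset
that separability asks for.\<close>

definition comb :: "(complex \<times> nat) list \<Rightarrow> 'm \<Rightarrow> complex" where
  "comb l x = (\<Sum>(c, i)\<leftarrow>l. c * indicator (D i) x)"

lemma comb_Nil: "comb [] x = 0" by (simp add: comb_def)
lemma comb_Cons: "comb ((c, i) # l) x = c * indicator (D i) x + comb l x" by (simp add: comb_def)
lemma comb_append: "comb (l @ l') x = comb l x + comb l' x" by (simp add: comb_def)
lemma comb_scale: "comb (map (\<lambda>(c, i). (q * c, i)) l) x = q * comb l x"
  by (induction l) (auto simp: comb_Nil comb_Cons ring_distribs mult.assoc)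
lemma comb_sqi: "sqi (comb l)"
proof (induction l)
  case Nil then show ?case using sqi_zero by (simp add: comb_Nil[abs_def])
next
  case (Cons a l)
  obtain c i where a: "a = (c, i)" by (cases a)
  have "comb (a # l) = (\<lambda>x. c * indicator (D i) x + comb l x)" by (simp add: fun_eq_iff a comb_Cons)
  then show ?case using Cons by (simp add: sqi_add sqi_cmult sqi_indicator)
qed

definition rational_complex :: "complex set" where "rational_complex = (\<lambda>(a, b). Complex a b) ` (\<rat> \<times> \<rat>)"

lemma countable_Qc: "countable rational_complex" unfolding rational_complex_def by (intro countable_image countable_SIGMA countable_rat)

lemma rational_complex_mult: "a \<in> rational_complex \<Longrightarrow> b \<in> rational_complex \<Longrightarrow> a * b \<in> rational_complex"
  by (auto simp: rational_complex_def image_iff complex_eq_iff intro!: bexI[of _ "(Re (a * b), Im (a * b))"])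

lemma rational_complex_dense: "0 < \<epsilon> \<Longrightarrow> \<exists>q\<in>rational_complex. cmod (c - q) < \<epsilon>"
proof -
  assume e: "0 < \<epsilon>"
  obtain a where a: "a \<in> \<rat>" "Re c - \<epsilon> / 2 < a" "a < Re c" using Rats_dense_in_real[of "Re c - \<epsilon> / 2" "Re c"] e by auto
  obtain b where b: "b \<in> \<rat>" "Im c - \<epsilon> / 2 < b" "b < Im c" using Rats_dense_in_real[of "Im c - \<epsilon> / 2" "Im c"] e by auto
  have "cmod (c - Complex a b) \<le> \<bar>Re (c - Complex a b)\<bar> + \<bar>Im (c - Complex a b)\<bar>" by (rule cmod_le)
  also have "\<dots> < \<epsilon>" using a b by simp
  finally show ?thesis using a b by (intro bexI[of _ "Complex a b"]) (auto simp: rational_complex_def)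
qed

definition rational_combs :: "('m \<Rightarrow> complex) set" where "rational_combs = comb ` lists (rational_complex \<times> UNIV)"

definition comb_closure :: "('m \<Rightarrow> complex) set" where "comb_closure = {f. sqi f \<and> (\<forall>\<epsilon>>0. \<exists>s\<in>rational_combs. L2n M (\<lambda>x. f x - s x) < \<epsilon>)}"

lemma rational_combs_sqi: "s \<in> rational_combs \<Longrightarrow> sqi s" by (auto simp: rational_combs_def comb_sqi)

lemma rational_combs_add: "s \<in> rational_combs \<Longrightarrow> t \<in> rational_combs \<Longrightarrow> (\<lambda>x. s x + t x) \<in> rational_combs"
proof -
  assume "s \<in> rational_combs" "t \<in> rational_combs"
  then obtain l l' where l: "l \<in> lists (rational_complex \<times> UNIV)" "s = comb l" "l' \<in> lists (rational_complex \<times> UNIV)" "t = comb l'" by (auto simp: rational_combs_def)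
  then have "(\<lambda>x. s x + t x) = comb (l @ l')" by (simp add: comb_append fun_eq_iff)
  then show ?thesis using l by (auto simp: rational_combs_def)
qed

lemma rational_combs_scale: "q \<in> rational_complex \<Longrightarrow> s \<in> rational_combs \<Longrightarrow> (\<lambda>x. q * s x) \<in> rational_combs"
proof -
  assume q: "q \<in> rational_complex" and "s \<in> rational_combs"
  then obtain l where l: "l \<in> lists (rational_complex \<times> UNIV)" "s = comb l" by (auto simp: rational_combs_def)
  have "(\<lambda>x. q * s x) = comb (map (\<lambda>(c, i). (q * c, i)) l)" using l by (simp add: comb_scale fun_eq_iff)
  moreover have "map (\<lambda>(c, i). (q * c, i)) l \<in> lists (rational_complex \<times> UNIV)" using l(1) q by (auto simp: in_lists_conv_set rational_complex_mult)
  ultimately show ?thesis by (auto simp: rational_combs_def)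
qed

lemma comb_closure_limit:
  assumes f: "sqi f" and "\<And>\<epsilon>. 0 < \<epsilon> \<Longrightarrow> \<exists>g\<in>comb_closure. L2n M (\<lambda>x. f x - g x) < \<epsilon>"
  shows "f \<in> comb_closure"
  unfolding comb_closure_def
proof (intro CollectI conjI allI impI f)
  fix \<epsilon> :: real assume e: "0 < \<epsilon>"
  obtain g where g: "g \<in> comb_closure" "L2n M (\<lambda>x. f x - g x) < \<epsilon> / 2" using assms(2)[of "\<epsilon> / 2"] e by auto
  then obtain s where s: "s \<in> rational_combs" "L2n M (\<lambda>x. g x - s x) < \<epsilon> / 2" using e by (auto simp: comb_closure_def dest: spec[of _ "\<epsilon> / 2"])
  have "sqi g" using g by (simp add: comb_closure_def)
  then have "L2n M (\<lambda>x. f x - s x) < \<epsilon>" using L2n_diff_triangle[OF f _ rational_combs_sqi[OF s(1)], of g] g s by simp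
  then show "\<exists>s\<in>rational_combs. L2n M (\<lambda>x. f x - s x) < \<epsilon>" using s by blast
qed

lemma comb_closure_add:
  assumes "f \<in> comb_closure" "g \<in> comb_closure" shows "(\<lambda>x. f x + g x) \<in> comb_closure"
  unfolding comb_closure_def
proof (intro CollectI conjI allI impI)
  have fg: "sqi f" "sqi g" using assms by (auto simp: comb_closure_def)
  then show "sqi (\<lambda>x. f x + g x)" by (rule sqi_add)
  fix \<epsilon> :: real assume e: "0 < \<epsilon>"
  obtain s where s: "s \<in> rational_combs" "L2n M (\<lambda>x. f x - s x) < \<epsilon> / 2" using assms(1) e by (auto simp: comb_closure_def dest: spec[of _ "\<epsilon> / 2"])
  obtain t where t: "t \<in> rational_combs" "L2n M (\<lambda>x. g x - t x) < \<epsilon> / 2" using assms(2) e by (auto simp: comb_closure_def dest: spec[of _ "\<epsilon> / 2"])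
  have "L2n M (\<lambda>x. (f x - s x) + (g x - t x)) \<le> L2n M (\<lambda>x. f x - s x) + L2n M (\<lambda>x. g x - t x)"
    by (intro L2n_triangle sqi_diff fg rational_combs_sqi s t)
  moreover have "(\<lambda>x. (f x - s x) + (g x - t x)) = (\<lambda>x. f x + g x - (s x + t x))" by auto
  ultimately have "L2n M (\<lambda>x. f x + g x - (s x + t x)) < \<epsilon>" using s t by simp
  then show "\<exists>s\<in>rational_combs. L2n M (\<lambda>x. f x + g x - s x) < \<epsilon>" using rational_combs_add[OF s(1) t(1)] by (intro bexI[of _ "\<lambda>x. s x + t x"]) auto
qed

lemma comb_closure_scale:
  assumes "f \<in> comb_closure" shows "(\<lambda>x. c * f x) \<in> comb_closure"
proof (rule comb_closure_limit)
  have f: "sqi f" using assms by (simp add: comb_closure_def)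
  then show "sqi (\<lambda>x. c * f x)" by (rule sqi_cmult)
  fix \<epsilon> :: real assume e: "0 < \<epsilon>"
  have n: "0 < L2n M f + 1" by (simp add: L2n_nonneg add_nonneg_pos)
  obtain q where q: "q \<in> rational_complex" "cmod (c - q) < \<epsilon> / (L2n M f + 1)" using rational_complex_dense[of "\<epsilon> / (L2n M f + 1)" c] e n by auto
  have qf: "(\<lambda>x. q * f x) \<in> comb_closure"
    unfolding comb_closure_def
  proof (intro CollectI conjI allI impI sqi_cmult f)
    fix \<delta> :: real assume d: "0 < \<delta>"
    have m: "0 < cmod q + 1" by (simp add: add_nonneg_pos)
    obtain s where s: "s \<in> rational_combs" "L2n M (\<lambda>x. f x - s x) < \<delta> / (cmod q + 1)" using assms d m by (auto simp: comb_closure_def dest: spec[of _ "\<delta> / (cmod q + 1)"])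
    have "(\<lambda>x. q * f x - q * s x) = (\<lambda>x. q * (f x - s x))" by (simp add: right_diff_distrib)
    then have "L2n M (\<lambda>x. q * f x - q * s x) = cmod q * L2n M (\<lambda>x. f x - s x)" by (simp only: L2n_cmult)
    also have "\<dots> \<le> cmod q * (\<delta> / (cmod q + 1))" using s by (intro mult_left_mono) auto
    also have "\<dots> < \<delta>" using m d by (simp add: field_simps)
    finally show "\<exists>s\<in>rational_combs. L2n M (\<lambda>x. q * f x - s x) < \<delta>" using rational_combs_scale[OF q(1) s(1)] by (intro bexI[of _ "\<lambda>x. q * s x"]) auto
  qed
  have "(\<lambda>x. c * f x - q * f x) = (\<lambda>x. (c - q) * f x)" by (simp add: left_diff_distrib)
  then have "L2n M (\<lambda>x. c * f x - q * f x) = cmod (c - q) * L2n M f" by (simp only: L2n_cmult)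
  also have "\<dots> \<le> (\<epsilon> / (L2n M f + 1)) * L2n M f" using q by (intro mult_right_mono L2n_nonneg) auto
  also have "\<dots> < \<epsilon>" using n e by (simp add: field_simps)
  finally show "\<exists>g\<in>comb_closure. L2n M (\<lambda>x. c * f x - g x) < \<epsilon>" using qf by (intro bexI[of _ "\<lambda>x. q * f x"])
qed

lemma comb_closure_indicator: assumes B: "B \<in> sets M" shows "indicator B \<in> comb_closure"
  unfolding comb_closure_def
proof (intro CollectI conjI allI impI sqi_indicator B)
  fix \<epsilon> :: real assume e: "0 < \<epsilon>"
  then have "0 < \<epsilon>\<^sup>2" by simp
  then obtain i where i: "measure M (sym_diff B (D i)) < \<epsilon>\<^sup>2" using D_dense[OF B] by blast
  have "comb [(1, i)] = indicator (D i)" by (simp add: fun_eq_iff comb_Cons comb_Nil)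
  moreover have "1 \<in> rational_complex" by (auto simp: rational_complex_def image_iff complex_eq_iff intro!: bexI[of _ "(1, 0)"])
  ultimately have s: "indicator (D i) \<in> rational_combs" unfolding rational_combs_def by (intro image_eqI[of _ _ "[(1, i)]"]) auto
  have "L2n M (\<lambda>x. indicator B x - indicator (D i) x) = sqrt (measure M (sym_diff B (D i)))" by (rule L2n_indicator_diff[OF B D])
  also have "\<dots> < sqrt (\<epsilon>\<^sup>2)" using i by (rule real_sqrt_less_mono)
  finally show "\<exists>s\<in>rational_combs. L2n M (\<lambda>x. indicator B x - s x) < \<epsilon>" using s e by auto
qed

lemma comb_closure_all: assumes f: "sqi f" shows "f \<in> comb_closure"
proof (rule comb_closure_limit[OF f])
  fix \<epsilon> :: real assume e: "0 < \<epsilon>"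
  obtain F where F: "\<And>i. simple_function M (F i)" "\<And>i. sqi (F i)" "(\<lambda>i. L2n M (\<lambda>x. F i x - f x)) \<longlonglongrightarrow> 0"
    using L2_simple_approx[OF f, of thesis] by blast
  obtain i where i: "L2n M (\<lambda>x. F i x - f x) < \<epsilon>" using order_tendstoD(2)[OF F(3) e] by (auto simp: eventually_sequentially)
  let ?Y = "F i ` space M"
  let ?g = "\<lambda>x. \<Sum>y\<in>?Y. y * indicator (F i -` {y} \<inter> space M) x"
  have fin: "finite ?Y" using F(1) by (simp add: simple_function_def)
  have S: "F i -` {y} \<inter> space M \<in> sets M" for y using F(1) by (rule simple_functionD)
  have "(\<lambda>x. \<Sum>y\<in>Y. y * indicator (F i -` {y} \<inter> space M) x) \<in> comb_closure" if "finite Y" for Y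
    using that
  proof (induction Y rule: finite_induct)
    case empty
    have "(\<lambda>x. 0 * indicator {} x) \<in> comb_closure" by (intro comb_closure_scale comb_closure_indicator) simp
    then show ?case by simp
  next
    case (insert y Y)
    have "(\<lambda>x. y * indicator (F i -` {y} \<inter> space M) x + (\<Sum>y\<in>Y. y * indicator (F i -` {y} \<inter> space M) x)) \<in> comb_closure"
      by (intro comb_closure_add comb_closure_scale comb_closure_indicator S insert.IH)
    then show ?case by (simp only: sum.insert[OF insert.hyps])
  qed
  then have g: "?g \<in> comb_closure" using fin by blast
  then have gs: "sqi ?g" by (simp add: comb_closure_def)
  have eq: "F i x = ?g x" if x: "x \<in> space M" for x
  proof -
    have "?g x = (\<Sum>y\<in>{F i x}. y * indicator (F i -` {y} \<inter> space M) x)"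
      by (rule sum.mono_neutral_right) (use fin x in \<open>auto simp: indicator_def\<close>)
    then show ?thesis using x by simp
  qed
  have "L2n M (\<lambda>x. f x - ?g x) = L2n M (\<lambda>x. f x - F i x)"
    unfolding L2n_def by (intro arg_cong[where f=sqrt] Bochner_Integration.integral_cong refl) (simp only: eq[symmetric])
  then have "L2n M (\<lambda>x. f x - ?g x) < \<epsilon>" using i L2n_minus_commute[of M f "F i"] by simp
  then show "\<exists>g\<in>comb_closure. L2n M (\<lambda>x. f x - g x) < \<epsilon>" by (rule bexI[OF _ g])
qed

lemma separable_L2H: "separable_space L2.mtopology"
  unfolding separable_space_def
proof (intro exI[of _ "emb ` rational_combs"] conjI)
  show "countable (emb ` rational_combs)" unfolding rational_combs_def
    by (intro countable_image countable_lists countable_SIGMA countable_Qc) simp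
  show "emb ` rational_combs \<subseteq> topspace L2.mtopology" using rational_combs_sqi by (auto simp: emb_C)
  show "L2.mtopology closure_of emb ` rational_combs = topspace L2.mtopology"
    unfolding L2.metric_closure_of L2.topspace_mtopology
  proof (intro equalityI subsetI CollectI conjI allI impI)
    fix x r assume x: "x \<in> C" and r: "0 < (r::real)"
    then obtain f where f: "sqi f" "x = emb f" by (elim C_cases)
    from comb_closure_all[OF f(1)] obtain s where s: "s \<in> rational_combs" "L2n M (\<lambda>x. f x - s x) < r" using r by (auto simp: comb_closure_def)
    then show "\<exists>y\<in>emb ` rational_combs. y \<in> L2.mball x r"
      using f rational_combs_sqi[OF s(1)] by (intro bexI[of _ "emb s"]) (auto simp: L2.in_mball emb_C hdist_emb)
  qed auto
qed

lemma hilbert_L2H: "separable_hilbert_space L2H"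
proof -
  interpret m: Module.module complex_ring L2H by (rule module_L2H)
  show ?thesis
  proof (unfold_locales, unfold L2H_sel(1))
    fix x y z assume "x \<in> C" "y \<in> C" "z \<in> C"
    then obtain f g h where f: "sqi f" "x = emb f" and g: "sqi g" "y = emb g" and h: "sqi h" "z = emb h" by (elim C_cases) blast
    show "hip L2H (x \<oplus>\<^bsub>L2H\<^esub> y) z = hip L2H x z + hip L2H y z"
      using f g h sqi_mult_integrable[OF f(1) sqi_cnj[OF h(1)]] sqi_mult_integrable[OF g(1) sqi_cnj[OF h(1)]]
      by (simp add: add_emb hip_emb sqi_add ring_distribs)
  next
    fix x y c assume "x \<in> C" "y \<in> C"
    then obtain f g where f: "sqi f" "x = emb f" and g: "sqi g" "y = emb g" by (elim C_cases) blast
    show "hip L2H (c \<odot>\<^bsub>L2H\<^esub> x) y = c * hip L2H x y"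
      using f g by (simp add: smult_emb hip_emb sqi_cmult mult.assoc)
  next
    fix x y assume "x \<in> C" "y \<in> C"
    then obtain f g where f: "sqi f" "x = emb f" and g: "sqi g" "y = emb g" by (elim C_cases) blast
    show "hip L2H y x = cnj (hip L2H x y)"
      using f g Bochner_Integration.integral_cnj[symmetric, of M "\<lambda>m. f m * cnj (g m)"] by (simp add: hip_emb mult.commute)
  next
    fix x assume "x \<in> C"
    then obtain f where f: "sqi f" "x = emb f" by (elim C_cases)
    show "0 \<le> Re (hip L2H x x)" using f by (simp add: hip_emb integral_mult_cnj)
  next
    fix x assume "x \<in> C" and z: "hip L2H x x = 0"
    then obtain f where f: "sqi f" "x = emb f" by (elim C_cases)
    have "L2n M f = 0" using z f by (simp add: hip_emb integral_mult_cnj)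
    then have "AE m in M. f m = 0" using L2n_0_iff[OF f(1)] by simp
    then show "x = \<zero>\<^bsub>L2H\<^esub>" unfolding f(2) L2H_sel(2) by (intro emb_cong f sqi_zero)
  next
    show "L2.mcomplete" by (rule complete_L2H)
    show "separable_space L2.mtopology" by (rule separable_L2H)
  qed
qed

end

section \<open>The Koopman representation and its fixed vectors\<close>

lemma gms_integral:
  fixes F :: "'m \<Rightarrow> complex"
  assumes M: "finite_measure M" and g: "g \<in> Gms M" and F: "F \<in> borel_measurable M"
  shows "(\<integral>m. complex_of_real (gms_deriv M g m) * F (g m) \<partial>M) = (\<integral>m. F m \<partial>M)"
proof -
  note [measurable] = Gms_measurable[OF g] gms_deriv(1)[OF M g] F
  have "distr (density M (\<lambda>m. ennreal (gms_deriv M g m))) M g = M" by (rule gms_distr[OF M g])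
  then have "(\<integral>m. F m \<partial>M) = (\<integral>m. F m \<partial>(distr (density M (\<lambda>m. ennreal (gms_deriv M g m))) M g))" by simp
  also have "\<dots> = (\<integral>m. F (g m) \<partial>(density M (\<lambda>m. ennreal (gms_deriv M g m))))" by (rule integral_distr) measurable
  also have "\<dots> = (\<integral>m. gms_deriv M g m *\<^sub>R F (g m) \<partial>M)"
    by (rule integral_density) (auto intro!: AE_I2 less_imp_le gms_deriv(2)[OF M g])
  finally show ?thesis by (simp add: scaleR_conv_of_real)
qed

text \<open>Invariance of a set in the sense of its image is invariance of its indicator function under the
operator of \<open>g\<close>. Both directions use that \<open>g\<close> is injective on a set of full measure and maps null sets to null
sets.\<close>

lemma invariant_iff:
  assumes M: "finite_measure M" and g: "g \<in> Gms M" and B: "B \<in> sets M"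
  shows "sym_diff B (gms_image M g B) \<in> null_sets M \<longleftrightarrow> (AE m in M. g m \<in> B \<longleftrightarrow> m \<in> B)"
proof -
  obtain X where X: "gms_on M g X" and im: "\<And>B. gms_image M g B = g ` (B \<inter> X)" using Gms_dom[OF g] by blast
  note Xd = gms_onD[OF X]
  have [measurable]: "X \<in> sets M" "g \<in> M \<rightarrow>\<^sub>M M" "B \<in> sets M" using Xd B by auto
  have XM: "AE m in M. m \<in> X" using AE_not_in[OF Xd(3)] AE_space by eventually_elim blast
  show ?thesis
  proof
    assume N: "sym_diff B (gms_image M g B) \<in> null_sets M"
    have "AE m in M. m \<notin> sym_diff B (gms_image M g B)" by (rule AE_not_in[OF N])
    then have "AE m in M. g m \<notin> sym_diff B (gms_image M g B)" by (rule gms_AE[OF M g])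
    with XM show "AE m in M. g m \<in> B \<longleftrightarrow> m \<in> B"
    proof eventually_elim
      case (elim m)
      have "g m \<in> g ` (B \<inter> X) \<longleftrightarrow> m \<in> B" using elim(1) Xd(5) by (auto simp: inj_on_def)
      then show ?case using elim(2) by (auto simp: im)
    qed
  next
    assume ae: "AE m in M. g m \<in> B \<longleftrightarrow> m \<in> B"
    define Z where "Z = {m \<in> space M. m \<in> X \<and> \<not> (g m \<in> B \<longleftrightarrow> m \<in> B)}"
    have Zs: "Z \<in> sets M" unfolding Z_def by measurable
    have "AE m in M. m \<notin> Z" using ae by eventually_elim (auto simp: Z_def)
    then have Z: "Z \<in> null_sets M" using Zs by (simp add: AE_iff_null_sets)
    have "g ` Z \<in> null_sets M" using Xd(7)[OF Zs] Z by (auto simp: Z_def)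
    with Xd(4) have N: "(space M - g ` X) \<union> g ` Z \<in> null_sets M" by (rule null_sets.Un)
    have s: "g ` (B \<inter> X) \<in> sets M" by (rule Xd(6)) auto
    have sub: "sym_diff B (g ` (B \<inter> X)) \<subseteq> (space M - g ` X) \<union> g ` Z"
    proof
      fix n assume n: "n \<in> sym_diff B (g ` (B \<inter> X))"
      then have ns: "n \<in> space M" using B s sets.sets_into_space by blast
      show "n \<in> (space M - g ` X) \<union> g ` Z"
      proof (cases "n \<in> g ` X")
        case True
        then obtain m where m: "m \<in> X" "n = g m" by blast
        have "g m \<in> g ` (B \<inter> X) \<longleftrightarrow> m \<in> B" using m(1) Xd(5) by (auto simp: inj_on_def)
        then have "m \<in> Z" using n m sets.sets_into_space[OF Xd(2)] by (auto simp: Z_def)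
        then show ?thesis using m by blast
      qed (use ns in blast)
    qed
    have "sym_diff B (g ` (B \<inter> X)) \<in> sets M" using s by (intro sets.Un sets.Diff) auto
    then show "sym_diff B (gms_image M g B) \<in> null_sets M" unfolding im by (rule null_sets_subset[OF N _ sub])
  qed
qed

lemma AE_real_invariant:
  fixes u :: "'m \<Rightarrow> real"
  assumes "\<And>q. q \<in> \<rat> \<Longrightarrow> AE m in M. u (g m) \<le> q \<longleftrightarrow> u m \<le> q"
  shows "AE m in M. u (g m) = u m"
proof -
  have "AE m in M. \<forall>q\<in>\<rat>. u (g m) \<le> q \<longleftrightarrow> u m \<le> q" by (rule AE_ball_countable'[OF assms countable_rat])
  then show ?thesis
  proof eventually_elim
    case (elim m)
    show ?case
    proof (rule ccontr)
      assume "u (g m) \<noteq> u m"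
      then consider "u (g m) < u m" | "u m < u (g m)" by linarith
      then show False
      proof cases
        case 1
        then obtain q where "q \<in> \<rat>" "u (g m) < q" "q < u m" using Rats_dense_in_real by blast
        then show False using elim by force
      next
        case 2
        then obtain q where "q \<in> \<rat>" "u m < q" "q < u (g m)" using Rats_dense_in_real by blast
        then show False using elim by force
      qed
    qed
  qed
qed

text \<open>\<open>U s g\<close> is the operator \<open>gms_op M s (act g)\<close> on functions and \<open>\<rho> s g\<close> the corresponding operator on
the Hilbert space of sequences.\<close>

locale koopman = L2_space M D for M :: "'m measure" and D +
  fixes G :: "'g monoid" and T :: "'g topology" and K :: "'g set" and act :: "'g \<Rightarrow> 'm \<Rightarrow> 'm"
  assumes TG: "topological_group G T" and KG: "subgroup K G" and action: "gk_action G T K M act"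
begin

sublocale topological_group G T by (rule TG)

lemma Mfin: "finite_measure M" by unfold_locales

lemma act_Gms: "g \<in> carrier G \<Longrightarrow> act g \<in> Gms M"
  using action by (simp add: gk_action_def)

lemma act_mult: "g \<in> carrier G \<Longrightarrow> h \<in> carrier G \<Longrightarrow> AE m in M. act (g \<otimes>\<^bsub>G\<^esub> h) m = act h (act g m)"
  using action by (simp add: gk_action_def)

lemma act_K: "k \<in> K \<Longrightarrow> AE m in M. gms_deriv M (act k) m = 1"
  using action subgroup.mem_carrier[OF KG] by (intro gms_deriv_preserving[OF Mfin act_Gms]) (auto simp: gk_action_def)

text \<open>The identity acts by an almost everywhere injective idempotent.\<close>

lemma act_one: "AE m in M. act \<one>\<^bsub>G\<^esub> m = m"
proof -
  obtain X where X: "gms_on M (act \<one>\<^bsub>G\<^esub>) X" using act_Gms[OF one_closed] unfolding Gms_def by blast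
  note Xd = gms_onD[OF X]
  have XM: "AE m in M. m \<in> X" using AE_not_in[OF Xd(3)] AE_space by eventually_elim blast
  have "AE m in M. act \<one>\<^bsub>G\<^esub> m \<in> X" by (rule gms_AE[OF Mfin act_Gms[OF one_closed] XM])
  moreover have "AE m in M. act \<one>\<^bsub>G\<^esub> m = act \<one>\<^bsub>G\<^esub> (act \<one>\<^bsub>G\<^esub> m)" using act_mult[OF one_closed one_closed] unfolding l_one[OF one_closed] .
  ultimately show ?thesis using XM
  proof eventually_elim
    case (elim m)
    from inj_onD[OF Xd(5) elim(2)[symmetric] elim(1,3)] show ?case .
  qed
qed

definition U :: "real \<Rightarrow> 'g \<Rightarrow> ('m \<Rightarrow> complex) \<Rightarrow> 'm \<Rightarrow> complex" where
  "U s g f m = f (act g m) * mel s (gms_deriv M (act g) m)"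

lemma gms_op_U: "gms_op M s (act g) f m = U s g f m"
  by (simp add: gms_op_def U_def mel_def)

lemma U_sqi: "g \<in> carrier G \<Longrightarrow> sqi f \<Longrightarrow> sqi (U s g f)"
  unfolding U_def by (rule mel_deriv_sqi(1)[OF Mfin act_Gms])

lemma U_cong: "g \<in> carrier G \<Longrightarrow> AE m in M. f m = f' m \<Longrightarrow> AE m in M. U s g f m = U s g f' m"
  using gms_AE[OF Mfin act_Gms, of g "\<lambda>m. f m = f' m"] by (auto simp: U_def elim: eventually_mono)

lemma U_mult:
  assumes g: "g \<in> carrier G" and h: "h \<in> carrier G"
  shows "AE m in M. U s (g \<otimes>\<^bsub>G\<^esub> h) f m = U s g (U s h f) m"
  using act_mult[OF g h] gms_chain[OF Mfin act_Gms[OF g] act_Gms[OF h] act_Gms[OF m_closed[OF g h]] act_mult[OF g h]]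
proof eventually_elim
  case (elim m)
  have "mel s (gms_deriv M (act (g \<otimes>\<^bsub>G\<^esub> h)) m) = mel s (gms_deriv M (act g) m) * mel s (gms_deriv M (act h) (act g m))"
    unfolding elim(2) by (intro mel_mult gms_deriv(2) Mfin act_Gms g h)
  then show ?case by (simp add: U_def elim(1))
qed

lemma U_K: "k \<in> K \<Longrightarrow> AE m in M. U s k f m = f (act k m)"
  using act_K[of k] by (auto simp: U_def elim!: eventually_mono)

lemma U_one: "AE m in M. U s \<one>\<^bsub>G\<^esub> f m = f m"
  using U_K[OF subgroup.one_closed[OF KG]] act_one by eventually_elim simp

text \<open>The squared modulus of the Mellin character of the derivative is the derivative itself, so this is the
change of variables formula.\<close>

lemma U_inner:
  assumes g: "g \<in> carrier G" and f: "sqi f" and h: "sqi h"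
  shows "(\<integral>m. U s g f m * cnj (U s g h m) \<partial>M) = (\<integral>m. f m * cnj (h m) \<partial>M)"
proof -
  let ?d = "gms_deriv M (act g)"
  have "mel s (?d m) * cnj (mel s (?d m)) = complex_of_real (?d m)" for m
  proof -
    have d: "0 < ?d m" by (rule gms_deriv(2)[OF Mfin act_Gms[OF g]])
    have "mel s (?d m) * cnj (mel s (?d m)) = complex_of_real ((cmod (mel s (?d m)))\<^sup>2)" by (rule complex_norm_square[symmetric])
    also have "(cmod (mel s (?d m)))\<^sup>2 = ?d m" using d by (simp add: norm_mel)
    finally show ?thesis .
  qed
  then have "U s g f m * cnj (U s g h m) = complex_of_real (?d m) * (f (act g m) * cnj (h (act g m)))" for m
    unfolding U_def by (metis (no_types, lifting) complex_cnj_mult mult.assoc mult.commute)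
  then have "(\<integral>m. U s g f m * cnj (U s g h m) \<partial>M) = (\<integral>m. complex_of_real (?d m) * (f (act g m) * cnj (h (act g m))) \<partial>M)" by simp
  also have "\<dots> = (\<integral>m. f m * cnj (h m) \<partial>M)"
    by (rule gms_integral[OF Mfin act_Gms[OF g]]) (rule borel_measurable_times[OF sqi_measurable[OF f] sqi_measurable[OF sqi_cnj[OF h]]])
  finally show ?thesis .
qed

definition \<rho> :: "real \<Rightarrow> 'g \<Rightarrow> hpoint \<Rightarrow> hpoint" where
  "\<rho> s g x = emb (U s g (rep x))"

lemma \<rho>_emb: "g \<in> carrier G \<Longrightarrow> sqi f \<Longrightarrow> \<rho> s g (emb f) = emb (U s g f)"
  unfolding \<rho>_def by (intro emb_cong U_cong rep_emb U_sqi rep_sqi)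

lemma \<rho>_mult: "g \<in> carrier G \<Longrightarrow> h \<in> carrier G \<Longrightarrow> x \<in> C \<Longrightarrow> \<rho> s (g \<otimes>\<^bsub>G\<^esub> h) x = \<rho> s g (\<rho> s h x)"
  by (elim C_cases) (simp add: \<rho>_emb U_sqi, intro emb_cong U_mult U_sqi m_closed, auto)

lemma \<rho>_one: "x \<in> C \<Longrightarrow> \<rho> s \<one>\<^bsub>G\<^esub> x = x"
  by (elim C_cases) (simp add: \<rho>_emb, intro emb_cong U_one U_sqi, auto)

lemma \<rho>_C: "g \<in> carrier G \<Longrightarrow> \<rho> s g x \<in> C"
  unfolding \<rho>_def by (intro emb_C U_sqi rep_sqi)

lemma unitary: assumes g: "g \<in> carrier G" shows "unitary_operator L2H (\<rho> s g)"
  unfolding unitary_operator_def L2H_sel(1)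
proof (intro conjI ballI allI)
  show "bij_betw (\<rho> s g) C C"
  proof (rule bij_betwI[where g="\<rho> s (inv\<^bsub>G\<^esub> g)"])
    show "\<rho> s g \<in> C \<rightarrow> C" "\<rho> s (inv\<^bsub>G\<^esub> g) \<in> C \<rightarrow> C" using g by (auto simp: \<rho>_C)
    fix x assume "x \<in> C"
    then show "\<rho> s (inv\<^bsub>G\<^esub> g) (\<rho> s g x) = x" "\<rho> s g (\<rho> s (inv\<^bsub>G\<^esub> g) x) = x"
      using g by (simp_all add: \<rho>_mult[symmetric] \<rho>_one)
  qed
next
  fix x y assume "x \<in> C" "y \<in> C"
  then obtain f h where f: "sqi f" "x = emb f" and h: "sqi h" "y = emb h" by (elim C_cases) blast
  have "U s g (\<lambda>m. f m + h m) = (\<lambda>m. U s g f m + U s g h m)" by (simp add: U_def fun_eq_iff ring_distribs)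
  then show "\<rho> s g (x \<oplus>\<^bsub>L2H\<^esub> y) = \<rho> s g x \<oplus>\<^bsub>L2H\<^esub> \<rho> s g y"
    using f h g by (simp add: add_emb \<rho>_emb U_sqi sqi_add)
  show "hip L2H (\<rho> s g x) (\<rho> s g y) = hip L2H x y"
    using f h g by (simp add: hip_emb \<rho>_emb U_sqi U_inner)
next
  fix c x assume "x \<in> C"
  then obtain f where f: "sqi f" "x = emb f" by (elim C_cases)
  have "U s g (\<lambda>m. c * f m) = (\<lambda>m. c * U s g f m)" by (simp add: U_def fun_eq_iff mult.assoc)
  then show "\<rho> s g (c \<odot>\<^bsub>L2H\<^esub> x) = c \<odot>\<^bsub>L2H\<^esub> \<rho> s g x"
    using f g by (simp add: smult_emb \<rho>_emb U_sqi sqi_cmult)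
qed

lemma strongly_continuous: assumes x: "x \<in> C" shows "continuous_map T L2.mtopology (\<lambda>g. \<rho> s g x)"
  unfolding continuous_map_atin topspace_eq
proof (intro ballI, unfold L2.limitin_metric, intro conjI allI impI)
  fix g0 assume g0: "g0 \<in> carrier G"
  show "\<rho> s g0 x \<in> C" by (rule \<rho>_C[OF g0])
  fix \<epsilon> :: real assume e: "0 < \<epsilon>"
  obtain f where f: "sqi f" "x = emb f" using x by (elim C_cases)
  let ?I = "\<lambda>g. \<integral>m. (cmod (gms_op M s (act g) f m - gms_op M s (act g0) f m))\<^sup>2 \<partial>M"
  have "limitin euclideanreal ?I 0 (atin T g0)" using action f g0 by (simp add: gk_action_def)
  then have "(?I \<longlongrightarrow> 0) (atin T g0)" by simp
  then have "\<forall>\<^sub>F g in atin T g0. ?I g < \<epsilon>\<^sup>2" by (rule order_tendstoD) (use e in simp)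
  moreover have "\<forall>\<^sub>F g in atin T g0. g \<in> carrier G"
    unfolding eventually_atin using openin_topspace[of T] g0 topspace_eq by blast
  ultimately show "\<forall>\<^sub>F g in atin T g0. \<rho> s g x \<in> C \<and> hdist L2H (\<rho> s g x) (\<rho> s g0 x) < \<epsilon>"
  proof eventually_elim
    case (elim g)
    have "hdist L2H (\<rho> s g x) (\<rho> s g0 x) = L2n M (\<lambda>m. U s g f m - U s g0 f m)"
      using f elim g0 by (simp add: \<rho>_emb hdist_emb U_sqi)
    also have "\<dots> = sqrt (?I g)" by (simp add: L2n_def gms_op_U)
    also have "\<dots> < sqrt (\<epsilon>\<^sup>2)" using elim(1) by (rule real_sqrt_less_mono)
    finally show ?case using e elim \<rho>_C by simp
  qed
qed

lemma unitary_rep_\<rho>: "unitary_rep G T L2H (\<rho> s)"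
  unfolding unitary_rep_def using hilbert_L2H unitary \<rho>_mult strongly_continuous by (simp add: L2H_sel(1))

end

text \<open>The elements of \<open>L\<close> preserve the measure, so their Koopman operators are compositions without a factor.\<close>

locale koopman_quotient = koopman M D G T K act
  for M :: "'m measure" and D and G :: "'g monoid" and T K act +
  fixes L :: "'g set" and Q :: "'q measure" and \<pi> :: "'m \<Rightarrow> 'q"
  assumes LG: "subgroup L G" and LK: "L \<subseteq> K" and quotient: "is_quotient M (invariant_sets M act L) Q \<pi>"
begin

lemma Qp: "lebesgue_prob_space Q" "prob_space Q" and \<pi>[measurable]: "\<pi> \<in> M \<rightarrow>\<^sub>M Q" and distr_\<pi>: "distr M Q \<pi> = Q"
  and \<pi>_invariant: "S \<in> sets Q \<Longrightarrow> \<pi> -` S \<inter> space M \<in> invariant_sets M act L"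
  and invariant_\<pi>: "B \<in> invariant_sets M act L \<Longrightarrow> \<exists>S\<in>sets Q. sym_diff B (\<pi> -` S \<inter> space M) \<in> null_sets M"
  using quotient by (auto simp: is_quotient_def lebesgue_prob_space_def)

lemma Qfin: "finite_measure Q" using Qp(2) by (rule prob_space.finite_measure)

lemma integral_\<pi>:
  fixes \<phi> :: "'q \<Rightarrow> 'b :: {banach, second_countable_topology}"
  assumes "\<phi> \<in> borel_measurable Q" shows "(\<integral>m. \<phi> (\<pi> m) \<partial>M) = (\<integral>q. \<phi> q \<partial>Q)"
  using integral_distr[OF \<pi> assms] by (simp add: distr_\<pi>)

lemma nn_integral_\<pi>: "\<phi> \<in> borel_measurable Q \<Longrightarrow> (\<integral>\<^sup>+m. \<phi> (\<pi> m) \<partial>M) = (\<integral>\<^sup>+q. \<phi> q \<partial>Q)"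
  using nn_integral_distr[OF \<pi>, of \<phi>] by (simp add: distr_\<pi>)

lemma sqi_\<pi>: assumes "square_integrable Q \<phi>" shows "sqi (\<lambda>m. \<phi> (\<pi> m))"
proof -
  have [measurable]: "\<phi> \<in> borel_measurable Q" using assms by (rule sqi_measurable)
  have "(\<integral>\<^sup>+m. (ennreal (cmod (\<phi> (\<pi> m))))\<^sup>2 \<partial>M) = (\<integral>\<^sup>+q. (ennreal (cmod (\<phi> q)))\<^sup>2 \<partial>Q)"
    by (rule nn_integral_\<pi>) measurable
  then show ?thesis using assms by (simp add: sqi_iff_nn)
qed

lemma L_carrier: "l \<in> L \<Longrightarrow> l \<in> carrier G" using subgroup.mem_carrier[OF LG] .

lemma AE_invariant:
  assumes B: "B \<in> invariant_sets M act L" and l: "l \<in> L"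
  shows "AE m in M. act l m \<in> B \<longleftrightarrow> m \<in> B"
  using invariant_iff[OF Mfin act_Gms[OF L_carrier[OF l]], of B] B l by (simp add: invariant_sets_def)

lemma \<pi>_real_invariant:
  fixes u :: "'q \<Rightarrow> real"
  assumes [measurable]: "u \<in> borel_measurable Q" and l: "l \<in> L"
  shows "AE m in M. u (\<pi> (act l m)) = u (\<pi> m)"
proof (rule AE_real_invariant)
  fix q :: real
  have "{n \<in> space Q. u n \<le> q} \<in> sets Q" by measurable
  from AE_invariant[OF \<pi>_invariant[OF this] l]
  have "AE m in M. act l m \<in> \<pi> -` {n \<in> space Q. u n \<le> q} \<inter> space M \<longleftrightarrow> m \<in> \<pi> -` {n \<in> space Q. u n \<le> q} \<inter> space M" .
  with AE_space show "AE m in M. u (\<pi> (act l m)) \<le> q \<longleftrightarrow> u (\<pi> m) \<le> q"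
  proof eventually_elim
    case (elim m)
    have "act l m \<in> space M" using measurable_space[OF Gms_measurable[OF act_Gms[OF L_carrier[OF l]]] elim(1)] .
    then show ?case using elim measurable_space[OF \<pi>] by auto
  qed
qed

lemma fixed_iff:
  assumes f: "sqi f"
  shows "emb f \<in> fixed_vectors L2H (\<rho> s) L \<longleftrightarrow> (\<forall>l\<in>L. AE m in M. f (act l m) = f m)"
proof -
  have "\<rho> s l (emb f) = emb f \<longleftrightarrow> (AE m in M. f (act l m) = f m)" if l: "l \<in> L" for l
  proof -
    have K: "AE m in M. U s l f m = f (act l m)" using LK l by (intro U_K) blast
    have s: "sqi (U s l f)" by (rule U_sqi[OF L_carrier[OF l] f])
    have "\<rho> s l (emb f) = emb f \<longleftrightarrow> (AE m in M. U s l f m = f m)"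
      using emb_inj[OF s f] emb_cong[OF _ s f] \<rho>_emb[OF L_carrier[OF l] f, of s] by metis
    also have "\<dots> \<longleftrightarrow> (AE m in M. f (act l m) = f m)"
    proof
      assume "AE m in M. U s l f m = f m"
      with K show "AE m in M. f (act l m) = f m" by eventually_elim simp
    next
      assume "AE m in M. f (act l m) = f m"
      with K show "AE m in M. U s l f m = f m" by eventually_elim simp
    qed
    finally show ?thesis .
  qed
  then show ?thesis using emb_C[OF f] by (simp add: fixed_vectors_def L2H_sel(1))
qed

text \<open>The level sets of a function on the quotient are invariant; rational levels suffice.\<close>

lemma \<pi>_fixed:
  assumes "square_integrable Q \<phi>" shows "emb (\<lambda>m. \<phi> (\<pi> m)) \<in> fixed_vectors L2H (\<rho> s) L"
  unfolding fixed_iff[OF sqi_\<pi>[OF assms]]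
proof
  fix l assume l: "l \<in> L"
  have [measurable]: "\<phi> \<in> borel_measurable Q" using assms by (rule sqi_measurable)
  have "AE m in M. Re (\<phi> (\<pi> (act l m))) = Re (\<phi> (\<pi> m))" "AE m in M. Im (\<phi> (\<pi> (act l m))) = Im (\<phi> (\<pi> m))"
    by (rule \<pi>_real_invariant[OF _ l], measurable)+
  then show "AE m in M. \<phi> (\<pi> (act l m)) = \<phi> (\<pi> m)" by eventually_elim (rule complex_eqI)
qed

text \<open>\<open>\<phi>\<close>, viewed on the quotient, is the conditional expectation of \<open>F\<close>.\<close>

lemma conditional_expectation:
  assumes F: "sqi F"
  obtains \<phi> where "square_integrable Q \<phi>" "\<And>g. square_integrable Q g \<Longrightarrow> (\<integral>m. g (\<pi> m) * F m \<partial>M) = (\<integral>q. g q * \<phi> q \<partial>Q)"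
proof -
  have [measurable]: "F \<in> borel_measurable M" using F by (rule sqi_measurable)
  have "(\<integral>\<^sup>+m. g (\<pi> m) * ennreal (cmod (F m)) \<partial>M)\<^sup>2 \<le> ennreal ((L2n M F)\<^sup>2) * (\<integral>\<^sup>+q. (g q)\<^sup>2 \<partial>Q)"
    if [measurable]: "g \<in> borel_measurable Q" for g
  proof -
    have "(\<integral>\<^sup>+m. g (\<pi> m) * ennreal (cmod (F m)) \<partial>M)\<^sup>2 \<le> (\<integral>\<^sup>+m. (g (\<pi> m))\<^sup>2 \<partial>M) * (\<integral>\<^sup>+m. (ennreal (cmod (F m)))\<^sup>2 \<partial>M)"
      by (rule Cauchy_Schwarz_nn_integral) measurable
    also have "\<dots> = (\<integral>\<^sup>+q. (g q)\<^sup>2 \<partial>Q) * ennreal ((L2n M F)\<^sup>2)"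
      using nn_L2n[OF F] by (simp add: nn_integral_\<pi>[of "\<lambda>q. (g q)\<^sup>2"])
    finally show ?thesis by (simp add: mult.commute)
  qed
  from riesz_representation[OF Qfin \<pi> \<open>F \<in> borel_measurable M\<close> _ this, of thesis] that show ?thesis by auto
qed

text \<open>The level sets of a fixed vector \<open>v\<close> are invariant, hence preimages from the quotient modulo null sets,
and \<open>w\<close> has integral \<open>0\<close> over them. The functional \<open>\<phi> \<mapsto> \<integral> \<phi> (v m) w m\<close> is bounded on the \<open>L\<^sup>2\<close> space of the
distribution of \<open>v\<close> and vanishes on indicators, so it vanishes at the conjugation.\<close>

lemma orthogonal_to_fixed:
  assumes w: "sqi w" and orth: "\<And>S. S \<in> sets Q \<Longrightarrow> (\<integral>m. indicator S (\<pi> m) * w m \<partial>M) = 0"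
    and v: "sqi v" and fix_v: "emb v \<in> fixed_vectors L2H (\<rho> s) L"
  shows "(\<integral>m. w m * cnj (v m) \<partial>M) = 0"
proof -
  have [measurable]: "v \<in> borel_measurable M" "w \<in> borel_measurable M" using v w by (auto intro: sqi_measurable)
  have vl: "AE m in M. v (act l m) = v m" if "l \<in> L" for l using fix_v that fixed_iff[OF v] by blast
  let ?N = "distr M borel v"
  interpret N: prob_space ?N by (rule prob_space_distr) measurable
  let ?\<Lambda> = "\<lambda>\<phi>. \<integral>m. \<phi> (v m) * w m \<partial>M"
  have sv: "sqi (\<lambda>m. \<phi> (v m))" and nv: "L2n M (\<lambda>m. \<phi> (v m)) = L2n ?N \<phi>" if "square_integrable ?N \<phi>" for \<phi>
  proof -
    have [measurable]: "\<phi> \<in> borel_measurable borel" using sqi_measurable[OF that] by simp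
    have "(\<integral>\<^sup>+m. (ennreal (cmod (\<phi> (v m))))\<^sup>2 \<partial>M) = (\<integral>\<^sup>+z. (ennreal (cmod (\<phi> z)))\<^sup>2 \<partial>?N)"
      by (rule nn_integral_distr[symmetric]) measurable
    then show "sqi (\<lambda>m. \<phi> (v m))" using that by (simp add: sqi_iff_nn)
    show "L2n M (\<lambda>m. \<phi> (v m)) = L2n ?N \<phi>" unfolding L2n_def by (subst integral_distr) auto
  qed
  have \<Lambda>: "L2_functional ?N ?\<Lambda> (L2n M w)"
  proof (rule L2_functionalI)
    fix f g c assume "square_integrable ?N f" "square_integrable ?N g"
    then have "integrable M (\<lambda>m. f (v m) * w m)" "integrable M (\<lambda>m. g (v m) * w m)" by (auto intro!: sqi_mult_integrable sv w)
    then show "?\<Lambda> (\<lambda>x. f x + c * g x) = ?\<Lambda> f + c * ?\<Lambda> g" by (simp add: ring_distribs mult.assoc)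
  next
    fix f assume f: "square_integrable ?N f"
    show "cmod (?\<Lambda> f) \<le> L2n M w * L2n ?N f" using integral_CS[OF sv[OF f] w] nv[OF f] by (simp add: mult.commute)
  qed
  have \<Lambda>0: "L2_functional ?N (\<lambda>_. 0) (L2n M w)" by (rule L2_functionalI) (auto simp: L2n_nonneg)
  have ind: "?\<Lambda> (indicator S) = 0" if "S \<in> sets ?N" for S
  proof -
    have [measurable]: "S \<in> sets borel" using that by simp
    let ?B = "{m \<in> space M. v m \<in> S}"
    have Bs: "?B \<in> sets M" by measurable
    have "?B \<in> invariant_sets M act L"
      unfolding invariant_sets_def
    proof (intro CollectI conjI ballI Bs)
      fix l assume l: "l \<in> L"
      show "sym_diff ?B (gms_image M (act l) ?B) \<in> null_sets M"
        unfolding invariant_iff[OF Mfin act_Gms[OF L_carrier[OF l]] Bs]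
        using vl[OF l] AE_space
      proof eventually_elim
        case (elim m)
        have "act l m \<in> space M" using measurable_space[OF Gms_measurable[OF act_Gms[OF L_carrier[OF l]]] elim(2)] .
        then show ?case using elim by simp
      qed
    qed
    then obtain S' where S': "S' \<in> sets Q" "sym_diff ?B (\<pi> -` S' \<inter> space M) \<in> null_sets M" using invariant_\<pi> by blast
    have [measurable]: "S' \<in> sets Q" by fact
    have "?\<Lambda> (indicator S) = (\<integral>m. indicator S' (\<pi> m) * w m \<partial>M)"
    proof (rule integral_cong_AE)
      show "AE m in M. indicator S (v m) * w m = indicator S' (\<pi> m) * w m"
        using AE_not_in[OF S'(2)] AE_space by eventually_elim (auto simp: indicator_def)
    qed measurable
    then show ?thesis using orth[OF S'(1)] by simp
  qed
  have c: "square_integrable ?N cnj"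
  proof -
    have "(\<integral>\<^sup>+m. (ennreal (cmod (v m)))\<^sup>2 \<partial>M) = (\<integral>\<^sup>+z. (ennreal (cmod z))\<^sup>2 \<partial>?N)"
      by (rule nn_integral_distr[symmetric]) measurable
    then have "square_integrable ?N (\<lambda>z. z)" using v by (simp add: sqi_iff_nn)
    then show ?thesis using sqi_cnj[of ?N "\<lambda>z. z"] by (simp add: fun_eq_iff)
  qed
  from N.L2_functional_eqI[OF \<Lambda> \<Lambda>0 _ c] ind have "?\<Lambda> cnj = 0" by blast
  then show ?thesis by (simp add: mult.commute)
qed

text \<open>The orthogonal projection to the fixed vectors is the conditional expectation.\<close>

lemma orth_proj_fixed:
  assumes F: "sqi F" and \<phi>: "square_integrable Q \<phi>"
    and ce: "\<And>S. S \<in> sets Q \<Longrightarrow> (\<integral>m. indicator S (\<pi> m) * F m \<partial>M) = (\<integral>q. indicator S q * \<phi> q \<partial>Q)"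
  shows "orth_proj L2H (fixed_vectors L2H (\<rho> s) L) (emb F) = emb (\<lambda>m. \<phi> (\<pi> m))"
  unfolding orth_proj_def
proof (rule the_equality)
  let ?V = "fixed_vectors L2H (\<rho> s) L"
  have VC: "z \<in> ?V \<Longrightarrow> z \<in> C" for z by (simp add: fixed_vectors_def L2H_sel(1))
  note \<phi>s = sqi_\<pi>[OF \<phi>]
  have m: "\<phi> \<in> borel_measurable Q" using \<phi> by (rule sqi_measurable)
  have "hip L2H (emb F \<ominus>\<^bsub>L2H\<^esub> emb (\<lambda>m. \<phi> (\<pi> m))) z = 0" if z: "z \<in> ?V" for z
  proof -
    obtain v where v: "sqi v" "z = emb v" using VC[OF z] by (elim C_cases)
    have "(\<integral>m. indicator S (\<pi> m) * (F m - \<phi> (\<pi> m)) \<partial>M) = 0" if S[measurable]: "S \<in> sets Q" for S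
    proof -
      have s: "square_integrable Q (indicator S)" by (rule finite_measure.sqi_indicator[OF Qfin S])
      have "(\<integral>m. indicator S (\<pi> m) * \<phi> (\<pi> m) \<partial>M) = (\<integral>q. indicator S q * \<phi> q \<partial>Q)"
        by (rule integral_\<pi>) (use m in measurable)
      moreover have "(\<integral>m. indicator S (\<pi> m) * (F m - \<phi> (\<pi> m)) \<partial>M) = (\<integral>m. indicator S (\<pi> m) * F m \<partial>M) - (\<integral>m. indicator S (\<pi> m) * \<phi> (\<pi> m) \<partial>M)"
        unfolding right_diff_distrib by (intro Bochner_Integration.integral_diff sqi_mult_integrable sqi_\<pi> s F \<phi>)
      ultimately show ?thesis using ce[OF S] by simp
    qed
    from orthogonal_to_fixed[OF sqi_diff[OF F \<phi>s] this v(1) z[unfolded v(2)]]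
    show ?thesis using v F \<phi>s by (simp add: minus_emb hip_emb sqi_diff)
  qed
  then show y: "emb (\<lambda>m. \<phi> (\<pi> m)) \<in> ?V \<and> (\<forall>z\<in>?V. hip L2H (emb F \<ominus>\<^bsub>L2H\<^esub> emb (\<lambda>m. \<phi> (\<pi> m))) z = 0)"
    using \<pi>_fixed[OF \<phi>] by blast
  fix y' assume y': "y' \<in> ?V \<and> (\<forall>z\<in>?V. hip L2H (emb F \<ominus>\<^bsub>L2H\<^esub> y') z = 0)"
  then obtain b where b: "sqi b" "y' = emb b" using VC by (blast elim: C_cases)
  let ?e = "\<lambda>m. \<phi> (\<pi> m) - b m"
  have e: "sqi ?e" by (rule sqi_diff[OF \<phi>s b(1)])
  have V: "emb ?e \<in> ?V"
    unfolding fixed_iff[OF e]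
  proof
    fix l assume "l \<in> L"
    then have "AE m in M. \<phi> (\<pi> (act l m)) = \<phi> (\<pi> m)" "AE m in M. b (act l m) = b m"
      using fixed_iff[OF \<phi>s] fixed_iff[OF b(1)] y y' b(2) by blast+
    then show "AE m in M. \<phi> (\<pi> (act l m)) - b (act l m) = \<phi> (\<pi> m) - b m" by eventually_elim simp
  qed
  have 1: "(\<integral>m. (F m - \<phi> (\<pi> m)) * cnj (?e m) \<partial>M) = 0" "(\<integral>m. (F m - b m) * cnj (?e m) \<partial>M) = 0"
    using V y y' b e F \<phi>s by (auto simp: minus_emb hip_emb sqi_diff simp del: complex_cnj_diff)
  have "complex_of_real ((L2n M ?e)\<^sup>2) = (\<integral>m. (F m - b m) * cnj (?e m) - (F m - \<phi> (\<pi> m)) * cnj (?e m) \<partial>M)"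
    unfolding integral_mult_cnj[symmetric] by (intro Bochner_Integration.integral_cong refl) (simp add: algebra_simps)
  also have "\<dots> = (\<integral>m. (F m - b m) * cnj (?e m) \<partial>M) - (\<integral>m. (F m - \<phi> (\<pi> m)) * cnj (?e m) \<partial>M)"
    by (intro Bochner_Integration.integral_diff sqi_mult_integrable sqi_cnj e sqi_diff F b(1) \<phi>s)
  also have "\<dots> = 0" using 1 by simp
  finally have "L2n M ?e = 0" by simp
  then have "AE m in M. ?e m = 0" using L2n_0_iff[OF e] by blast
  then have "AE m in M. b m = \<phi> (\<pi> m)" by eventually_elim simp
  then show "y' = emb (\<lambda>m. \<phi> (\<pi> m))" unfolding b(2) by (rule emb_cong[OF _ b(1) \<phi>s])
qed

end

section \<open>The functor\<close>

lemma reduced_rel_equiv: "equiv (carrier G) (reduced_rel G T L L')"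
  by (rule equivI) (auto simp: reduced_rel_def refl_on_def sym_def trans_def)

lemma reduced_class_self: "g \<in> carrier G \<Longrightarrow> g \<in> reduced_class G T L L' g"
  by (simp add: reduced_class_def reduced_rel_def)

lemma reduced_class_eq_iff:
  assumes "g \<in> carrier G" "g' \<in> carrier G"
  shows "reduced_class G T L L' g = reduced_class G T L L' g' \<longleftrightarrow>
    (\<forall>(H :: hpoint hilbert) \<rho>. unitary_rep G T H \<rho> \<longrightarrow> reduced_op H \<rho> L L' g = reduced_op H \<rho> L L' g')"
  unfolding reduced_class_def eq_equiv_class_iff[OF reduced_rel_equiv assms] using assms by (simp add: reduced_rel_def)

lemma the_elem_class:
  assumes g: "g \<in> carrier G" and inv: "\<And>g'. g' \<in> reduced_class G T L L' g \<Longrightarrow> f g' = f g"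
  shows "the_elem (f ` reduced_class G T L L' g) = f g"
proof -
  have "f ` reduced_class G T L L' g = {f g}" using inv reduced_class_self[OF g] by blast
  then show ?thesis by simp
qed

lemma class_op_reduced_class:
  fixes H :: "hpoint hilbert"
  assumes "g \<in> carrier G" "unitary_rep G T H \<rho>"
  shows "class_op H \<rho> L L' (reduced_class G T L L' g) = reduced_op H \<rho> L L' g"
  unfolding class_op_def by (rule the_elem_class[OF assms(1)]) (use assms(2) in \<open>auto simp: reduced_class_def reduced_rel_def\<close>)

text \<open>A class is determined by its operators in all representations.\<close>

lemma class_product_unique:
  assumes "is_class_product G T L1 L2 L3 c d p" "is_class_product G T L1 L2 L3 c d p'"
  shows "p = p'"
proof -
  obtain k k' where k: "k \<in> carrier G" "p = reduced_class G T L1 L3 k" and k': "k' \<in> carrier G" "p' = reduced_class G T L1 L3 k'"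
    using assms by (auto simp: is_class_product_def reduced_cosets_def quotient_def reduced_class_def)
  have "reduced_op H \<rho> L1 L3 k = reduced_op H \<rho> L1 L3 k'" if u: "unitary_rep G T H \<rho>" for H :: "hpoint hilbert" and \<rho>
  proof -
    have "class_op H \<rho> L1 L3 p = class_op H \<rho> L1 L3 p'" using assms u by (simp add: is_class_product_def)
    then show ?thesis using u k k' by (simp add: class_op_reduced_class)
  qed
  then show ?thesis using k k' by (simp add: reduced_class_eq_iff)
qed

text \<open>On functions on the quotients, the operator of the polymorphism of \<open>g\<close> is the reduced operator of \<open>g\<close>
in the Koopman representation.\<close>

lemma (in koopman) reduced_op_emb:
  assumes a: "koopman_quotient M D G T K act L Q \<pi>" and b: "koopman_quotient M D G T K act L' Q' \<pi>'"
    and g: "g \<in> carrier G" and \<phi>: "square_integrable Q' \<phi>"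
  obtains f where "square_integrable Q f" "reduced_op L2H (\<rho> s) L L' g (emb (\<lambda>m. \<phi> (\<pi>' m))) = emb (\<lambda>m. f (\<pi> m))"
    "\<And>h. square_integrable Q h \<Longrightarrow> pol_form s (law M Q Q' \<pi> (\<lambda>m. \<pi>' (act g m)) (gms_deriv M (act g))) h \<phi> = (\<integral>q. h q * f q \<partial>Q)"
proof -
  interpret a: koopman_quotient M D G T K act L Q \<pi> by (rule a)
  interpret b: koopman_quotient M D G T K act L' Q' \<pi>' by (rule b)
  note \<phi>s = b.sqi_\<pi>[OF \<phi>]
  obtain f where f: "square_integrable Q f" "\<And>h. square_integrable Q h \<Longrightarrow> (\<integral>m. h (\<pi> m) * U s g (\<lambda>m. \<phi> (\<pi>' m)) m \<partial>M) = (\<integral>q. h q * f q \<partial>Q)"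
    using a.conditional_expectation[OF U_sqi[OF g \<phi>s, of s]] by blast
  have "orth_proj L2H (fixed_vectors L2H (\<rho> s) L) (emb (U s g (\<lambda>m. \<phi> (\<pi>' m)))) = emb (\<lambda>m. f (\<pi> m))"
    by (rule a.orth_proj_fixed[OF U_sqi[OF g \<phi>s] f(1)]) (intro f(2) finite_measure.sqi_indicator[OF a.Qfin])
  then have r: "reduced_op L2H (\<rho> s) L L' g (emb (\<lambda>m. \<phi> (\<pi>' m))) = emb (\<lambda>m. f (\<pi> m))"
    using b.\<pi>_fixed[OF \<phi>] \<rho>_emb[OF g \<phi>s, of s] by (simp add: reduced_op_def)
  have "pol_form s (law M Q Q' \<pi> (\<lambda>m. \<pi>' (act g m)) (gms_deriv M (act g))) h \<phi> = (\<integral>q. h q * f q \<partial>Q)" if h: "square_integrable Q h" for h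
  proof -
    have "pol_form s (law M Q Q' \<pi> (\<lambda>m. \<pi>' (act g m)) (gms_deriv M (act g))) h \<phi> = (\<integral>m. h (\<pi> m) * U s g (\<lambda>m. \<phi> (\<pi>' m)) m \<partial>M)"
      unfolding U_def using sqi_measurable[OF h] sqi_measurable[OF \<phi>] Gms_measurable[OF act_Gms[OF g]] gms_deriv_measurable_Rpos[OF Mfin act_Gms[OF g]]
      by (intro pol_form_law) measurable
    then show ?thesis using f(2)[OF h] by simp
  qed
  then show ?thesis by (rule that[OF f(1) r])
qed

text \<open>The Mellin forms of the polymorphism of \<open>g\<close> are matrix coefficients of the reduced operator; in
particular they depend on this operator only.\<close>

lemma (in koopman) Xi_coefficient:
  assumes a: "koopman_quotient M D G T K act L Q \<pi>" and b: "koopman_quotient M D G T K act L' Q' \<pi>'"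
    and g: "g \<in> carrier G" and h: "square_integrable Q h" and \<phi>: "square_integrable Q' \<phi>"
  shows "pol_form s (law M Q Q' \<pi> (\<lambda>m. \<pi>' (act g m)) (gms_deriv M (act g))) h \<phi> =
    hip L2H (reduced_op L2H (\<rho> s) L L' g (emb (\<lambda>m. \<phi> (\<pi>' m)))) (emb (\<lambda>m. cnj (h (\<pi> m))))"
proof -
  interpret a: koopman_quotient M D G T K act L Q \<pi> by (rule a)
  obtain f where f: "square_integrable Q f" "reduced_op L2H (\<rho> s) L L' g (emb (\<lambda>m. \<phi> (\<pi>' m))) = emb (\<lambda>m. f (\<pi> m))"
    "pol_form s (law M Q Q' \<pi> (\<lambda>m. \<pi>' (act g m)) (gms_deriv M (act g))) h \<phi> = (\<integral>q. h q * f q \<partial>Q)"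
    using reduced_op_emb[OF a b g \<phi>, of s] h by metis
  have "(\<integral>m. h (\<pi> m) * f (\<pi> m) \<partial>M) = (\<integral>q. h q * f q \<partial>Q)"
    by (rule a.integral_\<pi>) (intro borel_measurable_times sqi_measurable h f(1))
  then show ?thesis unfolding f(2,3) by (simp add: hip_emb a.sqi_\<pi>[OF f(1)] sqi_cnj[OF a.sqi_\<pi>[OF h]] mult.commute)
qed

theorem theorem2p1:
  fixes G :: "'g monoid" and T :: "'g topology" and K :: "'g set"
    and A :: "'i set" and R :: "('i \<times> 'i) set" and Ks :: "'i \<Rightarrow> 'g set"
    and M :: "'m measure" and act :: "'g \<Rightarrow> 'm \<Rightarrow> 'm"
    and Q :: "'i \<Rightarrow> 'q measure" and \<pi> :: "'i \<Rightarrow> 'm \<Rightarrow> 'q"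
  assumes "gk_pair G T K A R Ks"
    and "lebesgue_prob_space M" and "continuous_measure M"
    and "gk_action G T K M act"
    and "\<And>\<alpha>. \<alpha> \<in> A \<Longrightarrow> is_quotient M (invariant_sets M act (Ks \<alpha>)) (Q \<alpha>) (\<pi> \<alpha>)"
  shows "(\<forall>\<alpha>\<in>A. \<forall>\<beta>\<in>A. \<forall>g\<in>carrier G. Xi M act Q \<pi> \<alpha> \<beta> g \<in> Pol (Q \<alpha>) (Q \<beta>)) \<and>
    (\<forall>\<alpha>\<in>A. \<forall>\<beta>\<in>A. \<forall>g\<in>carrier G. \<forall>g'\<in>carrier G.
       reduced_class G T (Ks \<alpha>) (Ks \<beta>) g = reduced_class G T (Ks \<alpha>) (Ks \<beta>) g' \<longrightarrow>
       Xi M act Q \<pi> \<alpha> \<beta> g = Xi M act Q \<pi> \<alpha> \<beta> g') \<and>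
    (\<forall>\<alpha>\<in>A. Xi_class M act Q \<pi> \<alpha> \<alpha> (train_id G T Ks \<alpha>) = pol_id (Q \<alpha>)) \<and>
    (\<forall>\<alpha>\<in>A. \<forall>\<beta>\<in>A. \<forall>\<gamma>\<in>A. \<forall>c\<in>train_hom G T Ks \<alpha> \<beta>. \<forall>d\<in>train_hom G T Ks \<beta> \<gamma>.
       pol_prod (Q \<alpha>) (Q \<beta>) (Q \<gamma>) (Xi_class M act Q \<pi> \<alpha> \<beta> c) (Xi_class M act Q \<pi> \<beta> \<gamma> d)
         = Xi_class M act Q \<pi> \<alpha> \<gamma> (train_comp G T Ks \<alpha> \<beta> \<gamma> c d))"
proof -
  note M = \<open>lebesgue_prob_space M\<close>
  obtain D :: "nat \<Rightarrow> 'm set" where D: "\<And>i. D i \<in> sets M" "\<And>B \<epsilon>. B \<in> sets M \<Longrightarrow> 0 < \<epsilon> \<Longrightarrow> \<exists>i. measure M (sym_diff B (D i)) < \<epsilon>"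
  proof (rule dense_sequence[OF M])
    fix D :: "nat \<Rightarrow> 'm set"
    assume "\<And>i. D i \<in> sets M" "\<And>B \<epsilon>. B \<in> sets M \<Longrightarrow> 0 < \<epsilon> \<Longrightarrow> \<exists>i. measure M (sym_diff B (D i)) < \<epsilon>"
    then show thesis by (rule that)
  qed
  have pair: "topological_group G T" "subgroup K G" "\<And>\<alpha>. \<alpha> \<in> A \<Longrightarrow> subgroup (Ks \<alpha>) G" "\<And>\<alpha>. \<alpha> \<in> A \<Longrightarrow> Ks \<alpha> \<subseteq> K"
    using assms(1) by (auto simp: gk_pair_def)
  interpret prob_space M using M by (simp add: lebesgue_prob_space_def)
  interpret koopman M D G T K act
  proof (intro koopman.intro L2_space.intro L2_space_axioms.intro koopman_axioms.intro)
    show "\<And>i. D i \<in> sets M" by (rule D(1))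
    show "\<And>B \<epsilon>. B \<in> sets M \<Longrightarrow> 0 < \<epsilon> \<Longrightarrow> \<exists>i. measure M (sym_diff B (D i)) < \<epsilon>" by (rule D(2))
    show "prob_space M" by unfold_locales
    show "topological_group G T" "subgroup K G" by (rule pair)+
    show "gk_action G T K M act" by (rule assms(4))
  qed
  have quot: "koopman_quotient M D G T K act (Ks \<alpha>) (Q \<alpha>) (\<pi> \<alpha>)" if "\<alpha> \<in> A" for \<alpha>
  proof (intro koopman_quotient.intro koopman_quotient_axioms.intro)
    show "koopman M D G T K act" by unfold_locales
    show "subgroup (Ks \<alpha>) G" "Ks \<alpha> \<subseteq> K" by (rule pair(3,4)[OF that])+
    show "is_quotient M (invariant_sets M act (Ks \<alpha>)) (Q \<alpha>) (\<pi> \<alpha>)" by (rule assms(5)[OF that])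
  qed
  have q: "lebesgue_prob_space (Q \<alpha>)" "prob_space (Q \<alpha>)" "\<pi> \<alpha> \<in> M \<rightarrow>\<^sub>M Q \<alpha>" "distr M (Q \<alpha>) (\<pi> \<alpha>) = Q \<alpha>" if "\<alpha> \<in> A" for \<alpha>
    using koopman_quotient.Qp[OF quot[OF that]] koopman_quotient.\<pi>[OF quot[OF that]] koopman_quotient.distr_\<pi>[OF quot[OF that]] by auto
  have sI: "square_integrable (Q \<alpha>) (indicator S)" if "\<alpha> \<in> A" "S \<in> sets (Q \<alpha>)" for \<alpha> S
    using prob_space.finite_measure[OF q(2)[OF that(1)]] that(2) by (rule finite_measure.sqi_indicator)
  let ?X = "\<lambda>\<alpha> \<beta> g. law M (Q \<alpha>) (Q \<beta>) (\<pi> \<alpha>) (\<lambda>m. \<pi> \<beta> (act g m)) (gms_deriv M (act g))"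
  have Xi: "Xi M act Q \<pi> \<alpha> \<beta> g = ?X \<alpha> \<beta> g" if "\<alpha> \<in> A" "\<beta> \<in> A" "g \<in> carrier G" for \<alpha> \<beta> g
    unfolding Xi_def by (rule Xi_product[OF M q(1)[OF that(1)] q(1)[OF that(2)] act_Gms[OF that(3)] q(3)[OF that(1)] q(3)[OF that(2)] q(4)[OF that(1)] q(4)[OF that(2)]])
  have XPol: "?X \<alpha> \<beta> g \<in> Pol (Q \<alpha>) (Q \<beta>)" if "\<alpha> \<in> A" "\<beta> \<in> A" "g \<in> carrier G" for \<alpha> \<beta> g
    by (rule law_Pol[OF Mfin act_Gms[OF that(3)] q(3)[OF that(1)] q(3)[OF that(2)] q(4)[OF that(1)] q(4)[OF that(2)]])
  have Xeq: "?X \<alpha> \<beta> g = ?X \<alpha> \<beta> g'" if a: "\<alpha> \<in> A" and b: "\<beta> \<in> A" and g: "g \<in> carrier G" and g': "g' \<in> carrier G"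
      and eq: "reduced_class G T (Ks \<alpha>) (Ks \<beta>) g = reduced_class G T (Ks \<alpha>) (Ks \<beta>) g'" for \<alpha> \<beta> g g'
  proof (rule Pol_mellin_eqI[OF XPol[OF a b g] XPol[OF a b g'] q(2)[OF a] q(2)[OF b]])
    fix s B S assume B: "B \<in> sets (Q \<alpha>)" and S: "S \<in> sets (Q \<beta>)"
    have "reduced_op L2H (\<rho> s) (Ks \<alpha>) (Ks \<beta>) g = reduced_op L2H (\<rho> s) (Ks \<alpha>) (Ks \<beta>) g'"
      using eq unfolding reduced_class_eq_iff[OF g g'] using unitary_rep_\<rho> by blast
    then show "pol_form s (?X \<alpha> \<beta> g) (indicator B) (indicator S) = pol_form s (?X \<alpha> \<beta> g') (indicator B) (indicator S)"
      by (simp only: Xi_coefficient[OF quot[OF a] quot[OF b] g sI[OF a B] sI[OF b S]] Xi_coefficient[OF quot[OF a] quot[OF b] g' sI[OF a B] sI[OF b S]])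
  qed
  have Xc: "Xi_class M act Q \<pi> \<alpha> \<beta> (reduced_class G T (Ks \<alpha>) (Ks \<beta>) g) = ?X \<alpha> \<beta> g"
    if a: "\<alpha> \<in> A" and b: "\<beta> \<in> A" and g: "g \<in> carrier G" for \<alpha> \<beta> g
  proof -
    have "Xi M act Q \<pi> \<alpha> \<beta> g' = Xi M act Q \<pi> \<alpha> \<beta> g" if "g' \<in> reduced_class G T (Ks \<alpha>) (Ks \<beta>) g" for g'
    proof -
      have r: "(g, g') \<in> reduced_rel G T (Ks \<alpha>) (Ks \<beta>)" using that by (simp add: reduced_class_def)
      then have g': "g' \<in> carrier G" by (simp add: reduced_rel_def)
      have "reduced_class G T (Ks \<alpha>) (Ks \<beta>) g = reduced_class G T (Ks \<alpha>) (Ks \<beta>) g'"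
        unfolding reduced_class_def by (rule equiv_class_eq[OF reduced_rel_equiv r])
      from Xeq[OF a b g g' this] show ?thesis using Xi[OF a b g] Xi[OF a b g'] by simp
    qed
    from the_elem_class[where f="Xi M act Q \<pi> \<alpha> \<beta>", OF g this] show ?thesis unfolding Xi_class_def Xi[OF a b g] by simp
  qed
  have id: "?X \<alpha> \<alpha> \<one>\<^bsub>G\<^esub> = pol_id (Q \<alpha>)" if a: "\<alpha> \<in> A" for \<alpha>
  proof -
    note [measurable] = q(3)[OF a] Gms_measurable[OF act_Gms[OF one_closed]] gms_deriv_measurable_Rpos[OF Mfin act_Gms[OF one_closed]]
    have o: "(\<lambda>m. 1) \<in> M \<rightarrow>\<^sub>M Rpos" "(\<lambda>m. 1) \<in> Q \<alpha> \<rightarrow>\<^sub>M Rpos" by (rule one_Rpos)+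
    have mQ: "(\<lambda>x. (x, x, 1)) \<in> Q \<alpha> \<rightarrow>\<^sub>M pol_space (Q \<alpha>) (Q \<alpha>)" by (intro measurable_Pair measurable_ident_sets refl o)
    have "?X \<alpha> \<alpha> \<one>\<^bsub>G\<^esub> = law M (Q \<alpha>) (Q \<alpha>) (\<pi> \<alpha>) (\<pi> \<alpha>) (\<lambda>m. 1)"
    proof (rule law_cong)
      show "AE m in M. \<pi> \<alpha> m = \<pi> \<alpha> m \<and> \<pi> \<alpha> (act \<one>\<^bsub>G\<^esub> m) = \<pi> \<alpha> m \<and> gms_deriv M (act \<one>\<^bsub>G\<^esub>) m = 1"
        using act_one act_K[OF subgroup.one_closed[OF KG]] by eventually_elim simp
    qed (use o in measurable)
    also have "\<dots> = distr (distr M (Q \<alpha>) (\<pi> \<alpha>)) (pol_space (Q \<alpha>) (Q \<alpha>)) (\<lambda>x. (x, x, 1))"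
      unfolding law_def distr_distr[OF mQ q(3)[OF a]] comp_def ..
    finally show ?thesis by (simp add: q(4)[OF a] pol_id_def)
  qed
  have prod: "pol_prod (Q \<alpha>) (Q \<beta>) (Q \<gamma>) (?X \<alpha> \<beta> g) (?X \<beta> \<gamma> h) = ?X \<alpha> \<gamma> k"
    if a: "\<alpha> \<in> A" and b: "\<beta> \<in> A" and c: "\<gamma> \<in> A" and g: "g \<in> carrier G" and h: "h \<in> carrier G" and k: "k \<in> carrier G"
      and comp: "\<And>(H :: hpoint hilbert) \<rho>. unitary_rep G T H \<rho> \<Longrightarrow>
        compose (fixed_vectors H \<rho> (Ks \<gamma>)) (reduced_op H \<rho> (Ks \<alpha>) (Ks \<beta>) g) (reduced_op H \<rho> (Ks \<beta>) (Ks \<gamma>) h) = reduced_op H \<rho> (Ks \<alpha>) (Ks \<gamma>) k"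
    for \<alpha> \<beta> \<gamma> g h k
  proof (rule pol_prod_eqI[OF q(1)[OF a] q(1)[OF b] q(1)[OF c] XPol[OF a b g] XPol[OF b c h] XPol[OF a c k]])
    fix s S assume S: "S \<in> sets (Q \<gamma>)"
    note Ss = sI[OF c S]
    \<comment> \<open>\<open>f\<close> is the reduced operator of \<open>h\<close> at the indicator of \<open>S\<close>, as a function on the quotient.\<close>
    obtain f where f: "square_integrable (Q \<beta>) f"
      "reduced_op L2H (\<rho> s) (Ks \<beta>) (Ks \<gamma>) h (emb (\<lambda>m. indicator S (\<pi> \<gamma> m))) = emb (\<lambda>m. f (\<pi> \<beta> m))"
      "\<And>u. square_integrable (Q \<beta>) u \<Longrightarrow> pol_form s (?X \<beta> \<gamma> h) u (indicator S) = (\<integral>q. u q * f q \<partial>(Q \<beta>))"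
      using reduced_op_emb[OF quot[OF b] quot[OF c] h Ss] by blast
    have "emb (\<lambda>m. indicator S (\<pi> \<gamma> m)) \<in> fixed_vectors L2H (\<rho> s) (Ks \<gamma>)" by (rule koopman_quotient.\<pi>_fixed[OF quot[OF c] Ss])
    then have r: "reduced_op L2H (\<rho> s) (Ks \<alpha>) (Ks \<beta>) g (emb (\<lambda>m. f (\<pi> \<beta> m))) = reduced_op L2H (\<rho> s) (Ks \<alpha>) (Ks \<gamma>) k (emb (\<lambda>m. indicator S (\<pi> \<gamma> m)))"
      using fun_cong[OF comp[OF unitary_rep_\<rho>[of s]], of "emb (\<lambda>m. indicator S (\<pi> \<gamma> m))"] by (simp add: compose_eq f(2))
    have "pol_form s (?X \<alpha> \<beta> g) (indicator B) f = pol_form s (?X \<alpha> \<gamma> k) (indicator B) (indicator S)" if B: "B \<in> sets (Q \<alpha>)" for B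
      by (simp only: Xi_coefficient[OF quot[OF a] quot[OF b] g sI[OF a B] f(1)] Xi_coefficient[OF quot[OF a] quot[OF c] k sI[OF a B] Ss] r)
    then show "\<exists>f. square_integrable (Q \<beta>) f \<and> (\<forall>A\<in>sets (Q \<beta>). pol_form s (?X \<beta> \<gamma> h) (indicator A) (indicator S) = (\<integral>n. indicator A n * f n \<partial>(Q \<beta>))) \<and>
       (\<forall>B\<in>sets (Q \<alpha>). pol_form s (?X \<alpha> \<beta> g) (indicator B) f = pol_form s (?X \<alpha> \<gamma> k) (indicator B) (indicator S))"
      using f(1) f(3)[OF sI[OF b]] by blast
  qed
  have comp: "pol_prod (Q \<alpha>) (Q \<beta>) (Q \<gamma>) (Xi_class M act Q \<pi> \<alpha> \<beta> c) (Xi_class M act Q \<pi> \<beta> \<gamma> d)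
         = Xi_class M act Q \<pi> \<alpha> \<gamma> (train_comp G T Ks \<alpha> \<beta> \<gamma> c d)"
    if a: "\<alpha> \<in> A" and b: "\<beta> \<in> A" and cA: "\<gamma> \<in> A" and c: "c \<in> train_hom G T Ks \<alpha> \<beta>" and d: "d \<in> train_hom G T Ks \<beta> \<gamma>" for \<alpha> \<beta> \<gamma> c d
  proof -
    have "\<exists>p. is_class_product G T (Ks \<alpha>) (Ks \<beta>) (Ks \<gamma>) c d p"
      using assms(1) a b cA c d by (simp add: gk_pair_def train_hom_def)
    then obtain p where p: "is_class_product G T (Ks \<alpha>) (Ks \<beta>) (Ks \<gamma>) c d p" by blast
    \<comment> \<open>By uniqueness of the product class, the description in the composition of the train is \<open>p\<close>.\<close>
    have tp: "train_comp G T Ks \<alpha> \<beta> \<gamma> c d = p"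
      unfolding train_comp_def by (rule the_equality, rule p, erule class_product_unique[OF _ p])
    obtain g where g: "g \<in> carrier G" "c = reduced_class G T (Ks \<alpha>) (Ks \<beta>) g"
      using c by (auto simp: train_hom_def reduced_cosets_def quotient_def reduced_class_def)
    obtain h where h: "h \<in> carrier G" "d = reduced_class G T (Ks \<beta>) (Ks \<gamma>) h"
      using d by (auto simp: train_hom_def reduced_cosets_def quotient_def reduced_class_def)
    obtain k where k: "k \<in> carrier G" "p = reduced_class G T (Ks \<alpha>) (Ks \<gamma>) k"
      using p by (auto simp: is_class_product_def reduced_cosets_def quotient_def reduced_class_def)
    have "compose (fixed_vectors H \<rho> (Ks \<gamma>)) (reduced_op H \<rho> (Ks \<alpha>) (Ks \<beta>) g) (reduced_op H \<rho> (Ks \<beta>) (Ks \<gamma>) h) = reduced_op H \<rho> (Ks \<alpha>) (Ks \<gamma>) k"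
      if u: "unitary_rep G T H \<rho>" for H :: "hpoint hilbert" and \<rho>
    proof -
      have "compose (fixed_vectors H \<rho> (Ks \<gamma>)) (class_op H \<rho> (Ks \<alpha>) (Ks \<beta>) c) (class_op H \<rho> (Ks \<beta>) (Ks \<gamma>) d) = class_op H \<rho> (Ks \<alpha>) (Ks \<gamma>) p"
        using p u by (simp add: is_class_product_def)
      then show ?thesis unfolding g(2) h(2) k(2) class_op_reduced_class[OF g(1) u] class_op_reduced_class[OF h(1) u] class_op_reduced_class[OF k(1) u] .
    qed
    note ops = this
    show ?thesis unfolding tp unfolding g(2) h(2) k(2) Xc[OF a b g(1)] Xc[OF b cA h(1)] Xc[OF a cA k(1)]
      by (rule prod[OF a b cA g(1) h(1) k(1)]) (rule ops)
  qed
  show ?thesis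
  proof (intro conjI ballI impI)
    fix \<alpha> \<beta> g assume a: "\<alpha> \<in> A" and b: "\<beta> \<in> A" and g: "g \<in> carrier G"
    show "Xi M act Q \<pi> \<alpha> \<beta> g \<in> Pol (Q \<alpha>) (Q \<beta>)" unfolding Xi[OF a b g] by (rule XPol[OF a b g])
    fix g' assume g': "g' \<in> carrier G" and eq: "reduced_class G T (Ks \<alpha>) (Ks \<beta>) g = reduced_class G T (Ks \<alpha>) (Ks \<beta>) g'"
    show "Xi M act Q \<pi> \<alpha> \<beta> g = Xi M act Q \<pi> \<alpha> \<beta> g'" unfolding Xi[OF a b g] Xi[OF a b g'] by (rule Xeq[OF a b g g' eq])
  next
    fix \<alpha> assume a: "\<alpha> \<in> A"
    show "Xi_class M act Q \<pi> \<alpha> \<alpha> (train_id G T Ks \<alpha>) = pol_id (Q \<alpha>)"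
      unfolding train_id_def Xc[OF a a one_closed] by (rule id[OF a])
  next
    fix \<alpha> \<beta> \<gamma> c d assume "\<alpha> \<in> A" "\<beta> \<in> A" "\<gamma> \<in> A" "c \<in> train_hom G T Ks \<alpha> \<beta>" "d \<in> train_hom G T Ks \<beta> \<gamma>"
    then show "pol_prod (Q \<alpha>) (Q \<beta>) (Q \<gamma>) (Xi_class M act Q \<pi> \<alpha> \<beta> c) (Xi_class M act Q \<pi> \<beta> \<gamma> d)
         = Xi_class M act Q \<pi> \<alpha> \<gamma> (train_comp G T Ks \<alpha> \<beta> \<gamma> c d)" by (rule comp)
  qed
qed

end
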